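(* Let $\mathfrak g$ be a simple Lie algebra, $\alpha\in\Pi$ a simple root and $m=\dim\mathfrak g_\alpha(1)$. Suppose that there is a subspace $\mathfrak a\subset\mathfrak g_\alpha(1)$ with $[\mathfrak a,\mathfrak a]=0$ and $\dim\mathfrak a=m/2$. Consider the sequence $\{\delta_\alpha(i)\}_{i=1}^m$. Then: (i) if $q_\alpha>2q_\alpha(1)$, then $\max_i\{\delta_\alpha(i)\}=\delta_\alpha(m/2)$ and the sequence $\{\delta_\alpha(i)\}$ is unimodal; (ii) if $q_\alpha=2q_\alpha(1)$, then the sequence $\{\delta_\alpha(i)\}$ stabilises after $i=m/2$ (i.e. $\delta_\alpha(i)=\delta_\alpha(m/2)$ for $i\ge m/2$); (iii) if $q_\alpha<2q_\alpha(1)$, then $\max_i\{\delta_\alpha(i)\}=\delta_\alpha(m)$ and the sequence $\{\delta_\alpha(i)\}$ strictly increases. Furthermore, if $d_\alpha\ge3$, then case (i) always occurs.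
   Context: The ground field $\Bbbk$ is algebraically closed of characteristic $0$. $\mathfrak g$ is a simple Lie algebra with Killing form $\Phi$, Cartan subalgebra $\mathfrak t$, root system $\Delta$, positive roots $\Delta^+$, simple roots $\Pi$, highest root $\theta$. $\varphi_\alpha$ is the fundamental weight corresponding to $\alpha\in\Pi$. For $\gamma=\sum_{\beta\in\Pi}n_\beta\beta$ put $\mathsf{ht}_\alpha(\gamma)=n_\alpha$; $\Delta_\alpha(i)=\{\gamma\in\Delta\mid \mathsf{ht}_\alpha(\gamma)=i\}$; $d_\alpha=\mathsf{ht}_\alpha(\theta)$. The $(\mathbb Z,\alpha)$-grading is $\mathfrak g=\bigoplus_{i=-d_\alpha}^{d_\alpha}\mathfrak g_\alpha(i)$ with $\mathfrak g_\alpha(0)=\mathfrak t\oplus\bigoplus_{\gamma\in\Delta_\alpha(0)}\mathfrak g^\gamma$ and $\mathfrak g_\alpha(i)=\bigoplus_{\gamma\in\Delta_\alpha(i)}\mathfrak g^\gamma$ for $i\ne0$, where $\mathfrak g^\gamma$ is the root space. $\mathcal C_\alpha(0)=\sum_j e_j'e_j\in\mathcal U(\mathfrak g_\alpha(0))$ is the Casimir element, where $\{e_j\},\{e'_j\}$ are bases of $\mathfrak g_\alpha(0)$ dual with respect to $\Phi|_{\mathfrak g_\alpha(0)}$; $\delta_\alpha(i)$ is the maximal eigenvalue of $\mathcal C_\alpha(0)$ in $\bigwedge^i\mathfrak g_\alpha(1)$. For a finite set $M\subset\mathfrak t^*$, $|M|$ denotes the sum of its elements. For $i\ge1$ the integer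 $q_\alpha(i)$ is defined by $|\Delta_\alpha(i)|=q_\alpha(i)\varphi_\alpha$, and $q_\alpha=\sum_{i\ge1}q_\alpha(i)$. *)

theory Defs
  imports
    "HOL-Computational_Algebra.Polynomial"
    "HOL-Library.Poly_Mapping"
    "HOL-Library.Function_Algebras"
begin

section \<open>Linear functionals and formal combinations of tuples\<close>

definition fun_scale :: "'k::field \<Rightarrow> ('g \<Rightarrow> 'k) \<Rightarrow> ('g \<Rightarrow> 'k)" where
  "fun_scale c f = (\<lambda>x. c * f x)"

global_interpretation functional: vector_space fun_scale
  by unfold_locales (auto simp: fun_scale_def fun_eq_iff algebra_simps)

definition free_scale :: "'k::field \<Rightarrow> ('b \<Rightarrow>\<^sub>0 'k) \<Rightarrow> ('b \<Rightarrow>\<^sub>0 'k)" where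
  "free_scale c p = Poly_Mapping.map ((*) c) p"

lemma lookup_free_scale: "Poly_Mapping.lookup (free_scale c p) x = c * Poly_Mapping.lookup p x"
  by (simp add: free_scale_def Poly_Mapping.map.rep_eq when_def)

global_interpretation free: vector_space free_scale
  by unfold_locales
    (auto simp: poly_mapping_eq_iff fun_eq_iff lookup_free_scale lookup_add algebra_simps)


section \<open>Lie algebras\<close>

locale lie_algebra = finite_dimensional_vector_space scale Basis
  for scale :: "'k::field \<Rightarrow> 'g::ab_group_add \<Rightarrow> 'g" and Basis :: "'g set" +
  fixes bracket :: "'g \<Rightarrow> 'g \<Rightarrow> 'g"
  assumes bracket_linear_left: "Vector_Spaces.linear scale scale (\<lambda>x. bracket x y)"
    and bracket_linear_right: "Vector_Spaces.linear scale scale (\<lambda>y. bracket x y)"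
    and bracket_self: "bracket x x = 0"
    and jacobi: "bracket x (bracket y z) + bracket y (bracket z x) + bracket z (bracket x y) = 0"
begin

definition lie_subalgebra :: "'g set \<Rightarrow> bool" where
  "lie_subalgebra S \<longleftrightarrow> subspace S \<and> (\<forall>x\<in>S. \<forall>y\<in>S. bracket x y \<in> S)"

definition lie_ideal :: "'g set \<Rightarrow> bool" where
  "lie_ideal I \<longleftrightarrow> subspace I \<and> (\<forall>x. \<forall>y\<in>I. bracket x y \<in> I)"

definition commuting :: "'g set \<Rightarrow> bool" where
  "commuting S \<longleftrightarrow> (\<forall>x\<in>S. \<forall>y\<in>S. bracket x y = 0)"

primrec lower_central_series :: "'g set \<Rightarrow> nat \<Rightarrow> 'g set" where
  "lower_central_series S 0 = S"
| "lower_central_series S (Suc n) =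
     span {bracket x y | x y. x \<in> S \<and> y \<in> lower_central_series S n}"

definition cartan_subalgebra :: "'g set \<Rightarrow> bool" where
  "cartan_subalgebra H \<longleftrightarrow> lie_subalgebra H \<and>
     (\<exists>n. lower_central_series H n = {0}) \<and>
     {x. \<forall>h\<in>H. bracket x h \<in> H} = H"

definition trace :: "('g \<Rightarrow> 'g) \<Rightarrow> 'k" where
  "trace f = (\<Sum>b\<in>Basis. representation Basis (f b) b)"

definition killing :: "'g \<Rightarrow> 'g \<Rightarrow> 'k" where
  "killing x y = trace (\<lambda>z. bracket x (bracket y z))"

text \<open>Functionals on a subspace \<open>H\<close> are represented by functions on the whole algebra
  that vanish outside \<open>H\<close>, so that equality of functionals is equality of functions.\<close>

definition dual_space :: "'g set \<Rightarrow> ('g \<Rightarrow> 'k) set" where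
  "dual_space H = {f. (\<forall>x\<in>H. \<forall>y\<in>H. f (x + y) = f x + f y) \<and>
     (\<forall>c. \<forall>x\<in>H. f (scale c x) = c * f x) \<and> (\<forall>x. x \<notin> H \<longrightarrow> f x = 0)}"

definition root_space :: "'g set \<Rightarrow> ('g \<Rightarrow> 'k) \<Rightarrow> 'g set" where
  "root_space H \<gamma> = {x. \<forall>h\<in>H. bracket h x = scale (\<gamma> h) x}"

definition roots :: "'g set \<Rightarrow> ('g \<Rightarrow> 'k) set" where
  "roots H = {\<gamma> \<in> dual_space H. \<gamma> \<noteq> 0 \<and> root_space H \<gamma> \<noteq> {0}}"

definition root_base :: "'g set \<Rightarrow> ('g \<Rightarrow> 'k) set \<Rightarrow> bool" where
  "root_base H \<Pi> \<longleftrightarrow> \<Pi> \<subseteq> roots H \<and> functional.independent \<Pi> \<and>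
     (\<forall>\<gamma>\<in>roots H. \<exists>n :: ('g \<Rightarrow> 'k) \<Rightarrow> int.
        ((\<forall>\<beta>\<in>\<Pi>. 0 \<le> n \<beta>) \<or> (\<forall>\<beta>\<in>\<Pi>. n \<beta> \<le> 0)) \<and>
        \<gamma> = (\<Sum>\<beta>\<in>\<Pi>. fun_scale (of_int (n \<beta>)) \<beta>))"

definition dual_bases :: "'g set \<Rightarrow> nat \<Rightarrow> (nat \<Rightarrow> 'g) \<Rightarrow> (nat \<Rightarrow> 'g) \<Rightarrow> bool" where
  "dual_bases V n e e' \<longleftrightarrow>
     inj_on e {..<n} \<and> independent (e ` {..<n}) \<and> span (e ` {..<n}) = V \<and>
     inj_on e' {..<n} \<and> independent (e' ` {..<n}) \<and> span (e' ` {..<n}) = V \<and>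
     (\<forall>i<n. \<forall>j<n. killing (e i) (e' j) = (if i = j then 1 else 0))"


subsection \<open>Exterior powers\<close>

text \<open>The \<open>i\<close>-th exterior power of a subspace \<open>V\<close> is the quotient of the vector space
  \<open>ext_free V i\<close>, freely generated by the tuples \<open>(v\<^sub>1, \<dots>, v\<^sub>i)\<close> with entries in \<open>V\<close>, by the subspace
  \<open>ext_rel V i\<close> expressing that the class \<open>v\<^sub>1 \<and> \<dots> \<and> v\<^sub>i\<close> of a tuple is multilinear and vanishes if
  two entries coincide. Vectors of the exterior power are handled through representatives.\<close>

definition tuples :: "'g set \<Rightarrow> nat \<Rightarrow> 'g list set" where
  "tuples V i = {vs. length vs = i \<and> set vs \<subseteq> V}"

definition ext_free :: "'g set \<Rightarrow> nat \<Rightarrow> ('g list \<Rightarrow>\<^sub>0 'k) set" where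
  "ext_free V i = {p. Poly_Mapping.keys p \<subseteq> tuples V i}"

definition ext_rel :: "'g set \<Rightarrow> nat \<Rightarrow> ('g list \<Rightarrow>\<^sub>0 'k) set" where
  "ext_rel V i = free.span
     ({Poly_Mapping.single (vs[j := x + y]) 1
         - Poly_Mapping.single (vs[j := x]) 1 - Poly_Mapping.single (vs[j := y]) 1
         | vs j x y. vs \<in> tuples V i \<and> j < i \<and> x \<in> V \<and> y \<in> V} \<union>
      {Poly_Mapping.single (vs[j := scale c x]) 1 - Poly_Mapping.single (vs[j := x]) c
         | vs j c x. vs \<in> tuples V i \<and> j < i \<and> x \<in> V} \<union>
      {Poly_Mapping.single vs 1 | vs. vs \<in> tuples V i \<and> \<not> distinct vs})"

text \<open>The linear extension of
  \<open>x \<cdot> (v\<^sub>1 \<and> \<dots> \<and> v\<^sub>i) = (\<Sum>j. v\<^sub>1 \<and> \<dots> \<and> [x, v\<^sub>j] \<and> \<dots> \<and> v\<^sub>i)\<close>.\<close>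

definition ext_act :: "'g \<Rightarrow> ('g list \<Rightarrow>\<^sub>0 'k) \<Rightarrow> ('g list \<Rightarrow>\<^sub>0 'k)" where
  "ext_act x p = (\<Sum>vs\<in>Poly_Mapping.keys p. free_scale (Poly_Mapping.lookup p vs)
     (\<Sum>j<length vs. Poly_Mapping.single (vs[j := bracket x (vs ! j)]) 1))"

text \<open>The action of the element \<open>\<Sum>j. e'\<^sub>j e\<^sub>j\<close> of the enveloping algebra.\<close>

definition casimir_act ::
    "nat \<Rightarrow> (nat \<Rightarrow> 'g) \<Rightarrow> (nat \<Rightarrow> 'g) \<Rightarrow> ('g list \<Rightarrow>\<^sub>0 'k) \<Rightarrow> ('g list \<Rightarrow>\<^sub>0 'k)" where
  "casimir_act n e e' p = (\<Sum>j<n. ext_act (e' j) (ext_act (e j) p))"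

definition casimir_eigenvalue ::
    "nat \<Rightarrow> (nat \<Rightarrow> 'g) \<Rightarrow> (nat \<Rightarrow> 'g) \<Rightarrow> 'g set \<Rightarrow> nat \<Rightarrow> 'k \<Rightarrow> bool" where
  "casimir_eigenvalue n e e' V i c \<longleftrightarrow>
     (\<exists>p\<in>ext_free V i. p \<notin> ext_rel V i \<and> casimir_act n e e' p - free_scale c p \<in> ext_rel V i)"

end

locale simple_lie_algebra = lie_algebra +
  assumes not_commuting: "\<not> commuting UNIV"
    and ideal_trivial: "lie_ideal I \<Longrightarrow> I = {0} \<or> I = UNIV"


section \<open>Gradings defined by a simple root\<close>

locale based_simple_lie_algebra = simple_lie_algebra scale Basis bracket
  for scale :: "'k::{alg_closed_field, field_char_0} \<Rightarrow> 'g::ab_group_add \<Rightarrow> 'g"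
    and Basis :: "'g set" and bracket :: "'g \<Rightarrow> 'g \<Rightarrow> 'g" +
  fixes H :: "'g set" and \<Pi> :: "('g \<Rightarrow> 'k) set"
  assumes cartan: "cartan_subalgebra H"
    and base: "root_base H \<Pi>"
begin

definition ht :: "('g \<Rightarrow> 'k) \<Rightarrow> ('g \<Rightarrow> 'k) \<Rightarrow> int" where
  "ht \<alpha> \<gamma> = (THE k. \<exists>n :: ('g \<Rightarrow> 'k) \<Rightarrow> int.
     \<gamma> = (\<Sum>\<beta>\<in>\<Pi>. fun_scale (of_int (n \<beta>)) \<beta>) \<and> n \<alpha> = k)"

definition roots_deg :: "('g \<Rightarrow> 'k) \<Rightarrow> int \<Rightarrow> ('g \<Rightarrow> 'k) set" where
  "roots_deg \<alpha> i = {\<gamma> \<in> roots H. ht \<alpha> \<gamma> = i}"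

definition highest_root :: "'g \<Rightarrow> 'k" where
  "highest_root = (THE \<theta>. \<theta> \<in> roots H \<and>
     (\<forall>\<gamma>\<in>roots H. \<exists>n :: ('g \<Rightarrow> 'k) \<Rightarrow> nat.
        \<theta> - \<gamma> = (\<Sum>\<beta>\<in>\<Pi>. fun_scale (of_nat (n \<beta>)) \<beta>)))"

definition depth :: "('g \<Rightarrow> 'k) \<Rightarrow> int" where
  "depth \<alpha> = ht \<alpha> highest_root"

definition grading :: "('g \<Rightarrow> 'k) \<Rightarrow> int \<Rightarrow> 'g set" where
  "grading \<alpha> i = span ((if i = 0 then H else {}) \<union> (\<Union>\<gamma>\<in>roots_deg \<alpha> i. root_space H \<gamma>))"

text \<open>The bilinear form on \<open>dual_space H\<close> induced by the Killing form.\<close>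

definition functional_vec :: "('g \<Rightarrow> 'k) \<Rightarrow> 'g" where
  "functional_vec \<mu> = (THE t. t \<in> H \<and> (\<forall>h\<in>H. killing t h = \<mu> h))"

definition dual_form :: "('g \<Rightarrow> 'k) \<Rightarrow> ('g \<Rightarrow> 'k) \<Rightarrow> 'k" where
  "dual_form \<mu> \<nu> = killing (functional_vec \<mu>) (functional_vec \<nu>)"

definition fundamental_weight :: "('g \<Rightarrow> 'k) \<Rightarrow> ('g \<Rightarrow> 'k)" where
  "fundamental_weight \<alpha> = (THE \<phi>. \<phi> \<in> dual_space H \<and>
     (\<forall>\<beta>\<in>\<Pi>. 2 * dual_form \<phi> \<beta> / dual_form \<beta> \<beta> = (if \<beta> = \<alpha> then 1 else 0)))"

definition q_deg :: "('g \<Rightarrow> 'k) \<Rightarrow> int \<Rightarrow> int" where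
  "q_deg \<alpha> i = (THE q. \<Sum>(roots_deg \<alpha> i) = fun_scale (of_int q) (fundamental_weight \<alpha>))"

text \<open>There are no roots of degree above \<open>depth \<alpha>\<close>, so this is the sum over all \<open>i \<ge> 1\<close>.\<close>

definition q_total :: "('g \<Rightarrow> 'k) \<Rightarrow> int" where
  "q_total \<alpha> = (\<Sum>i=1..depth \<alpha>. q_deg \<alpha> i)"

text \<open>The field carries no order: that \<open>r\<close> is the maximal eigenvalue means that all eigenvalues
  lie in the prime field of rationals and that \<open>r\<close> is the largest of them.\<close>

definition max_casimir ::
    "nat \<Rightarrow> (nat \<Rightarrow> 'g) \<Rightarrow> (nat \<Rightarrow> 'g) \<Rightarrow> ('g \<Rightarrow> 'k) \<Rightarrow> nat \<Rightarrow> rat" where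
  "max_casimir n e e' \<alpha> i = (THE r.
     casimir_eigenvalue n e e' (grading \<alpha> 1) i (of_rat r) \<and>
     (\<forall>c. casimir_eigenvalue n e e' (grading \<alpha> 1) i c \<longrightarrow> (\<exists>s\<le>r. c = of_rat s)))"

end

definition unimodal_on :: "nat set \<Rightarrow> (nat \<Rightarrow> 'a::linorder) \<Rightarrow> bool" where
  "unimodal_on I f \<longleftrightarrow> (\<exists>k\<in>I. mono_on {i\<in>I. i \<le> k} f \<and> antimono_on {i\<in>I. k \<le> i} f)"

end

theory Submission
  imports Defs
begin

text \<open>Write \<open>c = (\<alpha>, \<alpha>) / 2\<close>, where \<open>(_, _)\<close> is the form on weights dual to the Killing form, and \<open>\<phi>\<close> for the
fundamental weight of \<open>\<alpha>\<close>. The theorem is a consequence of an explicit formula: if \<open>g(1)\<close> has an abelian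
subspace of half its dimension, then \<open>\<delta>(i) = i q c\<close> for \<open>i \<le> m/2\<close>, and \<open>\<delta>(i) = ((m - i) q + (2 i - m) q\<^sub>1) c\<close> for \<open>i \<ge> m/2\<close>, where
\<open>q\<close> is the sum of all \<open>q\<^sub>i\<close>. So \<open>\<delta>\<close> is linear on each half of its range, with the positive slope \<open>q c\<close>
on the first half and the slope \<open>(2 q\<^sub>1 - q) c\<close> on the second, and the three cases are the three signs
of the second slope (\<open>piecewise_linear_cases\<close>).

Upper bounds. An eigenvector of the Casimir element of \<open>g(0)\<close> in the \<open>i\<close>-th exterior power of \<open>g(1)\<close>
can be replaced by a lowest weight vector for \<open>g(0)\<close> with the same eigenvalue. Its weight \<open>\<mu>\<close> is the sum
of an \<open>i\<close>-element set \<open>A\<close> of roots of degree 1, and the eigenvalue is \<open>(\<mu>, \<mu>) - (\<mu>, 2 \<rho>\<^sub>0)\<close>, with \<open>2 \<rho>\<^sub>0\<close> the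
sum of the positive roots of degree 0 (\<open>eigenvalue_cases\<close>). For every set \<open>S\<close> of positive roots the vector
\<open>2 \<rho> - 2 |S|\<close> is not longer than \<open>2 \<rho>\<close> (\<open>norm_half_system\<close>), that is \<open>(|S|, |S|) \<le> (|S|, 2 \<rho>)\<close>. As
\<open>2 \<rho> = 2 \<rho>\<^sub>0 + q \<phi>\<close> and \<open>(\<gamma>, \<phi>) = c\<close> for roots \<open>\<gamma>\<close> of degree 1, the choice \<open>S = A\<close> gives the bound \<open>i q c\<close>.
The choice of \<open>S\<close> as the union of the positive roots of degree 0 and the complement of \<open>A\<close> in degree 1
gives the other bound (\<open>cas_le\<close> and \<open>cas_le_complement\<close>).

Eigenvectors. Call a set of roots of degree 1 commutative if no two of its elements add up to a root.
The wedge product of the root vectors over a commutative set of \<open>k\<close> roots is an eigenvector for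
\<open>k q c\<close>, and the product over the complement is one for \<open>(k q + (m - 2 k) q\<^sub>1) c\<close>. Indeed, the Casimir
element is the scalar \<open>q c\<close> on \<open>g(1)\<close>, and its part that acts on two factors of a product at once
depends only on the bracket of these factors (\<open>isolated_eigenvalue\<close>). For the complement the resulting
structure constants are summed with the help of traces on the graded pieces: if \<open>x\<close> and \<open>y\<close> are opposite
root vectors of degree 1 and -1, the traces of \<open>ad y \<circ> ad x\<close> on \<open>g(j - 1)\<close> and on \<open>g(j)\<close> differ by \<open>q\<^sub>j c\<close>
(\<open>T_sum\<close> and \<open>sum_N\<close>).

Commutative sets. The leading roots of the vectors of an abelian subspace \<open>a\<close>, with respect to an
additive function that separates the roots of degree 1, form a commutative set with at least \<open>dim a\<close>
elements (\<open>leading_roots\<close>). Its subsets are commutative too, so the bounds are attained for all \<open>i\<close>.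

Depth at least 3. The numbers satisfy \<open>q\<^sub>i = q\<^bsub>d-i\<^esub>\<close>: the highest root \<open>\<theta>\<close> has degree \<open>d\<close>, its root vectors
preserve \<open>g(i) + g(i - d)\<close>, so the sum of the weights of this space is orthogonal to \<open>\<theta>\<close>
(\<open>Q_symmetric\<close>). Hence \<open>q \<ge> q\<^sub>1 + q\<^bsub>d-1\<^esub> + q\<^sub>d > 2 q\<^sub>1\<close>.

Two remarks on the foundations. Dual bases for the Killing form on \<open>g(0)\<close> exist only if this form is
nonzero; as its radical is an ideal, it is then nondegenerate, and the root space decomposition
follows without Cartan's criterion. And a formal combination of tuples represents
zero in the exterior power if and only if every alternating form vanishes on it (\<open>ext_rel_iff\<close>), so all
computations in exterior powers are carried out with the transposed action on alternating forms.\<close>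

section \<open>Linear algebra of a finite-dimensional Lie algebra\<close>

context lie_algebra
begin

definition lin :: "('g \<Rightarrow> 'g) \<Rightarrow> bool" where
  "lin f \<longleftrightarrow> Vector_Spaces.linear scale scale f"

definition lform :: "('g \<Rightarrow> 'k) \<Rightarrow> bool" where
  "lform \<xi> \<longleftrightarrow> (\<forall>x y. \<xi> (x + y) = \<xi> x + \<xi> y) \<and> (\<forall>c x. \<xi> (scale c x) = c * \<xi> x)"

lemma linI:
  assumes "\<And>x y. f (x + y) = f x + f y" and "\<And>c x. f (scale c x) = scale c (f x)"
  shows "lin f"
  by (simp add: lin_def assms Vector_Spaces.linear_iff vector_space_axioms)

lemma lin_add: "lin f \<Longrightarrow> f (x + y) = f x + f y"
  and lin_scale: "lin f \<Longrightarrow> f (scale c x) = scale c (f x)"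
  by (simp_all add: lin_def Vector_Spaces.linear_iff)

lemma lin_zero: "lin f \<Longrightarrow> f 0 = 0"
  using lin_scale[of f 0 0] by simp

lemma lin_minus: "lin f \<Longrightarrow> f (- x) = - f x"
  using lin_scale[of f "-1" x] by simp

lemma lin_diff: "lin f \<Longrightarrow> f (x - y) = f x - f y"
  using lin_add[of f x "- y"] lin_minus[of f y] by simp

lemma lin_sum: "lin f \<Longrightarrow> f (\<Sum>i\<in>I. g i) = (\<Sum>i\<in>I. f (g i))"
  by (induction I rule: infinite_finite_induct) (simp_all add: lin_zero lin_add)

lemma lform_add: "lform f \<Longrightarrow> f (x + y) = f x + f y"
  and lform_scale: "lform f \<Longrightarrow> f (scale c x) = c * f x"
  by (simp_all add: lform_def)

lemma lform_zero: "lform f \<Longrightarrow> f 0 = 0"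
  using lform_scale[of f 0 0] by simp

lemma lform_minus: "lform f \<Longrightarrow> f (- x) = - f x"
  using lform_scale[of f "-1" x] by simp

lemma lform_diff: "lform f \<Longrightarrow> f (x - y) = f x - f y"
  using lform_add[of f x "- y"] lform_minus[of f y] by simp

lemma lform_sum: "lform f \<Longrightarrow> f (\<Sum>i\<in>I. g i) = (\<Sum>i\<in>I. f (g i))"
  by (induction I rule: infinite_finite_induct) (simp_all add: lform_zero lform_add)

lemma lin_comp: "lin f \<Longrightarrow> lin g \<Longrightarrow> lin (\<lambda>x. f (g x))"
  by (intro linI) (simp_all add: lin_add lin_scale)

lemma lin_plus: "lin f \<Longrightarrow> lin g \<Longrightarrow> lin (\<lambda>x. f x + g x)"
  by (intro linI) (simp_all add: lin_add lin_scale algebra_simps)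

lemma lin_sub: "lin f \<Longrightarrow> lin g \<Longrightarrow> lin (\<lambda>x. f x - g x)"
  by (intro linI) (simp_all add: lin_add lin_scale algebra_simps)

lemma lin_smult: "lin f \<Longrightarrow> lin (\<lambda>x. scale c (f x))"
  by (intro linI) (simp_all add: lin_add lin_scale algebra_simps)

lemma lin_rank_one: "lform \<xi> \<Longrightarrow> lin (\<lambda>x. scale (\<xi> x) u)"
  by (intro linI) (simp_all add: lform_add lform_scale algebra_simps)

lemma lin_id: "lin (\<lambda>x. x)"
  by (intro linI) simp_all

lemma lin_const_zero: "lin (\<lambda>x. 0)"
  by (intro linI) simp_all

lemma lin_Sum: "(\<And>i. i \<in> I \<Longrightarrow> lin (f i)) \<Longrightarrow> lin (\<lambda>x. \<Sum>i\<in>I. f i x)"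
  by (induction I rule: infinite_finite_induct) (simp_all add: lin_const_zero lin_plus)

lemma lin_funpow: "lin f \<Longrightarrow> lin (f ^^ n)"
  by (induction n) (auto simp: lin_id id_def o_def intro: lin_comp)

lemma lin_bracket: "lin (bracket x)"
  using bracket_linear_right by (simp add: lin_def)

lemma lin_bracket_left: "lin (\<lambda>x. bracket x y)"
  using bracket_linear_left by (simp add: lin_def)

lemmas bracket_add_right = lin_add[OF lin_bracket]
  and bracket_scale_right = lin_scale[OF lin_bracket]
  and bracket_zero_right = lin_zero[OF lin_bracket]
  and bracket_minus_right = lin_minus[OF lin_bracket]
  and bracket_diff_right = lin_diff[OF lin_bracket]
  and bracket_sum_right = lin_sum[OF lin_bracket]

lemmas bracket_add_left = lin_add[OF lin_bracket_left]
  and bracket_scale_left = lin_scale[OF lin_bracket_left]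
  and bracket_zero_left = lin_zero[OF lin_bracket_left]
  and bracket_minus_left = lin_minus[OF lin_bracket_left]
  and bracket_diff_left = lin_diff[OF lin_bracket_left]
  and bracket_sum_left = lin_sum[OF lin_bracket_left]

declare bracket_zero_right [simp] bracket_zero_left [simp] bracket_self [simp]

lemma bracket_swap: "bracket y x = - bracket x y"
proof -
  have "0 = bracket (x + y) (x + y)" by (simp only: bracket_self)
  also have "\<dots> = bracket y x + bracket x y"
    unfolding bracket_add_left bracket_add_right by simp
  finally show ?thesis by (simp add: eq_neg_iff_add_eq_0)
qed

lemma bracket_derivation:
  "bracket x (bracket y z) = bracket (bracket x y) z + bracket y (bracket x z)"
proof -
  have "bracket z (bracket x y) = - bracket (bracket x y) z"
    and "bracket y (bracket z x) = - bracket y (bracket x z)"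
    using bracket_swap bracket_minus_right by metis+
  with jacobi[of x y z] show ?thesis
    by (simp add: algebra_simps add_eq_0_iff)
qed

lemma bracket_bracket_left:
  "bracket (bracket x y) z = bracket x (bracket y z) - bracket y (bracket x z)"
  by (simp add: bracket_derivation[of x y z])


subsection \<open>Traces\<close>

lemma repr_add: "representation Basis (x + y) b = representation Basis x b + representation Basis y b"
  and repr_scale: "representation Basis (scale c x) b = c * representation Basis x b"
  by (simp_all add: representation_add representation_scale independent_Basis span_Basis)

lemma lform_repr: "lform (\<lambda>x. representation Basis x b)"
  by (simp add: lform_def repr_add repr_scale)

lemma repr_sum: "(\<Sum>b\<in>Basis. scale (representation Basis x b) b) = x"
  by (rule sum_representation_eq)
    (simp_all add: independent_Basis span_Basis finite_Basis)

lemma trace_plus: "trace (\<lambda>x. f x + g x) = trace f + trace g"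
  by (simp add: trace_def repr_add sum.distrib)

lemma trace_smult: "trace (\<lambda>x. scale c (f x)) = c * trace f"
  by (simp add: trace_def repr_scale sum_distrib_left)

lemma trace_uminus: "trace (\<lambda>x. - f x) = - trace f"
  using trace_smult[of "-1" f] by simp

lemma trace_sub: "trace (\<lambda>x. f x - g x) = trace f - trace g"
  using trace_plus[of f "\<lambda>x. - g x"] by (simp add: trace_uminus)

lemma trace_zero: "trace (\<lambda>x. 0) = 0"
  using trace_smult[of 0 "\<lambda>x. 0"] by simp

lemma trace_sum: "trace (\<lambda>x. \<Sum>i\<in>I. f i x) = (\<Sum>i\<in>I. trace (f i))"
  by (induction I rule: infinite_finite_induct) (simp_all add: trace_zero trace_plus)

lemma trace_rank_one:
  assumes "lform \<xi>" shows "trace (\<lambda>x. scale (\<xi> x) u) = \<xi> u"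
proof -
  have "\<xi> u = \<xi> (\<Sum>b\<in>Basis. scale (representation Basis u b) b)"
    by (simp only: repr_sum)
  also have "\<dots> = (\<Sum>b\<in>Basis. representation Basis u b * \<xi> b)"
    by (simp add: lform_sum lform_scale assms)
  finally show ?thesis
    by (simp add: trace_def repr_scale mult.commute)
qed

lemma trace_comm:
  assumes f: "lin f" and g: "lin g"
  shows "trace (\<lambda>x. f (g x)) = trace (\<lambda>x. g (f x))"
proof -
  let ?r = "representation Basis"
  have exp: "?r (f (g b)) b = (\<Sum>c\<in>Basis. ?r (g b) c * ?r (f c) b)"
    if f: "lin f" for f g :: "'g \<Rightarrow> 'g" and b
  proof -
    have "?r (f (g b)) b = ?r (f (\<Sum>c\<in>Basis. scale (?r (g b) c) c)) b"
      by (simp only: repr_sum)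
    also have "\<dots> = (\<Sum>c\<in>Basis. ?r (g b) c * ?r (f c) b)"
      by (simp add: lin_sum[OF f] lin_scale[OF f] lform_sum[OF lform_repr] repr_scale)
    finally show ?thesis .
  qed
  show ?thesis
    unfolding trace_def exp[OF f, of g] exp[OF g, of f]
    by (subst sum.swap) (simp add: mult.commute)
qed

lemma lform_trace_comp:
  assumes "lin f" shows "lform (\<lambda>x. trace (\<lambda>z. f (bracket x (g z))))"
  by (simp add: lform_def bracket_add_left bracket_scale_left lin_add[OF assms] lin_scale[OF assms]
      trace_plus trace_smult)

lemma exists_projection:
  assumes "subspace U"
  obtains P where "lin P" "range P \<subseteq> U" "\<And>x. x \<in> U \<Longrightarrow> P x = x"
proof -
  interpret vector_space_pair scale scale ..
  obtain B where B: "B \<subseteq> U" "independent B" "U \<subseteq> span B"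
    using maximal_independent_subset by blast
  obtain P where P: "lin P" "\<forall>x\<in>B. P x = x" "range P = span ((\<lambda>x. x) ` B)"
    using linear_independent_extend_subspace[OF B(2), of "\<lambda>x. x"]
    by (auto simp: lin_def)
  have sp: "span B = U"
    using B assms span_minimal by blast
  have "P x = x" if "x \<in> U" for x
    by (rule linear_eq_on[OF P(1)[unfolded lin_def] lin_id[unfolded lin_def], of x B]) (use that sp P(2) in auto)
  moreover have "range P \<subseteq> U" using P(3) sp by simp
  ultimately show ?thesis
    using that P(1) by blast
qed

text \<open>Compressing to the range of the operator lowers the nilpotency index: if \<open>P\<close> projects onto
  the range of \<open>f\<close>, then \<open>f\<close> and \<open>f P\<close> have the same trace, and \<open>(f P) ^ n = f ^ n P\<close>.\<close>

lemma trace_nilpotent_Suc: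
  "\<forall>f. lin f \<longrightarrow> (\<forall>x. (f ^^ Suc n) x = 0) \<longrightarrow> trace f = 0"
proof (induction n)
  case 0
  show ?case
  proof (intro allI impI)
    fix f :: "'g \<Rightarrow> 'g" assume "\<forall>x. (f ^^ Suc 0) x = 0"
    then have "f = (\<lambda>x. 0)" by auto
    then show "trace f = 0" by (simp add: trace_zero)
  qed
next
  case (Suc n)
  show ?case
  proof (intro allI impI)
    fix f :: "'g \<Rightarrow> 'g" assume f: "lin f" and nil: "\<forall>x. (f ^^ Suc (Suc n)) x = 0"
    have "subspace (range f)"
    proof (rule subspaceI)
      show "0 \<in> range f" by (metis f lin_zero rangeI)
      show "x + y \<in> range f" if "x \<in> range f" "y \<in> range f" for x y
        using that by (auto simp flip: lin_add[OF f])
      show "scale c x \<in> range f" if "x \<in> range f" for c x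
        using that by (auto simp flip: lin_scale[OF f])
    qed
    then obtain P where P: "lin P" "range P \<subseteq> range f" "\<And>x. x \<in> range f \<Longrightarrow> P x = x"
      using exists_projection by blast
    have eq: "((\<lambda>x. f (P x)) ^^ Suc k) x = (f ^^ Suc k) (P x)" for k x
    proof (induction k)
      case (Suc k)
      have "P (f ((f ^^ k) (P x))) = f ((f ^^ k) (P x))" by (rule P(3)) simp
      then show ?case using Suc by simp
    qed simp
    have nil': "((\<lambda>x. f (P x)) ^^ Suc n) x = 0" for x
    proof -
      obtain y where "P x = f y" using P(2) by blast
      then have "(f ^^ Suc n) (P x) = (f ^^ Suc (Suc n)) y"
        by (simp add: funpow_swap1)
      then show ?thesis using eq[of n x] nil by simp
    qed
    have 0: "trace (\<lambda>x. f (P x)) = 0"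
      using Suc.IH[rule_format, of "\<lambda>x. f (P x)"] lin_comp[OF f P(1)] nil' by blast
    have "(\<lambda>x. P (f x)) = f"
      using P(3) by blast
    then have "trace f = trace (\<lambda>x. P (f x))"
      by (simp only:)
    also have "\<dots> = trace (\<lambda>x. f (P x))"
      by (rule trace_comm[OF P(1) f])
    also note 0
    finally show "trace f = 0" .
  qed
qed

lemma trace_nilpotent:
  fixes f :: "'g \<Rightarrow> 'g"
  assumes "lin f" "\<And>x. (f ^^ n) x = 0"
  shows "trace f = 0"
proof -
  have "\<forall>x. (f ^^ Suc n) x = 0"
    using assms(2) lin_zero[OF assms(1)] by simp
  then show ?thesis
    by (rule trace_nilpotent_Suc[THEN spec, THEN mp, THEN mp, OF assms(1)])
qed


subsection \<open>Generalised eigenspaces\<close>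

definition shift :: "('g \<Rightarrow> 'g) \<Rightarrow> 'k \<Rightarrow> 'g \<Rightarrow> 'g" where
  "shift T a x = T x - scale a x"

text \<open>The generalised eigenspace of \<open>T\<close> for \<open>a\<close>.\<close>

definition gev :: "('g \<Rightarrow> 'g) \<Rightarrow> 'k \<Rightarrow> 'g set" where
  "gev T a = {x. \<exists>n. (shift T a ^^ n) x = 0}"

lemma lin_shift: "lin T \<Longrightarrow> lin (shift T a)"
  by (intro linI) (simp_all add: shift_def lin_add[of T] lin_scale[of T] algebra_simps)

lemma lin_shift_pow: "lin T \<Longrightarrow> lin (shift T a ^^ n)"
  by (rule lin_funpow[OF lin_shift])

lemma shift_commute: "lin T \<Longrightarrow> shift T a (shift T b x) = shift T b (shift T a x)"
  by (simp add: shift_def lin_diff[of T] lin_scale[of T] algebra_simps)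

lemma shift_pow_commute: "lin T \<Longrightarrow> (shift T a ^^ n) (shift T b x) = shift T b ((shift T a ^^ n) x)"
  by (induction n) (simp_all add: shift_commute[of T a b])

lemma shift_pow_mono:
  assumes T: "lin T" and "(shift T a ^^ n) x = 0" "n \<le> m" shows "(shift T a ^^ m) x = 0"
proof -
  have "(shift T a ^^ m) x = (shift T a ^^ (m - n)) ((shift T a ^^ n) x)"
    using \<open>n \<le> m\<close> by (metis comp_apply funpow_add le_add_diff_inverse2)
  then show ?thesis
    by (simp add: assms(2) lin_zero[OF lin_shift_pow[OF T]])
qed

lemma subspace_gev:
  assumes T: "lin T" shows "subspace (gev T a)"
proof (rule subspaceI)
  show "0 \<in> gev T a" by (auto simp: gev_def intro: exI[of _ 0])
  show "x + y \<in> gev T a" if x: "x \<in> gev T a" and y: "y \<in> gev T a" for x y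
  proof -
    from x y obtain n m where "(shift T a ^^ n) x = 0" "(shift T a ^^ m) y = 0"
      by (auto simp: gev_def)
    then have "(shift T a ^^ max n m) x = 0" "(shift T a ^^ max n m) y = 0"
      using shift_pow_mono[OF T] by (metis max.cobounded1, metis max.cobounded2)
    then have "(shift T a ^^ max n m) (x + y) = 0"
      by (simp add: lin_add[OF lin_shift_pow[OF T]])
    then show ?thesis by (auto simp: gev_def)
  qed
  show "scale c x \<in> gev T a" if x: "x \<in> gev T a" for c x
  proof -
    from x obtain n where "(shift T a ^^ n) x = 0" by (auto simp: gev_def)
    then have "(shift T a ^^ n) (scale c x) = 0"
      by (simp add: lin_scale[OF lin_shift_pow[OF T]])
    then show ?thesis by (auto simp: gev_def)
  qed
qed

lemma shift_in_gev:
  assumes T: "lin T" and x: "x \<in> gev T a" shows "shift T b x \<in> gev T a"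
proof -
  from x obtain n where "(shift T a ^^ n) x = 0" by (auto simp: gev_def)
  then have "(shift T a ^^ n) (shift T b x) = 0"
    by (simp add: shift_pow_commute[OF T] lin_zero[OF lin_shift[OF T]])
  then show ?thesis by (auto simp: gev_def)
qed

lemma shift_pow_in_gev:
  assumes T: "lin T" and x: "x \<in> gev T a" shows "(shift T b ^^ n) x \<in> gev T a"
  by (induction n) (simp_all add: x shift_in_gev[OF T])

lemma gev_shift_iff: "shift T a x \<in> gev T a \<Longrightarrow> x \<in> gev T a"
  unfolding gev_def by (auto simp flip: funpow_Suc_right simp: funpow_swap1 intro: exI[of _ "Suc _"])

lemma shift_injective_on_gev:
  assumes T: "lin T" and "a \<noteq> b" and x: "x \<in> gev T b" and 0: "shift T a x = 0"
  shows "x = 0"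
proof -
  have Tx: "T x = scale a x" using 0 by (simp add: shift_def)
  have "(shift T b ^^ n) x = scale ((a - b) ^ n) x" for n
    by (induction n) (simp_all add: shift_def lin_scale[OF T] Tx algebra_simps)
  then show ?thesis using x \<open>a \<noteq> b\<close> by (auto simp: gev_def)
qed

lemma shift_pow_injective_on_gev:
  assumes T: "lin T" and "a \<noteq> b" and x: "x \<in> gev T b" and 0: "(shift T a ^^ n) x = 0"
  shows "x = 0"
  using x 0
proof (induction n)
  case (Suc n)
  then have "(shift T a ^^ n) x = 0"
    using shift_injective_on_gev[OF T \<open>a \<noteq> b\<close> shift_pow_in_gev[OF T]] by simp
  with Suc show ?case by simp
qed simp

text \<open>On the generalised eigenspace for \<open>b\<close> the operator \<open>T - a\<close> is the nonzero scalar \<open>b - a\<close> up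
  to a nilpotent operator, and can be inverted inside every subspace invariant under \<open>T\<close>.\<close>

lemma shift_solve:
  assumes T: "lin T" and "a \<noteq> b" and V: "subspace V" "\<And>x. x \<in> V \<Longrightarrow> T x \<in> V"
  shows "x \<in> V \<Longrightarrow> (shift T b ^^ n) x = 0 \<Longrightarrow> \<exists>w\<in>V. shift T a w = x \<and> (shift T b ^^ n) w = 0"
proof (induction n arbitrary: x)
  case 0
  then show ?case
    using lin_zero[OF lin_shift[OF T]] by (intro bexI[of _ 0]) (simp_all add: subspace_0[OF V(1)])
next
  case (Suc n)
  have "shift T b x \<in> V"
    unfolding shift_def using Suc.prems V by (intro subspace_diff subspace_scale) auto
  moreover have "(shift T b ^^ n) (shift T b x) = 0"
    using Suc.prems by (simp add: funpow_swap1)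
  ultimately obtain w where w: "w \<in> V" "shift T a w = shift T b x" "(shift T b ^^ n) w = 0"
    using Suc.IH by blast
  let ?w = "scale (1 / (b - a)) (x - w)"
  have "shift T a (x - w) = scale (b - a) x"
    using w(2) by (simp add: lin_diff[OF lin_shift[OF T]]) (simp add: shift_def algebra_simps)
  then have "shift T a ?w = x"
    using \<open>a \<noteq> b\<close> by (simp add: lin_scale[OF lin_shift[OF T]])
  moreover have "(shift T b ^^ Suc n) ?w = 0"
    using Suc.prems w(3) lin_zero[OF lin_shift[OF T]]
    by (simp only: lin_scale[OF lin_shift_pow[OF T]] lin_diff[OF lin_shift_pow[OF T]])
      (simp)
  moreover have "?w \<in> V"
    using w(1) Suc.prems(1) V by (intro subspace_scale subspace_diff) auto
  ultimately show ?case by blast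
qed

lemma shift_pow_solve:
  assumes T: "lin T" and ab: "a \<noteq> b" and x: "x \<in> gev T b"
  shows "\<exists>w \<in> gev T b. (shift T a ^^ m) w = x"
proof (induction m)
  case (Suc m)
  then obtain w where w: "w \<in> gev T b" "(shift T a ^^ m) w = x" by blast
  from w(1) obtain n where n: "(shift T b ^^ n) w = 0" by (auto simp: gev_def)
  have "\<exists>v\<in>UNIV. shift T a v = w \<and> (shift T b ^^ n) v = 0"
    by (rule shift_solve[OF T ab]) (simp_all add: n)
  then obtain v where "shift T a v = w" "(shift T b ^^ n) v = 0" by blast
  with w(2) show ?case
    by (intro bexI[of _ v]) (auto simp: gev_def funpow_swap1)
qed (use x in simp)


subsubsection \<open>Decomposition into generalised eigenspaces\<close>

text \<open>The operator \<open>p(T)\<close>, applied to a vector.\<close>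

definition pact :: "('g \<Rightarrow> 'g) \<Rightarrow> 'k poly \<Rightarrow> 'g \<Rightarrow> 'g" where
  "pact T p v = (\<Sum>i\<le>degree p. scale (coeff p i) ((T ^^ i) v))"

lemma pact_eq:
  assumes "degree p \<le> N" shows "pact T p v = (\<Sum>i\<le>N. scale (coeff p i) ((T ^^ i) v))"
  unfolding pact_def using assms
  by (intro sum.mono_neutral_left) (auto simp: coeff_eq_0)

lemma pact_add: "pact T (p + q) v = pact T p v + pact T q v"
proof -
  let ?N = "max (degree p) (degree q)"
  have "degree (p + q) \<le> ?N" by (rule degree_add_le_max)
  then show ?thesis
    by (simp add: pact_eq[of _ ?N] scale_left_distrib sum.distrib)
qed

lemma pact_smult: "pact T (smult c p) v = scale c (pact T p v)"
  by (simp add: pact_eq[of "smult c p" "degree p"] pact_def scale_sum_right)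

lemma pact_pCons:
  assumes T: "lin T" shows "pact T (pCons a p) v = scale a v + T (pact T p v)"
proof -
  have "pact T (pCons a p) v
      = (\<Sum>i\<le>Suc (degree p). scale (coeff (pCons a p) i) ((T ^^ i) v))"
    by (rule pact_eq) (simp add: degree_pCons_le)
  also have "\<dots> = scale a v + (\<Sum>i\<le>degree p. scale (coeff p i) (T ((T ^^ i) v)))"
    by (subst sum.atMost_Suc_shift) simp
  finally show ?thesis
    by (simp add: pact_def lin_sum[OF T] lin_scale[OF T])
qed

lemma pact_root:
  assumes T: "lin T" shows "pact T ([:- a, 1:] * p) v = shift T a (pact T p v)"
proof -
  have "[:- a, 1:] * p = pCons 0 p + smult (- a) p" by simp
  then show ?thesis
    by (simp only: pact_add pact_smult pact_pCons[OF T]) (simp add: shift_def)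
qed

lemma pact_shift:
  assumes T: "lin T" shows "pact T p (shift T a v) = shift T a (pact T p v)"
proof (induction p)
  case 0
  then show ?case by (simp add: pact_def lin_zero[OF lin_shift[OF T]])
next
  case (pCons c p)
  have "T (shift T a x) = shift T a (T x)" for x
    using shift_commute[OF T, of 0 a] by (simp add: shift_def)
  with pCons show ?case
    by (simp add: pact_pCons[OF T] lin_add[OF lin_shift[OF T]] lin_scale[OF lin_shift[OF T]])
qed

lemma annihilating_polynomial:
  assumes T: "lin T" shows "\<exists>p. p \<noteq> 0 \<and> pact T p v = 0"
proof -
  let ?S = "\<lambda>k. (\<lambda>i. (T ^^ i) v) ` {..<k}"
  have "\<exists>k. (T ^^ k) v \<in> span (?S k)"
  proof (rule ccontr)
    assume no: "\<nexists>k. (T ^^ k) v \<in> span (?S k)"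
    have "independent (?S k) \<and> card (?S k) = k" for k
    proof (induction k)
      case (Suc k)
      have "(T ^^ k) v \<notin> span (?S k)" using no by blast
      moreover then have "(T ^^ k) v \<notin> ?S k"
        by (rule contra_subsetD[OF span_superset])
      moreover have "?S (Suc k) = insert ((T ^^ k) v) (?S k)"
        by (simp add: lessThan_Suc)
      ultimately show ?case
        using Suc independent_insert by simp
    qed (simp add: independent_empty)
    then have "card Basis + 1 \<le> dim (UNIV :: 'g set)"
      by (metis Suc_eq_plus1 independent_card_le_dim subset_UNIV)
    then show False by simp
  qed
  then obtain k where k: "(T ^^ k) v \<in> span (?S k)" by blast
  let ?U = "{pact T p v | p. \<forall>i\<ge>k. coeff p i = 0}"
  have "subspace ?U"
  proof (rule subspaceI)
    show "0 \<in> ?U" by (auto simp: pact_def intro!: exI[of _ 0])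
    show "x + y \<in> ?U" if xy: "x \<in> ?U" "y \<in> ?U" for x y
    proof -
      from xy obtain p r where "\<forall>i\<ge>k. coeff p i = 0" "x = pact T p v"
        "\<forall>i\<ge>k. coeff r i = 0" "y = pact T r v" by blast
      then show ?thesis
        by (intro CollectI exI[of _ "p + r"]) (simp add: pact_add)
    qed
    show "scale c x \<in> ?U" if x: "x \<in> ?U" for c x
    proof -
      from x obtain p where "\<forall>i\<ge>k. coeff p i = 0" "x = pact T p v" by blast
      then show ?thesis
        by (intro CollectI exI[of _ "smult c p"]) (simp add: pact_smult)
    qed
  qed
  moreover have mon: "pact T (monom 1 i) v = (T ^^ i) v" for i
    by (simp add: pact_def degree_monom_eq if_distrib[of "\<lambda>c. scale c _"] cong: if_cong)
  then have "?S k \<subseteq> ?U"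
    by (auto intro!: exI[of _ "monom 1 _"])
  ultimately have "(T ^^ k) v \<in> ?U"
    using k span_minimal by blast
  then obtain p where p: "\<forall>i\<ge>k. coeff p i = 0" "(T ^^ k) v = pact T p v" by blast
  have "pact T (monom 1 k + smult (-1) p) v = 0"
    by (simp only: pact_add pact_smult mon) (simp add: p(2))
  moreover have "coeff (monom 1 k + smult (-1) p) k = 1"
    using p(1) by simp
  then have "monom 1 k + smult (-1) p \<noteq> 0" by force
  ultimately show ?thesis by blast
qed


text \<open>Inside the sum of the generalised eigenspaces, \<open>T - a\<close> is surjective up to the one for \<open>a\<close>.\<close>

lemma sum_of_gev_step:
  assumes T: "lin T" and V: "subspace V" "\<And>x. x \<in> V \<Longrightarrow> T x \<in> V"
    and u: "u \<in> span (\<Union>b. gev T b \<inter> V)"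
  shows "\<exists>w\<in>span (\<Union>b. gev T b \<inter> V). u - shift T a w \<in> gev T a \<inter> V"
  using u
proof (induction rule: span_induct_alt)
  case base
  have "0 \<in> gev T a \<inter> V"
    using subspace_gev[OF T] V(1) by (simp add: subspace_0)
  then show ?case
    by (intro bexI[of _ 0]) (simp_all add: span_zero lin_zero[OF lin_shift[OF T]])
next
  case (step c x y)
  then obtain b w where b: "x \<in> gev T b" "x \<in> V"
    and w: "w \<in> span (\<Union>b. gev T b \<inter> V)" "y - shift T a w \<in> gev T a \<inter> V" by blast
  have sub: "subspace (gev T a \<inter> V)"
    using subspace_gev[OF T] V(1) by (rule subspace_inter)
  obtain w' where w': "w' \<in> span (\<Union>b. gev T b \<inter> V)" "x - shift T a w' \<in> gev T a \<inter> V"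
  proof (cases "b = a")
    case True
    then show ?thesis
      using b by (intro that[of 0]) (simp_all add: span_zero lin_zero[OF lin_shift[OF T]])
  next
    case False
    from b obtain n where "(shift T b ^^ n) x = 0" by (auto simp: gev_def)
    from shift_solve[OF T not_sym[OF False] V b(2) this]
    obtain v where v: "v \<in> V" "shift T a v = x" "(shift T b ^^ n) v = 0" by blast
    then have "v \<in> gev T b \<inter> V" by (auto simp: gev_def)
    then show ?thesis
      using v(2) subspace_0[OF sub] by (intro that[of v] span_base) auto
  qed
  have "scale c x + y - shift T a (scale c w' + w)
      = scale c (x - shift T a w') + (y - shift T a w)"
    by (simp add: lin_add[OF lin_shift[OF T]] lin_scale[OF lin_shift[OF T]] algebra_simps)
  also have "\<dots> \<in> gev T a \<inter> V"
    by (rule subspace_add[OF sub subspace_scale[OF sub w'(2)] w(2)])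
  finally show ?case
    using w w' by (intro bexI[of _ "scale c w' + w"] span_add span_scale) auto
qed

end

locale lie_algebra_closed = lie_algebra scale Basis bracket
  for scale :: "'k::{alg_closed_field, field_char_0} \<Rightarrow> 'g::ab_group_add \<Rightarrow> 'g"
    and Basis :: "'g set" and bracket :: "'g \<Rightarrow> 'g \<Rightarrow> 'g"
begin

text \<open>Induction on the degree of a polynomial that annihilates \<open>v\<close>: if \<open>a\<close> is a root of it, then
  \<open>(T - a) v\<close> has an annihilating polynomial of smaller degree, so it lies in the sum, and \<open>v\<close> is recovered
  from \<open>(T - a) v\<close> up to an element of the generalised eigenspace for \<open>a\<close>.\<close>

lemma sum_of_gev:
  assumes T: "lin T" and V: "subspace V" "\<And>x. x \<in> V \<Longrightarrow> T x \<in> V" and v: "v \<in> V"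
  shows "v \<in> span (\<Union>b. gev T b \<inter> V)"
proof -
  have "v \<in> span (\<Union>b. gev T b \<inter> V)" if "v \<in> V" "degree p = n" "p \<noteq> 0" "pact T p v = 0" for v p n
    using that
  proof (induction n arbitrary: v p)
    case 0
    then obtain c where "p = [:c:]" "c \<noteq> 0" by (metis degree_eq_zeroE pCons_0_0)
    with 0 have "v = 0" by (simp add: pact_def)
    then show ?case by (simp add: span_zero)
  next
    case (Suc n)
    then obtain a where "poly p a = 0"
      using alg_closed_imp_poly_has_root[of p] by auto
    then obtain r where r: "p = [:- a, 1:] * r" by (metis dvdE poly_eq_0_iff_dvd)
    have "r \<noteq> 0" using Suc.prems(3) r by auto
    then have deg: "degree r = n"
      using Suc.prems(2) unfolding r by (subst (asm) degree_mult_eq) auto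
    have sv: "shift T a v \<in> V"
      unfolding shift_def using Suc.prems V by (intro subspace_diff subspace_scale) auto
    have "pact T r (shift T a v) = 0"
      using Suc.prems(4) by (simp only: r pact_root[OF T] pact_shift[OF T])
    then have "shift T a v \<in> span (\<Union>b. gev T b \<inter> V)"
      using Suc.IH sv deg \<open>r \<noteq> 0\<close> by blast
    from sum_of_gev_step[OF T V this] obtain w
      where w: "w \<in> span (\<Union>b. gev T b \<inter> V)" "shift T a v - shift T a w \<in> gev T a \<inter> V" by blast
    have "span (\<Union>b. gev T b \<inter> V) \<subseteq> V"
      using V(1) by (intro span_minimal) auto
    then have "v - w \<in> V" using w(1) Suc.prems(1) V(1) by (auto intro: subspace_diff)
    moreover have "v - w \<in> gev T a"
      using w(2) by - (rule gev_shift_iff, simp add: lin_diff[OF lin_shift[OF T]])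
    ultimately have "v - w \<in> span (\<Union>b. gev T b \<inter> V)"
      by (intro span_base) auto
    then show ?case using w(1) span_add by fastforce
  qed
  then show ?thesis
    using annihilating_polynomial[OF T, of v] v by blast
qed

end

context lie_algebra
begin

text \<open>By the Leibniz rule \<open>(ad h - a - b)\<^sup>k [x, y]\<close> is a sum of brackets of \<open>(ad h - a)\<^sup>i x\<close> and
  \<open>(ad h - b)\<^sup>j y\<close> with \<open>i + j = k\<close>.\<close>

lemma bracket_gev:
  assumes "x \<in> gev (bracket h) a" "y \<in> gev (bracket h) b"
  shows "bracket x y \<in> gev (bracket h) (a + b)"
proof -
  have step: "shift (bracket h) (a + b) (bracket x y)
      = bracket (shift (bracket h) a x) y + bracket x (shift (bracket h) b y)" for x y
    by (simp add: shift_def bracket_derivation[of h x y] bracket_diff_left bracket_diff_right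
        bracket_scale_left bracket_scale_right scale_left_distrib)
  have *: "(shift (bracket h) (a + b) ^^ k) (bracket x y) = 0"
    if "n + m = k" "(shift (bracket h) a ^^ n) x = 0" "(shift (bracket h) b ^^ m) y = 0" for n m k x y
    using that
  proof (induction k arbitrary: n m x y)
    case (Suc k)
    let ?N = "shift (bracket h) (a + b) ^^ k"
    have N0: "?N 0 = 0" by (rule lin_zero[OF lin_shift_pow[OF lin_bracket]])
    have 1: "?N (bracket (shift (bracket h) a x) y) = 0"
    proof (cases n)
      case 0
      with Suc.prems show ?thesis
        by (simp add: N0 lin_zero[OF lin_shift[OF lin_bracket]])
    next
      case (Suc n')
      with Suc.prems Suc.IH[of n' m "shift (bracket h) a x" y] show ?thesis
        by (simp add: funpow_swap1)
    qed
    have 2: "?N (bracket x (shift (bracket h) b y)) = 0"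
    proof (cases m)
      case 0
      with Suc.prems show ?thesis
        by (simp add: N0 lin_zero[OF lin_shift[OF lin_bracket]])
    next
      case (Suc m')
      with Suc.prems Suc.IH[of n m' x "shift (bracket h) b y"] show ?thesis
        by (simp add: funpow_swap1)
    qed
    have "(shift (bracket h) (a + b) ^^ Suc k) (bracket x y)
        = ?N (shift (bracket h) (a + b) (bracket x y))"
      by (simp add: funpow_swap1)
    then show ?case
      by (simp add: step lin_add[OF lin_shift_pow[OF lin_bracket]] 1 2)
  qed simp
  from assms obtain n m where "(shift (bracket h) a ^^ n) x = 0" "(shift (bracket h) b ^^ m) y = 0"
    by (auto simp: gev_def)
  from *[OF refl this] show ?thesis unfolding gev_def by blast
qed


subsection \<open>The Killing form\<close>

lemma lin_bracket2: "lin (\<lambda>z. bracket x (bracket y z))"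
  by (rule lin_comp[OF lin_bracket lin_bracket])

lemma killing_sym: "killing x y = killing y x"
  unfolding killing_def by (rule trace_comm[OF lin_bracket lin_bracket])

lemma lform_killing: "lform (killing x)"
  unfolding killing_def by (rule lform_trace_comp[OF lin_bracket, of x "\<lambda>z. z"])

lemma lform_killing_left: "lform (\<lambda>x. killing x y)"
  using lform_killing[of y] by (simp add: killing_sym[of _ y])

lemmas killing_add_right = lform_add[OF lform_killing]
  and killing_scale_right = lform_scale[OF lform_killing]
  and killing_zero_right [simp] = lform_zero[OF lform_killing]
  and killing_minus_right = lform_minus[OF lform_killing]
  and killing_diff_right = lform_diff[OF lform_killing]
  and killing_sum_right = lform_sum[OF lform_killing]
  and killing_add_left = lform_add[OF lform_killing_left]
  and killing_scale_left = lform_scale[OF lform_killing_left]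
  and killing_zero_left [simp] = lform_zero[OF lform_killing_left]
  and killing_minus_left = lform_minus[OF lform_killing_left]
  and killing_diff_left = lform_diff[OF lform_killing_left]
  and killing_sum_left = lform_sum[OF lform_killing_left]

lemma killing_invariant: "killing (bracket x y) z = killing x (bracket y z)"
proof -
  have "trace (\<lambda>v. bracket y (bracket x (bracket z v))) = trace (\<lambda>v. bracket x (bracket z (bracket y v)))"
    by (rule trace_comm[OF lin_bracket lin_bracket2])
  then show ?thesis
    by (simp add: killing_def bracket_bracket_left trace_sub bracket_diff_right)
qed

end

text \<open>The radical of the Killing form is an ideal, and not everything.\<close>

lemma (in simple_lie_algebra) killing_nondegenerate:
  assumes "killing u v \<noteq> 0" and x: "\<And>y. killing x y = 0"
  shows "x = 0"
proof -
  let ?I = "{x. \<forall>y. killing x y = 0}"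
  have "lie_ideal ?I"
    unfolding lie_ideal_def
  proof (intro conjI allI ballI)
    show "subspace ?I"
      by (rule subspaceI) (simp_all add: killing_add_left killing_scale_left)
    fix x y assume "y \<in> ?I"
    then show "bracket x y \<in> ?I"
      by (simp add: bracket_swap[of x y] killing_minus_left killing_invariant)
  qed
  moreover have "?I \<noteq> UNIV" using assms(1) by auto
  ultimately have "?I = {0}" using ideal_trivial by blast
  then show ?thesis using x by blast
qed

locale nondegenerate_lie_algebra = lie_algebra_closed +
  assumes nondegenerate: "(\<And>y. killing x y = 0) \<Longrightarrow> x = 0"
begin

text \<open>The map \<open>x \<mapsto> killing x\<close> is injective, hence surjective, by finite dimension.\<close>

lemma killing_represents:
  assumes \<xi>: "lform \<xi>" obtains t where "\<And>y. killing t y = \<xi> y"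
proof -
  let ?\<iota> = "\<lambda>x. \<Sum>b\<in>Basis. scale (killing x b) b"
  have lin: "lin ?\<iota>"
    by (intro lin_Sum lin_rank_one lform_killing_left)
  have ker: "\<iota> = \<iota>'" if "lform \<iota>" "lform \<iota>'" "\<And>b. b \<in> Basis \<Longrightarrow> \<iota> b = \<iota>' b" for \<iota> \<iota>' :: "'b \<Rightarrow> 'a"
  proof
    fix x
    have "\<iota> (\<Sum>b\<in>Basis. scale (representation Basis x b) b)
        = \<iota>' (\<Sum>b\<in>Basis. scale (representation Basis x b) b)"
      by (simp add: lform_sum[OF that(1)] lform_sum[OF that(2)] lform_scale[OF that(1)]
          lform_scale[OF that(2)] that(3))
    then show "\<iota> x = \<iota>' x" by (simp only: repr_sum)
  qed
  have coeff: "f b = g b" if "(\<Sum>b\<in>Basis. scale (f b) b) = (\<Sum>b\<in>Basis. scale (g b) b)" "b \<in> Basis"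
    for f g b
  proof -
    have "(\<Sum>b\<in>Basis. scale (f b - g b) b) = 0"
      using that(1) by (simp add: scale_left_diff_distrib sum_subtractf)
    from independentD[OF independent_Basis finite_Basis order_refl this that(2)] show ?thesis by simp
  qed
  have "inj ?\<iota>"
  proof (rule injI)
    fix x y assume "?\<iota> x = ?\<iota> y"
    then have "killing (x - y) b = 0" if "b \<in> Basis" for b
      using coeff[of "killing x" "killing y" b] that by (simp add: killing_diff_left)
    then have "killing (x - y) = (\<lambda>_. 0)"
      by (intro ker lform_killing) (simp_all add: lform_def)
    then show "x = y" using nondegenerate[of "x - y"] by simp
  qed
  then have "surj ?\<iota>"
    using lin linear_inj_imp_surj by (simp add: lin_def)
  then obtain t where "(\<Sum>b\<in>Basis. scale (\<xi> b) b) = ?\<iota> t" by (meson surjD)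
  then have "killing t = \<xi>"
    using coeff[of \<xi> "killing t"] by (intro ker lform_killing \<xi>) simp
  then show ?thesis using that by blast
qed

text \<open>The functional \<open>y \<mapsto> tr (D \<circ> ad y)\<close> is \<open>killing t\<close> for some \<open>t\<close>. Then \<open>E = D - ad t\<close> is a
  derivation with \<open>tr (E \<circ> ad y) = 0\<close> for all \<open>y\<close>, so \<open>killing (E x) y = tr (E \<circ> ad [x, y]) = 0\<close>.\<close>

lemma derivation_inner:
  assumes D: "lin D" and der: "\<And>x y. D (bracket x y) = bracket (D x) y + bracket x (D y)"
  obtains t where "\<And>x. D x = bracket t x"
proof -
  obtain t where t: "\<And>y. killing t y = trace (\<lambda>z. D (bracket y z))"
    using killing_represents[OF lform_trace_comp[OF D, of "\<lambda>z. z"]] by blast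
  define E where "E x = D x - bracket t x" for x
  have E: "lin E" unfolding E_def by (intro lin_sub D lin_bracket)
  have Eder: "E (bracket x y) = bracket (E x) y + bracket x (E y)" for x y
    by (simp add: E_def der bracket_derivation[of t x y] bracket_diff_left bracket_diff_right)
  have tr0: "trace (\<lambda>z. E (bracket y z)) = 0" for y
    using t[of y] by (simp add: E_def trace_sub killing_def)
  have "E x = 0" for x
  proof (rule nondegenerate)
    fix y
    have "killing (E x) y = trace (\<lambda>z. E (bracket x (bracket y z)) - bracket x (E (bracket y z)))"
      by (simp add: killing_def Eder)
    also have "\<dots> = trace (\<lambda>z. E (bracket x (bracket y z))) - trace (\<lambda>z. bracket x (E (bracket y z)))"
      by (rule trace_sub)
    also have "trace (\<lambda>z. bracket x (E (bracket y z))) = trace (\<lambda>z. E (bracket y (bracket x z)))"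
      by (rule trace_comm[OF lin_bracket lin_comp[OF E lin_bracket]])
    also have "trace (\<lambda>z. E (bracket x (bracket y z))) - \<dots> = trace (\<lambda>z. E (bracket (bracket x y) z))"
      by (simp add: bracket_bracket_left lin_diff[OF E] trace_sub)
    finally show "killing (E x) y = 0" by (simp add: tr0)
  qed
  then have "D x = bracket t x" for x by (simp add: E_def)
  then show ?thesis using that by blast
qed

end

section \<open>The root space decomposition\<close>

lemma (in lie_algebra) trace_locally_nilpotent:
  fixes f :: "'g \<Rightarrow> 'g"
  assumes f: "lin f" and nil: "\<And>x. \<exists>n. (f ^^ n) x = 0"
  shows "trace f = 0"
proof -
  from nil obtain n where n: "\<And>x. (f ^^ n x) x = 0" by metis
  define N where "N = Max (insert 0 (n ` Basis))"
  have "(f ^^ N) b = 0" if "b \<in> Basis" for b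
  proof -
    have "n b \<le> N" using that finite_Basis by (simp add: N_def)
    then have "(f ^^ N) b = (f ^^ (N - n b)) ((f ^^ n b) b)"
      by (metis comp_apply funpow_add le_add_diff_inverse2)
    then show ?thesis by (simp add: n lin_zero[OF lin_funpow[OF f]])
  qed
  then have "(f ^^ N) (\<Sum>b\<in>Basis. scale (representation Basis x b) b) = 0" for x
    by (simp add: lin_sum[OF lin_funpow[OF f]] lin_scale[OF lin_funpow[OF f]])
  then have "(f ^^ N) x = 0" for x by (simp only: repr_sum)
  then show ?thesis by (rule trace_nilpotent[OF f])
qed

locale cartan_lie_algebra = nondegenerate_lie_algebra scale Basis bracket
  for scale :: "'k::{alg_closed_field, field_char_0} \<Rightarrow> 'g::ab_group_add \<Rightarrow> 'g"
    and Basis :: "'g set" and bracket :: "'g \<Rightarrow> 'g \<Rightarrow> 'g" +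
  fixes H :: "'g set"
  assumes cartan: "cartan_subalgebra H"
begin

lemma subspace_H: "subspace H"
  and bracket_H: "x \<in> H \<Longrightarrow> y \<in> H \<Longrightarrow> bracket x y \<in> H"
  and normalizer_H: "(\<And>h. h \<in> H \<Longrightarrow> bracket h x \<in> H) \<Longrightarrow> x \<in> H"
proof -
  show "subspace H" and "x \<in> H \<Longrightarrow> y \<in> H \<Longrightarrow> bracket x y \<in> H"
    using cartan by (auto simp: cartan_subalgebra_def lie_subalgebra_def)
  assume *: "\<And>h. h \<in> H \<Longrightarrow> bracket h x \<in> H"
  have "bracket x h \<in> H" if "h \<in> H" for h
    using subspace_neg[OF \<open>subspace H\<close> *[OF that]] by (simp add: bracket_swap[of x h])
  then show "x \<in> H"
    using cartan unfolding cartan_subalgebra_def by blast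
qed

lemma lcs_funpow:
  assumes "h \<in> H" "x \<in> H" shows "(bracket h ^^ n) x \<in> lower_central_series H n"
proof (induction n)
  case (Suc n)
  then show ?case using assms(1) by (auto intro!: span_base)
qed (simp add: assms)

lemma shift_0: "shift T 0 = T"
  by (simp add: shift_def fun_eq_iff)

lemma H_gev_0: "h \<in> H \<Longrightarrow> x \<in> H \<Longrightarrow> x \<in> gev (bracket h) 0"
  using cartan lcs_funpow[of h x] unfolding cartan_subalgebra_def gev_def shift_0
  by (metis (mono_tags, lifting) mem_Collect_eq singletonD)


subsection \<open>Generalised weight spaces\<close>

text \<open>The generalised weight space of \<open>H\<close> for \<open>\<kappa>\<close>.\<close>

definition gws :: "('g \<Rightarrow> 'k) \<Rightarrow> 'g set" where
  "gws \<kappa> = {x. \<forall>h\<in>H. x \<in> gev (bracket h) (\<kappa> h)}"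

definition on_H :: "('g \<Rightarrow> 'k) \<Rightarrow> bool" where
  "on_H \<kappa> \<longleftrightarrow> (\<forall>h. h \<notin> H \<longrightarrow> \<kappa> h = 0)"

lemma subspace_gws: "subspace (gws \<kappa>)"
proof -
  have "gws \<kappa> = \<Inter> {gev (bracket h) (\<kappa> h) |h. h \<in> H}"
    by (auto simp: gws_def)
  then show ?thesis
    by (auto intro!: subspace_Inter subspace_gev lin_bracket)
qed

lemma bracket_gws: "x \<in> gws \<kappa> \<Longrightarrow> y \<in> gws \<mu> \<Longrightarrow> bracket x y \<in> gws (\<kappa> + \<mu>)"
  by (simp add: gws_def bracket_gev)

lemma H_gws_0: "H \<subseteq> gws 0"
  by (auto simp: gws_def H_gev_0)

lemma bracket_H_gws: "h \<in> H \<Longrightarrow> x \<in> gws \<kappa> \<Longrightarrow> bracket h x \<in> gws \<kappa>"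
  using bracket_gws[of h 0 x \<kappa>] H_gws_0 by auto

lemma shift_gws:
  assumes "h \<in> H" "x \<in> gws \<kappa>" shows "shift (bracket h) a x \<in> gws \<kappa>"
  unfolding shift_def using assms
  by (intro subspace_diff subspace_scale subspace_gws bracket_H_gws)

lemma shift_pow_gws:
  assumes "h \<in> H" "x \<in> gws \<kappa>" shows "(shift (bracket h) a ^^ n) x \<in> gws \<kappa>"
  by (induction n) (simp_all add: assms shift_gws)

text \<open>Induction on \<open>dim V\<close>: an \<open>h \<in> H\<close> with more than one generalised eigenspace on \<open>V\<close> splits \<open>V\<close> into
  proper subspaces, which are again stable because \<open>H \<subseteq> gws 0\<close>.\<close>

lemma gws_cover:
  assumes "subspace V" "\<And>h x. h \<in> H \<Longrightarrow> x \<in> V \<Longrightarrow> bracket h x \<in> V"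
  shows "V \<subseteq> span (\<Union>\<kappa>\<in>Collect on_H. gws \<kappa>)"
  using assms
proof (induction "dim V" arbitrary: V rule: less_induct)
  case less
  show ?case
  proof (cases "\<forall>h\<in>H. \<exists>a. V \<subseteq> gev (bracket h) a")
    case True
    then obtain a where a: "\<And>h. h \<in> H \<Longrightarrow> V \<subseteq> gev (bracket h) (a h)" by metis
    let ?\<kappa> = "\<lambda>h. if h \<in> H then a h else 0"
    have "V \<subseteq> gws ?\<kappa>" using a by (auto simp: gws_def)
    moreover have "on_H ?\<kappa>" by (simp add: on_H_def)
    ultimately show ?thesis using span_superset by fast
  next
    case False
    then obtain h where h: "h \<in> H" "\<And>a. \<not> V \<subseteq> gev (bracket h) a" by blast
    have part: "gev (bracket h) b \<inter> V \<subseteq> span (\<Union>\<kappa>\<in>Collect on_H. gws \<kappa>)" for b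
    proof (rule less.hyps)
      show sub: "subspace (gev (bracket h) b \<inter> V)"
        by (intro subspace_inter subspace_gev lin_bracket less.prems)
      have "gev (bracket h) b \<inter> V \<subset> V" using h(2)[of b] by blast
      then show "dim (gev (bracket h) b \<inter> V) < dim V"
        using sub less.prems(1) by (intro dim_psubset) (simp add: span_eq_iff[THEN iffD2])
      show "bracket h' x \<in> gev (bracket h) b \<inter> V" if "h' \<in> H" "x \<in> gev (bracket h) b \<inter> V" for h' x
        using bracket_gev[of h' h 0 x b] that h(1) less.prems(2) by (simp add: H_gev_0)
    qed
    have "V \<subseteq> span (\<Union>b. gev (bracket h) b \<inter> V)"
      using sum_of_gev[OF lin_bracket less.prems(1)] less.prems(2) h(1) by blast
    also have "\<dots> \<subseteq> span (\<Union>\<kappa>\<in>Collect on_H. gws \<kappa>)"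
      using part by (intro span_minimal subspace_span UN_least)
    finally show ?thesis .
  qed
qed

lemma gws_independent:
  assumes "finite F" "\<And>\<kappa>. \<kappa> \<in> F \<Longrightarrow> on_H \<kappa>" "\<And>\<kappa>. \<kappa> \<in> F \<Longrightarrow> x \<kappa> \<in> gws \<kappa>" "(\<Sum>\<kappa>\<in>F. x \<kappa>) = 0" "\<nu> \<in> F"
  shows "x \<nu> = 0"
  using assms
proof (induction F arbitrary: x \<nu>)
  case (insert \<mu> F)
  have F: "x \<nu> = 0" if "\<nu> \<in> F" for \<nu>
  proof -
    have "\<mu> \<noteq> \<nu>" using insert.hyps that by blast
    moreover have "on_H \<mu>" "on_H \<nu>" using insert.prems that by auto
    ultimately obtain h where h: "h \<in> H" "\<mu> h \<noteq> \<nu> h"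
      unfolding on_H_def by (metis ext)
    obtain n where n: "(shift (bracket h) (\<mu> h) ^^ n) (x \<mu>) = 0"
      using insert.prems(2)[of \<mu>] h(1) by (auto simp: gws_def gev_def)
    let ?S = "shift (bracket h) (\<mu> h) ^^ n"
    have S: "lin ?S" by (intro lin_shift_pow lin_bracket)
    have "?S (\<Sum>\<kappa>\<in>insert \<mu> F. x \<kappa>) = 0"
      using insert.prems(3) lin_zero[OF S] by simp
    then have "(\<Sum>\<kappa>\<in>F. ?S (x \<kappa>)) = 0"
      using insert.hyps n by (simp add: lin_sum[OF S] lin_add[OF S])
    then have 0: "?S (x \<nu>) = 0"
      using insert.IH[of "\<lambda>\<kappa>. ?S (x \<kappa>)" \<nu>] insert.prems(1,2) h(1) that
      by (simp add: shift_pow_gws)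
    have "x \<nu> \<in> gev (bracket h) (\<nu> h)"
      using insert.prems(2)[of \<nu>] that h(1) by (simp add: gws_def)
    then show ?thesis
      by (rule shift_pow_injective_on_gev[OF lin_bracket h(2) _ 0])
  qed
  then have "x \<mu> = 0" using insert.prems(3) insert.hyps by simp
  with F insert.prems(4) show ?case by blast
qed simp

lemma lcs_subset_H: "lower_central_series H n \<subseteq> H"
proof (induction n)
  case (Suc n)
  then show ?case
    unfolding lower_central_series.simps
    by (intro span_minimal subspace_H) (auto intro: bracket_H)
qed simp

lemma lcs_bracket: "x \<in> H \<Longrightarrow> y \<in> lower_central_series H n \<Longrightarrow> bracket x y \<in> lower_central_series H (Suc n)"
  by (auto intro: span_base)

text \<open>Engel's theorem for the action of the nilpotent algebra \<open>H\<close> on \<open>gws 0 / H\<close>, by descent along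
  the lower central series: if some \<open>x\<close> outside \<open>H\<close> is moved into \<open>H\<close> by the \<open>j+1\<close>-st term, then the
  \<open>j\<close>-th term acts on such vectors modulo \<open>H\<close> by commuting nilpotent operators.\<close>

lemma lcs_common_vector:
  assumes x: "x \<in> gws 0" "x \<notin> H" "\<And>c. c \<in> lower_central_series H (Suc j) \<Longrightarrow> bracket c x \<in> H"
  obtains y where "y \<in> gws 0" "y \<notin> H" "\<And>c. c \<in> lower_central_series H j \<Longrightarrow> bracket c y \<in> H"
proof -
  let ?C = "lower_central_series H"
  define K where "K = {x \<in> gws 0. \<forall>c\<in>?C (Suc j). bracket c x \<in> H}"
  \<comment> \<open>one element \<open>b\<close> at a time: the last of the vectors \<open>y, [b, y], [b, [b, y]], \<dots>\<close> outside \<open>H\<close> serves for \<open>b\<close> as well\<close>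
  have *: "\<exists>y\<in>K - H. \<forall>b\<in>B. bracket b y \<in> H" if "finite B" "B \<subseteq> ?C j" for B
    using that
  proof (induction B)
    case empty
    then show ?case using x by (auto simp: K_def)
  next
    case (insert b B)
    then obtain y where y: "y \<in> K - H" "\<forall>b\<in>B. bracket b y \<in> H" by auto
    have b: "b \<in> H" "b \<in> ?C j" using insert.prems lcs_subset_H by auto
    have pow: "(bracket b ^^ s) y \<in> K \<and> (\<forall>b'\<in>B. bracket b' ((bracket b ^^ s) y) \<in> H)" for s
    proof (induction s)
      case (Suc s)
      let ?z = "(bracket b ^^ s) y"
      have z: "?z \<in> gws 0" "\<And>c. c \<in> ?C (Suc j) \<Longrightarrow> bracket c ?z \<in> H"
        "\<And>b'. b' \<in> B \<Longrightarrow> bracket b' ?z \<in> H"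
        using Suc by (auto simp: K_def)
      have "bracket c (bracket b ?z) \<in> H" if "bracket c b \<in> ?C (Suc j)" "bracket c ?z \<in> H" for c
      proof -
        have "bracket c (bracket b ?z) = bracket (bracket c b) ?z + bracket b (bracket c ?z)"
          by (rule bracket_derivation)
        then show ?thesis
          using z(2)[OF that(1)] bracket_H[OF b(1) that(2)] subspace_add[OF subspace_H] by simp
      qed
      moreover have "c \<in> H" if "c \<in> ?C n" for c n using lcs_subset_H that by blast
      moreover have "bracket b ?z \<in> gws 0" using bracket_H_gws b(1) z(1) by blast
      ultimately show ?case
        using z insert.prems b(2) lcs_bracket by (auto simp: K_def simp del: lower_central_series.simps)
    qed (use y in auto)
    obtain N where "(bracket b ^^ N) y = 0"
      using y(1) b(1) by (auto simp: K_def gws_def gev_def shift_0)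
    then have ex: "\<exists>s. (bracket b ^^ s) y \<in> H" using subspace_0[OF subspace_H] by metis
    define s where "s = (LEAST s. (bracket b ^^ s) y \<in> H)"
    have s: "(bracket b ^^ s) y \<in> H" unfolding s_def by (rule LeastI_ex[OF ex])
    have "s \<noteq> 0" using s y(1) by (cases s) auto
    then obtain r where r: "s = Suc r" by (cases s) auto
    have "(bracket b ^^ r) y \<notin> H"
      using not_less_Least[of r "\<lambda>s. (bracket b ^^ s) y \<in> H"] r unfolding s_def by auto
    then show ?case
      using pow[of r] s r by (intro bexI[of _ "(bracket b ^^ r) y"]) auto
  qed
  obtain B where B: "B \<subseteq> ?C j" "independent B" "?C j \<subseteq> span B"
    using maximal_independent_subset by blast
  obtain y where y: "y \<in> K - H" "\<forall>b\<in>B. bracket b y \<in> H"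
    using *[OF finiteI_independent[OF B(2)] B(1)] by blast
  have "subspace {c. bracket c y \<in> H}"
    using subspace_H by (intro subspaceI)
      (auto simp: subspace_0 bracket_add_left bracket_scale_left subspace_add subspace_scale)
  then have "span B \<subseteq> {c. bracket c y \<in> H}"
    using y(2) by (intro span_minimal) auto
  then show ?thesis
    using that[of y] y(1) B(3) by (auto simp: K_def)
qed

lemma gws_0: "gws 0 = H"
proof (rule ccontr)
  assume "gws 0 \<noteq> H"
  then obtain x where x: "x \<in> gws 0" "x \<notin> H" using H_gws_0 by blast
  obtain n where n: "lower_central_series H n = {0}"
    using cartan by (auto simp: cartan_subalgebra_def)
  have "\<exists>y\<in>gws 0 - H. \<forall>c\<in>lower_central_series H (n - i). bracket c y \<in> H" if "i \<le> n" for i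
    using that
  proof (induction i)
    case 0
    have "\<forall>c\<in>lower_central_series H (n - 0). bracket c x \<in> H"
      using n subspace_0[OF subspace_H] by simp
    then show ?case using x by blast
  next
    case (Suc i)
    have "i \<le> n" using Suc.prems by simp
    from Suc.IH[OF this] obtain y
      where "y \<in> gws 0 - H" "\<forall>c\<in>lower_central_series H (n - i). bracket c y \<in> H" by blast
    moreover have "n - i = Suc (n - Suc i)" using Suc.prems by simp
    ultimately show ?case
      using lcs_common_vector[of y "n - Suc i"] by (metis DiffD1 DiffD2 DiffI)
  qed
  from this[of n] obtain y where "y \<notin> H" "\<forall>c\<in>H. bracket c y \<in> H" by auto
  then show False using normalizer_H by blast
qed


subsection \<open>Projections to the weight spaces\<close>

definition wts :: "('g \<Rightarrow> 'k) set" where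
  "wts = {\<kappa>. on_H \<kappa> \<and> gws \<kappa> \<noteq> {0}}"

definition is_decomp :: "'g \<Rightarrow> (('g \<Rightarrow> 'k) \<Rightarrow> 'g) \<Rightarrow> bool" where
  "is_decomp x c \<longleftrightarrow> (\<forall>\<kappa>. c \<kappa> \<in> gws \<kappa>) \<and> (\<forall>\<kappa>. \<kappa> \<notin> wts \<longrightarrow> c \<kappa> = 0) \<and> x = (\<Sum>\<kappa>\<in>wts. c \<kappa>)"

definition proj :: "('g \<Rightarrow> 'k) \<Rightarrow> 'g \<Rightarrow> 'g" where
  "proj \<kappa> x = (THE c. is_decomp x c) \<kappa>"

lemma zero_in_gws: "0 \<in> gws \<kappa>"
  by (rule subspace_0[OF subspace_gws])

lemma sum_of_gws:
  assumes "finite F" and "x \<in> span (\<Union>\<kappa>\<in>F. gws \<kappa>)"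
  shows "\<exists>c. (\<forall>\<kappa>. c \<kappa> \<in> gws \<kappa>) \<and> x = (\<Sum>\<kappa>\<in>F. c \<kappa>)"
  using assms(2)
proof (induction rule: span_induct_alt)
  case base
  show ?case by (intro exI[of _ "\<lambda>_. 0"]) (simp add: zero_in_gws)
next
  case (step a x y)
  then obtain \<mu> c where \<mu>: "\<mu> \<in> F" "x \<in> gws \<mu>" and c: "\<forall>\<kappa>. c \<kappa> \<in> gws \<kappa>" "y = (\<Sum>\<kappa>\<in>F. c \<kappa>)"
    by blast
  let ?d = "\<lambda>\<kappa>. (if \<kappa> = \<mu> then scale a x else 0) + c \<kappa>"
  have "scale a x + y = (\<Sum>\<kappa>\<in>F. ?d \<kappa>)"
    using c(2) \<mu>(1) assms(1) by (simp add: sum.distrib)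
  moreover have "?d \<kappa> \<in> gws \<kappa>" for \<kappa>
    using \<mu>(2) c(1) subspace_gws[of \<kappa>] by (auto intro!: subspace_add subspace_scale)
  ultimately show ?case by (intro exI[of _ ?d] conjI allI)
qed

lemma finite_wts: "finite wts"
proof -
  have "\<exists>F. finite F \<and> F \<subseteq> Collect on_H \<and> b \<in> span (\<Union>\<kappa>\<in>F. gws \<kappa>)" for b
  proof -
    have "b \<in> span (\<Union>\<kappa>\<in>Collect on_H. gws \<kappa>)"
      using gws_cover[of UNIV] by auto
    then show ?thesis
    proof (induction rule: span_induct_alt)
      case base
      show ?case by (intro exI[of _ "{}"]) simp
    next
      case (step a x y)
      then obtain \<mu> F where \<mu>: "on_H \<mu>" "x \<in> gws \<mu>"
        and F: "finite F" "F \<subseteq> Collect on_H" "y \<in> span (\<Union>\<kappa>\<in>F. gws \<kappa>)" by blast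
      have "(\<Union>\<kappa>\<in>F. gws \<kappa>) \<subseteq> (\<Union>\<kappa>\<in>insert \<mu> F. gws \<kappa>)" by blast
      then have "y \<in> span (\<Union>\<kappa>\<in>insert \<mu> F. gws \<kappa>)"
        using F(3) span_mono by blast
      moreover have "x \<in> span (\<Union>\<kappa>\<in>insert \<mu> F. gws \<kappa>)"
        using \<mu>(2) by (intro span_base) blast
      ultimately show ?case
        using F(1,2) \<mu>(1) by (intro exI[of _ "insert \<mu> F"]) (auto intro: span_add span_scale)
    qed
  qed
  then obtain S where S: "\<And>b. finite (S b)" "\<And>b. S b \<subseteq> Collect on_H"
    "\<And>b. b \<in> span (\<Union>\<kappa>\<in>S b. gws \<kappa>)" by metis
  define F where "F = (\<Union>b\<in>Basis. S b)"
  have fin: "finite F" using S(1) finite_Basis by (simp add: F_def)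
  have "b \<in> span (\<Union>\<kappa>\<in>F. gws \<kappa>)" if "b \<in> Basis" for b
  proof -
    have "(\<Union>\<kappa>\<in>S b. gws \<kappa>) \<subseteq> (\<Union>\<kappa>\<in>F. gws \<kappa>)" using that by (auto simp: F_def)
    then show ?thesis using S(3)[of b] span_mono by blast
  qed
  then have "span Basis \<subseteq> span (\<Union>\<kappa>\<in>F. gws \<kappa>)"
    by (intro span_minimal subspace_span) blast
  then have all: "x \<in> span (\<Union>\<kappa>\<in>F. gws \<kappa>)" for x
    by (auto simp: span_Basis)
  have "wts \<subseteq> F"
  proof (rule subsetI, rule ccontr)
    fix \<mu> assume \<mu>: "\<mu> \<in> wts" and not: "\<mu> \<notin> F"
    then obtain x where x: "x \<in> gws \<mu>" "x \<noteq> 0" using zero_in_gws by (auto simp: wts_def)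
    obtain c where c: "\<And>\<kappa>. c \<kappa> \<in> gws \<kappa>" "x = (\<Sum>\<kappa>\<in>F. c \<kappa>)"
      using sum_of_gws[OF fin all, of x] by blast
    let ?y = "\<lambda>\<kappa>. if \<kappa> = \<mu> then - x else c \<kappa>"
    have "(\<Sum>\<kappa>\<in>F. ?y \<kappa>) = (\<Sum>\<kappa>\<in>F. c \<kappa>)"
      using not by (intro sum.cong) auto
    then have "(\<Sum>\<kappa>\<in>insert \<mu> F. ?y \<kappa>) = 0"
      using fin not c(2) by simp
    moreover have "?y \<kappa> \<in> gws \<kappa>" for \<kappa>
      using x(1) c(1) subspace_gws by (auto intro: subspace_neg)
    moreover have "on_H \<kappa>" if "\<kappa> \<in> insert \<mu> F" for \<kappa>
      using that S(2) \<mu> by (auto simp: wts_def F_def)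
    ultimately have "?y \<mu> = 0"
      using gws_independent[of "insert \<mu> F" ?y \<mu>] fin by blast
    then show False using x(2) by simp
  qed
  then show ?thesis using fin finite_subset by blast
qed

lemma is_decomp_add: "is_decomp x c \<Longrightarrow> is_decomp y d \<Longrightarrow> is_decomp (x + y) (\<lambda>\<kappa>. c \<kappa> + d \<kappa>)"
  by (simp add: is_decomp_def sum.distrib subspace_add[OF subspace_gws])

lemma is_decomp_scale: "is_decomp x c \<Longrightarrow> is_decomp (scale a x) (\<lambda>\<kappa>. scale a (c \<kappa>))"
  by (simp add: is_decomp_def scale_sum_right subspace_scale[OF subspace_gws])

lemma is_decomp_gws:
  assumes "x \<in> gws \<mu>" "on_H \<mu>" shows "is_decomp x (\<lambda>\<kappa>. if \<kappa> = \<mu> then x else 0)"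
  using assms finite_wts by (auto simp: is_decomp_def zero_in_gws wts_def sum.delta')

lemma is_decomp_unique:
  assumes "is_decomp x c" "is_decomp x d" shows "c = d"
proof
  fix \<kappa>
  have "(\<Sum>\<kappa>\<in>wts. c \<kappa> - d \<kappa>) = 0"
    using assms by (simp add: is_decomp_def sum_subtractf)
  then have "c \<kappa> - d \<kappa> = 0" if "\<kappa> \<in> wts"
    using gws_independent[OF finite_wts, of "\<lambda>\<kappa>. c \<kappa> - d \<kappa>" \<kappa>] assms that
    by (auto simp: is_decomp_def wts_def subspace_diff[OF subspace_gws])
  then show "c \<kappa> = d \<kappa>"
    using assms by (cases "\<kappa> \<in> wts") (auto simp: is_decomp_def)
qed

lemma is_decomp_exists: "\<exists>c. is_decomp x c"
proof -
  have "x \<in> span (\<Union>\<kappa>\<in>Collect on_H. gws \<kappa>)"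
    using gws_cover[of UNIV] by auto
  then show ?thesis
  proof (induction rule: span_induct_alt)
    case base
    show ?case by (intro exI[of _ "\<lambda>_. 0"]) (simp add: is_decomp_def zero_in_gws)
  next
    case (step a x y)
    then show ?case
      using is_decomp_add is_decomp_scale is_decomp_gws by blast
  qed
qed

lemma proj_eqI: "is_decomp x c \<Longrightarrow> proj \<kappa> x = c \<kappa>"
  unfolding proj_def using is_decomp_unique by (metis the_equality)

lemma is_decomp_proj: "is_decomp x (\<lambda>\<kappa>. proj \<kappa> x)"
proof -
  obtain c where "is_decomp x c" using is_decomp_exists by blast
  moreover then have "c = (\<lambda>\<kappa>. proj \<kappa> x)" using proj_eqI by auto
  ultimately show ?thesis by simp
qed

lemma lin_proj: "lin (proj \<kappa>)"
  by (intro linI) (auto intro!: proj_eqI is_decomp_add is_decomp_scale is_decomp_proj)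

lemma proj_in: "proj \<kappa> x \<in> gws \<kappa>"
  and proj_outside: "\<kappa> \<notin> wts \<Longrightarrow> proj \<kappa> x = 0"
  and sum_proj: "(\<Sum>\<kappa>\<in>wts. proj \<kappa> x) = x"
  using is_decomp_proj[of x] by (simp_all add: is_decomp_def)

lemma proj_gws: "x \<in> gws \<mu> \<Longrightarrow> on_H \<mu> \<Longrightarrow> proj \<kappa> x = (if \<kappa> = \<mu> then x else 0)"
  using proj_eqI[OF is_decomp_gws] .

lemma trace_proj:
  assumes "on_H \<kappa>" shows "trace (proj \<kappa>) = of_nat (dim (gws \<kappa>))"
proof -
  obtain B where B: "B \<subseteq> gws \<kappa>" "independent B" "gws \<kappa> \<subseteq> span B" "card B = dim (gws \<kappa>)"
    using basis_exists by blast
  note fin = finiteI_independent[OF B(2)]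
  have sp: "proj \<kappa> x \<in> span B" for x using proj_in B(3) by blast
  let ?r = "\<lambda>b x. representation B (proj \<kappa> x) b"
  have rl: "lform (?r b)" for b
    using sp B(2) lin_proj
    by (simp add: lform_def lin_add lin_scale representation_add representation_scale)
  show ?thesis
  proof (cases "\<kappa> \<in> wts")
    case False
    then have "proj \<kappa> = (\<lambda>x. 0)" by (auto simp: proj_outside)
    then show ?thesis
      using False assms by (simp add: wts_def trace_zero)
  next
    case True
    have "proj \<kappa> = (\<lambda>x. \<Sum>b\<in>B. scale (?r b x) b)"
      using sum_representation_eq[OF B(2) sp fin] by auto
    then have "trace (proj \<kappa>) = trace (\<lambda>x. \<Sum>b\<in>B. scale (?r b x) b)"
      by (rule arg_cong)
    also have "\<dots> = (\<Sum>b\<in>B. trace (\<lambda>x. scale (?r b x) b))"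
      by (rule trace_sum)
    also have "\<dots> = (\<Sum>b\<in>B. ?r b b)"
      by (simp only: trace_rank_one[OF rl])
    also have "\<dots> = (\<Sum>b\<in>B. 1)"
      using B True by (intro sum.cong)
        (auto simp: wts_def proj_gws representation_basis subset_iff)
    finally show ?thesis using B(4) by simp
  qed
qed


subsection \<open>Elements of the Cartan subalgebra are semisimple\<close>

text \<open>On the generalised weight space \<open>ad h - \<kappa> h\<close> is nilpotent, so its trace there is 0.\<close>

lemma weight_trace:
  assumes h: "h \<in> H"
  shows "trace (\<lambda>x. proj \<kappa> (bracket h x)) = \<kappa> h * trace (proj \<kappa>)"
proof (cases "on_H \<kappa>")
  case True
  let ?S = "shift (bracket h) (\<kappa> h)"
  let ?f = "\<lambda>x. proj \<kappa> (?S x)"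
  have lf: "lin ?f" by (rule lin_comp[OF lin_proj lin_shift[OF lin_bracket]])
  have f_eq: "(?f ^^ n) y = (?S ^^ n) y" if "y \<in> gws \<kappa>" for n y
    using proj_gws[OF shift_gws[OF h shift_pow_gws[OF h that]] True]
    by (induction n) simp_all
  have "\<exists>n. (?f ^^ n) x = 0" for x
  proof -
    have fx: "?f x \<in> gws \<kappa>" by (rule proj_in)
    then obtain n where "(?S ^^ n) (?f x) = 0"
      using h by (auto simp: gws_def gev_def)
    then have "(?f ^^ Suc n) x = 0"
      using f_eq[OF fx, of n] by (simp add: funpow_Suc_right del: funpow.simps)
    then show ?thesis by blast
  qed
  from trace_locally_nilpotent[OF lf this] have "trace ?f = 0" .
  then show ?thesis
    by (simp add: shift_def lin_diff[OF lin_proj] lin_scale[OF lin_proj] trace_sub trace_smult)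
next
  case False
  then have "proj \<kappa> = (\<lambda>x. 0)" by (auto simp: proj_outside wts_def)
  then show ?thesis by (simp add: trace_zero)
qed

lemma trace_proj_nonzero: "\<kappa> \<in> wts \<Longrightarrow> trace (proj \<kappa>) \<noteq> 0"
  using zero_in_gws[of \<kappa>] by (auto simp: wts_def trace_proj)

text \<open>A weight is linear because \<open>h \<mapsto> tr (ad h)\<close> on its weight space is.\<close>

lemma wts_dual_space:
  assumes "\<kappa> \<in> wts" shows "\<kappa> \<in> dual_space H"
proof -
  have "\<kappa> (h + h') = \<kappa> h + \<kappa> h'" if "h \<in> H" "h' \<in> H" for h h'
  proof -
    have "\<kappa> (h + h') * trace (proj \<kappa>) = (\<kappa> h + \<kappa> h') * trace (proj \<kappa>)"
      using weight_trace[OF that(1), of \<kappa>] weight_trace[OF that(2), of \<kappa>]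
        weight_trace[OF subspace_add[OF subspace_H that], of \<kappa>]
      by (simp add: bracket_add_left lin_add[OF lin_proj] trace_plus distrib_right)
    then show ?thesis using trace_proj_nonzero[OF assms] by simp
  qed
  moreover have "\<kappa> (scale c h) = c * \<kappa> h" if "h \<in> H" for c h
  proof -
    have "\<kappa> (scale c h) * trace (proj \<kappa>) = (c * \<kappa> h) * trace (proj \<kappa>)"
      using weight_trace[OF that, of \<kappa>] weight_trace[OF subspace_scale[OF subspace_H that], of \<kappa> c]
      by (auto simp: bracket_scale_left lin_scale[OF lin_proj] trace_smult)
    then show ?thesis using trace_proj_nonzero[OF assms] by (metis mult_right_cancel)
  qed
  ultimately show ?thesis
    using assms by (auto simp: dual_space_def wts_def on_H_def)
qed

lemma dual_space_add: "\<mu> \<in> dual_space H \<Longrightarrow> x \<in> H \<Longrightarrow> y \<in> H \<Longrightarrow> \<mu> (x + y) = \<mu> x + \<mu> y"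
  and dual_space_scale: "\<mu> \<in> dual_space H \<Longrightarrow> x \<in> H \<Longrightarrow> \<mu> (scale c x) = c * \<mu> x"
  and dual_space_outside: "\<mu> \<in> dual_space H \<Longrightarrow> x \<notin> H \<Longrightarrow> \<mu> x = 0"
  by (auto simp: dual_space_def)

lemma dual_space_diff: "\<mu> \<in> dual_space H \<Longrightarrow> x \<in> H \<Longrightarrow> y \<in> H \<Longrightarrow> \<mu> (x - y) = \<mu> x - \<mu> y"
  using dual_space_add[of \<mu> x "scale (-1) y"] dual_space_scale[of \<mu> y "-1"] subspace_neg[OF subspace_H, of y]
  by simp

text \<open>The semisimple part of \<open>ad h\<close>, which is a derivation and therefore inner.\<close>

definition ss_part :: "'g \<Rightarrow> 'g \<Rightarrow> 'g" where
  "ss_part h x = (\<Sum>\<kappa>\<in>wts. scale (\<kappa> h) (proj \<kappa> x))"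

lemma ss_part_gws:
  assumes "x \<in> gws \<kappa>" "on_H \<kappa>" shows "ss_part h x = scale (\<kappa> h) x"
proof (cases "\<kappa> \<in> wts")
  case True
  have "ss_part h x = (\<Sum>\<mu>\<in>wts. if \<mu> = \<kappa> then scale (\<kappa> h) x else 0)"
    unfolding ss_part_def by (intro sum.cong) (auto simp: proj_gws[OF assms])
  then show ?thesis using True finite_wts by simp
next
  case False
  then have "x = 0" using assms by (auto simp: wts_def)
  then show ?thesis by (simp add: ss_part_def lin_zero[OF lin_proj])
qed

lemma lin_ss_part: "lin (ss_part h)"
  unfolding ss_part_def by (intro lin_Sum lin_smult lin_proj)

lemma ss_part_derivation:
  "ss_part h (bracket x y) = bracket (ss_part h x) y + bracket x (ss_part h y)"
proof -
  let ?b = "\<lambda>\<kappa> \<mu>. bracket (proj \<kappa> x) (proj \<mu> y)"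
  have "bracket x y = bracket (\<Sum>\<kappa>\<in>wts. proj \<kappa> x) (\<Sum>\<mu>\<in>wts. proj \<mu> y)"
    by (simp only: sum_proj)
  then have xy: "bracket x y = (\<Sum>\<kappa>\<in>wts. \<Sum>\<mu>\<in>wts. ?b \<kappa> \<mu>)"
    by (simp only: bracket_sum_left) (simp only: bracket_sum_right)
  have "ss_part h (?b \<kappa> \<mu>) = scale (\<kappa> h) (?b \<kappa> \<mu>) + scale (\<mu> h) (?b \<kappa> \<mu>)"
    if "\<kappa> \<in> wts" "\<mu> \<in> wts" for \<kappa> \<mu>
  proof -
    have "on_H (\<kappa> + \<mu>)" using that by (simp add: wts_def on_H_def)
    then have "ss_part h (?b \<kappa> \<mu>) = scale ((\<kappa> + \<mu>) h) (?b \<kappa> \<mu>)"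
      by (rule ss_part_gws[OF bracket_gws[OF proj_in proj_in]])
    then show ?thesis by (simp add: scale_left_distrib)
  qed
  then have "ss_part h (bracket x y)
      = (\<Sum>\<kappa>\<in>wts. \<Sum>\<mu>\<in>wts. scale (\<kappa> h) (?b \<kappa> \<mu>)) + (\<Sum>\<kappa>\<in>wts. \<Sum>\<mu>\<in>wts. scale (\<mu> h) (?b \<kappa> \<mu>))"
    unfolding xy by (simp add: lin_sum[OF lin_ss_part] sum.distrib cong: sum.cong)
  also have "(\<Sum>\<kappa>\<in>wts. \<Sum>\<mu>\<in>wts. scale (\<kappa> h) (?b \<kappa> \<mu>)) = bracket (ss_part h x) (\<Sum>\<mu>\<in>wts. proj \<mu> y)"
    unfolding ss_part_def bracket_sum_left
    by (simp add: bracket_sum_right bracket_scale_left scale_sum_right)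
  also have "(\<Sum>\<kappa>\<in>wts. \<Sum>\<mu>\<in>wts. scale (\<mu> h) (?b \<kappa> \<mu>)) = bracket (\<Sum>\<kappa>\<in>wts. proj \<kappa> x) (ss_part h y)"
    unfolding ss_part_def bracket_sum_left by (simp add: bracket_sum_right bracket_scale_right)
  finally show ?thesis by (simp only: sum_proj)
qed

text \<open>The element \<open>t\<close> with \<open>ad t = ss_part h\<close> centralises \<open>H = gws 0\<close>, so it normalises \<open>H\<close> and belongs to it.\<close>

lemma ss_part_inner:
  obtains t where "t \<in> H" "\<And>x. ss_part h x = bracket t x" "\<And>y. y \<in> H \<Longrightarrow> bracket t y = 0"
    "\<And>\<kappa>. \<kappa> \<in> wts \<Longrightarrow> \<kappa> t = \<kappa> h"
proof -
  obtain t where t: "\<And>x. ss_part h x = bracket t x"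
    using derivation_inner[OF lin_ss_part ss_part_derivation] by blast
  have "on_H 0" by (simp add: on_H_def)
  then have central: "bracket t y = 0" if "y \<in> H" for y
    using ss_part_gws[of y 0 h] that t by (simp add: gws_0)
  have tH: "t \<in> H"
  proof (rule normalizer_H)
    fix y assume "y \<in> H"
    then show "bracket y t \<in> H"
      using central[of y] bracket_swap[of y t] by (simp add: subspace_0[OF subspace_H])
  qed
  have "\<kappa> t = \<kappa> h" if \<kappa>: "\<kappa> \<in> wts" for \<kappa>
  proof (rule ccontr)
    assume ne: "\<kappa> t \<noteq> \<kappa> h"
    obtain x where x: "x \<in> gws \<kappa>" "x \<noteq> 0" using \<kappa> zero_in_gws by (auto simp: wts_def)
    have "bracket t x = scale (\<kappa> h) x"
      using ss_part_gws[OF x(1), of h] \<kappa> t by (simp add: wts_def)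
    then have "shift (bracket t) (\<kappa> h) x = 0" by (simp add: shift_def)
    moreover have "x \<in> gev (bracket t) (\<kappa> t)" using x(1) tH by (simp add: gws_def)
    ultimately show False
      using shift_injective_on_gev[OF lin_bracket not_sym[OF ne]] x(2) by blast
  qed
  with t tH central show ?thesis using that by blast
qed

lemma nil_locally:
  assumes n: "n \<in> H" "\<forall>\<kappa>\<in>wts. \<kappa> n = 0" shows "\<exists>k. (bracket n ^^ k) x = 0"
proof -
  have "(\<Sum>\<kappa>\<in>wts. proj \<kappa> x) \<in> gev (bracket n) 0"
  proof (intro subspace_sum subspace_gev lin_bracket)
    fix \<kappa> assume "\<kappa> \<in> wts"
    then show "proj \<kappa> x \<in> gev (bracket n) 0"
      using proj_in[of \<kappa> x] n unfolding gws_def by force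
  qed
  then show ?thesis by (simp add: sum_proj gev_def shift_0)
qed

text \<open>If \<open>ad t\<close> commutes with the nilpotent \<open>ad n\<close>, then \<open>ad t \<circ> ad n\<close> is nilpotent.\<close>

lemma killing_commuting_nil:
  assumes n: "n \<in> H" "\<forall>\<kappa>\<in>wts. \<kappa> n = 0" and tn: "bracket t n = 0"
  shows "killing t n = 0"
proof -
  have comm: "bracket t (bracket n z) = bracket n (bracket t z)" for z
    using bracket_derivation[of t n z] tn by simp
  have comm': "bracket n ((bracket t ^^ k) z) = (bracket t ^^ k) (bracket n z)" for k z
    by (induction k) (simp_all flip: comm)
  have pow: "((\<lambda>z. bracket t (bracket n z)) ^^ k) z = (bracket t ^^ k) ((bracket n ^^ k) z)" for k z
    by (induction k) (simp_all add: comm')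
  have "\<exists>k. ((\<lambda>z. bracket t (bracket n z)) ^^ k) z = 0" for z
  proof -
    obtain k where "(bracket n ^^ k) z = 0" using nil_locally[OF n] by blast
    then have "((\<lambda>z. bracket t (bracket n z)) ^^ k) z = 0"
      by (simp add: pow lin_zero[OF lin_funpow[OF lin_bracket]])
    then show ?thesis by blast
  qed
  from trace_locally_nilpotent[OF lin_bracket2 this] show ?thesis
    by (simp add: killing_def)
qed

text \<open>Modifying \<open>y \<in> H\<close> by an ad-nilpotent \<open>n \<in> H\<close> does not change its semisimple part, so
  \<open>killing y y\<close> is unchanged, and polarization makes \<open>n\<close> orthogonal to \<open>H\<close>.\<close>

lemma killing_nil_H:
  assumes n: "n \<in> H" "\<forall>\<kappa>\<in>wts. \<kappa> n = 0" and y: "y \<in> H"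
  shows "killing n y = 0"
proof -
  obtain t where t: "t \<in> H" "\<And>y. y \<in> H \<Longrightarrow> bracket t y = 0" "\<And>\<kappa>. \<kappa> \<in> wts \<Longrightarrow> \<kappa> t = \<kappa> y"
    using ss_part_inner[of y] by metis
  \<comment> \<open>\<open>killing z z\<close> depends on \<open>z\<close> only through the values of the weights\<close>
  have sq: "killing z z = killing t t" if z: "z \<in> H" "\<And>\<kappa>. \<kappa> \<in> wts \<Longrightarrow> \<kappa> t = \<kappa> z" for z
  proof -
    let ?n = "z - t"
    have nH: "?n \<in> H" by (rule subspace_diff[OF subspace_H z(1) t(1)])
    have n0: "\<forall>\<kappa>\<in>wts. \<kappa> ?n = 0"
    proof
      fix \<kappa> assume \<kappa>: "\<kappa> \<in> wts"
      show "\<kappa> ?n = 0"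
        using dual_space_diff[OF wts_dual_space[OF \<kappa>] z(1) t(1)] z(2)[OF \<kappa>] by simp
    qed
    have "killing t ?n = 0" "killing ?n ?n = 0"
      using killing_commuting_nil[OF nH n0] t(2)[OF nH] by auto
    moreover have "killing z z = killing (t + ?n) (t + ?n)" by simp
    ultimately show ?thesis
      by (simp only: killing_add_left killing_add_right killing_sym[of ?n t]) simp
  qed
  have "\<kappa> t = \<kappa> (y + n)" if "\<kappa> \<in> wts" for \<kappa>
    using dual_space_add[OF wts_dual_space[OF that] y n(1)] t(3)[OF that] n(2) that by simp
  then have "killing (y + n) (y + n) = killing y y"
    using sq[of "y + n"] sq[of y] t(3) y n(1) subspace_add[OF subspace_H] by simp
  moreover have "killing n n = 0" by (rule killing_commuting_nil[OF n]) simp_all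
  ultimately have "2 * killing n y = 0"
    by (simp add: killing_add_left killing_add_right killing_sym[of y n])
  then show ?thesis by simp
qed

lemma killing_funpow: "killing ((bracket h ^^ k) x) y = (- 1) ^ k * killing x ((bracket h ^^ k) y)"
proof (induction k arbitrary: y)
  case (Suc k)
  have "killing (bracket h z) y = - killing z (bracket h y)" for z
    by (simp add: bracket_swap[of h z] killing_minus_left killing_invariant)
  from this[of "(bracket h ^^ k) x"] Suc[of "bracket h y"] show ?case by (simp add: funpow_swap1)
qed simp

text \<open>For \<open>\<mu> h \<noteq> 0\<close> the operator \<open>ad h\<close> is invertible on \<open>gws \<mu>\<close> and nilpotent on \<open>H\<close>; move its powers across
  the form.\<close>

lemma killing_H_gws:
  assumes n: "n \<in> H" and x: "x \<in> gws \<mu>" and \<mu>: "on_H \<mu>" "\<mu> \<noteq> 0"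
  shows "killing n x = 0"
proof -
  obtain h where h: "h \<in> H" "\<mu> h \<noteq> 0" using \<mu> by (auto simp: on_H_def fun_eq_iff)
  obtain k where k: "(bracket h ^^ k) n = 0"
    using H_gev_0[OF h(1) n] by (auto simp: gev_def shift_0)
  have "x \<in> gev (bracket h) (\<mu> h)" using x h(1) by (simp add: gws_def)
  from shift_pow_solve[OF lin_bracket not_sym[OF h(2)] this, of k]
  obtain w where "x = (bracket h ^^ k) w" by (auto simp: shift_0)
  then have "(- 1) ^ k * killing n x = 0"
    using killing_funpow[of k h n w] k by simp
  then show ?thesis by simp
qed

text \<open>An ad-nilpotent element of \<open>H\<close> is orthogonal to \<open>H\<close> and to all other weight spaces.\<close>

lemma nil_zero:
  assumes n: "n \<in> H" "\<forall>\<kappa>\<in>wts. \<kappa> n = 0" shows "n = 0"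
proof (rule nondegenerate)
  fix y
  have "killing n (proj \<kappa> y) = 0" if "\<kappa> \<in> wts" for \<kappa>
  proof (cases "\<kappa> = 0")
    case True
    then have "proj \<kappa> y \<in> H" using proj_in[of \<kappa> y] gws_0 by simp
    then show ?thesis by (rule killing_nil_H[OF n])
  next
    case False
    then show ?thesis
      using killing_H_gws[OF n(1) proj_in _ False] that by (simp add: wts_def)
  qed
  then have "killing n (\<Sum>\<kappa>\<in>wts. proj \<kappa> y) = 0" by (simp add: killing_sum_right)
  then show "killing n y = 0" by (simp only: sum_proj)
qed

text \<open>The difference of \<open>h\<close> and its semisimple part vanishes by \<open>nil_zero\<close>, so \<open>ad h\<close> is semisimple; from here
  on generalised weight spaces are root spaces.\<close>

lemma bracket_H_gws_eq:
  assumes h: "h \<in> H" and x: "x \<in> gws \<kappa>" "on_H \<kappa>" shows "bracket h x = scale (\<kappa> h) x"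
proof -
  obtain t where t: "t \<in> H" "\<And>x. ss_part h x = bracket t x" "\<And>\<kappa>. \<kappa> \<in> wts \<Longrightarrow> \<kappa> t = \<kappa> h"
    using ss_part_inner[of h] by metis
  have "h - t = 0"
  proof (rule nil_zero[OF subspace_diff[OF subspace_H h t(1)]], rule ballI)
    fix \<kappa> assume \<kappa>: "\<kappa> \<in> wts"
    show "\<kappa> (h - t) = 0"
      using dual_space_diff[OF wts_dual_space[OF \<kappa>] h t(1)] t(3)[OF \<kappa>] by simp
  qed
  then show ?thesis using t(2)[of x] ss_part_gws[OF x, of h] by simp
qed


subsection \<open>Roots\<close>

abbreviation rs :: "('g \<Rightarrow> 'k) \<Rightarrow> 'g set" where "rs \<equiv> root_space H"

abbreviation R :: "('g \<Rightarrow> 'k) set" where "R \<equiv> roots H"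

abbreviation W :: "('g \<Rightarrow> 'k) set" where "W \<equiv> insert 0 (roots H)"

lemma on_H_dual: "\<mu> \<in> dual_space H \<Longrightarrow> on_H \<mu>"
  by (simp add: dual_space_def on_H_def)

lemma rs_eq_gws: "on_H \<mu> \<Longrightarrow> rs \<mu> = gws \<mu>"
proof
  show "rs \<mu> \<subseteq> gws \<mu>"
  proof
    fix x assume "x \<in> rs \<mu>"
    then have "(shift (bracket h) (\<mu> h) ^^ 1) x = 0" if "h \<in> H" for h
      using that by (simp add: root_space_def shift_def)
    then show "x \<in> gws \<mu>" unfolding gws_def gev_def by blast
  qed
  show "gws \<mu> \<subseteq> rs \<mu>" if "on_H \<mu>"
    using bracket_H_gws_eq that by (auto simp: root_space_def)
qed

lemma rs_0: "rs 0 = H"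
  using rs_eq_gws[of 0] gws_0 by (simp add: on_H_def)

lemma roots_eq_wts: "R = wts - {0}"
proof (intro set_eqI iffI)
  fix \<gamma> assume "\<gamma> \<in> R"
  then have \<gamma>: "on_H \<gamma>" "\<gamma> \<noteq> 0" "rs \<gamma> \<noteq> {0}"
    unfolding roots_def using on_H_dual by blast+
  then show "\<gamma> \<in> wts - {0}" unfolding wts_def rs_eq_gws[OF \<gamma>(1)] by blast
next
  fix \<gamma> assume \<gamma>: "\<gamma> \<in> wts - {0}"
  then have "\<gamma> \<in> dual_space H" using wts_dual_space by blast
  moreover have "on_H \<gamma>" "gws \<gamma> \<noteq> {0}" using \<gamma> unfolding wts_def by blast+
  ultimately show "\<gamma> \<in> R" using \<gamma> rs_eq_gws[of \<gamma>] unfolding roots_def by blast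
qed

lemma finite_roots: "finite R"
  using finite_wts by (simp add: roots_eq_wts)

lemma zero_not_root: "0 \<notin> R"
  by (simp add: roots_def)

lemma root_dual: "\<gamma> \<in> R \<Longrightarrow> \<gamma> \<in> dual_space H"
  by (simp add: roots_def)

lemma zero_dual: "0 \<in> dual_space H"
  by (simp add: dual_space_def)

lemma W_dual: "\<gamma> \<in> W \<Longrightarrow> \<gamma> \<in> dual_space H"
  using root_dual zero_dual by blast

lemma add_dual: "\<mu> \<in> dual_space H \<Longrightarrow> \<nu> \<in> dual_space H \<Longrightarrow> \<mu> + \<nu> \<in> dual_space H"
  and uminus_dual: "\<mu> \<in> dual_space H \<Longrightarrow> - \<mu> \<in> dual_space H"
  and diff_dual: "\<mu> \<in> dual_space H \<Longrightarrow> \<nu> \<in> dual_space H \<Longrightarrow> \<mu> - \<nu> \<in> dual_space H"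
  and scale_dual: "\<mu> \<in> dual_space H \<Longrightarrow> fun_scale c \<mu> \<in> dual_space H"
  by (simp_all add: dual_space_def fun_scale_def algebra_simps)

lemma sum_dual: "(\<And>i. i \<in> I \<Longrightarrow> f i \<in> dual_space H) \<Longrightarrow> (\<Sum>i\<in>I. f i) \<in> dual_space H"
  by (induction I rule: infinite_finite_induct) (simp_all add: zero_dual add_dual)

lemma subspace_rs: "subspace (rs \<mu>)"
  by (rule subspaceI) (auto simp: root_space_def bracket_add_right bracket_scale_right scale_right_distrib
      scale_left_commute)

lemma rs_bracket_H: "h \<in> H \<Longrightarrow> x \<in> rs \<mu> \<Longrightarrow> bracket h x = scale (\<mu> h) x"
  by (simp add: root_space_def)

lemma rs_bracket_H': "h \<in> H \<Longrightarrow> x \<in> rs \<mu> \<Longrightarrow> bracket x h = scale (- \<mu> h) x"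
  using bracket_swap[of x h] by (simp add: rs_bracket_H)

lemma rs_bracket: "x \<in> rs \<mu> \<Longrightarrow> y \<in> rs \<nu> \<Longrightarrow> bracket x y \<in> rs (\<mu> + \<nu>)"
  by (simp add: root_space_def bracket_derivation[of _ x y] bracket_scale_left bracket_scale_right
      scale_left_distrib)

lemma rs_weight: "\<mu> \<in> dual_space H \<Longrightarrow> x \<in> rs \<mu> \<Longrightarrow> x \<noteq> 0 \<Longrightarrow> \<mu> \<in> W"
  using subspace_0[OF subspace_rs] by (auto simp: roots_def)

lemma rs_nonzero: "\<gamma> \<in> R \<Longrightarrow> \<exists>x\<in>rs \<gamma>. x \<noteq> 0"
  using subspace_0[OF subspace_rs] by (auto simp: roots_def)

lemma proj_rs: "proj \<mu> x \<in> rs \<mu>" if "\<mu> \<in> dual_space H"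
  using proj_in[of \<mu> x] rs_eq_gws[OF on_H_dual[OF that]] by simp

lemma proj_of_rs: "\<nu> \<in> dual_space H \<Longrightarrow> x \<in> rs \<nu> \<Longrightarrow> proj \<mu> x = (if \<mu> = \<nu> then x else 0)"
  using proj_gws[of x \<nu> \<mu>] rs_eq_gws[OF on_H_dual, of \<nu>] on_H_dual[of \<nu>] by simp

lemma finite_W: "finite W"
  using finite_roots by simp

lemma proj_outside_W: "\<mu> \<notin> W \<Longrightarrow> proj \<mu> x = 0"
  using proj_outside by (auto simp: roots_eq_wts)

lemma sum_proj_W: "(\<Sum>\<mu>\<in>W. proj \<mu> x) = x"
proof -
  have "(\<Sum>\<mu>\<in>W. proj \<mu> x) = (\<Sum>\<mu>\<in>wts. proj \<mu> x)"
    by (rule sum.mono_neutral_right[OF finite_W]) (auto simp: roots_eq_wts proj_outside)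
  then show ?thesis by (simp add: sum_proj)
qed

lemma killing_rs_zero:
  assumes "x \<in> rs \<mu>" "y \<in> rs \<nu>" "\<mu> \<in> dual_space H" "\<nu> \<in> dual_space H" "\<mu> + \<nu> \<noteq> 0"
  shows "killing x y = 0"
proof -
  obtain h where h: "\<mu> h + \<nu> h \<noteq> 0" using assms(5) by (auto simp: fun_eq_iff)
  then have hH: "h \<in> H" using dual_space_outside[OF assms(3), of h] dual_space_outside[OF assms(4), of h] by fastforce
  have "\<mu> h * killing x y = killing (bracket h x) y"
    using assms(1) hH by (simp add: rs_bracket_H killing_scale_left)
  also have "\<dots> = - killing x (bracket h y)"
    using bracket_swap[of h x] by (simp add: killing_minus_left killing_invariant)
  also have "\<dots> = - \<nu> h * killing x y"
    using assms(2) hH by (simp add: rs_bracket_H killing_scale_right)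
  finally have "(\<mu> h + \<nu> h) * killing x y = 0" by (simp add: algebra_simps)
  then show ?thesis using h by simp
qed

lemma killing_proj:
  assumes x: "x \<in> rs \<mu>" and \<mu>: "\<mu> \<in> dual_space H"
  shows "killing x y = killing x (proj (- \<mu>) y)"
proof -
  have "killing x y = (\<Sum>\<nu>\<in>W. killing x (proj \<nu> y))"
    by (simp only: killing_sum_right[symmetric] sum_proj_W)
  also have "\<dots> = (\<Sum>\<nu>\<in>W. if \<nu> = - \<mu> then killing x (proj (- \<mu>) y) else 0)"
  proof (intro sum.cong refl)
    fix \<nu> assume "\<nu> \<in> W"
    then have \<nu>: "\<nu> \<in> dual_space H" by (rule W_dual)
    have "\<mu> + \<nu> \<noteq> 0" if "\<nu> \<noteq> - \<mu>" using that minus_unique by blast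
    then show "killing x (proj \<nu> y) = (if \<nu> = - \<mu> then killing x (proj (- \<mu>) y) else 0)"
      using killing_rs_zero[OF x proj_rs[OF \<nu>] \<mu> \<nu>] by auto
  qed
  also have "\<dots> = killing x (proj (- \<mu>) y)"
    using finite_W by (auto simp: proj_outside_W)
  finally show ?thesis .
qed

lemma killing_pair:
  assumes "x \<in> rs \<mu>" "\<mu> \<in> dual_space H" "x \<noteq> 0"
  obtains y where "y \<in> rs (- \<mu>)" "killing x y = 1"
proof -
  obtain z where z: "killing x z \<noteq> 0" using nondegenerate assms(3) by blast
  let ?y = "proj (- \<mu>) z"
  have "killing x ?y \<noteq> 0" using killing_proj[OF assms(1,2)] z by metis
  then have "killing x (scale (1 / killing x ?y) ?y) = 1"
    by (simp add: killing_scale_right)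
  moreover have "scale (1 / killing x ?y) ?y \<in> rs (- \<mu>)"
    by (intro subspace_scale subspace_rs proj_rs uminus_dual assms)
  ultimately show ?thesis using that by blast
qed

lemma uminus_root: "\<gamma> \<in> R \<Longrightarrow> - \<gamma> \<in> R"
proof -
  assume \<gamma>: "\<gamma> \<in> R"
  obtain x where x: "x \<in> rs \<gamma>" "x \<noteq> 0" using rs_nonzero[OF \<gamma>] by blast
  obtain y where y: "y \<in> rs (- \<gamma>)" "killing x y = 1" using killing_pair[OF x(1) root_dual[OF \<gamma>] x(2)] .
  have "y \<noteq> 0" using y(2) by auto
  then have "- \<gamma> \<in> W" by (rule rs_weight[OF uminus_dual[OF root_dual[OF \<gamma>]] y(1)])
  then show ?thesis using \<gamma> zero_not_root by auto
qed

lemma killing_H_unique: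
  assumes t: "t \<in> H" and 0: "\<And>h. h \<in> H \<Longrightarrow> killing t h = 0" shows "t = 0"
proof (rule nondegenerate)
  fix y
  have "t \<in> rs 0" using t by (simp only: rs_0)
  then have "killing t y = killing t (proj (- 0) y)"
    using zero_dual by (rule killing_proj)
  also have "proj (- 0) y \<in> rs (- 0)" using uminus_dual[OF zero_dual] by (rule proj_rs)
  then have "proj (- 0) y \<in> H" by (simp only: minus_zero rs_0)
  then have "killing t (proj (- 0) y) = 0" by (rule 0)
  finally show "killing t y = 0" .
qed

lemma roots_separate:
  assumes t: "t \<in> H" and 0: "\<And>\<gamma>. \<gamma> \<in> R \<Longrightarrow> \<gamma> t = 0" shows "t = 0"
proof (rule nil_zero[OF t], rule ballI)
  fix \<kappa> assume "\<kappa> \<in> wts"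
  then show "\<kappa> t = 0" using 0[of \<kappa>] by (cases "\<kappa> = 0") (auto simp: roots_eq_wts)
qed

definition tv :: "('g \<Rightarrow> 'k) \<Rightarrow> 'g" where
  "tv \<mu> = (THE t. t \<in> H \<and> (\<forall>h\<in>H. killing t h = \<mu> h))"

lemma tv:
  assumes \<mu>: "\<mu> \<in> dual_space H"
  shows "tv \<mu> \<in> H" and "h \<in> H \<Longrightarrow> killing (tv \<mu>) h = \<mu> h"
proof -
  have pH: "proj 0 y \<in> H" for y using proj_rs[OF zero_dual, of y] by (simp add: rs_0)
  have "lform (\<lambda>y. \<mu> (proj 0 y))"
    by (simp add: lform_def lin_add[OF lin_proj] lin_scale[OF lin_proj]
        dual_space_add[OF \<mu> pH pH] dual_space_scale[OF \<mu> pH])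
  then obtain t where t: "\<And>y. killing t y = \<mu> (proj 0 y)"
    using killing_represents by blast
  have "proj \<kappa> t = 0" if \<kappa>: "\<kappa> \<in> W" "\<kappa> \<noteq> 0" for \<kappa>
  proof (rule ccontr)
    assume ne: "proj \<kappa> t \<noteq> 0"
    have \<kappa>': "\<kappa> \<in> dual_space H" "- \<kappa> \<in> dual_space H" using W_dual[OF \<kappa>(1)] uminus_dual by auto
    obtain y where y: "y \<in> rs (- \<kappa>)" "killing (proj \<kappa> t) y = 1"
      using killing_pair[OF proj_rs[OF \<kappa>'(1)] \<kappa>'(1) ne] .
    have "killing t y = killing (proj \<kappa> t) y"
      using killing_proj[OF y(1) \<kappa>'(2), of t] by (simp add: killing_sym)
    moreover have "proj 0 y = 0" using proj_of_rs[OF \<kappa>'(2) y(1), of 0] \<kappa>(2) by auto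
    ultimately show False
      using t[of y] y(2) dual_space_scale[OF \<mu> subspace_0[OF subspace_H], of 0] by simp
  qed
  then have "(\<Sum>\<kappa>\<in>W. proj \<kappa> t) = (\<Sum>\<kappa>\<in>W. if \<kappa> = 0 then proj 0 t else 0)"
    by (intro sum.cong) auto
  then have "t = proj 0 t" using finite_W by (simp add: sum_proj_W del: sum.insert)
  then have "t \<in> H" using pH by metis
  moreover have "killing t h = \<mu> h" if "h \<in> H" for h
    using t[of h] proj_of_rs[OF zero_dual, of h 0] that by (simp add: rs_0)
  moreover have "t' = t" if "t' \<in> H" "\<forall>h\<in>H. killing t' h = \<mu> h" for t'
    using killing_H_unique[of "t' - t"] subspace_diff[OF subspace_H] that calculation
    by (simp add: killing_diff_left)
  ultimately have "\<exists>!t. t \<in> H \<and> (\<forall>h\<in>H. killing t h = \<mu> h)" by blast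
  from theI'[OF this] show "tv \<mu> \<in> H" and "h \<in> H \<Longrightarrow> killing (tv \<mu>) h = \<mu> h"
    by (auto simp: tv_def)
qed

lemma bracket_opposite:
  assumes \<gamma>: "\<gamma> \<in> dual_space H" and x: "x \<in> rs \<gamma>" and y: "y \<in> rs (- \<gamma>)"
  shows "bracket x y = scale (killing x y) (tv \<gamma>)"
proof -
  have "bracket x y \<in> H" using rs_bracket[OF x y] by (simp add: rs_0)
  moreover have "killing (bracket x y) h = killing (scale (killing x y) (tv \<gamma>)) h" if h: "h \<in> H" for h
  proof -
    have "killing (bracket x y) h = killing x (bracket y h)" by (rule killing_invariant)
    also have "\<dots> = \<gamma> h * killing x y"
      using rs_bracket_H'[OF h y] by (simp add: killing_scale_right)
    finally show ?thesis using tv(2)[OF \<gamma> h] by (simp add: killing_scale_left)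
  qed
  ultimately show ?thesis
    using killing_H_unique[of "bracket x y - scale (killing x y) (tv \<gamma>)"] tv(1)[OF \<gamma>]
    by (simp add: killing_diff_left subspace_diff[OF subspace_H] subspace_scale[OF subspace_H])
qed

text \<open>The bilinear form on functionals dual to the Killing form.\<close>

definition ip :: "('g \<Rightarrow> 'k) \<Rightarrow> ('g \<Rightarrow> 'k) \<Rightarrow> 'k" where
  "ip \<mu> \<nu> = \<mu> (tv \<nu>)"

lemma ip_killing: "\<mu> \<in> dual_space H \<Longrightarrow> \<nu> \<in> dual_space H \<Longrightarrow> ip \<mu> \<nu> = killing (tv \<mu>) (tv \<nu>)"
  by (simp add: ip_def tv)

lemma ip_sym: "\<mu> \<in> dual_space H \<Longrightarrow> \<nu> \<in> dual_space H \<Longrightarrow> ip \<mu> \<nu> = ip \<nu> \<mu>"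
  by (simp add: ip_killing killing_sym)

lemma ip_add: "ip (\<mu> + \<nu>) \<kappa> = ip \<mu> \<kappa> + ip \<nu> \<kappa>"
  and ip_uminus: "ip (- \<mu>) \<kappa> = - ip \<mu> \<kappa>"
  and ip_diff: "ip (\<mu> - \<nu>) \<kappa> = ip \<mu> \<kappa> - ip \<nu> \<kappa>"
  and ip_zero: "ip 0 \<kappa> = 0"
  and ip_scale: "ip (fun_scale c \<mu>) \<kappa> = c * ip \<mu> \<kappa>"
  by (simp_all add: ip_def fun_scale_def)

lemma sum_fun_apply: "(\<Sum>i\<in>I. f i) x = (\<Sum>i\<in>I. f i x)"
  by (induction I rule: infinite_finite_induct) simp_all

lemma ip_sum: "ip (\<Sum>i\<in>I. f i) \<kappa> = (\<Sum>i\<in>I. ip (f i) \<kappa>)"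
  by (simp add: ip_def sum_fun_apply)


subsection \<open>Traces of commutators and root strings\<close>

text \<open>The trace of a commutator vanishes on every subspace stable under both factors; \<open>P\<close> projects onto it.\<close>

lemma trace_commutator:
  assumes P: "lin P" and x: "\<And>z. P (bracket x (P z)) = bracket x (P z)"
    and y: "\<And>z. P (bracket y (P z)) = bracket y (P z)"
  shows "trace (\<lambda>z. bracket (bracket x y) (P z)) = 0"
proof -
  have xP: "lin (\<lambda>z. bracket x (P z))" and yP: "lin (\<lambda>z. bracket y (P z))"
    by (rule lin_comp[OF lin_bracket P])+
  have "trace (\<lambda>z. bracket x (P (bracket y (P z)))) = trace (\<lambda>z. bracket y (P (bracket x (P z))))"
    by (rule trace_comm[OF xP yP])
  then show ?thesis
    by (simp add: x y bracket_bracket_left trace_sub)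
qed

definition PS :: "('g \<Rightarrow> 'k) set \<Rightarrow> 'g \<Rightarrow> 'g" where
  "PS S z = (\<Sum>\<kappa>\<in>S. proj \<kappa> z)"

lemma lin_PS: "lin (PS S)"
  unfolding PS_def by (intro lin_Sum lin_proj)

lemma PS_of_rs:
  assumes "finite S" "\<nu> \<in> dual_space H" "v \<in> rs \<nu>"
  shows "PS S v = (if \<nu> \<in> S then v else 0)"
  using assms by (simp add: PS_def proj_of_rs)

lemma PS_invariant:
  assumes S: "S \<subseteq> W" and \<alpha>: "\<alpha> \<in> dual_space H" "x \<in> rs \<alpha>"
    and inv: "\<And>\<kappa> v. \<kappa> \<in> S \<Longrightarrow> v \<in> rs \<kappa> \<Longrightarrow> bracket x v \<noteq> 0 \<Longrightarrow> \<kappa> + \<alpha> \<in> S"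
  shows "PS S (bracket x (PS S z)) = bracket x (PS S z)"
proof -
  have fin: "finite S" by (rule finite_subset[OF S finite_W])
  have "PS S (bracket x (proj \<kappa> z)) = bracket x (proj \<kappa> z)" if \<kappa>: "\<kappa> \<in> S" for \<kappa>
  proof (cases "bracket x (proj \<kappa> z) = 0")
    case True
    then show ?thesis by (simp add: lin_zero[OF lin_PS])
  next
    case False
    have d: "\<kappa> \<in> dual_space H" using \<kappa> S W_dual by blast
    have "\<kappa> + \<alpha> \<in> S" using inv[OF \<kappa> proj_rs[OF d] False] .
    moreover have "bracket x (proj \<kappa> z) \<in> rs (\<kappa> + \<alpha>)"
      using rs_bracket[OF \<alpha>(2) proj_rs[OF d, of z]] by (simp add: add.commute)
    ultimately show ?thesis
      using PS_of_rs[OF fin add_dual[OF d \<alpha>(1)]] by simp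
  qed
  then show ?thesis
    by (simp add: PS_def[of S z] bracket_sum_right lin_sum[OF lin_PS])
qed

lemma trace_PS:
  assumes S: "S \<subseteq> W" and h: "h \<in> H"
  shows "trace (\<lambda>z. bracket h (PS S z)) = (\<Sum>\<kappa>\<in>S. \<kappa> h * of_nat (dim (rs \<kappa>)))"
proof -
  have "trace (\<lambda>z. bracket h (PS S z)) = (\<Sum>\<kappa>\<in>S. trace (\<lambda>z. bracket h (proj \<kappa> z)))"
    by (simp add: PS_def bracket_sum_right trace_sum)
  also have "\<dots> = (\<Sum>\<kappa>\<in>S. \<kappa> h * of_nat (dim (rs \<kappa>)))"
  proof (rule sum.cong[OF refl])
    fix \<kappa> assume "\<kappa> \<in> S"
    then have d: "\<kappa> \<in> dual_space H" using S W_dual by blast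
    have "(\<lambda>z. bracket h (proj \<kappa> z)) = (\<lambda>z. scale (\<kappa> h) (proj \<kappa> z))"
      using rs_bracket_H[OF h proj_rs[OF d]] by blast
    then show "trace (\<lambda>z. bracket h (proj \<kappa> z)) = \<kappa> h * of_nat (dim (rs \<kappa>))"
      using trace_proj[OF on_H_dual[OF d]] rs_eq_gws[OF on_H_dual[OF d]] by (simp add: trace_smult)
  qed
  finally show ?thesis .
qed

lemma root_pair:
  assumes "\<alpha> \<in> R"
  obtains x y where "x \<in> rs \<alpha>" "y \<in> rs (- \<alpha>)" "killing x y = 1" "bracket x y = tv \<alpha>"
proof -
  obtain x where x: "x \<in> rs \<alpha>" "x \<noteq> 0" using rs_nonzero[OF assms] by blast
  obtain y where y: "y \<in> rs (- \<alpha>)" "killing x y = 1"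
    using killing_pair[OF x(1) root_dual[OF assms] x(2)] .
  show ?thesis
    using that[OF x(1) y] bracket_opposite[OF root_dual[OF assms] x(1) y(1)] y(2) by simp
qed

text \<open>If the sum of the root spaces for \<open>S\<close> is stable under \<open>x\<close> and under the opposite root vector, then
  \<open>tv \<alpha>\<close> is a commutator of operators on it and has trace 0 there.\<close>

lemma weighted_sum_zero:
  assumes S: "S \<subseteq> W" and \<alpha>: "\<alpha> \<in> R" and x: "x \<in> rs \<alpha>" "x \<noteq> 0"
    and up: "\<And>\<kappa> v. \<kappa> \<in> S \<Longrightarrow> v \<in> rs \<kappa> \<Longrightarrow> bracket x v \<noteq> 0 \<Longrightarrow> \<kappa> + \<alpha> \<in> S"
    and down: "\<And>\<kappa>. \<kappa> \<in> S \<Longrightarrow> \<kappa> - \<alpha> \<in> W \<Longrightarrow> \<kappa> - \<alpha> \<in> S"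
  shows "(\<Sum>\<kappa>\<in>S. ip \<kappa> \<alpha> * of_nat (dim (rs \<kappa>))) = 0"
proof -
  note d = root_dual[OF \<alpha>]
  obtain y where y: "y \<in> rs (- \<alpha>)" "killing x y = 1" using killing_pair[OF x(1) d x(2)] .
  have xy: "bracket x y = tv \<alpha>" using bracket_opposite[OF d x(1) y(1)] y(2) by simp
  have "\<kappa> + - \<alpha> \<in> S" if \<kappa>: "\<kappa> \<in> S" and v: "v \<in> rs \<kappa>" "bracket y v \<noteq> 0" for \<kappa> v
  proof -
    have \<kappa>d: "\<kappa> \<in> dual_space H" using \<kappa> S W_dual by blast
    have "bracket y v \<in> rs (\<kappa> - \<alpha>)" using rs_bracket[OF y(1) v(1)] by (simp add: add.commute)
    then have "\<kappa> - \<alpha> \<in> W" by (rule rs_weight[OF diff_dual[OF \<kappa>d d] _ v(2)])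
    then show ?thesis using down[OF \<kappa>] by simp
  qed
  then have "PS S (bracket y (PS S z)) = bracket y (PS S z)" for z
    by (rule PS_invariant[OF S uminus_dual[OF d] y(1)])
  moreover have "PS S (bracket x (PS S z)) = bracket x (PS S z)" for z
    by (rule PS_invariant[OF S d x(1) up])
  ultimately have "trace (\<lambda>z. bracket (bracket x y) (PS S z)) = 0"
    by (intro trace_commutator lin_PS)
  then show ?thesis
    using trace_PS[OF S tv(1)[OF d]] by (simp add: xy ip_def)
qed

lemma dim_rs_pos: "\<gamma> \<in> R \<Longrightarrow> dim (rs \<gamma>) > 0"
  using rs_nonzero[of \<gamma>] by (metis bot_nat_0.not_eq_extremum dim_eq_0 singletonD subsetD)

text \<open>If \<open>(\<alpha>, \<alpha>) = 0\<close>, then \<open>(\<kappa>, \<alpha>)\<close> is the same for all \<open>\<kappa>\<close> in the \<open>\<alpha>\<close>-string through a root \<open>\<beta>\<close>. Its weighted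
  sum over the string is 0, so \<open>(\<beta>, \<alpha>) = 0\<close> for all \<open>\<beta>\<close>, and \<open>tv \<alpha> = 0\<close>.\<close>

lemma ip_self_nonzero:
  assumes \<alpha>: "\<alpha> \<in> R" shows "ip \<alpha> \<alpha> \<noteq> 0"
proof
  assume 0: "ip \<alpha> \<alpha> = 0"
  obtain x where x: "x \<in> rs \<alpha>" "x \<noteq> 0" using rs_nonzero[OF \<alpha>] by blast
  have "\<beta> (tv \<alpha>) = 0" if \<beta>: "\<beta> \<in> R" for \<beta>
  proof -
    let ?S = "{\<kappa> \<in> W. \<exists>j::int. \<kappa> = \<beta> + fun_scale (of_int j) \<alpha>}"
    have plus: "\<kappa> + \<alpha> \<in> ?S" if "\<kappa> \<in> ?S" "\<kappa> + \<alpha> \<in> W" for \<kappa>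
    proof -
      from that obtain j :: int where "\<kappa> = \<beta> + fun_scale (of_int j) \<alpha>" by blast
      then have "\<kappa> + \<alpha> = \<beta> + fun_scale (of_int (j + 1)) \<alpha>"
        by (simp add: fun_eq_iff fun_scale_def algebra_simps)
      then show ?thesis using that(2) by blast
    qed
    have minus: "\<kappa> - \<alpha> \<in> ?S" if "\<kappa> \<in> ?S" "\<kappa> - \<alpha> \<in> W" for \<kappa>
    proof -
      from that obtain j :: int where "\<kappa> = \<beta> + fun_scale (of_int j) \<alpha>" by blast
      then have "\<kappa> - \<alpha> = \<beta> + fun_scale (of_int (j - 1)) \<alpha>"
        by (simp add: fun_eq_iff fun_scale_def algebra_simps)
      then show ?thesis using that(2) by blast
    qed
    have up: "\<kappa> + \<alpha> \<in> ?S" if "\<kappa> \<in> ?S" "v \<in> rs \<kappa>" "bracket x v \<noteq> 0" for \<kappa> v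
    proof (rule plus[OF that(1)])
      have "\<kappa> \<in> dual_space H" using that(1) W_dual by blast
      then have "\<kappa> + \<alpha> \<in> dual_space H" by (rule add_dual[OF _ root_dual[OF \<alpha>]])
      moreover have "bracket x v \<in> rs (\<kappa> + \<alpha>)" using rs_bracket[OF x(1) that(2)] by (simp add: add.commute)
      ultimately show "\<kappa> + \<alpha> \<in> W" using that(3) by (rule rs_weight)
    qed
    have sum0: "(\<Sum>\<kappa>\<in>?S. ip \<kappa> \<alpha> * of_nat (dim (rs \<kappa>))) = 0"
    proof (rule weighted_sum_zero[OF _ \<alpha> x])
      show "?S \<subseteq> W" by blast
      show "\<kappa> + \<alpha> \<in> ?S" if "\<kappa> \<in> ?S" "v \<in> rs \<kappa>" "bracket x v \<noteq> 0" for \<kappa> v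
        by (rule up[OF that])
      show "\<kappa> - \<alpha> \<in> ?S" if "\<kappa> \<in> ?S" "\<kappa> - \<alpha> \<in> W" for \<kappa>
        by (rule minus[OF that])
    qed
    have "(\<Sum>\<kappa>\<in>?S. ip \<kappa> \<alpha> * of_nat (dim (rs \<kappa>))) = (\<Sum>\<kappa>\<in>?S. ip \<beta> \<alpha> * of_nat (dim (rs \<kappa>)))"
    proof (rule sum.cong[OF refl])
      fix \<kappa> assume "\<kappa> \<in> ?S"
      then obtain j :: int where "\<kappa> = \<beta> + fun_scale (of_int j) \<alpha>" by blast
      then have "ip \<kappa> \<alpha> = ip \<beta> \<alpha>" by (simp only: ip_add ip_scale 0) simp
      then show "ip \<kappa> \<alpha> * of_nat (dim (rs \<kappa>)) = ip \<beta> \<alpha> * of_nat (dim (rs \<kappa>))" by simp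
    qed
    then have prod0: "ip \<beta> \<alpha> * of_nat (\<Sum>\<kappa>\<in>?S. dim (rs \<kappa>)) = 0"
      using sum0 by (simp add: sum_distrib_left)
    have "\<beta> = \<beta> + fun_scale (of_int 0) \<alpha>" by (simp add: fun_eq_iff fun_scale_def)
    then have "\<beta> \<in> ?S" using \<beta> by blast
    moreover have "finite ?S" by (rule finite_subset[OF _ finite_W]) blast
    ultimately have "dim (rs \<beta>) \<le> (\<Sum>\<kappa>\<in>?S. dim (rs \<kappa>))" by (intro member_le_sum) auto
    then have "(\<Sum>\<kappa>\<in>?S. dim (rs \<kappa>)) \<noteq> 0" using dim_rs_pos[OF \<beta>] by linarith
    then show ?thesis using prod0 by (simp only: mult_eq_0_iff of_nat_eq_0_iff ip_def) blast
  qed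
  then have "tv \<alpha> = 0" by (rule roots_separate[OF tv(1)[OF root_dual[OF \<alpha>]]])
  then have "\<alpha> h = 0" for h
    using tv(2)[OF root_dual[OF \<alpha>], of h] dual_space_outside[OF root_dual[OF \<alpha>], of h]
    by (cases "h \<in> H") simp_all
  then have "\<alpha> = 0" by (simp add: fun_eq_iff)
  then show False using \<alpha> zero_not_root by blast
qed

lemma root_multiple_ne:
  assumes "\<alpha> \<in> R" "fun_scale c \<alpha> = fun_scale d \<alpha>" shows "c = d"
proof -
  have "\<alpha> \<noteq> 0" using assms(1) zero_not_root by blast
  then obtain h where "\<alpha> h \<noteq> 0" by (auto simp: fun_eq_iff)
  moreover have "c * \<alpha> h = d * \<alpha> h" using fun_cong[OF assms(2), of h] by (simp add: fun_scale_def)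
  ultimately show ?thesis by simp
qed

text \<open>With \<open>y \<in> rs (- \<alpha>)\<close> paired with \<open>x \<in> rs \<alpha>\<close>, the span of \<open>y\<close>, \<open>H\<close> and all \<open>rs (j \<alpha>)\<close> with
  \<open>j \<ge> 1\<close> is stable under \<open>x\<close> and \<open>y\<close>, so \<open>tv \<alpha> = [x, y]\<close> has trace 0 on it; this says
  \<open>-1 + (\<Sum>j. j dim (rs (j \<alpha>))) = 0\<close>.\<close>

lemma root_multiples:
  assumes \<alpha>: "\<alpha> \<in> R"
  shows "dim (rs \<alpha>) = 1" and "\<And>j::nat. j \<ge> 1 \<Longrightarrow> fun_scale (of_nat j) \<alpha> \<in> R \<Longrightarrow> j = 1"
proof -
  note d = root_dual[OF \<alpha>]
  obtain x y where x: "x \<in> rs \<alpha>" and y: "y \<in> rs (- \<alpha>)" and xy: "killing x y = 1" "bracket x y = tv \<alpha>"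
    using root_pair[OF \<alpha>] .
  note t = tv(1)[OF d]
  define mul where "mul j = fun_scale (of_nat j) \<alpha>" for j :: nat
  define J where "J = {j. j \<ge> 1 \<and> mul j \<in> R}"
  have inj: "inj_on mul A" for A
  proof (rule inj_onI)
    fix i j assume "mul i = mul j"
    from root_multiple_ne[OF \<alpha> this[unfolded mul_def]] show "i = j" by simp
  qed
  have finJ: "finite J"
    by (rule finite_imageD[OF _ inj]) (auto simp: J_def intro: finite_subset[OF _ finite_roots])
  have mul_dual: "mul j \<in> dual_space H" for j unfolding mul_def by (rule scale_dual[OF d])
  have mul0: "mul 0 = 0" and mul1: "mul 1 = \<alpha>" by (simp_all add: mul_def fun_eq_iff fun_scale_def)
  have mul_Suc: "mul j + \<alpha> = mul (Suc j)" for j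
    by (simp add: mul_def fun_eq_iff fun_scale_def algebra_simps)
  have mul_ne: "mul j + \<alpha> \<noteq> 0" for j
  proof
    assume "mul j + \<alpha> = 0"
    then have "mul (Suc j) = mul 0" by (simp only: mul_Suc mul0)
    then show False using inj[of UNIV] by (auto dest: injD)
  qed
  have J1: "1 \<in> J" using \<alpha> mul1 by (simp add: J_def)
  let ?V = "mul ` J"
  \<comment> \<open>the projection onto the span of \<open>y\<close>, \<open>H\<close> and the root spaces of the positive multiples\<close>
  define P where "P z = scale (killing z x) y + PS (insert 0 ?V) z" for z
  have SW: "insert 0 ?V \<subseteq> W" by (auto simp: J_def)
  have fin: "finite (insert 0 ?V)" using finJ by simp
  have P: "lin P"
    unfolding P_def by (intro lin_plus lin_rank_one lform_killing_left lin_PS)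
  have ker: "killing v x = 0" if "v \<in> rs (mul j)" for v j
    by (rule killing_rs_zero[OF that x mul_dual d mul_ne])
  have P_rs: "P v = v" if v: "v \<in> rs (mul j)" and j: "j = 0 \<or> j \<in> J \<or> mul j \<notin> W" for v j
  proof (cases "v = 0")
    case False
    then have "mul j \<in> W" by (rule rs_weight[OF mul_dual v])
    then have "mul j \<in> insert 0 ?V" using j mul0 by auto
    then show ?thesis using PS_of_rs[OF fin mul_dual v] ker[OF v] by (simp add: P_def)
  qed (simp add: lin_zero[OF P])
  have P_y: "P y = y"
  proof -
    have "- \<alpha> \<notin> insert 0 ?V"
    proof
      assume "- \<alpha> \<in> insert 0 ?V"
      then obtain j where "- \<alpha> = mul j" using mul0 by auto
      then have "mul j + \<alpha> = - \<alpha> + \<alpha>" by (simp only:)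
      then have "mul j + \<alpha> = 0" by (simp only: add.left_inverse)
      then show False using mul_ne by blast
    qed
    then show ?thesis
      using PS_of_rs[OF fin uminus_dual[OF d] y] xy(1) by (simp add: P_def killing_sym)
  qed
  have decomp: "P z = scale (killing z x) y + (\<Sum>j\<in>insert 0 J. proj (mul j) z)" for z
  proof -
    have "insert 0 ?V = mul ` insert 0 J" by (simp add: mul0)
    then show ?thesis by (simp only: P_def PS_def sum.reindex[OF inj] o_def)
  qed
  have inv: "P (bracket w (P z)) = bracket w (P z)"
    if "P (bracket w y) = bracket w y"
      and "\<And>j v. j \<in> insert 0 J \<Longrightarrow> v \<in> rs (mul j) \<Longrightarrow> P (bracket w v) = bracket w v" for w z
    using that proj_rs[OF mul_dual]
    by (simp only: decomp[of z] bracket_add_right bracket_sum_right bracket_scale_right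
        lin_add[OF P] lin_sum[OF P] lin_scale[OF P] cong: sum.cong)
  have suc: "j \<in> J \<or> mul j \<notin> W" if "j \<ge> 1" for j
  proof -
    have "mul j \<noteq> 0" using inj[of UNIV] mul0 that by (metis injD not_one_le_zero)
    then show ?thesis using that by (auto simp: J_def)
  qed
  have up: "P (bracket x (P z)) = bracket x (P z)" for z
  proof (rule inv)
    have "tv \<alpha> \<in> rs (mul 0)" using t by (simp only: mul0 rs_0)
    then show "P (bracket x y) = bracket x y" unfolding xy(2) by (rule P_rs) simp
  next
    fix j v assume "v \<in> rs (mul j)"
    then have "bracket x v \<in> rs (mul (Suc j))"
      using rs_bracket[OF x, of v "mul j"] mul_Suc[of j] by (simp add: add.commute)
    then show "P (bracket x v) = bracket x v" by (rule P_rs) (use suc[of "Suc j"] in simp)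
  qed
  have down: "P (bracket y (P z)) = bracket y (P z)" for z
  proof (rule inv)
    show "P (bracket y y) = bracket y y" by (simp add: lin_zero[OF P])
  next
    fix j v assume v: "v \<in> rs (mul j)"
    show "P (bracket y v) = bracket y v"
    proof (cases j)
      case 0
      then have "v \<in> H" using v by (simp only: mul0 rs_0)
      then show ?thesis
        using rs_bracket_H'[OF _ y, of v] by (simp add: lin_scale[OF P] P_y)
    next
      case (Suc i)
      have "bracket y v \<in> rs (- \<alpha> + mul (Suc i))" using rs_bracket[OF y v] Suc by simp
      also have "- \<alpha> + mul (Suc i) = mul i" by (simp add: mul_Suc[symmetric])
      finally show ?thesis by (rule P_rs) (use suc[of i] in auto)
    qed
  qed
  have "trace (\<lambda>z. bracket (tv \<alpha>) (P z)) = 0"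
    using trace_commutator[OF P up down] by (simp only: xy(2))
  moreover have "trace (\<lambda>z. bracket (tv \<alpha>) (P z))
      = trace (\<lambda>z. scale (killing z x) (bracket (tv \<alpha>) y)) + trace (\<lambda>z. bracket (tv \<alpha>) (PS (insert 0 ?V) z))"
    by (simp add: P_def bracket_add_right bracket_scale_right trace_plus)
  moreover have "trace (\<lambda>z. scale (killing z x) (bracket (tv \<alpha>) y)) = - ip \<alpha> \<alpha>"
    using xy(1) rs_bracket_H[OF t y]
    by (simp only: trace_rank_one[OF lform_killing_left] killing_scale_left) (simp add: killing_sym ip_def)
  moreover have "trace (\<lambda>z. bracket (tv \<alpha>) (PS (insert 0 ?V) z)) = ip \<alpha> \<alpha> * of_nat (\<Sum>j\<in>J. j * dim (rs (mul j)))"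
  proof -
    have "0 \<notin> ?V" using zero_not_root by (auto simp: J_def)
    then have "(\<Sum>\<kappa>\<in>insert 0 ?V. \<kappa> (tv \<alpha>) * of_nat (dim (rs \<kappa>))) = (\<Sum>\<kappa>\<in>?V. \<kappa> (tv \<alpha>) * of_nat (dim (rs \<kappa>)))"
      using finJ by simp
    also have "\<dots> = (\<Sum>j\<in>J. mul j (tv \<alpha>) * of_nat (dim (rs (mul j))))"
      by (simp only: sum.reindex[OF inj] o_def)
    also have "\<dots> = (\<Sum>j\<in>J. ip \<alpha> \<alpha> * of_nat (j * dim (rs (mul j))))"
    proof (rule sum.cong[OF refl])
      fix j
      have "mul j (tv \<alpha>) = of_nat j * ip \<alpha> \<alpha>" by (simp add: mul_def fun_scale_def ip_def)
      then show "mul j (tv \<alpha>) * of_nat (dim (rs (mul j))) = ip \<alpha> \<alpha> * of_nat (j * dim (rs (mul j)))"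
        by (simp add: algebra_simps)
    qed
    finally show ?thesis
      by (simp only: trace_PS[OF SW t] sum_distrib_left of_nat_sum)
  qed
  ultimately have "ip \<alpha> \<alpha> * (of_nat (\<Sum>j\<in>J. j * dim (rs (mul j))) - 1) = 0"
    by (simp add: algebra_simps)
  then have "of_nat (\<Sum>j\<in>J. j * dim (rs (mul j))) = (of_nat 1 :: 'k)"
    using ip_self_nonzero[OF \<alpha>] by simp
  then have one: "(\<Sum>j\<in>J. j * dim (rs (mul j))) = 1"
    by (simp only: of_nat_eq_iff)
  have pos: "j * dim (rs (mul j)) \<ge> 1" if "j \<in> J" for j
    using that dim_rs_pos[of "mul j"] by (simp add: J_def)
  have rest: "(\<Sum>j\<in>J. j * dim (rs (mul j))) = dim (rs \<alpha>) + (\<Sum>j\<in>J - {1}. j * dim (rs (mul j)))"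
    using sum.remove[OF finJ J1, of "\<lambda>j. j * dim (rs (mul j))"] by (simp add: mul1[simplified])
  have d1: "dim (rs \<alpha>) \<ge> 1" using dim_rs_pos[OF \<alpha>] by simp
  show "dim (rs \<alpha>) = 1" using one rest d1 by simp
  have "(\<Sum>j\<in>J - {1}. j * dim (rs (mul j))) = 0" using one rest d1 by simp
  moreover have "1 \<le> (\<Sum>j\<in>J - {1}. j * dim (rs (mul j)))" if "k \<in> J - {1}" for k
  proof -
    have "k * dim (rs (mul k)) \<le> (\<Sum>j\<in>J - {1}. j * dim (rs (mul j)))"
      using that finJ by (intro member_le_sum) auto
    then show ?thesis using pos[of k] that by (meson DiffD1 le_trans)
  qed
  ultimately have "J - {1} = {}" by fastforce
  then show "j = 1" if "j \<ge> 1" "fun_scale (of_nat j) \<alpha> \<in> R" for j :: nat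
    using that by (auto simp: J_def mul_def)
qed


lemma rs_line:
  assumes \<gamma>: "\<gamma> \<in> R" and v: "v \<in> rs \<gamma>" "v \<noteq> 0" and w: "w \<in> rs \<gamma>"
  obtains c where "w = scale c v"
proof -
  have "rs \<gamma> \<subseteq> span {v}"
    using v root_multiples(1)[OF \<gamma>] by (intro card_ge_dim_independent) auto
  then have "w \<in> range (\<lambda>c. scale c v)" using w by (auto simp: span_singleton)
  then show ?thesis using that by blast
qed

lemma sum_symmetric_interval:
  fixes a b :: int assumes "a \<le> b"
  shows "2 * (\<Sum>j\<in>{a..b}. of_int j) = (of_int (b - a + 1) * of_int (a + b) :: 'k)"
proof -
  have "(\<Sum>j\<in>{a..b}. of_int j) = (\<Sum>j\<in>{a..b}. of_int (a + b - j) :: 'k)"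
    by (rule sum.reindex_bij_witness[of _ "\<lambda>j. a + b - j" "\<lambda>j. a + b - j"]) auto
  then have "2 * (\<Sum>j\<in>{a..b}. of_int j) = (\<Sum>j\<in>{a..b}. of_int j + of_int (a + b - j) :: 'k)"
    by (simp only: sum.distrib mult_2)
  also have "\<dots> = (\<Sum>j\<in>{a..b}. of_int (a + b))"
    by (simp flip: of_int_add)
  also have "\<dots> = of_int (int (card {a..b})) * of_int (a + b)"
    by simp
  also have "int (card {a..b}) = b - a + 1" using assms by simp
  finally show ?thesis .
qed

definition str :: "('g \<Rightarrow> 'k) \<Rightarrow> ('g \<Rightarrow> 'k) \<Rightarrow> int \<Rightarrow> ('g \<Rightarrow> 'k)" where
  "str \<beta> \<alpha> j = \<beta> + fun_scale (of_int j) \<alpha>"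

lemma str_0: "str \<beta> \<alpha> 0 = \<beta>"
  and str_plus: "str \<beta> \<alpha> j + \<alpha> = str \<beta> \<alpha> (j + 1)"
  and str_minus: "str \<beta> \<alpha> j - \<alpha> = str \<beta> \<alpha> (j - 1)"
  by (simp_all add: str_def fun_eq_iff fun_scale_def algebra_simps)

lemma ip_str: "ip (str \<beta> \<alpha> j) \<kappa> = ip \<beta> \<kappa> + of_int j * ip \<alpha> \<kappa>"
  by (simp add: str_def ip_add ip_scale)

lemma str_inj:
  assumes "\<alpha> \<in> R" "str \<beta> \<alpha> i = str \<beta> \<alpha> j" shows "i = j"
proof -
  have "fun_scale (of_int i) \<alpha> = fun_scale (of_int j) \<alpha>" using assms(2) by (simp add: str_def)
  from root_multiple_ne[OF assms(1) this] show ?thesis by simp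
qed

text \<open>A run of the string that cannot be left upwards by \<open>x\<close> nor downwards at all spans a space on which
  \<open>tv \<alpha>\<close> has trace 0; all root spaces have dimension 1, except that the weight 0, where the term
  vanishes anyway, may occur. So the sum of \<open>(\<beta> + j \<alpha>, \<alpha>)\<close> over \<open>a \<le> j \<le> b\<close> is 0. The run may end at \<open>b\<close>
  although the string goes on, if \<open>x\<close> kills the root space there.\<close>

lemma interval_trace:
  assumes \<alpha>: "\<alpha> \<in> R" and ab: "a \<le> b"
    and inW: "\<And>j. a \<le> j \<Longrightarrow> j \<le> b \<Longrightarrow> str \<beta> \<alpha> j \<in> W"
    and low: "str \<beta> \<alpha> (a - 1) \<notin> W"
    and x: "x \<in> rs \<alpha>" "x \<noteq> 0"
    and up: "str \<beta> \<alpha> (b + 1) \<notin> W \<or> (\<forall>v\<in>rs (str \<beta> \<alpha> b). bracket x v = 0)"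
  shows "2 * ip \<beta> \<alpha> = - of_int (a + b) * ip \<alpha> \<alpha>"
proof -
  let ?S = "str \<beta> \<alpha> ` {a..b}"
  have S: "?S \<subseteq> W" by (intro image_subsetI inW) auto
  have "(\<Sum>\<kappa>\<in>?S. ip \<kappa> \<alpha> * of_nat (dim (rs \<kappa>))) = 0"
  proof (rule weighted_sum_zero[OF S \<alpha> x])
    fix \<kappa> v assume \<kappa>: "\<kappa> \<in> ?S" and v: "v \<in> rs \<kappa>" "bracket x v \<noteq> 0"
    then obtain j where j: "a \<le> j" "j \<le> b" "\<kappa> = str \<beta> \<alpha> j" by auto
    have "j \<noteq> b"
    proof
      assume "j = b"
      then have "str \<beta> \<alpha> (b + 1) \<notin> W" using up v j(3) by blast
      moreover have "\<kappa> + \<alpha> \<in> W"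
      proof (rule rs_weight[OF _ _ v(2)])
        show "\<kappa> + \<alpha> \<in> dual_space H" using \<kappa> S W_dual root_dual[OF \<alpha>] by (blast intro: add_dual)
        show "bracket x v \<in> rs (\<kappa> + \<alpha>)" using rs_bracket[OF x(1) v(1)] by (simp only: add.commute)
      qed
      ultimately show False using j(3) \<open>j = b\<close> by (simp only: str_plus)
    qed
    then show "\<kappa> + \<alpha> \<in> ?S" using j by (simp add: str_plus)
  next
    fix \<kappa> assume \<kappa>: "\<kappa> \<in> ?S" "\<kappa> - \<alpha> \<in> W"
    then obtain j where j: "a \<le> j" "j \<le> b" "\<kappa> = str \<beta> \<alpha> j" by auto
    then have "j \<noteq> a" using low \<kappa>(2) by (auto simp: str_minus)
    then show "\<kappa> - \<alpha> \<in> ?S" using j by (simp add: str_minus)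
  qed
  then have "0 = (\<Sum>\<kappa>\<in>?S. ip \<kappa> \<alpha> * of_nat (dim (rs \<kappa>)))" by (rule sym)
  also have "\<dots> = (\<Sum>\<kappa>\<in>?S. ip \<kappa> \<alpha>)"
  proof (rule sum.cong[OF refl])
    fix \<kappa> assume "\<kappa> \<in> ?S"
    then show "ip \<kappa> \<alpha> * of_nat (dim (rs \<kappa>)) = ip \<kappa> \<alpha>"
      using S root_multiples(1)[of \<kappa>] by (cases "\<kappa> = 0") (auto simp: ip_zero)
  qed
  also have "inj_on (str \<beta> \<alpha>) {a..b}" by (rule inj_onI, rule str_inj[OF \<alpha>])
  then have "(\<Sum>\<kappa>\<in>?S. ip \<kappa> \<alpha>) = (\<Sum>j\<in>{a..b}. ip \<beta> \<alpha> + of_int j * ip \<alpha> \<alpha>)"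
    by (simp add: sum.reindex ip_str)
  also have "\<dots> = of_int (b - a + 1) * ip \<beta> \<alpha> + (\<Sum>j\<in>{a..b}. of_int j) * ip \<alpha> \<alpha>"
    using ab by (simp add: sum.distrib sum_distrib_right)
  finally have "2 * (of_int (b - a + 1) * ip \<beta> \<alpha> + (\<Sum>j\<in>{a..b}. of_int j) * ip \<alpha> \<alpha>) = 0"
    by (simp only: mult_zero_right)
  then have "of_int (b - a + 1) * (2 * ip \<beta> \<alpha>) + (2 * (\<Sum>j\<in>{a..b}. of_int j)) * ip \<alpha> \<alpha> = 0"
    by (simp only: distrib_left mult.assoc mult.left_commute)
  then have "of_int (b - a + 1) * (2 * ip \<beta> \<alpha> + of_int (a + b) * ip \<alpha> \<alpha>) = 0"
    unfolding sum_symmetric_interval[OF ab] by (simp only: distrib_left mult.assoc)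
  moreover have "of_int (b - a + 1) \<noteq> (0 :: 'k)" using ab by (simp only: of_int_eq_0_iff)
  ultimately have "2 * ip \<beta> \<alpha> + of_int (a + b) * ip \<alpha> \<alpha> = 0"
    by (simp only: mult_eq_0_iff) blast
  then show ?thesis by (simp only: eq_neg_iff_add_eq_0[THEN iffD2, of _ "of_int (a + b) * ip \<alpha> \<alpha>"] mult_minus_left)
qed

lemma finite_run:
  fixes f :: "nat \<Rightarrow> 'b"
  assumes "inj f" "finite A" "f 0 \<in> A"
  obtains p where "\<And>j. j \<le> p \<Longrightarrow> f j \<in> A" "f (Suc p) \<notin> A"
proof -
  have "\<exists>p. f p \<notin> A"
  proof (rule ccontr)
    assume "\<not> ?thesis"
    then have "range f \<subseteq> A" by blast
    then show False using assms(1,2) finite_subset infinite_UNIV_nat finite_imageD by blast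
  qed
  then have L: "f (LEAST p. f p \<notin> A) \<notin> A" by (rule LeastI_ex)
  then have "(LEAST p. f p \<notin> A) \<noteq> 0" using assms(3) by metis
  then obtain p where p: "(LEAST p. f p \<notin> A) = Suc p" using not0_implies_Suc by blast
  have "f j \<in> A" if "j \<le> p" for j
    using not_less_Least[of j "\<lambda>p. f p \<notin> A"] p that by auto
  moreover have "f (Suc p) \<notin> A" using L p by simp
  ultimately show ?thesis by (rule that)
qed

lemma root_string:
  assumes \<alpha>: "\<alpha> \<in> R" and \<beta>: "\<beta> \<in> R"
  obtains p r :: nat where "2 * ip \<beta> \<alpha> = of_int (int p - int r) * ip \<alpha> \<alpha>"
    "\<And>j. - int p \<le> j \<Longrightarrow> j \<le> int r \<Longrightarrow> str \<beta> \<alpha> j \<in> W"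
    "str \<beta> \<alpha> (int r + 1) \<notin> W" "str \<beta> \<alpha> (- int p - 1) \<notin> W"
proof -
  have inj: "inj (\<lambda>j. str \<beta> \<alpha> (int j))" "inj (\<lambda>j. str \<beta> \<alpha> (- int j))"
    by (rule injI, drule str_inj[OF \<alpha>], simp)+
  have "str \<beta> \<alpha> (int 0) \<in> W" "str \<beta> \<alpha> (- int 0) \<in> W" using \<beta> by (simp_all add: str_0)
  then obtain p r where r: "\<And>j. j \<le> r \<Longrightarrow> str \<beta> \<alpha> (int j) \<in> W" "str \<beta> \<alpha> (int (Suc r)) \<notin> W"
    and p: "\<And>j. j \<le> p \<Longrightarrow> str \<beta> \<alpha> (- int j) \<in> W" "str \<beta> \<alpha> (- int (Suc p)) \<notin> W"
    using finite_run[OF inj(1) finite_W] finite_run[OF inj(2) finite_W] by metis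
  have inW: "str \<beta> \<alpha> j \<in> W" if "- int p \<le> j" "j \<le> int r" for j
    using r(1)[of "nat j"] p(1)[of "nat (- j)"] that by (cases "j \<ge> 0") auto
  obtain x where x: "x \<in> rs \<alpha>" "x \<noteq> 0" using rs_nonzero[OF \<alpha>] by blast
  have "int (Suc r) = int r + 1" "- int (Suc p) = - int p - 1" by simp_all
  then have ends: "str \<beta> \<alpha> (int r + 1) \<notin> W" "str \<beta> \<alpha> (- int p - 1) \<notin> W"
    using r(2) p(2) by metis+
  have "2 * ip \<beta> \<alpha> = - of_int (- int p + int r) * ip \<alpha> \<alpha>"
    using ends by (intro interval_trace[OF \<alpha> _ inW _ x]) auto
  then show ?thesis using that[of p r] inW ends by simp
qed

lemma cartan_integer_unique:
  "\<alpha> \<in> R \<Longrightarrow> of_int m * ip \<alpha> \<alpha> = of_int n * ip \<alpha> \<alpha> \<Longrightarrow> m = n"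
  using ip_self_nonzero[of \<alpha>] by simp

lemma reflection_root:
  assumes \<alpha>: "\<alpha> \<in> R" and \<beta>: "\<beta> \<in> R"
  obtains n :: int where "2 * ip \<beta> \<alpha> = of_int n * ip \<alpha> \<alpha>" "\<beta> - fun_scale (of_int n) \<alpha> \<in> R"
proof -
  obtain p r :: nat where pr: "2 * ip \<beta> \<alpha> = of_int (int p - int r) * ip \<alpha> \<alpha>"
    "\<And>j. - int p \<le> j \<Longrightarrow> j \<le> int r \<Longrightarrow> str \<beta> \<alpha> j \<in> W"
    using root_string[OF assms] by metis
  let ?n = "int p - int r"
  have eq: "str \<beta> \<alpha> (- ?n) = \<beta> - fun_scale (of_int ?n) \<alpha>"
    by (simp add: str_def fun_eq_iff fun_scale_def algebra_simps)
  have "str \<beta> \<alpha> (- ?n) \<in> W" by (rule pr(2)) auto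
  moreover have "str \<beta> \<alpha> (- ?n) \<noteq> 0"
  proof
    assume 0: "str \<beta> \<alpha> (- ?n) = 0"
    have "ip (str \<beta> \<alpha> (- ?n)) \<alpha> = ip \<beta> \<alpha> - of_int ?n * ip \<alpha> \<alpha>"
      by (simp only: ip_str of_int_minus) (simp add: algebra_simps)
    then have "ip \<beta> \<alpha> = of_int ?n * ip \<alpha> \<alpha>" unfolding 0 ip_zero by simp
    then have "of_int ?n * ip \<alpha> \<alpha> = 0" using pr(1) by simp
    then have "?n = 0" using ip_self_nonzero[OF \<alpha>] by (simp only: mult_eq_0_iff of_int_eq_0_iff) blast
    then show False using 0 \<beta> zero_not_root by (simp only: minus_zero str_0)
  qed
  ultimately have "\<beta> - fun_scale (of_int ?n) \<alpha> \<in> R" unfolding eq by blast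
  then show ?thesis using that pr(1) by blast
qed

lemma cartan_integer: "\<alpha> \<in> R \<Longrightarrow> \<beta> \<in> R \<Longrightarrow> \<exists>n::int. 2 * ip \<beta> \<alpha> = of_int n * ip \<alpha> \<alpha>"
  by (rule reflection_root[of \<alpha> \<beta>]) blast+

lemma add_root_of_negative:
  assumes \<alpha>: "\<alpha> \<in> R" and \<beta>: "\<beta> \<in> R" and n: "2 * ip \<beta> \<alpha> = of_int n * ip \<alpha> \<alpha>"
  shows "n < 0 \<Longrightarrow> \<beta> + \<alpha> \<in> W" and "n > 0 \<Longrightarrow> \<beta> - \<alpha> \<in> W"
proof -
  obtain p r :: nat where pr: "2 * ip \<beta> \<alpha> = of_int (int p - int r) * ip \<alpha> \<alpha>"
    "\<And>j. - int p \<le> j \<Longrightarrow> j \<le> int r \<Longrightarrow> str \<beta> \<alpha> j \<in> W"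
    using root_string[OF assms(1,2)] by metis
  have "n = int p - int r" using cartan_integer_unique[OF \<alpha>] n pr(1) by metis
  then show "n < 0 \<Longrightarrow> \<beta> + \<alpha> \<in> W" and "n > 0 \<Longrightarrow> \<beta> - \<alpha> \<in> W"
    using pr(2)[of 1] pr(2)[of "-1"] str_plus[of \<beta> \<alpha> 0] str_minus[of \<beta> \<alpha> 0]
    by (simp_all add: str_0)
qed

text \<open>If \<open>[x, v] = 0\<close>, the run from the lower end of the string to \<open>\<beta>\<close> is stable, and comparing its trace with
  that of the whole string shows that \<open>\<beta>\<close> is the upper end.\<close>

lemma bracket_nonzero:
  assumes \<alpha>: "\<alpha> \<in> R" and \<beta>: "\<beta> \<in> R" and ab: "\<beta> + \<alpha> \<in> R"
    and x: "x \<in> rs \<alpha>" "x \<noteq> 0" and v: "v \<in> rs \<beta>" "v \<noteq> 0"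
  shows "bracket x v \<noteq> 0"
proof
  assume 0: "bracket x v = 0"
  have null: "bracket x w = 0" if "w \<in> rs \<beta>" for w
    using rs_line[OF \<beta> v that] 0 by (metis bracket_scale_right scale_zero_right)
  obtain p r :: nat where pr: "2 * ip \<beta> \<alpha> = of_int (int p - int r) * ip \<alpha> \<alpha>"
    "\<And>j. - int p \<le> j \<Longrightarrow> j \<le> int r \<Longrightarrow> str \<beta> \<alpha> j \<in> W"
    "str \<beta> \<alpha> (int r + 1) \<notin> W" "str \<beta> \<alpha> (- int p - 1) \<notin> W"
    using root_string[OF \<alpha> \<beta>] by metis
  have "2 * ip \<beta> \<alpha> = - of_int (- int p + 0) * ip \<alpha> \<alpha>"
    using pr(2,4) null by (intro interval_trace[OF \<alpha> _ _ _ x]) (auto simp: str_0)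
  then have "of_int (int p) * ip \<alpha> \<alpha> = of_int (int p - int r) * ip \<alpha> \<alpha>"
    using pr(1) by simp
  then have "int p = int p - int r" by (rule cartan_integer_unique[OF \<alpha>])
  then have "r = 0" by simp
  then show False using pr(3) ab str_plus[of \<beta> \<alpha> 0] by (simp add: str_0)
qed


subsection \<open>Rationality of the form\<close>

lemma killing_H_sum:
  assumes h: "h \<in> H" and h': "h' \<in> H"
  shows "killing h h' = (\<Sum>\<kappa>\<in>R. \<kappa> h * \<kappa> h')"
proof -
  have "bracket h (bracket h' z) = bracket h (\<Sum>\<kappa>\<in>W. scale (\<kappa> h') (proj \<kappa> z))" for z
  proof -
    have "bracket h' z = (\<Sum>\<kappa>\<in>W. bracket h' (proj \<kappa> z))"
      by (simp only: bracket_sum_right[symmetric] sum_proj_W)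
    also have "\<dots> = (\<Sum>\<kappa>\<in>W. scale (\<kappa> h') (proj \<kappa> z))"
      by (intro sum.cong refl rs_bracket_H[OF h'] proj_rs W_dual)
    finally show ?thesis by simp
  qed
  also have "\<dots> z = (\<Sum>\<kappa>\<in>W. scale (\<kappa> h * \<kappa> h') (proj \<kappa> z))" for z
    by (simp only: bracket_sum_right bracket_scale_right)
      (intro sum.cong refl, simp add: rs_bracket_H[OF h proj_rs[OF W_dual]] mult.commute)
  finally have "killing h h' = (\<Sum>\<kappa>\<in>W. \<kappa> h * \<kappa> h' * trace (proj \<kappa>))"
    by (simp only: killing_def trace_sum trace_smult)
  also have "\<dots> = (\<Sum>\<kappa>\<in>R. \<kappa> h * \<kappa> h' * trace (proj \<kappa>))"
    using finite_roots zero_not_root by simp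
  also have "\<dots> = (\<Sum>\<kappa>\<in>R. \<kappa> h * \<kappa> h')"
  proof (rule sum.cong[OF refl])
    fix \<kappa> assume \<kappa>: "\<kappa> \<in> R"
    note on = on_H_dual[OF root_dual[OF \<kappa>]]
    show "\<kappa> h * \<kappa> h' * trace (proj \<kappa>) = \<kappa> h * \<kappa> h'"
      using trace_proj[OF on] root_multiples(1)[OF \<kappa>] rs_eq_gws[OF on] by simp
  qed
  finally show ?thesis .
qed

lemma ip_sum_roots:
  "\<mu> \<in> dual_space H \<Longrightarrow> \<nu> \<in> dual_space H \<Longrightarrow> ip \<mu> \<nu> = (\<Sum>\<kappa>\<in>R. ip \<kappa> \<mu> * ip \<kappa> \<nu>)"
  using killing_H_sum[OF tv(1) tv(1)] by (simp add: ip_killing) (simp add: ip_def)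

text \<open>As \<open>(\<alpha>, \<alpha>)\<close> is the sum of \<open>(\<kappa>, \<alpha>)\<^sup>2\<close> over all roots \<open>\<kappa>\<close> and each \<open>2 (\<kappa>, \<alpha>)\<close> is \<open>n\<^sub>\<kappa> (\<alpha>, \<alpha>)\<close> with \<open>n\<^sub>\<kappa>\<close> an
  integer, \<open>4 = (\<Sum>\<kappa>. n\<^sub>\<kappa>\<^sup>2) (\<alpha>, \<alpha>)\<close>.\<close>

lemma ip_self_rat:
  assumes \<alpha>: "\<alpha> \<in> R" obtains r :: rat where "r > 0" "ip \<alpha> \<alpha> = of_rat r"
proof -
  obtain n where n: "\<And>\<kappa>. \<kappa> \<in> R \<Longrightarrow> 2 * ip \<kappa> \<alpha> = of_int (n \<kappa>) * ip \<alpha> \<alpha>"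
    using cartan_integer[OF \<alpha>] by metis
  define N where "N = (\<Sum>\<kappa>\<in>R. (n \<kappa>)\<^sup>2)"
  have "4 * ip \<alpha> \<alpha> = (\<Sum>\<kappa>\<in>R. (2 * ip \<kappa> \<alpha>) * (2 * ip \<kappa> \<alpha>))"
    by (subst ip_sum_roots[OF root_dual[OF \<alpha>] root_dual[OF \<alpha>]]) (simp add: sum_distrib_left algebra_simps)
  also have "\<dots> = (\<Sum>\<kappa>\<in>R. of_int ((n \<kappa>)\<^sup>2) * (ip \<alpha> \<alpha> * ip \<alpha> \<alpha>))"
    by (intro sum.cong refl) (simp only: n, simp add: power2_eq_square mult_ac)
  also have "\<dots> = of_int N * (ip \<alpha> \<alpha> * ip \<alpha> \<alpha>)"
    by (simp add: N_def sum_distrib_right)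
  finally have "of_int N * ip \<alpha> \<alpha> = 4"
    using ip_self_nonzero[OF \<alpha>] by simp
  moreover have "N \<ge> 0" by (simp add: N_def sum_nonneg)
  ultimately have "N > 0" "ip \<alpha> \<alpha> = of_rat (4 / of_int N)"
    by (cases "N = 0"; simp add: of_rat_divide field_simps)+
  then show ?thesis by (intro that[of "4 / of_int N"]) simp_all
qed

lemma ip_rat:
  assumes "\<alpha> \<in> R" "\<beta> \<in> R" shows "ip \<beta> \<alpha> \<in> \<rat>"
proof -
  obtain n :: int where "2 * ip \<beta> \<alpha> = of_int n * ip \<alpha> \<alpha>" using cartan_integer[OF assms] by blast
  then have "ip \<beta> \<alpha> = of_int n * ip \<alpha> \<alpha> / 2" by (simp add: eq_divide_eq mult.commute)
  moreover have "ip \<alpha> \<alpha> \<in> \<rat>" using ip_self_rat[OF assms(1)] by (metis Rats_of_rat)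
  ultimately show ?thesis by (metis Rats_divide Rats_mult Rats_of_int Rats_number_of)
qed

end

section \<open>Bases, heights and the highest root\<close>

locale root_lie_algebra =
  based_simple_lie_algebra scale Basis bracket H \<Pi> + cartan_lie_algebra scale Basis bracket H
  for scale :: "'k::{alg_closed_field, field_char_0} \<Rightarrow> 'g::ab_group_add \<Rightarrow> 'g"
    and Basis :: "'g set" and bracket :: "'g \<Rightarrow> 'g \<Rightarrow> 'g"
    and H :: "'g set" and \<Pi> :: "('g \<Rightarrow> 'k) set"
begin

lemma base_root: "\<beta> \<in> \<Pi> \<Longrightarrow> \<beta> \<in> R"
  using base by (auto simp: root_base_def)

lemma finite_base: "finite \<Pi>"
  using base_root by (intro finite_subset[OF _ finite_roots] subsetI)

text \<open>The integral combination of simple roots with coefficients \<open>n\<close>; the set \<open>L\<close> of these is the root lattice.\<close>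

definition zl :: "(('g \<Rightarrow> 'k) \<Rightarrow> int) \<Rightarrow> ('g \<Rightarrow> 'k)" where
  "zl n = (\<Sum>\<beta>\<in>\<Pi>. fun_scale (of_int (n \<beta>)) \<beta>)"

definition L :: "('g \<Rightarrow> 'k) set" where "L = range zl"

lemma zl_add: "zl n + zl m = zl (\<lambda>\<beta>. n \<beta> + m \<beta>)"
  by (simp add: zl_def sum.distrib functional.scale_left_distrib)

lemma zl_uminus: "- zl n = zl (\<lambda>\<beta>. - n \<beta>)"
  by (simp add: zl_def functional.scale_minus_left sum_negf)

lemma zl_zero: "zl (\<lambda>_. 0) = 0"
  by (simp add: zl_def functional.scale_zero_left)

lemma zl_unique:
  assumes "zl n = zl m" "\<beta> \<in> \<Pi>" shows "n \<beta> = m \<beta>"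
proof -
  have ind: "functional.independent \<Pi>" using base by (simp add: root_base_def)
  have "(\<Sum>\<beta>\<in>\<Pi>. fun_scale (of_int (n \<beta>) - of_int (m \<beta>)) \<beta>) = zl n - zl m"
    by (simp add: zl_def functional.scale_left_diff_distrib sum_subtractf)
  also have "\<dots> = 0" using assms(1) by simp
  finally have "of_int (n \<beta>) - of_int (m \<beta>) = (0 :: 'k)"
    using functional.independentD[OF ind finite_base order_refl _ assms(2), of "\<lambda>\<beta>. of_int (n \<beta>) - of_int (m \<beta>)"]
    by blast
  then show ?thesis by simp
qed

lemma ht_zl:
  assumes "\<alpha> \<in> \<Pi>" shows "ht \<alpha> (zl n) = n \<alpha>"
  unfolding ht_def zl_def[symmetric]
proof (rule the_equality)
  show "\<exists>m. zl n = zl m \<and> m \<alpha> = n \<alpha>" by (rule exI[of _ n]) simp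
  fix k assume "\<exists>m. zl n = zl m \<and> m \<alpha> = k"
  then obtain m where "zl n = zl m" "m \<alpha> = k" by blast
  then show "k = n \<alpha>" using zl_unique[of n m \<alpha>] assms by simp
qed

lemma L_cases: "\<mu> \<in> L \<Longrightarrow> (\<And>n. \<mu> = zl n \<Longrightarrow> thesis) \<Longrightarrow> thesis"
  by (auto simp: L_def)

lemma zl_L: "zl n \<in> L"
  by (simp add: L_def)

lemma L_add: "\<mu> \<in> L \<Longrightarrow> \<nu> \<in> L \<Longrightarrow> \<mu> + \<nu> \<in> L"
  by (elim L_cases) (simp only: zl_add zl_L)

lemma L_uminus: "\<mu> \<in> L \<Longrightarrow> - \<mu> \<in> L"
  by (elim L_cases) (simp only: zl_uminus zl_L)

lemma L_diff: "\<mu> \<in> L \<Longrightarrow> \<nu> \<in> L \<Longrightarrow> \<mu> - \<nu> \<in> L"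
  using L_add[OF _ L_uminus] by (simp only: diff_conv_add_uminus)

lemma L_zero: "0 \<in> L"
  by (metis zl_zero zl_L)

lemma L_sum: "(\<And>i. i \<in> I \<Longrightarrow> f i \<in> L) \<Longrightarrow> (\<Sum>i\<in>I. f i) \<in> L"
proof (induction I rule: infinite_finite_induct)
  case (infinite I)
  then show ?case by (simp only: sum.infinite L_zero not_False_eq_True)
next
  case empty
  show ?case by (simp only: sum.empty L_zero)
next
  case (insert i I)
  have "f i + (\<Sum>i\<in>I. f i) \<in> L" using insert by (intro L_add) auto
  then show ?case using insert.hyps by (simp only: sum.insert not_False_eq_True)
qed

lemma root_L: "\<gamma> \<in> R \<Longrightarrow> \<gamma> \<in> L"
  using base unfolding root_base_def L_def zl_def by blast

lemma base_L: "\<beta> \<in> \<Pi> \<Longrightarrow> \<beta> \<in> L"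
  by (simp add: root_L base_root)

lemma L_dual: "\<mu> \<in> L \<Longrightarrow> \<mu> \<in> dual_space H"
  by (elim L_cases) (simp add: zl_def sum_dual scale_dual root_dual base_root)

lemma ht_add: "\<alpha> \<in> \<Pi> \<Longrightarrow> \<mu> \<in> L \<Longrightarrow> \<nu> \<in> L \<Longrightarrow> ht \<alpha> (\<mu> + \<nu>) = ht \<alpha> \<mu> + ht \<alpha> \<nu>"
  by (elim L_cases) (simp only: zl_add ht_zl)

lemma ht_uminus: "\<alpha> \<in> \<Pi> \<Longrightarrow> \<mu> \<in> L \<Longrightarrow> ht \<alpha> (- \<mu>) = - ht \<alpha> \<mu>"
  by (elim L_cases) (simp only: zl_uminus ht_zl)

lemma ht_zero: "\<alpha> \<in> \<Pi> \<Longrightarrow> ht \<alpha> 0 = 0"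
  using ht_zl[of \<alpha> "\<lambda>_. 0"] by (simp only: zl_zero)

lemma ht_diff: "\<alpha> \<in> \<Pi> \<Longrightarrow> \<mu> \<in> L \<Longrightarrow> \<nu> \<in> L \<Longrightarrow> ht \<alpha> (\<mu> - \<nu>) = ht \<alpha> \<mu> - ht \<alpha> \<nu>"
  using ht_add[OF _ _ L_uminus] by (simp only: diff_conv_add_uminus ht_uminus)

lemma ht_sum: "\<alpha> \<in> \<Pi> \<Longrightarrow> (\<And>i. i \<in> I \<Longrightarrow> f i \<in> L) \<Longrightarrow> ht \<alpha> (\<Sum>i\<in>I. f i) = (\<Sum>i\<in>I. ht \<alpha> (f i))"
proof (induction I rule: infinite_finite_induct)
  case (infinite I)
  then show ?case by (simp only: sum.infinite ht_zero not_False_eq_True)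
next
  case empty
  then show ?case by (simp only: sum.empty ht_zero)
next
  case (insert i I)
  have "ht \<alpha> (f i + (\<Sum>i\<in>I. f i)) = ht \<alpha> (f i) + ht \<alpha> (\<Sum>i\<in>I. f i)"
    using insert by (intro ht_add L_sum) auto
  also have "ht \<alpha> (\<Sum>i\<in>I. f i) = (\<Sum>i\<in>I. ht \<alpha> (f i))" using insert by auto
  finally show ?case using insert.hyps by (simp only: sum.insert not_False_eq_True)
qed

lemma L_expand:
  assumes "\<mu> \<in> L" shows "\<mu> = (\<Sum>\<beta>\<in>\<Pi>. fun_scale (of_int (ht \<beta> \<mu>)) \<beta>)"
proof -
  obtain n where n: "\<mu> = zl n" using assms by (rule L_cases)
  have "zl n = (\<Sum>\<beta>\<in>\<Pi>. fun_scale (of_int (ht \<beta> (zl n))) \<beta>)"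
    unfolding zl_def[of n] by (intro sum.cong refl) (simp only: zl_def[symmetric] ht_zl)
  then show ?thesis by (simp only: n)
qed

lemma L_eqI: "\<mu> \<in> L \<Longrightarrow> \<nu> \<in> L \<Longrightarrow> (\<And>\<beta>. \<beta> \<in> \<Pi> \<Longrightarrow> ht \<beta> \<mu> = ht \<beta> \<nu>) \<Longrightarrow> \<mu> = \<nu>"
  using L_expand[of \<mu>] L_expand[of \<nu>] by (simp cong: sum.cong)

lemma ht_int_scale: "\<alpha> \<in> \<Pi> \<Longrightarrow> \<mu> \<in> L \<Longrightarrow> ht \<alpha> (fun_scale (of_int k) \<mu>) = k * ht \<alpha> \<mu>"
  and L_int_scale: "\<mu> \<in> L \<Longrightarrow> fun_scale (of_int k) \<mu> \<in> L"
proof -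
  have eq: "fun_scale (of_int k) (zl n) = zl (\<lambda>\<beta>. k * n \<beta>)" for n
    by (simp add: zl_def functional.scale_sum_right functional.scale_scale)
  show "\<alpha> \<in> \<Pi> \<Longrightarrow> \<mu> \<in> L \<Longrightarrow> ht \<alpha> (fun_scale (of_int k) \<mu>) = k * ht \<alpha> \<mu>"
    by (elim L_cases) (simp only: eq ht_zl)
  show "\<mu> \<in> L \<Longrightarrow> fun_scale (of_int k) \<mu> \<in> L"
    by (elim L_cases) (simp only: eq zl_L)
qed

lemma ht_base: "\<alpha> \<in> \<Pi> \<Longrightarrow> \<beta> \<in> \<Pi> \<Longrightarrow> ht \<alpha> \<beta> = (if \<beta> = \<alpha> then 1 else 0)"
proof -
  assume \<alpha>: "\<alpha> \<in> \<Pi>" and \<beta>: "\<beta> \<in> \<Pi>"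
  have "zl (\<lambda>\<kappa>. if \<kappa> = \<beta> then 1 else 0) = (\<Sum>\<kappa>\<in>\<Pi>. if \<kappa> = \<beta> then \<beta> else 0)"
    unfolding zl_def by (intro sum.cong refl) auto
  then have "zl (\<lambda>\<kappa>. if \<kappa> = \<beta> then 1 else 0) = \<beta>" using finite_base \<beta> by simp
  then show ?thesis using ht_zl[OF \<alpha>, of "\<lambda>\<kappa>. if \<kappa> = \<beta> then 1 else 0"] by auto
qed

definition Pos :: "('g \<Rightarrow> 'k) set" where
  "Pos = {\<gamma> \<in> R. \<forall>\<beta>\<in>\<Pi>. 0 \<le> ht \<beta> \<gamma>}"

lemma Pos_root: "\<gamma> \<in> Pos \<Longrightarrow> \<gamma> \<in> R"
  and Pos_ht: "\<gamma> \<in> Pos \<Longrightarrow> \<beta> \<in> \<Pi> \<Longrightarrow> 0 \<le> ht \<beta> \<gamma>"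
  by (simp_all add: Pos_def)

lemma finite_Pos: "finite Pos"
  by (rule finite_subset[OF _ finite_roots]) (auto simp: Pos_def)

lemma root_sign: "\<gamma> \<in> R \<Longrightarrow> \<gamma> \<in> Pos \<or> - \<gamma> \<in> Pos"
proof -
  assume \<gamma>: "\<gamma> \<in> R"
  then obtain n where n: "(\<forall>\<beta>\<in>\<Pi>. 0 \<le> n \<beta>) \<or> (\<forall>\<beta>\<in>\<Pi>. n \<beta> \<le> 0)" "\<gamma> = zl n"
    using base unfolding root_base_def zl_def by blast
  have "ht \<beta> \<gamma> = n \<beta>" if "\<beta> \<in> \<Pi>" for \<beta> using ht_zl[OF that] n(2) by simp
  then show ?thesis
    using n(1) \<gamma> uminus_root[OF \<gamma>] ht_uminus[OF _ root_L[OF \<gamma>]] by (auto simp: Pos_def)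
qed

lemma PosI: "\<gamma> \<in> R \<Longrightarrow> \<beta> \<in> \<Pi> \<Longrightarrow> ht \<beta> \<gamma> > 0 \<Longrightarrow> \<gamma> \<in> Pos"
  using root_sign[of \<gamma>] ht_uminus[OF _ root_L, of \<beta> \<gamma>] by (fastforce simp: Pos_def)

lemma base_Pos: "\<beta> \<in> \<Pi> \<Longrightarrow> \<beta> \<in> Pos"
  using PosI[OF base_root, of \<beta> \<beta>] ht_base[of \<beta> \<beta>] by simp

definition hgt :: "('g \<Rightarrow> 'k) \<Rightarrow> int" where
  "hgt \<mu> = (\<Sum>\<beta>\<in>\<Pi>. ht \<beta> \<mu>)"

lemma hgt_add: "\<mu> \<in> L \<Longrightarrow> \<nu> \<in> L \<Longrightarrow> hgt (\<mu> + \<nu>) = hgt \<mu> + hgt \<nu>"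
  and hgt_diff: "\<mu> \<in> L \<Longrightarrow> \<nu> \<in> L \<Longrightarrow> hgt (\<mu> - \<nu>) = hgt \<mu> - hgt \<nu>"
  and hgt_uminus: "\<mu> \<in> L \<Longrightarrow> hgt (- \<mu>) = - hgt \<mu>"
  by (simp_all add: hgt_def ht_add ht_diff ht_uminus sum.distrib sum_subtractf sum_negf)

lemma hgt_base: "\<beta> \<in> \<Pi> \<Longrightarrow> hgt \<beta> = 1"
  using finite_base by (simp add: hgt_def ht_base)

lemma hgt_int_scale: "\<mu> \<in> L \<Longrightarrow> hgt (fun_scale (of_int k) \<mu>) = k * hgt \<mu>"
  by (simp add: hgt_def ht_int_scale sum_distrib_left)

lemma hgt_sum: "(\<And>i. i \<in> I \<Longrightarrow> f i \<in> L) \<Longrightarrow> hgt (\<Sum>i\<in>I. f i) = (\<Sum>i\<in>I. hgt (f i))"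
  unfolding hgt_def by (simp add: ht_sum cong: sum.cong) (rule sum.swap)

lemma Pos_ht_pos: "\<gamma> \<in> Pos \<Longrightarrow> \<exists>\<beta>\<in>\<Pi>. ht \<beta> \<gamma> > 0"
proof (rule ccontr)
  assume \<gamma>: "\<gamma> \<in> Pos" and "\<not> (\<exists>\<beta>\<in>\<Pi>. ht \<beta> \<gamma> > 0)"
  then have "ht \<beta> \<gamma> = ht \<beta> 0" if "\<beta> \<in> \<Pi>" for \<beta>
    using that Pos_ht[OF \<gamma> that] ht_zero[OF that] by fastforce
  then have "\<gamma> = 0" by (rule L_eqI[OF root_L[OF Pos_root[OF \<gamma>]] L_zero])
  then show False using Pos_root[OF \<gamma>] zero_not_root by simp
qed

lemma hgt_Pos: "\<gamma> \<in> Pos \<Longrightarrow> hgt \<gamma> > 0"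
proof -
  assume \<gamma>: "\<gamma> \<in> Pos"
  then obtain \<beta> where \<beta>: "\<beta> \<in> \<Pi>" "ht \<beta> \<gamma> > 0" using Pos_ht_pos by blast
  have "ht \<beta> \<gamma> \<le> hgt \<gamma>"
    unfolding hgt_def using \<beta>(1) finite_base Pos_ht[OF \<gamma>] by (intro member_le_sum) auto
  then show ?thesis using \<beta>(2) by simp
qed

lemma Pos_uminus: "\<gamma> \<in> Pos \<Longrightarrow> - \<gamma> \<notin> Pos"
  using hgt_Pos[of \<gamma>] hgt_Pos[of "- \<gamma>"] hgt_uminus[OF root_L[OF Pos_root], of \<gamma>] by fastforce


subsection \<open>The rational form on the root lattice\<close>

lemma ip_sum_right: "\<kappa> \<in> dual_space H \<Longrightarrow> (\<And>i. i \<in> I \<Longrightarrow> f i \<in> dual_space H) \<Longrightarrow>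
    ip \<kappa> (\<Sum>i\<in>I. f i) = (\<Sum>i\<in>I. ip \<kappa> (f i))"
  by (simp add: ip_sym[of \<kappa>] sum_dual ip_sum)

lemma ip_expand: "\<mu> \<in> L \<Longrightarrow> ip \<mu> \<nu> = (\<Sum>\<beta>\<in>\<Pi>. of_int (ht \<beta> \<mu>) * ip \<beta> \<nu>)"
  by (subst L_expand) (simp_all add: ip_sum ip_scale)

lemma ip_L_rat:
  assumes "\<mu> \<in> L" "\<nu> \<in> L" shows "ip \<mu> \<nu> \<in> \<rat>"
proof -
  have 1: "ip \<mu> \<beta> \<in> \<rat>" if "\<beta> \<in> \<Pi>" "\<mu> \<in> L" for \<mu> \<beta>
    unfolding ip_expand[OF that(2)] using that(1)
    by (intro Rats_sum Rats_mult Rats_of_int ip_rat base_root)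
  show ?thesis
    unfolding ip_expand[OF assms(1)] using assms
    by (intro Rats_sum Rats_mult Rats_of_int) (metis 1 L_dual base_L ip_sym)
qed

text \<open>The field is not ordered; inequalities are stated for the form with values in the rational numbers.\<close>

definition rf :: "('g \<Rightarrow> 'k) \<Rightarrow> ('g \<Rightarrow> 'k) \<Rightarrow> rat" where
  "rf \<mu> \<nu> = (THE r. ip \<mu> \<nu> = of_rat r)"

lemma rf_eqI: "ip \<mu> \<nu> = of_rat r \<Longrightarrow> rf \<mu> \<nu> = r"
  by (auto simp: rf_def)

lemma of_rat_rf: "\<mu> \<in> L \<Longrightarrow> \<nu> \<in> L \<Longrightarrow> of_rat (rf \<mu> \<nu>) = ip \<mu> \<nu>"
  using ip_L_rat[of \<mu> \<nu>] rf_eqI[of \<mu> \<nu>] by (metis Rats_cases)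

lemma rf_sym: "\<mu> \<in> L \<Longrightarrow> \<nu> \<in> L \<Longrightarrow> rf \<mu> \<nu> = rf \<nu> \<mu>"
  by (rule rf_eqI) (simp add: of_rat_rf ip_sym L_dual)

lemma rf_add: "\<mu> \<in> L \<Longrightarrow> \<nu> \<in> L \<Longrightarrow> \<kappa> \<in> L \<Longrightarrow> rf (\<mu> + \<nu>) \<kappa> = rf \<mu> \<kappa> + rf \<nu> \<kappa>"
  and rf_diff: "\<mu> \<in> L \<Longrightarrow> \<nu> \<in> L \<Longrightarrow> \<kappa> \<in> L \<Longrightarrow> rf (\<mu> - \<nu>) \<kappa> = rf \<mu> \<kappa> - rf \<nu> \<kappa>"
  by (rule rf_eqI, simp add: of_rat_add of_rat_diff of_rat_rf ip_add ip_diff)+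

lemma rf_add_right: "\<mu> \<in> L \<Longrightarrow> \<nu> \<in> L \<Longrightarrow> \<kappa> \<in> L \<Longrightarrow> rf \<kappa> (\<mu> + \<nu>) = rf \<kappa> \<mu> + rf \<kappa> \<nu>"
  and rf_diff_right: "\<mu> \<in> L \<Longrightarrow> \<nu> \<in> L \<Longrightarrow> \<kappa> \<in> L \<Longrightarrow> rf \<kappa> (\<mu> - \<nu>) = rf \<kappa> \<mu> - rf \<kappa> \<nu>"
  by (simp_all add: rf_sym[of \<kappa>] rf_add rf_diff L_add L_diff)

lemma rf_int_scale: "\<mu> \<in> L \<Longrightarrow> \<kappa> \<in> L \<Longrightarrow> rf (fun_scale (of_int k) \<mu>) \<kappa> = of_int k * rf \<mu> \<kappa>"
  by (rule rf_eqI) (simp add: of_rat_mult of_rat_rf ip_scale)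

lemma rf_int_scale_right: "\<mu> \<in> L \<Longrightarrow> \<kappa> \<in> L \<Longrightarrow> rf \<kappa> (fun_scale (of_int k) \<mu>) = of_int k * rf \<kappa> \<mu>"
  by (simp add: rf_sym[of \<kappa>] rf_int_scale L_int_scale)

lemma rf_sum:
  assumes "\<And>i. i \<in> I \<Longrightarrow> f i \<in> L" "\<kappa> \<in> L" shows "rf (\<Sum>i\<in>I. f i) \<kappa> = (\<Sum>i\<in>I. rf (f i) \<kappa>)"
proof (rule rf_eqI)
  have "of_rat (\<Sum>i\<in>I. rf (f i) \<kappa>) = (\<Sum>i\<in>I. of_rat (rf (f i) \<kappa>) :: 'k)"
    by (rule of_rat_sum)
  also have "\<dots> = (\<Sum>i\<in>I. ip (f i) \<kappa>)"
    by (intro sum.cong refl of_rat_rf assms)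
  finally show "ip (\<Sum>i\<in>I. f i) \<kappa> = of_rat (\<Sum>i\<in>I. rf (f i) \<kappa>)" by (simp add: ip_sum)
qed

lemma rf_sum_right:
  assumes "\<And>i. i \<in> I \<Longrightarrow> f i \<in> L" "\<kappa> \<in> L" shows "rf \<kappa> (\<Sum>i\<in>I. f i) = (\<Sum>i\<in>I. rf \<kappa> (f i))"
  using rf_sum[OF assms] assms by (simp add: rf_sym[of \<kappa>] L_sum cong: sum.cong)

lemma rf_expand: "\<mu> \<in> L \<Longrightarrow> \<nu> \<in> L \<Longrightarrow> rf \<nu> \<mu> = (\<Sum>\<beta>\<in>\<Pi>. of_int (ht \<beta> \<mu>) * rf \<nu> \<beta>)"
  by (subst L_expand[of \<mu>]) (simp_all add: rf_sum_right rf_int_scale_right L_int_scale base_L)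

lemma rf_self_pos: "\<gamma> \<in> R \<Longrightarrow> rf \<gamma> \<gamma> > 0"
  using ip_self_rat[of \<gamma>] rf_eqI by metis

lemma rf_nonneg_Pos:
  assumes "\<nu> \<in> L" "\<And>\<beta>. \<beta> \<in> \<Pi> \<Longrightarrow> rf \<nu> \<beta> \<ge> 0" "\<gamma> \<in> Pos" shows "rf \<nu> \<gamma> \<ge> 0"
  using assms Pos_ht[OF assms(3)]
  by (simp add: rf_expand[OF root_L[OF Pos_root]] sum_nonneg)

lemma cartan_integer_L:
  assumes \<beta>: "\<beta> \<in> R" and \<mu>: "\<mu> \<in> L"
  shows "\<exists>n::int. 2 * rf \<mu> \<beta> = of_int n * rf \<beta> \<beta>"
proof -
  have 1: "\<exists>n::int. 2 * rf \<kappa> \<beta> = of_int n * rf \<beta> \<beta>" if \<kappa>: "\<kappa> \<in> \<Pi>" for \<kappa>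
  proof -
    obtain n :: int where n: "2 * ip \<kappa> \<beta> = of_int n * ip \<beta> \<beta>"
      using cartan_integer[OF \<beta> base_root[OF \<kappa>]] by blast
    have "of_rat (2 * rf \<kappa> \<beta>) = (of_rat (of_int n * rf \<beta> \<beta>) :: 'k)"
      by (simp add: of_rat_mult of_rat_rf base_L[OF \<kappa>] root_L[OF \<beta>] n)
    then show ?thesis by (simp only: of_rat_eq_iff) blast
  qed
  then obtain n where n: "\<And>\<kappa>. \<kappa> \<in> \<Pi> \<Longrightarrow> 2 * rf \<kappa> \<beta> = of_int (n \<kappa>) * rf \<beta> \<beta>" by metis
  have "2 * rf \<mu> \<beta> = (\<Sum>\<kappa>\<in>\<Pi>. of_int (ht \<kappa> \<mu>) * (2 * rf \<kappa> \<beta>))"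
  proof -
    have "rf \<mu> \<beta> = (\<Sum>\<kappa>\<in>\<Pi>. of_int (ht \<kappa> \<mu>) * rf \<beta> \<kappa>)"
      using rf_sym[OF \<mu> root_L[OF \<beta>]] rf_expand[OF \<mu> root_L[OF \<beta>]] by (rule trans)
    also have "\<dots> = (\<Sum>\<kappa>\<in>\<Pi>. of_int (ht \<kappa> \<mu>) * rf \<kappa> \<beta>)"
      by (intro sum.cong refl arg_cong2[where f = "(*)"] rf_sym[OF root_L[OF \<beta>] base_L])
    finally show ?thesis by (simp add: sum_distrib_left algebra_simps)
  qed
  also have "\<dots> = of_int (\<Sum>\<kappa>\<in>\<Pi>. ht \<kappa> \<mu> * n \<kappa>) * rf \<beta> \<beta>"
    by (simp add: n sum_distrib_right mult.assoc cong: sum.cong)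
  finally show ?thesis by blast
qed


subsection \<open>Simple reflections\<close>

text \<open>The Cartan integer \<open>2 (\<mu>, \<beta>) / (\<beta>, \<beta>)\<close>.\<close>

definition cint :: "('g \<Rightarrow> 'k) \<Rightarrow> ('g \<Rightarrow> 'k) \<Rightarrow> int" where
  "cint \<mu> \<beta> = (THE n. 2 * rf \<mu> \<beta> = of_int n * rf \<beta> \<beta>)"

definition refl :: "('g \<Rightarrow> 'k) \<Rightarrow> ('g \<Rightarrow> 'k) \<Rightarrow> ('g \<Rightarrow> 'k)" where
  "refl \<beta> \<mu> = \<mu> - fun_scale (of_int (cint \<mu> \<beta>)) \<beta>"

lemma cint_eqI: "\<beta> \<in> R \<Longrightarrow> 2 * rf \<mu> \<beta> = of_int n * rf \<beta> \<beta> \<Longrightarrow> cint \<mu> \<beta> = n"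
  using rf_self_pos[of \<beta>] by (auto simp: cint_def)

lemma cint: "\<beta> \<in> R \<Longrightarrow> \<mu> \<in> L \<Longrightarrow> 2 * rf \<mu> \<beta> = of_int (cint \<mu> \<beta>) * rf \<beta> \<beta>"
  using cartan_integer_L[of \<beta> \<mu>] cint_eqI[of \<beta> \<mu>] by metis

lemma cint_add: "\<beta> \<in> R \<Longrightarrow> \<mu> \<in> L \<Longrightarrow> \<nu> \<in> L \<Longrightarrow> cint (\<mu> + \<nu>) \<beta> = cint \<mu> \<beta> + cint \<nu> \<beta>"
  using cint[of \<beta> \<mu>] cint[of \<beta> \<nu>] by (intro cint_eqI) (simp_all add: rf_add root_L distrib_right)

lemma cint_diff: "\<beta> \<in> R \<Longrightarrow> \<mu> \<in> L \<Longrightarrow> \<nu> \<in> L \<Longrightarrow> cint (\<mu> - \<nu>) \<beta> = cint \<mu> \<beta> - cint \<nu> \<beta>"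
  using cint[of \<beta> \<mu>] cint[of \<beta> \<nu>]
  by (intro cint_eqI) (simp_all add: rf_diff root_L left_diff_distrib right_diff_distrib)

lemma cint_int_scale: "\<beta> \<in> R \<Longrightarrow> \<mu> \<in> L \<Longrightarrow> cint (fun_scale (of_int k) \<mu>) \<beta> = k * cint \<mu> \<beta>"
  using cint[of \<beta> \<mu>] by (intro cint_eqI) (simp_all add: rf_int_scale root_L)

lemma cint_self: "\<beta> \<in> R \<Longrightarrow> cint \<beta> \<beta> = 2"
  by (rule cint_eqI) simp_all

lemma refl_add: "\<beta> \<in> R \<Longrightarrow> \<mu> \<in> L \<Longrightarrow> \<nu> \<in> L \<Longrightarrow> refl \<beta> (\<mu> + \<nu>) = refl \<beta> \<mu> + refl \<beta> \<nu>"
  by (simp add: refl_def cint_add functional.scale_left_distrib algebra_simps)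

lemma refl_diff: "\<beta> \<in> R \<Longrightarrow> \<mu> \<in> L \<Longrightarrow> \<nu> \<in> L \<Longrightarrow> refl \<beta> (\<mu> - \<nu>) = refl \<beta> \<mu> - refl \<beta> \<nu>"
  by (simp add: refl_def cint_diff functional.scale_left_diff_distrib algebra_simps)

lemma refl_zero: "\<beta> \<in> R \<Longrightarrow> refl \<beta> 0 = 0"
  using refl_diff[OF _ L_zero L_zero, of \<beta>] by (simp only: diff_self)

lemma refl_sum:
  assumes \<beta>: "\<beta> \<in> R" and "finite I" "\<And>i. i \<in> I \<Longrightarrow> f i \<in> L"
  shows "refl \<beta> (\<Sum>i\<in>I. f i) = (\<Sum>i\<in>I. refl \<beta> (f i))"
  using assms(2,3)
proof (induction I rule: finite_induct)
  case empty
  show ?case by (simp only: sum.empty refl_zero[OF \<beta>])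
next
  case (insert i I)
  have "refl \<beta> (f i + (\<Sum>i\<in>I. f i)) = refl \<beta> (f i) + refl \<beta> (\<Sum>i\<in>I. f i)"
    using insert.prems by (intro refl_add[OF \<beta>] L_sum) auto
  also have "refl \<beta> (\<Sum>i\<in>I. f i) = (\<Sum>i\<in>I. refl \<beta> (f i))" using insert by auto
  finally show ?case using insert.hyps by (simp only: sum.insert not_False_eq_True)
qed

lemma refl_self: "\<beta> \<in> R \<Longrightarrow> refl \<beta> \<beta> = - \<beta>"
  by (simp add: refl_def cint_self fun_eq_iff fun_scale_def)

lemma refl_refl: "\<beta> \<in> R \<Longrightarrow> \<mu> \<in> L \<Longrightarrow> refl \<beta> (refl \<beta> \<mu>) = \<mu>"
proof -
  assume \<beta>: "\<beta> \<in> R" and \<mu>: "\<mu> \<in> L"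
  have "cint (refl \<beta> \<mu>) \<beta> = - cint \<mu> \<beta>"
    unfolding refl_def
    by (simp add: cint_diff \<beta> \<mu> root_L L_int_scale cint_int_scale cint_self)
  then show ?thesis by (simp add: refl_def[of \<beta> "refl \<beta> \<mu>"]) (simp add: refl_def)
qed

lemma rf_refl:
  assumes \<beta>: "\<beta> \<in> R" and \<mu>: "\<mu> \<in> L" and \<nu>: "\<nu> \<in> L"
  shows "rf (refl \<beta> \<mu>) (refl \<beta> \<nu>) = rf \<mu> \<nu>"
proof -
  note \<beta>L = root_L[OF \<beta>]
  let ?n = "of_int (cint \<mu> \<beta>) :: rat" and ?m = "of_int (cint \<nu> \<beta>) :: rat" and ?b = "rf \<beta> \<beta>"
  have n: "rf \<mu> \<beta> = ?n * ?b / 2" and m: "rf \<beta> \<nu> = ?m * ?b / 2"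
    using cint[OF \<beta> \<mu>] cint[OF \<beta> \<nu>] rf_sym[OF \<beta>L \<nu>] by simp_all
  have "rf (refl \<beta> \<mu>) (refl \<beta> \<nu>) = rf \<mu> \<nu> - ?n * rf \<beta> \<nu> - ?m * (rf \<mu> \<beta> - ?n * ?b)"
    by (simp add: refl_def rf_diff rf_diff_right rf_int_scale rf_int_scale_right L_int_scale L_diff \<mu> \<nu> \<beta>L)
  then show ?thesis by (simp add: n m algebra_simps)
qed

lemma refl_root: "\<beta> \<in> R \<Longrightarrow> \<gamma> \<in> R \<Longrightarrow> refl \<beta> \<gamma> \<in> R"
proof -
  assume \<beta>: "\<beta> \<in> R" and \<gamma>: "\<gamma> \<in> R"
  obtain n :: int where n: "2 * ip \<gamma> \<beta> = of_int n * ip \<beta> \<beta>" "\<gamma> - fun_scale (of_int n) \<beta> \<in> R"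
    using reflection_root[OF \<beta> \<gamma>] by metis
  have "of_rat (2 * rf \<gamma> \<beta>) = (of_rat (of_int n * rf \<beta> \<beta>) :: 'k)"
    by (simp add: of_rat_mult of_rat_rf root_L \<beta> \<gamma> n(1))
  then have "cint \<gamma> \<beta> = n" by (intro cint_eqI[OF \<beta>]) (simp only: of_rat_eq_iff)
  then show ?thesis using n(2) by (simp add: refl_def)
qed

text \<open>A positive root other than \<open>\<beta>\<close> has a positive coefficient at some other simple root, which the reflection
  does not change.\<close>

lemma refl_Pos:
  assumes \<beta>: "\<beta> \<in> \<Pi>" and \<gamma>: "\<gamma> \<in> Pos" "\<gamma> \<noteq> \<beta>"
  shows "refl \<beta> \<gamma> \<in> Pos - {\<beta>}"
proof -
  note \<beta>R = base_root[OF \<beta>] and \<gamma>R = Pos_root[OF \<gamma>(1)]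
  have "\<exists>\<beta>'\<in>\<Pi>. \<beta>' \<noteq> \<beta> \<and> ht \<beta>' \<gamma> > 0"
  proof (rule ccontr)
    assume "\<not> ?thesis"
    then have 0: "ht \<beta>' \<gamma> = 0" if "\<beta>' \<in> \<Pi>" "\<beta>' \<noteq> \<beta>" for \<beta>'
      using Pos_ht[OF \<gamma>(1) that(1)] that by force
    have "\<gamma> = (\<Sum>\<kappa>\<in>\<Pi>. fun_scale (of_int (ht \<kappa> \<gamma>)) \<kappa>)" by (rule L_expand[OF root_L[OF \<gamma>R]])
    also have "\<dots> = (\<Sum>\<kappa>\<in>\<Pi>. if \<kappa> = \<beta> then fun_scale (of_int (ht \<beta> \<gamma>)) \<beta> else 0)"
      by (intro sum.cong refl) (auto simp: 0)
    also have "\<dots> = fun_scale (of_int (ht \<beta> \<gamma>)) \<beta>" using finite_base \<beta> by simp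
    also have "of_int (ht \<beta> \<gamma>) = (of_nat (nat (ht \<beta> \<gamma>)) :: 'k)"
      using Pos_ht[OF \<gamma>(1) \<beta>] by simp
    finally have eq: "\<gamma> = fun_scale (of_nat (nat (ht \<beta> \<gamma>))) \<beta>" .
    obtain \<beta>' where "\<beta>' \<in> \<Pi>" "ht \<beta>' \<gamma> > 0" using Pos_ht_pos[OF \<gamma>(1)] by blast
    then have "ht \<beta> \<gamma> > 0" using 0[of \<beta>'] by (cases "\<beta>' = \<beta>") auto
    then have "nat (ht \<beta> \<gamma>) \<ge> 1" by simp
    then have "nat (ht \<beta> \<gamma>) = 1" by (rule root_multiples(2)[OF \<beta>R]) (simp only: eq[symmetric] \<gamma>R)
    then have "\<gamma> = \<beta>" using eq by (simp add: fun_scale_def)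
    then show False using \<gamma>(2) by simp
  qed
  then obtain \<beta>' where \<beta>': "\<beta>' \<in> \<Pi>" "\<beta>' \<noteq> \<beta>" "ht \<beta>' \<gamma> > 0" by blast
  have "ht \<beta>' (refl \<beta> \<gamma>) = ht \<beta>' \<gamma>"
    using \<beta>' \<beta> by (simp add: refl_def ht_diff ht_int_scale root_L \<gamma>R L_int_scale \<beta>R ht_base)
  then have "refl \<beta> \<gamma> \<in> Pos"
    using PosI[OF refl_root[OF \<beta>R \<gamma>R] \<beta>'(1)] \<beta>'(3) by simp
  moreover have "refl \<beta> \<gamma> \<noteq> \<beta>"
  proof
    assume "refl \<beta> \<gamma> = \<beta>"
    then have "\<gamma> = - \<beta>" using refl_refl[OF \<beta>R root_L[OF \<gamma>R]] refl_self[OF \<beta>R] by simp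
    then show False using Pos_uminus[OF base_Pos[OF \<beta>]] \<gamma>(1) by simp
  qed
  ultimately show ?thesis by simp
qed

lemma sum_L: "A \<subseteq> R \<Longrightarrow> \<Sum>A \<in> L"
  by (rule L_sum) (auto intro: root_L)

lemma inj_on_refl: "\<beta> \<in> R \<Longrightarrow> A \<subseteq> R \<Longrightarrow> inj_on (refl \<beta>) A"
  by (rule inj_on_inverseI[of _ "refl \<beta>"]) (auto simp: refl_refl root_L)

lemma refl_sum_image:
  assumes "\<beta> \<in> R" "A \<subseteq> R" shows "refl \<beta> (\<Sum>A) = \<Sum>(refl \<beta> ` A)"
proof -
  have "finite A" using assms(2) finite_roots by (rule finite_subset)
  then have "refl \<beta> (\<Sum>A) = (\<Sum>\<gamma>\<in>A. refl \<beta> \<gamma>)"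
    using assms by (intro refl_sum) (auto intro: root_L)
  also have "\<dots> = \<Sum>(refl \<beta> ` A)" by (simp add: sum.reindex[OF inj_on_refl[OF assms]])
  finally show ?thesis .
qed


subsection \<open>Half sums of positive roots\<close>

definition rho2 :: "'g \<Rightarrow> 'k" where "rho2 = \<Sum>Pos"

lemma Pos_sub: "Pos \<subseteq> R" by (auto simp: Pos_def)

lemma rho2_L: "rho2 \<in> L"
  unfolding rho2_def by (rule sum_L[OF Pos_sub])

lemma refl_rho2: "\<beta> \<in> \<Pi> \<Longrightarrow> refl \<beta> rho2 = rho2 - \<beta> - \<beta>"
proof -
  assume \<beta>: "\<beta> \<in> \<Pi>"
  note \<beta>R = base_root[OF \<beta>]
  have sub: "Pos - {\<beta>} \<subseteq> R" using Pos_sub by blast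
  have into: "refl \<beta> ` (Pos - {\<beta>}) \<subseteq> Pos - {\<beta>}"
    by (intro image_subsetI refl_Pos[OF \<beta>]) auto
  have fin: "finite (Pos - {\<beta>})" using finite_Pos by simp
  have "refl \<beta> ` (Pos - {\<beta>}) = Pos - {\<beta>}"
    using endo_inj_surj[OF fin into inj_on_refl[OF \<beta>R sub]] .
  then have "refl \<beta> (\<Sum>(Pos - {\<beta>})) = \<Sum>(Pos - {\<beta>})"
    by (simp add: refl_sum_image[OF \<beta>R sub])
  moreover have rho: "rho2 = \<Sum>(Pos - {\<beta>}) + \<beta>"
    unfolding rho2_def using sum.remove[OF finite_Pos base_Pos[OF \<beta>], of "\<lambda>x. x"] by (simp add: add.commute)
  ultimately show ?thesis
    using refl_add[OF \<beta>R sum_L[OF sub] base_L[OF \<beta>]] refl_self[OF \<beta>R] by simp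
qed

lemma rf_rho2_base: "\<beta> \<in> \<Pi> \<Longrightarrow> rf rho2 \<beta> = rf \<beta> \<beta>"
proof -
  assume \<beta>: "\<beta> \<in> \<Pi>"
  note \<beta>R = base_root[OF \<beta>]
  have "fun_scale (of_int (cint rho2 \<beta>)) \<beta> = \<beta> + \<beta>"
    using refl_rho2[OF \<beta>] by (simp add: refl_def algebra_simps)
  also have "\<beta> + \<beta> = fun_scale (of_int 2) \<beta>" by (simp add: fun_eq_iff fun_scale_def)
  finally have "of_int (cint rho2 \<beta>) = (of_int 2 :: 'k)" by (rule root_multiple_ne[OF \<beta>R])
  then have "cint rho2 \<beta> = 2" by (simp only: of_int_eq_iff)
  then show ?thesis using cint[OF \<beta>R rho2_L] by simp
qed

text \<open>For the vector \<open>\<nu> = 2\<rho> - 2 \<Sum>A\<close>: if \<open>\<nu>\<close> is dominant, then \<open>(\<nu>, \<nu>) \<le> (\<nu>, 2\<rho>) \<le> (2\<rho>, 2\<rho>)\<close>;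
  otherwise a simple reflection turns \<open>A\<close> into a set of positive roots with a smaller sum, and
  preserves the norm of \<open>\<nu>\<close>.\<close>

lemma norm_half_system:
  assumes "A \<subseteq> Pos"
  shows "rf (rho2 - \<Sum>A - \<Sum>A) (rho2 - \<Sum>A - \<Sum>A) \<le> rf rho2 rho2"
  using assms
proof (induction "nat (hgt (\<Sum>A))" arbitrary: A rule: less_induct)
  case less
  have AR: "A \<subseteq> R" using less.prems Pos_sub by blast
  note AL = sum_L[OF AR]
  have finA: "finite A" using less.prems finite_Pos by (rule finite_subset)
  let ?\<nu> = "rho2 - \<Sum>A - \<Sum>A"
  have \<nu>L: "?\<nu> \<in> L" by (intro L_diff rho2_L AL)
  show ?case
  proof (cases "\<forall>\<beta>\<in>\<Pi>. rf ?\<nu> \<beta> \<ge> 0")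
    case True
    have nonneg: "rf \<mu> (\<Sum>A) \<ge> 0" if "\<mu> \<in> L" "\<And>\<beta>. \<beta> \<in> \<Pi> \<Longrightarrow> rf \<mu> \<beta> \<ge> 0" for \<mu>
    proof -
      have "rf \<mu> (\<Sum>A) = (\<Sum>\<gamma>\<in>A. rf \<mu> \<gamma>)"
        using AR that(1) by (intro rf_sum_right) (auto intro: root_L)
      then show ?thesis using rf_nonneg_Pos[OF that] less.prems by (simp add: sum_nonneg subset_iff)
    qed
    have "rf ?\<nu> (\<Sum>A) \<ge> 0" using True by (intro nonneg \<nu>L) blast
    moreover have "rf rho2 (\<Sum>A) \<ge> 0"
      using rf_self_pos[OF base_root] by (intro nonneg rho2_L) (simp add: rf_rho2_base less_imp_le)
    moreover have "rf ?\<nu> ?\<nu> = rf ?\<nu> rho2 - rf ?\<nu> (\<Sum>A) - rf ?\<nu> (\<Sum>A)"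
      by (simp only: rf_diff_right rho2_L AL L_diff)
    moreover have "rf ?\<nu> rho2 = rf rho2 rho2 - rf (\<Sum>A) rho2 - rf (\<Sum>A) rho2"
      by (simp only: rf_diff rho2_L AL L_diff)
    ultimately show ?thesis using rf_sym[OF AL rho2_L] by linarith
  next
    case False
    then obtain \<beta> where \<beta>: "\<beta> \<in> \<Pi>" "rf ?\<nu> \<beta> < 0" by force
    note \<beta>R = base_root[OF \<beta>(1)]
    let ?n = "cint ?\<nu> \<beta>"
    have "of_int ?n * rf \<beta> \<beta> < 0" using cint[OF \<beta>R \<nu>L] \<beta>(2) by simp
    then have n: "?n < 0" using rf_self_pos[OF \<beta>R] by (simp add: mult_less_0_iff)
    define B where "B = refl \<beta> ` (A - {\<beta>})"
    have BPos: "B \<subseteq> Pos - {\<beta>}" unfolding B_def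
      using less.prems by (intro image_subsetI refl_Pos[OF \<beta>(1)]) auto
    have sumB: "\<Sum>B = refl \<beta> (\<Sum>(A - {\<beta>}))"
      unfolding B_def using AR by (intro refl_sum_image[symmetric] \<beta>R) blast
    \<comment> \<open>the reflection permutes the positive roots other than \<open>\<beta>\<close> and changes the sign of \<open>\<beta>\<close>, and
      \<open>2 \<rho>\<close> loses \<open>2 \<beta>\<close>; the set whose sum absorbs this contains \<open>\<beta>\<close> if and only if \<open>A\<close> does not\<close>
    define A' where "A' = (if \<beta> \<in> A then B else insert \<beta> B)"
    have A'Pos: "A' \<subseteq> Pos" using BPos base_Pos[OF \<beta>(1)] by (auto simp: A'_def)
    have sumA': "\<Sum>A' = refl \<beta> (\<Sum>A) + \<beta>"
    proof (cases "\<beta> \<in> A")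
      case True
      have "\<Sum>A = \<beta> + \<Sum>(A - {\<beta>})" using sum.remove[OF finA True, of "\<lambda>x. x"] by simp
      moreover have "\<Sum>(A - {\<beta>}) \<in> L" using AR by (intro sum_L) blast
      ultimately have "refl \<beta> (\<Sum>A) = - \<beta> + \<Sum>B"
        using refl_add[OF \<beta>R base_L[OF \<beta>(1)]] refl_self[OF \<beta>R] sumB by simp
      then show ?thesis using True by (simp add: A'_def)
    next
      case False
      have "\<beta> \<notin> B" "finite B" using BPos finite_subset[OF _ finite_Pos, of B] by auto
      then have "\<Sum>(insert \<beta> B) = \<beta> + \<Sum>B" by simp
      then show ?thesis using False sumB by (simp add: A'_def add.commute)
    qed
    have refl_\<nu>: "refl \<beta> ?\<nu> = rho2 - \<Sum>A' - \<Sum>A'"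
    proof -
      have "refl \<beta> ?\<nu> = refl \<beta> rho2 - refl \<beta> (\<Sum>A) - refl \<beta> (\<Sum>A)"
        by (simp only: refl_diff \<beta>R rho2_L AL L_diff)
      moreover have "x - b - b - r - r = x - (r + b) - (r + b)" for x b r :: "'g \<Rightarrow> 'k"
        by (simp add: fun_eq_iff)
      ultimately show ?thesis by (simp only: refl_rho2[OF \<beta>(1)] sumA')
    qed
    have A'L: "\<Sum>A' \<in> L" using A'Pos Pos_sub by (intro sum_L) blast
    have "rho2 - \<Sum>A' - \<Sum>A' = ?\<nu> - fun_scale (of_int ?n) \<beta>"
      using refl_\<nu> by (simp only: refl_def)
    then have "\<Sum>A' + \<Sum>A' = \<Sum>A + \<Sum>A + fun_scale (of_int ?n) \<beta>"
      by (simp add: algebra_simps)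
    then have "hgt (\<Sum>A' + \<Sum>A') = hgt (\<Sum>A + \<Sum>A + fun_scale (of_int ?n) \<beta>)" by (simp only:)
    then have "hgt (\<Sum>A') + hgt (\<Sum>A') = hgt (\<Sum>A) + hgt (\<Sum>A) + ?n * 1"
      by (simp only: hgt_add A'L AL L_add L_int_scale base_L \<beta>(1) hgt_int_scale hgt_base)
    then have "hgt (\<Sum>A') < hgt (\<Sum>A)" using n by simp
    moreover have "hgt (\<Sum>A') \<ge> 0"
    proof -
      have "hgt (\<Sum>A') = (\<Sum>\<gamma>\<in>A'. hgt \<gamma>)"
        using A'Pos by (intro hgt_sum root_L[OF Pos_root]) blast
      also have "\<dots> \<ge> 0" using A'Pos hgt_Pos by (intro sum_nonneg less_imp_le) blast
      finally show ?thesis .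
    qed
    ultimately have "nat (hgt (\<Sum>A')) < nat (hgt (\<Sum>A))" by simp
    from less.hyps[OF this A'Pos] show ?thesis
      using rf_refl[OF \<beta>R \<nu>L \<nu>L] by (simp only: refl_\<nu>)
  qed
qed


subsection \<open>The highest root\<close>

text \<open>From \<open>(\<gamma>, \<gamma>) > 0\<close> some simple \<open>\<beta>\<close> with a positive coefficient in \<open>\<gamma>\<close> satisfies \<open>(\<gamma>, \<beta>) > 0\<close>.\<close>

lemma Pos_simple_difference:
  assumes \<gamma>: "\<gamma> \<in> Pos" "\<gamma> \<notin> \<Pi>"
  obtains \<beta> where "\<beta> \<in> \<Pi>" "\<gamma> - \<beta> \<in> Pos" "hgt (\<gamma> - \<beta>) < hgt \<gamma>"
proof -
  note \<gamma>R = Pos_root[OF \<gamma>(1)]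
  have "(\<Sum>\<beta>\<in>\<Pi>. of_int (ht \<beta> \<gamma>) * rf \<gamma> \<beta>) > 0"
    using rf_self_pos[OF \<gamma>R] rf_expand[OF root_L[OF \<gamma>R] root_L[OF \<gamma>R]] by simp
  then obtain \<beta> where \<beta>: "\<beta> \<in> \<Pi>" "of_int (ht \<beta> \<gamma>) * rf \<gamma> \<beta> > 0"
    by (meson not_le sum_nonpos)
  note \<beta>R = base_root[OF \<beta>(1)]
  have "rf \<gamma> \<beta> > 0" using \<beta>(2) Pos_ht[OF \<gamma>(1) \<beta>(1)] by (auto simp: zero_less_mult_iff)
  then have "of_int (cint \<gamma> \<beta>) * rf \<beta> \<beta> > 0" using cint[OF \<beta>R root_L[OF \<gamma>R]] by simp
  then have pos: "cint \<gamma> \<beta> > 0" using rf_self_pos[OF \<beta>R] by (auto simp: zero_less_mult_iff)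
  have "(of_rat (2 * rf \<gamma> \<beta>) :: 'k) = of_rat (of_int (cint \<gamma> \<beta>) * rf \<beta> \<beta>)"
    by (simp only: cint[OF \<beta>R root_L[OF \<gamma>R]])
  then have "2 * ip \<gamma> \<beta> = of_int (cint \<gamma> \<beta>) * ip \<beta> \<beta>"
    by (simp add: of_rat_mult of_rat_rf root_L \<gamma>R \<beta>R)
  from add_root_of_negative(2)[OF \<beta>R \<gamma>R this pos] have "\<gamma> - \<beta> \<in> W" .
  moreover have "\<gamma> \<noteq> \<beta>" using \<gamma>(2) \<beta>(1) by blast
  ultimately have diff: "\<gamma> - \<beta> \<in> R" by auto
  have h: "hgt (\<gamma> - \<beta>) = hgt \<gamma> - 1"
    by (simp add: hgt_diff root_L \<gamma>R base_L \<beta>(1) hgt_base)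
  have "- (\<gamma> - \<beta>) \<notin> Pos"
  proof
    assume "- (\<gamma> - \<beta>) \<in> Pos"
    from hgt_Pos[OF this] have "hgt (\<gamma> - \<beta>) < 0" using hgt_uminus[OF root_L[OF diff]] by linarith
    then show False using h hgt_Pos[OF \<gamma>(1)] by simp
  qed
  then have "\<gamma> - \<beta> \<in> Pos" using root_sign[OF diff] by blast
  then show ?thesis using that \<beta>(1) h by simp
qed

lemma Pos_induct [consumes 1, case_names base step]:
  assumes "\<gamma> \<in> Pos" and base: "\<And>\<beta>. \<beta> \<in> \<Pi> \<Longrightarrow> Q \<beta>"
    and step: "\<And>\<gamma> \<beta>. \<gamma> \<in> Pos \<Longrightarrow> \<beta> \<in> \<Pi> \<Longrightarrow> \<gamma> + \<beta> \<in> Pos \<Longrightarrow> Q \<gamma> \<Longrightarrow> Q (\<gamma> + \<beta>)"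
  shows "Q \<gamma>"
  using assms(1)
proof (induction "nat (hgt \<gamma>)" arbitrary: \<gamma> rule: less_induct)
  case less
  show ?case
  proof (cases "\<gamma> \<in> \<Pi>")
    case False
    then obtain \<beta> where \<beta>: "\<beta> \<in> \<Pi>" "\<gamma> - \<beta> \<in> Pos" "hgt (\<gamma> - \<beta>) < hgt \<gamma>"
      using Pos_simple_difference[OF less.prems] by blast
    have "nat (hgt (\<gamma> - \<beta>)) < nat (hgt \<gamma>)" using \<beta>(3) hgt_Pos[OF \<beta>(2)] by simp
    then have "Q (\<gamma> - \<beta>)" using less.hyps \<beta>(2) by blast
    with step[OF \<beta>(2,1)] less.prems show ?thesis by simp
  qed (rule base)
qed

text \<open>The vectors obtained from \<open>v\<close> by repeatedly applying lowering operators.\<close>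

inductive_set desc :: "'g \<Rightarrow> 'g set" for v where
  desc_base: "v \<in> desc v"
| desc_step: "w \<in> desc v \<Longrightarrow> \<beta> \<in> \<Pi> \<Longrightarrow> y \<in> rs (- \<beta>) \<Longrightarrow> bracket y w \<in> desc v"

lemma root_vectors_generate:
  assumes S: "subspace S" "\<And>x y. x \<in> S \<Longrightarrow> y \<in> S \<Longrightarrow> bracket x y \<in> S"
    and H: "H \<subseteq> S" and simple: "\<And>\<beta>. \<beta> \<in> \<Pi> \<Longrightarrow> rs \<beta> \<subseteq> S \<and> rs (- \<beta>) \<subseteq> S"
  shows "S = UNIV"
proof -
  have gen: "rs (\<gamma> + \<beta>) \<subseteq> S" if gb: "\<gamma> \<in> R" "\<beta> \<in> R" "\<gamma> + \<beta> \<in> R" "rs \<gamma> \<subseteq> S" "rs \<beta> \<subseteq> S" for \<gamma> \<beta>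
  proof
    fix w assume w: "w \<in> rs (\<gamma> + \<beta>)"
    obtain x where x: "x \<in> rs \<beta>" "x \<noteq> 0" using rs_nonzero[OF gb(2)] by blast
    obtain v where v: "v \<in> rs \<gamma>" "v \<noteq> 0" using rs_nonzero[OF gb(1)] by blast
    have "bracket x v \<noteq> 0" by (rule bracket_nonzero[OF gb(2,1,3) x v])
    moreover have "bracket x v \<in> rs (\<gamma> + \<beta>)"
      using rs_bracket[OF x(1) v(1)] by (simp only: add.commute)
    ultimately obtain c where "w = scale c (bracket x v)"
      using rs_line[OF gb(3) _ _ w] by blast
    moreover have "bracket x v \<in> S" using S(2) x(1) v(1) gb(4,5) by blast
    ultimately show "w \<in> S" using S(1) by (simp add: subspace_scale)
  qed
  have pos: "rs \<gamma> \<subseteq> S \<and> rs (- \<gamma>) \<subseteq> S" if "\<gamma> \<in> Pos" for \<gamma>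
    using that
  proof (induction rule: Pos_induct)
    case (step \<gamma> \<beta>)
    note R = Pos_root[OF step(1)] base_root[OF step(2)] Pos_root[OF step(3)]
    have "rs (\<gamma> + \<beta>) \<subseteq> S" using gen[OF R] step.IH simple[OF step(2)] by blast
    moreover have "rs (- \<gamma> + - \<beta>) \<subseteq> S"
      using gen[of "- \<gamma>" "- \<beta>"] R uminus_root[OF R(3)] step.IH simple[OF step(2)]
      by (simp add: uminus_root)
    ultimately show ?case unfolding minus_add_distrib by blast
  qed (rule simple)
  have "rs \<kappa> \<subseteq> S" if "\<kappa> \<in> W" for \<kappa>
  proof (cases "\<kappa> = 0")
    case True
    then show ?thesis using H rs_0 by simp
  next
    case False
    then have "\<kappa> \<in> R" using that by simp
    then show ?thesis using root_sign[of \<kappa>] pos[of \<kappa>] pos[of "- \<kappa>"] by auto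
  qed
  then have "(\<Sum>\<kappa>\<in>W. proj \<kappa> z) \<in> S" for z
    using proj_rs[OF W_dual] by (intro subspace_sum[OF S(1)]) blast
  then show ?thesis by (auto simp: sum_proj_W)
qed

text \<open>Let \<open>v\<close> be a root vector for a root \<open>\<theta>\<close> of maximal height. The vectors obtained from \<open>v\<close> by lowering
  operators span a subspace that is stable under \<open>H\<close> and under all simple root vectors, since the positive
  ones kill \<open>v\<close>. These generate the algebra, so the span is an ideal, hence everything, and every root
  is \<open>\<theta>\<close> minus a sum of simple roots.\<close>

lemma exists_highest_root:
  assumes "\<alpha> \<in> \<Pi>"
  obtains \<theta> where "\<theta> \<in> R" "\<And>\<gamma> \<beta>. \<gamma> \<in> R \<Longrightarrow> \<beta> \<in> \<Pi> \<Longrightarrow> ht \<beta> \<gamma> \<le> ht \<beta> \<theta>"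
proof -
  have "R \<noteq> {}" using base_root[OF assms] by blast
  obtain \<theta> where \<theta>: "\<theta> \<in> R" and max: "\<And>\<gamma>. \<gamma> \<in> R \<Longrightarrow> hgt \<gamma> \<le> hgt \<theta>"
  proof -
    assume *: "\<And>\<theta>. \<theta> \<in> R \<Longrightarrow> (\<And>\<gamma>. \<gamma> \<in> R \<Longrightarrow> hgt \<gamma> \<le> hgt \<theta>) \<Longrightarrow> thesis"
    have "Max (hgt ` R) \<in> hgt ` R" using \<open>R \<noteq> {}\<close> finite_roots by (intro Max_in) auto
    then obtain \<theta> where "\<theta> \<in> R" "hgt \<theta> = Max (hgt ` R)" by auto
    then show thesis using finite_roots by (intro *[of \<theta>]) auto
  qed
  have \<theta>_pos: "hgt \<theta> > 0" using max[OF base_root[OF assms]] hgt_base[OF assms] by simp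
  note \<theta>L = root_L[OF \<theta>]
  obtain v where v: "v \<in> rs \<theta>" "v \<noteq> 0" using rs_nonzero[OF \<theta>] by blast
  let ?U = "span (desc v)"
  have wt: "\<exists>\<mu>\<in>L. w \<in> rs (\<theta> - \<mu>) \<and> (\<forall>\<beta>\<in>\<Pi>. ht \<beta> \<mu> \<ge> 0)" if "w \<in> desc v" for w
    using that
  proof induction
    case desc_base
    have "v \<in> rs (\<theta> - 0)" using v(1) by (simp only: diff_zero)
    moreover have "\<forall>\<beta>\<in>\<Pi>. ht \<beta> 0 \<ge> 0" by (rule ballI) (simp only: ht_zero order_refl)
    ultimately show ?case using L_zero by blast
  next
    case (desc_step w \<beta> y)
    then obtain \<mu> where \<mu>: "\<mu> \<in> L" "w \<in> rs (\<theta> - \<mu>)" "\<forall>\<beta>\<in>\<Pi>. ht \<beta> \<mu> \<ge> 0" by blast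
    have "bracket y w \<in> rs (- \<beta> + (\<theta> - \<mu>))" by (rule rs_bracket[OF desc_step.hyps(3) \<mu>(2)])
    also have "- \<beta> + (\<theta> - \<mu>) = \<theta> - (\<mu> + \<beta>)" by simp
    finally have "bracket y w \<in> rs (\<theta> - (\<mu> + \<beta>))" .
    moreover have "\<forall>\<beta>'\<in>\<Pi>. ht \<beta>' (\<mu> + \<beta>) \<ge> 0"
      using \<mu> desc_step.hyps(2) by (auto simp: ht_add base_L ht_base)
    ultimately show ?case using \<mu>(1) base_L[OF desc_step.hyps(2)] L_add by blast
  qed
  define S where "S = {x. \<forall>w\<in>?U. bracket x w \<in> ?U}"
  have SI: "x \<in> S" if "\<And>w. w \<in> desc v \<Longrightarrow> bracket x w \<in> ?U" for x
  proof -
    have "subspace {w. bracket x w \<in> ?U}"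
      by (rule subspaceI) (auto simp: bracket_add_right bracket_scale_right span_zero span_add span_scale)
    then have "?U \<subseteq> {w. bracket x w \<in> ?U}" using that by (intro span_minimal) auto
    then show ?thesis by (auto simp: S_def)
  qed
  have S: "subspace S"
    by (rule subspaceI) (auto simp: S_def bracket_add_left bracket_scale_left span_zero span_add span_scale)
  have SB: "bracket x y \<in> S" if "x \<in> S" "y \<in> S" for x y
    using that by (auto simp: S_def bracket_bracket_left span_diff)
  have HS: "H \<subseteq> S"
  proof
    fix h assume h: "h \<in> H"
    show "h \<in> S"
    proof (rule SI)
      fix w assume w: "w \<in> desc v"
      then obtain \<mu> where "w \<in> rs (\<theta> - \<mu>)" using wt by blast
      then show "bracket h w \<in> ?U" using rs_bracket_H[OF h] w by (simp add: span_scale span_base)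
    qed
  qed
  have neg: "rs (- \<beta>) \<subseteq> S" if "\<beta> \<in> \<Pi>" for \<beta>
    using that by (auto intro!: SI span_base desc_step)
  \<comment> \<open>raising operators: \<open>[x, [y, w]] = [[x, y], w] + [y, [x, w]]\<close>, where \<open>[x, y]\<close> lies in \<open>H\<close> or is 0, because a
    difference of two simple roots is no root\<close>
  have posS: "rs \<beta> \<subseteq> S" if \<beta>: "\<beta> \<in> \<Pi>" for \<beta>
  proof
    fix x assume x: "x \<in> rs \<beta>"
    show "x \<in> S"
    proof (rule SI)
      fix w assume "w \<in> desc v"
      then show "bracket x w \<in> ?U"
      proof induction
        case desc_base
        have "bracket x v = 0"
        proof (rule ccontr)
          assume ne: "bracket x v \<noteq> 0"
          have "\<beta> + \<theta> \<in> W"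
            by (rule rs_weight[OF add_dual[OF root_dual[OF base_root[OF \<beta>]] root_dual[OF \<theta>]] rs_bracket[OF x v(1)] ne])
          moreover have h: "hgt (\<beta> + \<theta>) = 1 + hgt \<theta>" by (simp add: hgt_add base_L \<beta> \<theta>L hgt_base)
          moreover have "hgt 0 = 0" by (simp add: hgt_def ht_zero)
          ultimately have "\<beta> + \<theta> \<in> R" using \<theta>_pos by (metis add_pos_pos insertE less_irrefl zero_less_one)
          from max[OF this] h show False by simp
        qed
        then show ?case by (simp add: span_zero)
      next
        case (desc_step w \<beta>' y)
        have xy: "bracket x y \<in> S"
        proof (cases "\<beta>' = \<beta>")
          case True
          then have "bracket x y \<in> H" using rs_bracket[OF x, of y "- \<beta>"] desc_step.hyps(3) by (simp add: rs_0)
          then show ?thesis using HS by blast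
        next
          case False
          have "bracket x y = 0"
          proof (rule ccontr)
            assume ne: "bracket x y \<noteq> 0"
            note \<beta>' = desc_step.hyps(2)
            have "\<beta> - \<beta>' \<in> W"
            proof (rule rs_weight[OF _ _ ne])
              show "\<beta> - \<beta>' \<in> dual_space H" by (intro L_dual L_diff base_L \<beta> \<beta>')
              show "bracket x y \<in> rs (\<beta> - \<beta>')" using rs_bracket[OF x desc_step.hyps(3)] by simp
            qed
            then have "\<beta> - \<beta>' \<in> R" using False by simp
            moreover have "ht \<beta> (\<beta> - \<beta>') = 1" "ht \<beta>' (\<beta> - \<beta>') = - 1"
              using False \<beta> \<beta>' by (auto simp: ht_diff base_L ht_base)
            ultimately show False
              using PosI[of "\<beta> - \<beta>'" \<beta>] Pos_ht[of "\<beta> - \<beta>'" \<beta>'] \<beta> \<beta>' by simp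
          qed
          then show ?thesis using S by (simp add: subspace_0)
        qed
        have "y \<in> S" using neg[OF desc_step.hyps(2)] desc_step.hyps(3) by blast
        then have "bracket y (bracket x w) \<in> ?U" using desc_step.IH by (simp add: S_def)
        moreover have "bracket (bracket x y) w \<in> ?U"
          using xy span_base[OF desc_step.hyps(1)] by (simp add: S_def)
        ultimately show ?case by (subst bracket_derivation) (rule span_add)
      qed
    qed
  qed
  have "S = UNIV" by (rule root_vectors_generate[OF S SB HS]) (use neg posS in blast)+
  then have "lie_ideal ?U" by (auto simp: lie_ideal_def S_def)
  moreover have "?U \<noteq> {0}" using v(2) span_base[OF desc_base, of v] by auto
  ultimately have U: "?U = UNIV" using ideal_trivial by blast
  have "ht \<beta> \<gamma> \<le> ht \<beta> \<theta>" if \<gamma>: "\<gamma> \<in> R" and \<beta>: "\<beta> \<in> \<Pi>" for \<gamma> \<beta>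
  proof -
    obtain u where u: "u \<in> rs \<gamma>" "u \<noteq> 0" using rs_nonzero[OF \<gamma>] by blast
    let ?T = "{\<theta> - \<mu> | \<mu>. \<mu> \<in> L \<and> (\<forall>\<beta>\<in>\<Pi>. ht \<beta> \<mu> \<ge> 0)}"
    have "subspace {z. \<forall>\<kappa>. \<kappa> \<notin> ?T \<longrightarrow> proj \<kappa> z = 0}"
      by (rule subspaceI) (auto simp: lin_zero[OF lin_proj] lin_add[OF lin_proj] lin_scale[OF lin_proj])
    moreover have "desc v \<subseteq> {z. \<forall>\<kappa>. \<kappa> \<notin> ?T \<longrightarrow> proj \<kappa> z = 0}"
    proof (intro subsetI CollectI allI impI)
      fix w \<kappa> assume "w \<in> desc v" and \<kappa>: "\<kappa> \<notin> ?T"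
      then obtain \<mu> where \<mu>: "\<mu> \<in> L" "w \<in> rs (\<theta> - \<mu>)" "\<forall>\<beta>\<in>\<Pi>. ht \<beta> \<mu> \<ge> 0" using wt by blast
      then have "\<kappa> \<noteq> \<theta> - \<mu>" using \<kappa> by blast
      then show "proj \<kappa> w = 0" using proj_of_rs[OF L_dual[OF L_diff[OF \<theta>L \<mu>(1)]] \<mu>(2)] by simp
    qed
    ultimately have "?U \<subseteq> {z. \<forall>\<kappa>. \<kappa> \<notin> ?T \<longrightarrow> proj \<kappa> z = 0}" by (intro span_minimal)
    then have "u \<in> {z. \<forall>\<kappa>. \<kappa> \<notin> ?T \<longrightarrow> proj \<kappa> z = 0}" using U by blast
    moreover have "proj \<gamma> u \<noteq> 0" using proj_of_rs[OF root_dual[OF \<gamma>] u(1)] u(2) by simp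
    ultimately have "\<gamma> \<in> ?T" by blast
    then obtain \<mu> where \<mu>: "\<gamma> = \<theta> - \<mu>" "\<mu> \<in> L" "\<forall>\<beta>\<in>\<Pi>. ht \<beta> \<mu> \<ge> 0" by blast
    then show ?thesis using \<beta> \<theta>L by (simp add: ht_diff)
  qed
  then show ?thesis using that \<theta> by blast
qed

lemma nonneg_combination_iff:
  assumes "\<mu> \<in> L"
  shows "(\<exists>n :: ('g \<Rightarrow> 'k) \<Rightarrow> nat. \<mu> = (\<Sum>\<beta>\<in>\<Pi>. fun_scale (of_nat (n \<beta>)) \<beta>)) \<longleftrightarrow> (\<forall>\<beta>\<in>\<Pi>. ht \<beta> \<mu> \<ge> 0)"
proof
  assume "\<exists>n :: ('g \<Rightarrow> 'k) \<Rightarrow> nat. \<mu> = (\<Sum>\<beta>\<in>\<Pi>. fun_scale (of_nat (n \<beta>)) \<beta>)"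
  then obtain n :: "('g \<Rightarrow> 'k) \<Rightarrow> nat" where "\<mu> = zl (\<lambda>\<beta>. int (n \<beta>))" by (auto simp: zl_def)
  then show "\<forall>\<beta>\<in>\<Pi>. ht \<beta> \<mu> \<ge> 0" by (simp add: ht_zl)
next
  assume nonneg: "\<forall>\<beta>\<in>\<Pi>. ht \<beta> \<mu> \<ge> 0"
  have "\<mu> = (\<Sum>\<beta>\<in>\<Pi>. fun_scale (of_int (ht \<beta> \<mu>)) \<beta>)" by (rule L_expand[OF assms])
  also have "\<dots> = (\<Sum>\<beta>\<in>\<Pi>. fun_scale (of_nat (nat (ht \<beta> \<mu>))) \<beta>)"
    using nonneg by (intro sum.cong refl) simp
  finally show "\<exists>n :: ('g \<Rightarrow> 'k) \<Rightarrow> nat. \<mu> = (\<Sum>\<beta>\<in>\<Pi>. fun_scale (of_nat (n \<beta>)) \<beta>)"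
    by (rule exI[of _ "\<lambda>\<beta>. nat (ht \<beta> \<mu>)"])
qed

lemma highest_root:
  assumes "\<alpha> \<in> \<Pi>"
  shows "highest_root \<in> R" and "\<And>\<gamma> \<beta>. \<gamma> \<in> R \<Longrightarrow> \<beta> \<in> \<Pi> \<Longrightarrow> ht \<beta> \<gamma> \<le> ht \<beta> highest_root"
proof -
  let ?P = "\<lambda>\<theta>. \<theta> \<in> R \<and> (\<forall>\<gamma>\<in>R. \<exists>n :: ('g \<Rightarrow> 'k) \<Rightarrow> nat. \<theta> - \<gamma> = (\<Sum>\<beta>\<in>\<Pi>. fun_scale (of_nat (n \<beta>)) \<beta>))"
  have P: "?P \<theta> \<longleftrightarrow> \<theta> \<in> R \<and> (\<forall>\<gamma>\<in>R. \<forall>\<beta>\<in>\<Pi>. ht \<beta> \<gamma> \<le> ht \<beta> \<theta>)" for \<theta>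
    using nonneg_combination_iff[OF L_diff[OF root_L root_L]] ht_diff[OF _ root_L root_L]
    by (auto 0 0 cong: ball_cong conj_cong)
  obtain \<theta> where \<theta>: "?P \<theta>" using exists_highest_root[OF assms] unfolding P by metis
  have "\<theta>' = \<theta>" if "?P \<theta>'" for \<theta>'
    using that \<theta> unfolding P by (intro L_eqI root_L antisym) auto
  then have "highest_root = \<theta>" unfolding highest_root_def using \<theta> by (intro the_equality) blast+
  then show "highest_root \<in> R" and "\<And>\<gamma> \<beta>. \<gamma> \<in> R \<Longrightarrow> \<beta> \<in> \<Pi> \<Longrightarrow> ht \<beta> \<gamma> \<le> ht \<beta> highest_root"
    using \<theta> unfolding P by auto
qed

end

section \<open>The grading of a simple root\<close>

locale simple_grading = root_lie_algebra scale Basis bracket H \<Pi>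
  for scale :: "'k::{alg_closed_field, field_char_0} \<Rightarrow> 'g::ab_group_add \<Rightarrow> 'g"
    and Basis :: "'g set" and bracket :: "'g \<Rightarrow> 'g \<Rightarrow> 'g"
    and H :: "'g set" and \<Pi> :: "('g \<Rightarrow> 'k) set" +
  fixes \<alpha> :: "'g \<Rightarrow> 'k"
  assumes \<alpha>: "\<alpha> \<in> \<Pi>"
begin

abbreviation D :: "int \<Rightarrow> ('g \<Rightarrow> 'k) set" where "D \<equiv> roots_deg \<alpha>"

abbreviation h :: "('g \<Rightarrow> 'k) \<Rightarrow> int" where "h \<equiv> ht \<alpha>"

lemma D_iff: "\<gamma> \<in> D i \<longleftrightarrow> \<gamma> \<in> R \<and> h \<gamma> = i"
  by (simp add: roots_deg_def)

lemma D_sub: "D i \<subseteq> R"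
  by (auto simp: D_iff)

lemma finite_D: "finite (D i)"
  by (rule finite_subset[OF D_sub finite_roots])

lemma W_L: "\<kappa> \<in> W \<Longrightarrow> \<kappa> \<in> L"
  using root_L L_zero by blast

lemma h_zero: "h 0 = 0" by (rule ht_zero[OF \<alpha>])

lemma D_Pos: "\<gamma> \<in> D i \<Longrightarrow> i > 0 \<Longrightarrow> \<gamma> \<in> Pos"
  using PosI[OF _ \<alpha>] by (auto simp: D_iff)

lemma \<alpha>_D1: "\<alpha> \<in> D 1"
  using base_root[OF \<alpha>] ht_base[OF \<alpha> \<alpha>] by (simp add: D_iff)


subsection \<open>The fundamental weight\<close>

lemma functional_vec_eq: "functional_vec = tv"
  by (simp add: fun_eq_iff functional_vec_def tv_def)

lemma dual_form_eq: "\<mu> \<in> dual_space H \<Longrightarrow> \<nu> \<in> dual_space H \<Longrightarrow> dual_form \<mu> \<nu> = ip \<mu> \<nu>"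
  by (simp add: dual_form_def functional_vec_eq ip_killing)

text \<open>A special case of \<open>weighted_sum_zero\<close>: root spaces have dimension 1, and the weight 0 contributes 0.\<close>

lemma closed_sum_zero:
  assumes S: "S \<subseteq> W" and \<beta>: "\<beta> \<in> R"
    and plus: "\<And>\<kappa>. \<kappa> \<in> S \<Longrightarrow> \<kappa> + \<beta> \<in> W \<Longrightarrow> \<kappa> + \<beta> \<in> S"
    and minus: "\<And>\<kappa>. \<kappa> \<in> S \<Longrightarrow> \<kappa> - \<beta> \<in> W \<Longrightarrow> \<kappa> - \<beta> \<in> S"
  shows "ip (\<Sum>S) \<beta> = 0"
proof -
  obtain x where x: "x \<in> rs \<beta>" "x \<noteq> 0" using rs_nonzero[OF \<beta>] by blast
  have "(\<Sum>\<kappa>\<in>S. ip \<kappa> \<beta> * of_nat (dim (rs \<kappa>))) = 0"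
  proof (rule weighted_sum_zero[OF S \<beta> x _ minus])
    fix \<kappa> v assume \<kappa>: "\<kappa> \<in> S" and v: "v \<in> rs \<kappa>" "bracket x v \<noteq> 0"
    have "\<kappa> + \<beta> \<in> W"
    proof (rule rs_weight[OF _ _ v(2)])
      show "\<kappa> + \<beta> \<in> dual_space H" using \<kappa> S by (intro add_dual W_dual root_dual[OF \<beta>]) blast
      show "bracket x v \<in> rs (\<kappa> + \<beta>)" using rs_bracket[OF x(1) v(1)] by (simp only: add.commute)
    qed
    then show "\<kappa> + \<beta> \<in> S" by (rule plus[OF \<kappa>])
  qed
  moreover have "(\<Sum>\<kappa>\<in>S. ip \<kappa> \<beta> * of_nat (dim (rs \<kappa>))) = (\<Sum>\<kappa>\<in>S. ip \<kappa> \<beta>)"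
  proof (rule sum.cong[OF refl])
    fix \<kappa> assume "\<kappa> \<in> S"
    then show "ip \<kappa> \<beta> * of_nat (dim (rs \<kappa>)) = ip \<kappa> \<beta>"
      using S root_multiples(1)[of \<kappa>] by (cases "\<kappa> = 0") (auto simp: ip_zero)
  qed
  ultimately show ?thesis by (simp only: ip_sum)
qed

lemma sum_D_L: "\<Sum>(D i) \<in> L"
  by (rule sum_L[OF D_sub])

lemma ip_sum_D:
  assumes i: "i \<noteq> 0" and \<beta>: "\<beta> \<in> \<Pi>" "\<beta> \<noteq> \<alpha>" shows "ip (\<Sum>(D i)) \<beta> = 0"
proof (rule closed_sum_zero[OF _ base_root[OF \<beta>(1)]])
  show "D i \<subseteq> W" using D_sub by blast
  have h\<beta>: "h \<beta> = 0" using ht_base[OF \<alpha> \<beta>(1)] \<beta>(2) by simp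
  show "\<kappa> + \<beta> \<in> D i" if "\<kappa> \<in> D i" "\<kappa> + \<beta> \<in> W" for \<kappa>
  proof -
    have "h (\<kappa> + \<beta>) = i" using that(1) h\<beta> by (simp add: D_iff ht_add \<alpha> root_L base_L \<beta>(1))
    then show ?thesis using that(2) i h_zero unfolding D_iff by auto
  qed
  show "\<kappa> - \<beta> \<in> D i" if "\<kappa> \<in> D i" "\<kappa> - \<beta> \<in> W" for \<kappa>
  proof -
    have "h (\<kappa> - \<beta>) = i" using that(1) h\<beta> by (simp add: D_iff ht_diff \<alpha> root_L base_L \<beta>(1))
    then show ?thesis using that(2) i h_zero unfolding D_iff by auto
  qed
qed

lemma dual_eqI:
  assumes \<mu>: "\<mu> \<in> dual_space H" and \<nu>: "\<nu> \<in> dual_space H" and eq: "\<And>\<beta>. \<beta> \<in> \<Pi> \<Longrightarrow> ip \<mu> \<beta> = ip \<nu> \<beta>"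
  shows "\<mu> = \<nu>"
proof -
  have d: "\<mu> - \<nu> \<in> dual_space H" by (rule diff_dual[OF \<mu> \<nu>])
  have "\<gamma> (tv (\<mu> - \<nu>)) = 0" if \<gamma>: "\<gamma> \<in> R" for \<gamma>
  proof -
    have "ip \<beta> (\<mu> - \<nu>) = 0" if "\<beta> \<in> \<Pi>" for \<beta>
      using eq[OF that] ip_sym[OF L_dual[OF base_L[OF that]] d] by (simp add: ip_diff)
    then have "ip \<gamma> (\<mu> - \<nu>) = 0" by (subst ip_expand[OF root_L[OF \<gamma>]]) simp
    then show ?thesis by (simp only: ip_def)
  qed
  then have 0: "tv (\<mu> - \<nu>) = 0" by (rule roots_separate[OF tv(1)[OF d]])
  have "(\<mu> - \<nu>) y = 0" for y
    using tv(2)[OF d, of y] dual_space_outside[OF d, of y] 0 by (cases "y \<in> H") simp_all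
  then show ?thesis by (simp add: fun_eq_iff)
qed

text \<open>This is \<open>q\<^sub>i\<close>: the sum of the roots of degree \<open>i\<close> is orthogonal to all simple roots other than \<open>\<alpha>\<close>, so it
  is determined by its Cartan integer at \<open>\<alpha>\<close>.\<close>

definition Q :: "int \<Rightarrow> int" where "Q i = cint (\<Sum>(D i)) \<alpha>"

definition c :: rat where "c = rf \<alpha> \<alpha> / 2"

lemma c_pos: "c > 0"
  using rf_self_pos[OF base_root[OF \<alpha>]] by (simp add: c_def)

lemma of_rat_c: "of_rat c = ip \<alpha> \<alpha> / 2"
  by (simp add: c_def of_rat_divide of_rat_rf base_L \<alpha>)

lemma ip_sum_D_\<alpha>: "ip (\<Sum>(D i)) \<alpha> = of_int (Q i) * of_rat c"
proof -
  have "2 * rf (\<Sum>(D i)) \<alpha> = of_int (Q i) * rf \<alpha> \<alpha>"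
    unfolding Q_def by (rule cint[OF base_root[OF \<alpha>] sum_D_L])
  then have "rf (\<Sum>(D i)) \<alpha> = of_int (Q i) * c" by (simp add: c_def)
  then have "of_rat (rf (\<Sum>(D i)) \<alpha>) = (of_int (Q i) * of_rat c :: 'k)" by (simp add: of_rat_mult)
  then show ?thesis by (simp only: of_rat_rf sum_D_L base_L \<alpha>)
qed

lemma h_sum_D: "h (\<Sum>(D i)) = i * int (card (D i))"
proof -
  have "h (\<Sum>(D i)) = (\<Sum>\<gamma>\<in>D i. h \<gamma>)"
    by (rule ht_sum[OF \<alpha>]) (auto simp: D_iff root_L)
  also have "\<dots> = (\<Sum>\<gamma>\<in>D i. i)" by (rule sum.cong) (auto simp: D_iff)
  finally show ?thesis by (simp add: mult.commute)
qed

lemma card_D1_pos: "card (D 1) > 0"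
  using \<alpha>_D1 finite_D by (auto simp: card_gt_0_iff)

lemma Q1_nonzero: "Q 1 \<noteq> 0"
proof
  assume 0: "Q 1 = 0"
  have "\<Sum>(D 1) = 0"
  proof (rule dual_eqI[OF L_dual[OF sum_D_L] zero_dual])
    fix \<beta> assume "\<beta> \<in> \<Pi>"
    then show "ip (\<Sum>(D 1)) \<beta> = ip 0 \<beta>"
      using ip_sum_D[of 1 \<beta>] ip_sum_D_\<alpha>[of 1] 0 by (cases "\<beta> = \<alpha>") (simp_all add: ip_zero)
  qed
  then have "h (\<Sum>(D 1)) = 0" by (simp only: h_zero)
  then show False using h_sum_D[of 1] card_D1_pos by simp
qed

abbreviation \<phi> :: "'g \<Rightarrow> 'k" where "\<phi> \<equiv> fundamental_weight \<alpha>"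

lemma ip_base_self_nonzero: "\<beta> \<in> \<Pi> \<Longrightarrow> ip \<beta> \<beta> \<noteq> 0"
  by (rule ip_self_nonzero[OF base_root])

text \<open>Existence: the sum of the roots of degree 1 is a nonzero multiple of \<open>\<phi>\<close>.\<close>

lemma fundamental_weight:
  shows "\<phi> \<in> dual_space H" and "\<And>\<beta>. \<beta> \<in> \<Pi> \<Longrightarrow> ip \<phi> \<beta> = (if \<beta> = \<alpha> then of_rat c else 0)"
proof -
  let ?P = "\<lambda>\<phi>. \<phi> \<in> dual_space H \<and> (\<forall>\<beta>\<in>\<Pi>. 2 * dual_form \<phi> \<beta> / dual_form \<beta> \<beta> = (if \<beta> = \<alpha> then 1 else 0))"
  have P: "?P \<phi> \<longleftrightarrow> \<phi> \<in> dual_space H \<and> (\<forall>\<beta>\<in>\<Pi>. ip \<phi> \<beta> = (if \<beta> = \<alpha> then of_rat c else 0))" for \<phi>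
  proof (cases "\<phi> \<in> dual_space H")
    case True
    have "2 * dual_form \<phi> \<beta> / dual_form \<beta> \<beta> = (if \<beta> = \<alpha> then 1 else 0)
        \<longleftrightarrow> ip \<phi> \<beta> = (if \<beta> = \<alpha> then of_rat c else 0)" if "\<beta> \<in> \<Pi>" for \<beta>
      using ip_base_self_nonzero[OF that] L_dual[OF base_L[OF that]] True
      by (auto simp: dual_form_eq of_rat_c field_simps)
    then show ?thesis using True by blast
  qed simp
  define \<psi> where "\<psi> = fun_scale (1 / of_int (Q 1)) (\<Sum>(D 1))"
  have "?P \<psi>"
    unfolding P
  proof
    show "\<psi> \<in> dual_space H" unfolding \<psi>_def by (rule scale_dual[OF L_dual[OF sum_D_L]])
    show "\<forall>\<beta>\<in>\<Pi>. ip \<psi> \<beta> = (if \<beta> = \<alpha> then of_rat c else 0)"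
      using ip_sum_D[of 1] ip_sum_D_\<alpha>[of 1] Q1_nonzero by (auto simp: \<psi>_def ip_scale)
  qed
  moreover have "\<psi>' = \<psi>" if "?P \<psi>'" for \<psi>'
    using that calculation unfolding P by (intro dual_eqI) simp_all
  ultimately have "?P \<phi>" unfolding fundamental_weight_def by (rule theI)
  then show "\<phi> \<in> dual_space H" and "\<And>\<beta>. \<beta> \<in> \<Pi> \<Longrightarrow> ip \<phi> \<beta> = (if \<beta> = \<alpha> then of_rat c else 0)"
    unfolding P by simp_all
qed

lemma ip_\<phi>: "\<mu> \<in> L \<Longrightarrow> ip \<mu> \<phi> = of_int (h \<mu>) * of_rat c"
proof -
  assume \<mu>: "\<mu> \<in> L"
  have "ip \<mu> \<phi> = (\<Sum>\<beta>\<in>\<Pi>. of_int (ht \<beta> \<mu>) * ip \<beta> \<phi>)" by (rule ip_expand[OF \<mu>])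
  also have "\<dots> = (\<Sum>\<beta>\<in>\<Pi>. if \<beta> = \<alpha> then of_int (h \<mu>) * of_rat c else 0)"
    by (intro sum.cong refl)
      (simp add: ip_sym[OF L_dual[OF base_L] fundamental_weight(1)] fundamental_weight(2))
  finally show ?thesis using finite_base \<alpha> by simp
qed

lemma sum_D: "i \<noteq> 0 \<Longrightarrow> \<Sum>(D i) = fun_scale (of_int (Q i)) \<phi>"
proof (rule dual_eqI[OF L_dual[OF sum_D_L] scale_dual[OF fundamental_weight(1)]])
  fix \<beta> assume i: "i \<noteq> 0" and \<beta>: "\<beta> \<in> \<Pi>"
  show "ip (\<Sum>(D i)) \<beta> = ip (fun_scale (of_int (Q i)) \<phi>) \<beta>"
    using ip_sum_D[OF i \<beta>] ip_sum_D_\<alpha>[of i] fundamental_weight(2)[OF \<beta>]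
    by (cases "\<beta> = \<alpha>") (simp_all add: ip_scale)
qed

lemma ip_sum_D_L: "i \<noteq> 0 \<Longrightarrow> \<mu> \<in> L \<Longrightarrow> ip \<mu> (\<Sum>(D i)) = of_int (Q i * h \<mu>) * of_rat c"
  using ip_sym[OF L_dual L_dual[OF sum_D_L], of \<mu> i] ip_\<phi>[of \<mu>] ip_sym[OF fundamental_weight(1) L_dual, of \<mu>]
  by (simp add: sum_D ip_scale)

lemma rf_sum_D: "i \<noteq> 0 \<Longrightarrow> \<mu> \<in> L \<Longrightarrow> rf \<mu> (\<Sum>(D i)) = of_int (Q i * h \<mu>) * c"
  by (rule rf_eqI) (simp add: ip_sum_D_L of_rat_mult)

lemma fundamental_weight_nonzero: "\<phi> \<noteq> 0"
  using fundamental_weight(2)[OF \<alpha>] c_pos by (auto simp: ip_zero)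

lemma q_deg_eq: "i \<noteq> 0 \<Longrightarrow> q_deg \<alpha> i = Q i"
  unfolding q_deg_def
proof (rule the_equality)
  assume i: "i \<noteq> 0"
  show "\<Sum>(D i) = fun_scale (of_int (Q i)) \<phi>" by (rule sum_D[OF i])
  fix q assume "\<Sum>(D i) = fun_scale (of_int q) \<phi>"
  then have "fun_scale (of_int q) \<phi> = fun_scale (of_int (Q i)) \<phi>" by (simp only: sum_D[OF i])
  then have "(of_int q :: 'k) = of_int (Q i)"
    using fundamental_weight_nonzero functional.scale_right_imp_eq by blast
  then show "q = Q i" by simp
qed

text \<open>The value \<open>(\<phi>, \<phi>) / c\<close>. Pairing the sum of \<open>D i\<close> with \<open>\<phi>\<close> in two ways shows that
  \<open>Q i (\<phi>, \<phi>) = i card (D i) c\<close>, so \<open>Q i\<close> is positive as soon as \<open>D i\<close> is nonempty.\<close>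

definition \<phi>_norm :: rat where "\<phi>_norm = c * of_int (\<Sum>\<gamma>\<in>R. (h \<gamma>)\<^sup>2)"

lemma \<phi>_norm_pos: "\<phi>_norm > 0"
proof -
  have "(h \<alpha>)\<^sup>2 \<le> (\<Sum>\<gamma>\<in>R. (h \<gamma>)\<^sup>2)"
    using finite_roots base_root[OF \<alpha>] by (intro member_le_sum) auto
  then have "(\<Sum>\<gamma>\<in>R. (h \<gamma>)\<^sup>2) > 0" using ht_base[OF \<alpha> \<alpha>] by simp
  then show ?thesis using c_pos unfolding \<phi>_norm_def by (simp only: mult_pos_pos of_int_0_less_iff)
qed

lemma Q_card:
  assumes i: "i \<noteq> 0" shows "of_int (Q i) * \<phi>_norm = of_int (i * int (card (D i)))"
proof -
  have "ip \<phi> \<phi> = (\<Sum>\<gamma>\<in>R. ip \<gamma> \<phi> * ip \<gamma> \<phi>)"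
    by (rule ip_sum_roots[OF fundamental_weight(1) fundamental_weight(1)])
  also have "\<dots> = (\<Sum>\<gamma>\<in>R. of_rat c * (of_rat c * of_int ((h \<gamma>)\<^sup>2)))"
    by (intro sum.cong refl) (simp add: ip_\<phi> root_L power2_eq_square)
  also have "\<dots> = of_rat (c * \<phi>_norm)"
    by (simp only: \<phi>_norm_def sum_distrib_left[symmetric] of_int_sum[symmetric] of_rat_mult of_rat_of_int_eq)
  finally have \<phi>\<phi>: "ip \<phi> \<phi> = of_rat (c * \<phi>_norm)" .
  have "of_int (h (\<Sum>(D i))) * of_rat c = ip (\<Sum>(D i)) \<phi>" by (rule ip_\<phi>[OF sum_D_L, symmetric])
  also have "\<dots> = of_int (Q i) * of_rat (c * \<phi>_norm)" by (simp add: sum_D[OF i] ip_scale \<phi>\<phi>)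
  finally have "(of_rat (of_int (h (\<Sum>(D i))) * c) :: 'k) = of_rat (of_int (Q i) * (c * \<phi>_norm))"
    by (simp add: of_rat_mult)
  then have "of_int (h (\<Sum>(D i))) * c = of_int (Q i) * (c * \<phi>_norm)" by (simp only: of_rat_eq_iff)
  then show ?thesis using c_pos by (simp add: h_sum_D)
qed

lemma Q_nonneg: "i > 0 \<Longrightarrow> Q i \<ge> 0"
  and Q_pos: "i > 0 \<Longrightarrow> D i \<noteq> {} \<Longrightarrow> Q i > 0"
proof -
  assume i: "i > 0"
  then have eq: "of_int (Q i) * \<phi>_norm = of_int (i * int (card (D i)))" by (intro Q_card) simp
  have "of_int (Q i) * \<phi>_norm \<ge> 0" unfolding eq using i by simp
  then show "Q i \<ge> 0" using \<phi>_norm_pos by (simp add: zero_le_mult_iff)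
  assume "D i \<noteq> {}"
  then have "card (D i) > 0" using finite_D by (simp add: card_gt_0_iff)
  then have "of_int (Q i) * \<phi>_norm > 0" unfolding eq using i by simp
  then show "Q i > 0" using \<phi>_norm_pos by (simp add: zero_less_mult_iff)
qed


subsection \<open>The depth\<close>

abbreviation d :: int where "d \<equiv> depth \<alpha>"

lemma h_le_d: "\<gamma> \<in> R \<Longrightarrow> h \<gamma> \<le> d"
  unfolding depth_def by (rule highest_root(2)[OF \<alpha> _ \<alpha>])

lemma d_pos: "d \<ge> 1"
  using h_le_d[of \<alpha>] \<alpha>_D1 by (simp add: D_iff)

lemma D_empty: "i > d \<Longrightarrow> D i = {}"
  using h_le_d by (fastforce simp: D_iff)

definition q :: int where "q = (\<Sum>i=1..d. Q i)"

lemma q_total_eq: "q_total \<alpha> = q"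
  unfolding q_total_def q_def by (intro sum.cong refl q_deg_eq) simp

text \<open>For a root \<open>\<theta>\<close> of degree \<open>d\<close> and \<open>0 < i < d\<close> the sum of \<open>g(i)\<close> and \<open>g(i - d)\<close> is stable under
  the root vectors of \<open>\<theta>\<close> and \<open>- \<theta>\<close>, so the sum of its weights is orthogonal to \<open>\<theta>\<close>.\<close>

lemma Q_symmetric:
  assumes i: "0 < i" "i < d" shows "Q i = Q (d - i)"
proof -
  define \<theta> where "\<theta> = highest_root"
  have \<theta>: "\<theta> \<in> R" "h \<theta> = d" using highest_root(1)[OF \<alpha>] by (simp_all add: \<theta>_def depth_def)
  let ?S = "D i \<union> D (i - d)"
  have hW: "- d \<le> h \<kappa> \<and> h \<kappa> \<le> d" if "\<kappa> \<in> W" for \<kappa>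
  proof (cases "\<kappa> = 0")
    case True
    then show ?thesis using h_zero d_pos by simp
  next
    case False
    then have "\<kappa> \<in> R" using that by simp
    then show ?thesis
      using h_le_d[of \<kappa>] h_le_d[OF uminus_root, of \<kappa>] ht_uminus[OF \<alpha> root_L, of \<kappa>] by simp
  qed
  have inS: "\<kappa> \<in> ?S" if "\<kappa> \<in> W" "h \<kappa> = i \<or> h \<kappa> = i - d" for \<kappa>
    using that i h_zero by (auto simp: D_iff)
  have "ip (\<Sum>?S) \<theta> = 0"
  proof (rule closed_sum_zero[OF _ \<theta>(1)])
    show "?S \<subseteq> W" using D_sub by blast
    fix \<kappa> assume \<kappa>: "\<kappa> \<in> ?S"
    then have \<kappa>L: "\<kappa> \<in> L" using root_L D_sub by blast
    have \<kappa>h: "h \<kappa> = i \<or> h \<kappa> = i - d" using \<kappa> by (auto simp: D_iff)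
    show "\<kappa> + \<theta> \<in> ?S" if "\<kappa> + \<theta> \<in> W"
      using hW[OF that] \<kappa>h i ht_add[OF \<alpha> \<kappa>L root_L[OF \<theta>(1)]] \<theta>(2) by (intro inS[OF that]) linarith
    show "\<kappa> - \<theta> \<in> ?S" if "\<kappa> - \<theta> \<in> W"
      using hW[OF that] \<kappa>h i ht_diff[OF \<alpha> \<kappa>L root_L[OF \<theta>(1)]] \<theta>(2) by (intro inS[OF that]) linarith
  qed
  moreover have "\<Sum>?S = \<Sum>(D i) + \<Sum>(D (i - d))"
    using i d_pos by (intro sum.union_disjoint finite_D) (auto simp: D_iff)
  moreover have "\<Sum>(D (i - d)) = - \<Sum>(D (d - i))"
  proof -
    have "D (i - d) = uminus ` D (d - i)"
    proof (intro equalityI subsetI)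
      fix \<gamma> assume "\<gamma> \<in> D (i - d)"
      then have "- \<gamma> \<in> D (d - i)" using uminus_root ht_uminus[OF \<alpha> root_L] by (simp add: D_iff)
      then show "\<gamma> \<in> uminus ` D (d - i)" by (rule image_eqI[rotated]) simp
    next
      fix \<gamma> assume "\<gamma> \<in> uminus ` D (d - i)"
      then show "\<gamma> \<in> D (i - d)" using uminus_root ht_uminus[OF \<alpha> root_L] by (auto simp: D_iff)
    qed
    then show ?thesis by (simp add: sum.reindex sum_negf inj_on_def)
  qed
  ultimately have "ip (\<Sum>(D i)) \<theta> - ip (\<Sum>(D (d - i))) \<theta> = 0" by (simp add: ip_add ip_uminus ip_diff)
  moreover have "ip (\<Sum>(D j)) \<theta> = of_int (Q j * d) * of_rat c" if "j \<noteq> 0" for j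
    using ip_sum_D_L[OF that root_L[OF \<theta>(1)]] ip_sym[OF L_dual[OF sum_D_L] root_dual[OF \<theta>(1)], of j] \<theta>(2)
    by simp
  ultimately have "of_int (Q i * d) * of_rat c = (of_int (Q (d - i) * d) * of_rat c :: 'k)" using i by simp
  then have "Q i * d = Q (d - i) * d" using c_pos by (simp only: mult_cancel_right of_int_eq_iff of_rat_eq_0_iff) simp
  then show ?thesis using d_pos by simp
qed

text \<open>The degrees 1, \<open>d - 1\<close> and \<open>d\<close> are distinct, and \<open>Q (d - 1) = Q 1\<close>.\<close>

lemma q_depth_ge_3:
  assumes "d \<ge> 3" shows "q > 2 * Q 1"
proof -
  have "highest_root \<in> D d" using highest_root(1)[OF \<alpha>] by (simp add: D_iff depth_def)
  then have Qd: "Q d > 0" using assms by (intro Q_pos) auto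
  have sub: "{1, d - 1, d} \<subseteq> {1..d}" using assms by auto
  have "(\<Sum>i\<in>{1, d - 1, d}. Q i) \<le> q"
    unfolding q_def using sub by (intro sum_mono2) (auto intro: Q_nonneg)
  moreover have "(\<Sum>i\<in>{1, d - 1, d}. Q i) = Q 1 + (Q (d - 1) + Q d)" using assms by simp
  moreover have "Q 1 = Q (d - 1)" using assms by (intro Q_symmetric) auto
  ultimately show ?thesis using Qd by linarith
qed

lemma q_pos: "q > 0"
proof -
  have "Q 1 \<le> q" unfolding q_def using d_pos by (intro member_le_sum) (auto intro: Q_nonneg)
  moreover have "Q 1 > 0" using \<alpha>_D1 by (intro Q_pos) auto
  ultimately show ?thesis by simp
qed


subsection \<open>Bounds for Casimir eigenvalues\<close>

definition Pos0 :: "('g \<Rightarrow> 'k) set" where "Pos0 = {\<gamma> \<in> Pos. h \<gamma> = 0}"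

text \<open>The sum of the weights of the nilradical, the sum of all \<open>g(i)\<close> with \<open>i \<ge> 1\<close>; it equals \<open>q \<phi>\<close>.\<close>

definition nil2 :: "'g \<Rightarrow> 'k" where "nil2 = (\<Sum>i=1..d. \<Sum>(D i))"

lemma nil2_L: "nil2 \<in> L"
  unfolding nil2_def by (intro L_sum sum_D_L)

lemma Pos0_sub: "Pos0 \<subseteq> Pos" by (auto simp: Pos0_def)

lemma sum_Pos0_L: "\<Sum>Pos0 \<in> L"
  using Pos0_sub Pos_sub by (intro sum_L) blast

lemma finite_Pos0: "finite Pos0"
  by (rule finite_subset[OF Pos0_sub finite_Pos])

lemma rho2_split: "rho2 = \<Sum>Pos0 + nil2"
proof -
  have Pos: "Pos = Pos0 \<union> (\<Union>i\<in>{1..d}. D i)"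
  proof (intro equalityI subsetI)
    fix \<gamma> assume \<gamma>: "\<gamma> \<in> Pos"
    have "0 \<le> h \<gamma>" "h \<gamma> \<le> d" using Pos_ht[OF \<gamma> \<alpha>] h_le_d[OF Pos_root[OF \<gamma>]] .
    then show "\<gamma> \<in> Pos0 \<union> (\<Union>i\<in>{1..d}. D i)"
      using \<gamma> Pos_root[OF \<gamma>] by (cases "h \<gamma> = 0") (auto simp: Pos0_def D_iff)
  qed (auto simp: Pos0_def intro: D_Pos)
  have "\<Sum>(\<Union>i\<in>{1..d}. D i) = nil2"
    unfolding nil2_def by (intro sum.UNION_disjoint) (auto simp: finite_D, auto simp: D_iff)
  moreover have "\<Sum>Pos = \<Sum>Pos0 + \<Sum>(\<Union>i\<in>{1..d}. D i)"
    unfolding Pos by (intro sum.union_disjoint finite_Pos0) (auto simp: finite_D, auto simp: Pos0_def D_iff)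
  ultimately show ?thesis by (simp only: rho2_def)
qed

lemma rf_nil2: "\<mu> \<in> L \<Longrightarrow> rf \<mu> nil2 = of_int (q * h \<mu>) * c"
proof -
  assume \<mu>: "\<mu> \<in> L"
  have "rf \<mu> nil2 = (\<Sum>i=1..d. rf \<mu> (\<Sum>(D i)))"
    unfolding nil2_def by (rule rf_sum_right) (simp_all add: sum_D_L \<mu>)
  also have "\<dots> = (\<Sum>i=1..d. of_int (Q i * h \<mu>) * c)"
    by (intro sum.cong refl rf_sum_D \<mu>) simp
  finally show ?thesis by (simp add: q_def sum_distrib_right)
qed

lemma h_sum_Pos0: "h (\<Sum>Pos0) = 0"
proof -
  have "h (\<Sum>Pos0) = (\<Sum>\<gamma>\<in>Pos0. h \<gamma>)"
    using Pos0_sub by (intro ht_sum[OF \<alpha>] root_L Pos_root) blast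
  also have "\<dots> = 0" by (rule sum.neutral) (simp add: Pos0_def)
  finally show ?thesis .
qed

lemma norm_le_rho2:
  assumes "A \<subseteq> Pos" shows "rf (\<Sum>A) (\<Sum>A) \<le> rf (\<Sum>A) rho2"
proof -
  have A: "\<Sum>A \<in> L" using assms Pos_sub by (intro sum_L) blast
  let ?\<nu> = "rho2 - \<Sum>A - \<Sum>A"
  have \<nu>: "?\<nu> \<in> L" by (intro L_diff rho2_L A)
  have "rf ?\<nu> ?\<nu> = rf ?\<nu> rho2 - rf ?\<nu> (\<Sum>A) - rf ?\<nu> (\<Sum>A)"
    by (simp only: rf_diff_right rho2_L A L_diff)
  moreover have "rf ?\<nu> rho2 = rf rho2 rho2 - rf (\<Sum>A) rho2 - rf (\<Sum>A) rho2"
    and "rf ?\<nu> (\<Sum>A) = rf rho2 (\<Sum>A) - rf (\<Sum>A) (\<Sum>A) - rf (\<Sum>A) (\<Sum>A)"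
    by (simp_all only: rf_diff rho2_L A L_diff)
  ultimately show ?thesis using norm_half_system[OF assms] rf_sym[OF A rho2_L] by linarith
qed

text \<open>The eigenvalue of the Casimir element on a lowest weight vector of weight \<open>\<mu>\<close>, where the sum of \<open>Pos0\<close>
  is \<open>2 \<rho>\<^sub>0\<close>.\<close>

definition cas :: "('g \<Rightarrow> 'k) \<Rightarrow> rat" where
  "cas \<mu> = rf \<mu> \<mu> - rf \<mu> (\<Sum>Pos0)"

abbreviation m :: nat where "m \<equiv> card (D 1)"

lemma D1_Pos: "D 1 \<subseteq> Pos"
  using D_Pos by auto

lemma sum_D1_L: "A \<subseteq> D 1 \<Longrightarrow> \<Sum>A \<in> L"
  using D_sub by (intro sum_L) blast

lemma h_sum_D1: "A \<subseteq> D 1 \<Longrightarrow> h (\<Sum>A) = int (card A)"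
proof -
  assume A: "A \<subseteq> D 1"
  have "h (\<Sum>A) = (\<Sum>\<gamma>\<in>A. h \<gamma>)" using A by (intro ht_sum[OF \<alpha>] root_L) (auto simp: D_iff)
  also have "\<dots> = (\<Sum>\<gamma>\<in>A. 1)" using A by (intro sum.cong) (auto simp: D_iff)
  finally show ?thesis by simp
qed

text \<open>The inequality \<open>norm_le_rho2\<close> for \<open>A\<close>, with \<open>2 \<rho> = 2 \<rho>\<^sub>0 + q \<phi>\<close>.\<close>

lemma cas_le:
  assumes A: "A \<subseteq> D 1" shows "cas (\<Sum>A) \<le> of_int (q * int (card A)) * c"
proof -
  have "rf (\<Sum>A) (\<Sum>A) \<le> rf (\<Sum>A) rho2" using A D1_Pos by (intro norm_le_rho2) blast
  also have "\<dots> = rf (\<Sum>A) (\<Sum>Pos0) + rf (\<Sum>A) nil2"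
    by (simp only: rho2_split rf_add_right sum_Pos0_L nil2_L sum_D1_L[OF A])
  finally show ?thesis by (simp add: cas_def rf_nil2 sum_D1_L[OF A] h_sum_D1[OF A])
qed

text \<open>The inequality \<open>norm_le_rho2\<close> for \<open>Pos0 \<union> A\<close>; the terms without \<open>A\<close> cancel.\<close>

lemma cas_opposite_le:
  assumes A: "A \<subseteq> D 1"
  shows "rf (\<Sum>A) (\<Sum>A) + rf (\<Sum>A) (\<Sum>Pos0) \<le> of_int (q * int (card A)) * c"
proof -
  note AL = sum_D1_L[OF A] and PL = sum_Pos0_L
  have finA: "finite A" by (rule finite_subset[OF A finite_D])
  have "\<Sum>(Pos0 \<union> A) = \<Sum>Pos0 + \<Sum>A"
    using A by (intro sum.union_disjoint finA finite_Pos0) (auto simp: Pos0_def D_iff)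
  moreover have "Pos0 \<union> A \<subseteq> Pos" using A D1_Pos Pos0_sub by blast
  ultimately have "rf (\<Sum>Pos0 + \<Sum>A) (\<Sum>Pos0 + \<Sum>A) \<le> rf (\<Sum>Pos0 + \<Sum>A) rho2"
    using norm_le_rho2[of "Pos0 \<union> A"] by simp
  moreover have "rf (\<Sum>Pos0 + \<Sum>A) (\<Sum>Pos0 + \<Sum>A)
      = rf (\<Sum>Pos0) (\<Sum>Pos0) + rf (\<Sum>A) (\<Sum>Pos0) + (rf (\<Sum>Pos0) (\<Sum>A) + rf (\<Sum>A) (\<Sum>A))"
    by (simp only: rf_add_right rf_add AL PL L_add)
  moreover have "rf (\<Sum>Pos0 + \<Sum>A) rho2
      = rf (\<Sum>Pos0) (\<Sum>Pos0) + rf (\<Sum>A) (\<Sum>Pos0) + (rf (\<Sum>Pos0) nil2 + rf (\<Sum>A) nil2)"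
    by (simp only: rho2_split rf_add_right rf_add AL PL nil2_L L_add)
  moreover have "rf (\<Sum>Pos0) nil2 = 0" by (simp add: rf_nil2 PL h_sum_Pos0)
  moreover have "rf (\<Sum>A) nil2 = of_int (q * int (card A)) * c" by (simp add: rf_nil2 AL h_sum_D1[OF A])
  ultimately show ?thesis using rf_sym[OF AL PL] by linarith
qed

text \<open>The sum of \<open>D 1\<close> is orthogonal to \<open>Pos0\<close>, so replacing \<open>A\<close> by its complement changes the sign of the
  linear term, and \<open>cas_opposite_le\<close> applies to the complement.\<close>

lemma cas_le_complement:
  assumes A: "A \<subseteq> D 1"
  shows "cas (\<Sum>A) \<le> of_int (q * int (m - card A) + Q 1 * (2 * int (card A) - int m)) * c"
proof -
  define B where "B = D 1 - A"
  have B: "B \<subseteq> D 1" by (auto simp: B_def)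
  have finA: "finite A" by (rule finite_subset[OF A finite_D])
  have cB: "card B = m - card A" unfolding B_def by (rule card_Diff_subset[OF finA A])
  have le: "card A \<le> m" by (rule card_mono[OF finite_D A])
  let ?s = "\<Sum>(D 1)" and ?\<nu> = "\<Sum>B"
  note sL = sum_D_L[of 1] and \<nu>L = sum_D1_L[OF B] and PL = sum_Pos0_L
  have "?s = \<Sum>A + ?\<nu>" unfolding B_def using sum.subset_diff[OF A finite_D, of "\<lambda>x. x"] by (simp add: add.commute)
  then have SA: "\<Sum>A = ?s - ?\<nu>" by simp
  have "cas (\<Sum>A) = (rf ?s ?s - rf ?\<nu> ?s - (rf ?s ?\<nu> - rf ?\<nu> ?\<nu>)) - (rf ?s (\<Sum>Pos0) - rf ?\<nu> (\<Sum>Pos0))"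
    unfolding cas_def SA by (simp only: rf_diff_right rf_diff sL \<nu>L PL L_diff)
  moreover have "rf ?s ?s = of_int (Q 1 * int m) * c" using rf_sum_D[OF _ sL, of 1] h_sum_D[of 1] by simp
  moreover have "rf ?\<nu> ?s = of_int (Q 1 * int (card B)) * c" using rf_sum_D[OF _ \<nu>L, of 1] h_sum_D1[OF B] by simp
  moreover have "rf ?s ?\<nu> = rf ?\<nu> ?s" by (rule rf_sym[OF sL \<nu>L])
  moreover have "rf ?s (\<Sum>Pos0) = 0"
    using rf_sym[OF sL PL] rf_sum_D[OF _ PL, of 1] h_sum_Pos0 by simp
  ultimately have "cas (\<Sum>A) = (rf ?\<nu> ?\<nu> + rf ?\<nu> (\<Sum>Pos0)) + of_int (Q 1 * int m) * c
      - 2 * (of_int (Q 1 * int (card B)) * c)" by simp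
  also have "\<dots> \<le> of_int (q * int (card B)) * c + of_int (Q 1 * int m) * c - 2 * (of_int (Q 1 * int (card B)) * c)"
    using cas_opposite_le[OF B] by simp
  also have "\<dots> = of_int (q * int (m - card A) + Q 1 * (2 * int (card A) - int m)) * c"
    using le by (simp add: cB of_nat_diff algebra_simps)
  finally show ?thesis .
qed


section \<open>The Casimir element of the Levi subalgebra\<close>

subsection \<open>Root vectors and graded pieces\<close>

text \<open>Root vectors normalised so that opposite ones are dual for the Killing form.\<close>

definition rv :: "('g \<Rightarrow> 'k) \<Rightarrow> 'g" where
  "rv = (SOME v. \<forall>\<gamma>\<in>R. v \<gamma> \<in> rs \<gamma> \<and> killing (v \<gamma>) (v (- \<gamma>)) = 1)"

lemma rv_rs: "\<gamma> \<in> R \<Longrightarrow> rv \<gamma> \<in> rs \<gamma>"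
  and killing_rv: "\<gamma> \<in> R \<Longrightarrow> killing (rv \<gamma>) (rv (- \<gamma>)) = 1"
proof -
  have "\<forall>\<gamma>\<in>R. \<exists>x y. x \<in> rs \<gamma> \<and> y \<in> rs (- \<gamma>) \<and> killing x y = 1"
    using root_pair by metis
  then obtain x y where xy: "\<And>\<gamma>. \<gamma> \<in> R \<Longrightarrow> x \<gamma> \<in> rs \<gamma>" "\<And>\<gamma>. \<gamma> \<in> R \<Longrightarrow> y \<gamma> \<in> rs (- \<gamma>)"
    "\<And>\<gamma>. \<gamma> \<in> R \<Longrightarrow> killing (x \<gamma>) (y \<gamma>) = 1" by metis
  \<comment> \<open>a choice for the positive roots determines the vectors of the negative ones\<close>
  let ?v = "\<lambda>\<gamma>. if \<gamma> \<in> Pos then x \<gamma> else y (- \<gamma>)"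
  have "?v \<gamma> \<in> rs \<gamma> \<and> killing (?v \<gamma>) (?v (- \<gamma>)) = 1" if \<gamma>: "\<gamma> \<in> R" for \<gamma>
  proof (cases "\<gamma> \<in> Pos")
    case True
    then show ?thesis using xy(1,3)[OF \<gamma>] Pos_uminus[OF True] by simp
  next
    case False
    then have "- \<gamma> \<in> Pos" using root_sign[OF \<gamma>] by blast
    then show ?thesis
      using False xy(2,3)[OF uminus_root[OF \<gamma>]] killing_sym by simp
  qed
  then have "\<exists>v. \<forall>\<gamma>\<in>R. v \<gamma> \<in> rs \<gamma> \<and> killing (v \<gamma>) (v (- \<gamma>)) = 1" by (intro exI[of _ ?v]) blast
  from someI_ex[OF this]
  show "\<gamma> \<in> R \<Longrightarrow> rv \<gamma> \<in> rs \<gamma>" and "\<gamma> \<in> R \<Longrightarrow> killing (rv \<gamma>) (rv (- \<gamma>)) = 1"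
    unfolding rv_def[symmetric] by blast+
qed

lemma rv_nonzero: "\<gamma> \<in> R \<Longrightarrow> rv \<gamma> \<noteq> 0"
  using killing_rv[of \<gamma>] by auto

lemma bracket_rv: "\<gamma> \<in> R \<Longrightarrow> bracket (rv \<gamma>) (rv (- \<gamma>)) = tv \<gamma>"
  using bracket_opposite[OF root_dual rv_rs rv_rs[OF uminus_root], of \<gamma>] by (simp add: killing_rv)

lemma proj_rv:
  assumes \<gamma>: "\<gamma> \<in> R" shows "proj \<gamma> v = scale (killing v (rv (- \<gamma>))) (rv \<gamma>)"
proof -
  obtain a where a: "proj \<gamma> v = scale a (rv \<gamma>)"
    using rs_line[OF \<gamma> rv_rs[OF \<gamma>] rv_nonzero[OF \<gamma>] proj_rs[OF root_dual[OF \<gamma>]]] .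
  have "killing v (rv (- \<gamma>)) = killing (rv (- \<gamma>)) v" by (rule killing_sym)
  also have "\<dots> = killing (rv (- \<gamma>)) (proj \<gamma> v)"
    using killing_proj[OF rv_rs[OF uminus_root[OF \<gamma>]] root_dual[OF uminus_root[OF \<gamma>]], of v] by simp
  also have "\<dots> = a" using killing_rv[OF \<gamma>] by (simp add: a killing_scale_right killing_sym)
  finally show ?thesis by (simp add: a)
qed

lemma killing_rv_rv:
  assumes "\<gamma> \<in> R" "\<delta> \<in> R" shows "killing (rv \<gamma>) (rv (- \<delta>)) = (if \<gamma> = \<delta> then 1 else 0)"
proof (cases "\<gamma> = \<delta>")
  case False
  then have "\<gamma> + - \<delta> \<noteq> 0" by (simp add: add_eq_0_iff)
  then show ?thesis
    using killing_rs_zero[OF rv_rs[OF assms(1)] rv_rs[OF uminus_root[OF assms(2)]]] False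
      root_dual[OF assms(1)] root_dual[OF uminus_root[OF assms(2)]] by simp
qed (simp add: killing_rv assms)

text \<open>The weights of \<open>g(i)\<close>, including the weight 0 in degree 0.\<close>

definition G :: "int \<Rightarrow> ('g \<Rightarrow> 'k) set" where "G i = {\<kappa> \<in> W. h \<kappa> = i}"

lemma G_sub: "G i \<subseteq> W" by (auto simp: G_def)

lemma finite_G: "finite (G i)" by (rule finite_subset[OF G_sub finite_W])

lemma G_eq_D: "i \<noteq> 0 \<Longrightarrow> G i = D i"
  using h_zero by (auto simp: G_def D_iff)

lemma G_0: "G 0 = insert 0 (D 0)"
  using h_zero by (auto simp: G_def D_iff)

lemma grading_eq: "grading \<alpha> i = {v. PS (G i) v = v}"
proof
  have sub: "subspace {v. PS (G i) v = v}"
    by (rule subspaceI) (simp_all add: lin_zero[OF lin_PS] lin_add[OF lin_PS] lin_scale[OF lin_PS])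
  have mem: "rs \<kappa> \<subseteq> {v. PS (G i) v = v}" if "\<kappa> \<in> G i" for \<kappa>
  proof
    fix x assume x: "x \<in> rs \<kappa>"
    have "\<kappa> \<in> W" using that G_sub by blast
    from PS_of_rs[OF finite_G W_dual[OF this] x] show "x \<in> {v. PS (G i) v = v}" using that by simp
  qed
  have "(if i = 0 then H else {}) \<union> (\<Union>\<gamma>\<in>D i. rs \<gamma>) \<subseteq> {v. PS (G i) v = v}"
    using mem rs_0 G_0 G_eq_D[of i] by (cases "i = 0") auto
  then show "grading \<alpha> i \<subseteq> {v. PS (G i) v = v}"
    unfolding grading_def by (intro span_minimal sub)
  show "{v. PS (G i) v = v} \<subseteq> grading \<alpha> i"
  proof
    fix v assume "v \<in> {v. PS (G i) v = v}"
    then have "v = (\<Sum>\<kappa>\<in>G i. proj \<kappa> v)" by (simp add: PS_def)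
    also have "\<dots> \<in> grading \<alpha> i"
      unfolding grading_def
    proof (intro span_sum span_base)
      fix \<kappa> assume \<kappa>: "\<kappa> \<in> G i"
      have p: "proj \<kappa> v \<in> rs \<kappa>" using \<kappa> G_sub by (intro proj_rs W_dual) blast
      show "proj \<kappa> v \<in> (if i = 0 then H else {}) \<union> (\<Union>\<gamma>\<in>D i. rs \<gamma>)"
      proof (cases "\<kappa> = 0")
        case True
        then show ?thesis using p \<kappa> rs_0 h_zero by (simp add: G_def)
      next
        case False
        then have "\<kappa> \<in> D i" using \<kappa> by (simp add: G_def D_iff)
        then show ?thesis using p by blast
      qed
    qed
    finally show "v \<in> grading \<alpha> i" .
  qed
qed

lemma subspace_grading: "subspace (grading \<alpha> i)"
  by (simp add: grading_def)

lemma rs_grading: "\<kappa> \<in> W \<Longrightarrow> rs \<kappa> \<subseteq> grading \<alpha> (h \<kappa>)"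
  using PS_of_rs[OF finite_G W_dual, of \<kappa> _ "h \<kappa>"] by (auto simp: grading_eq G_def)

lemma bracket_grading:
  assumes x: "x \<in> grading \<alpha> i" and y: "y \<in> grading \<alpha> j" shows "bracket x y \<in> grading \<alpha> (i + j)"
proof -
  have "x = (\<Sum>\<kappa>\<in>G i. proj \<kappa> x)" "y = (\<Sum>\<mu>\<in>G j. proj \<mu> y)"
    using x y by (simp_all add: grading_eq PS_def)
  then have "bracket x y = bracket (\<Sum>\<kappa>\<in>G i. proj \<kappa> x) (\<Sum>\<mu>\<in>G j. proj \<mu> y)" by simp
  also have "\<dots> = (\<Sum>\<kappa>\<in>G i. \<Sum>\<mu>\<in>G j. bracket (proj \<kappa> x) (proj \<mu> y))"
    by (simp only: bracket_sum_left) (simp only: bracket_sum_right)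
  also have "\<dots> \<in> grading \<alpha> (i + j)"
  proof (intro subspace_sum subspace_grading)
    fix \<kappa> \<mu> assume \<kappa>: "\<kappa> \<in> G i" and \<mu>: "\<mu> \<in> G j"
    then have W: "\<kappa> \<in> W" "\<mu> \<in> W" and hs: "h (\<kappa> + \<mu>) = i + j"
      using ht_add[OF \<alpha> W_L W_L] by (auto simp: G_def)
    have mem: "bracket (proj \<kappa> x) (proj \<mu> y) \<in> rs (\<kappa> + \<mu>)"
      by (intro rs_bracket proj_rs W_dual W)
    show "bracket (proj \<kappa> x) (proj \<mu> y) \<in> grading \<alpha> (i + j)"
    proof (cases "bracket (proj \<kappa> x) (proj \<mu> y) = 0")
      case True
      then show ?thesis using subspace_0[OF subspace_grading] by simp
    next
      case False
      have "\<kappa> + \<mu> \<in> W" by (rule rs_weight[OF _ mem False]) (intro add_dual W_dual W)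
      then show ?thesis using rs_grading[of "\<kappa> + \<mu>"] mem hs by auto
    qed
  qed
  finally show ?thesis .
qed

lemma rv_grading: "\<gamma> \<in> D i \<Longrightarrow> rv \<gamma> \<in> grading \<alpha> i"
  using rs_grading[of \<gamma>] rv_rs[of \<gamma>] by (auto simp: D_iff)

lemma D_uminus: "\<gamma> \<in> D i \<Longrightarrow> - \<gamma> \<in> D (- i)"
  by (simp add: D_iff uminus_root ht_uminus[OF \<alpha> root_L])

lemma PS_D_expand:
  "PS (D i) v = (\<Sum>\<gamma>\<in>D i. scale (killing v (rv (- \<gamma>))) (rv \<gamma>))"
  unfolding PS_def by (intro sum.cong refl proj_rv) (simp add: D_iff)

lemma grading_expand:
  assumes "v \<in> grading \<alpha> i" "i \<noteq> 0"
  shows "v = (\<Sum>\<gamma>\<in>D i. scale (killing v (rv (- \<gamma>))) (rv \<gamma>))"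
  using assms PS_D_expand[of i v] by (simp add: grading_eq G_eq_D)

lemma inj_on_rv: "inj_on rv R"
proof (rule inj_onI)
  fix \<gamma> \<delta> assume "\<gamma> \<in> R" "\<delta> \<in> R" "rv \<gamma> = rv \<delta>"
  then show "\<gamma> = \<delta>" using killing_rv_rv[of \<gamma> \<delta>] killing_rv[of \<delta>] by (metis zero_neq_one)
qed

lemma dim_grading_1: "dim (grading \<alpha> 1) = m"
proof -
  let ?B = "rv ` D 1"
  have inj: "inj_on rv (D 1)" by (rule inj_on_subset[OF inj_on_rv D_sub])
  have fin: "finite ?B" using finite_D by simp
  have "independent ?B"
  proof (rule independent_if_scalars_zero[OF fin])
    fix f x assume sum0: "(\<Sum>x\<in>?B. scale (f x) x) = 0" and "x \<in> ?B"
    then obtain \<delta> where \<delta>: "\<delta> \<in> D 1" "x = rv \<delta>" by blast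
    have "0 = killing (\<Sum>\<gamma>\<in>D 1. scale (f (rv \<gamma>)) (rv \<gamma>)) (rv (- \<delta>))"
      using sum0 by (simp add: sum.reindex[OF inj])
    also have "\<dots> = (\<Sum>\<gamma>\<in>D 1. if \<gamma> = \<delta> then f (rv \<delta>) else 0)"
      unfolding killing_sum_left killing_scale_left
      using \<delta>(1) D_sub by (intro sum.cong refl) (auto simp: killing_rv_rv subset_iff)
    finally show "f x = 0" using \<delta> finite_D by simp
  qed
  moreover have "span ?B = grading \<alpha> 1"
  proof
    show "span ?B \<subseteq> grading \<alpha> 1" using rv_grading by (intro span_minimal subspace_grading) auto
    show "grading \<alpha> 1 \<subseteq> span ?B"
    proof
      fix v assume "v \<in> grading \<alpha> 1"
      then have "v = (\<Sum>\<gamma>\<in>D 1. scale (killing v (rv (- \<gamma>))) (rv \<gamma>))" by (rule grading_expand) simp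
      also have "\<dots> \<in> span ?B" by (intro span_sum span_scale span_base imageI)
      finally show "v \<in> span ?B" .
    qed
  qed
  ultimately have "dim (grading \<alpha> 1) = card ?B" using dim_span_eq_card_independent by metis
  then show ?thesis by (simp add: card_image[OF inj])
qed


subsection \<open>Traces on graded pieces\<close>

lemma bracket_PS_G:
  assumes \<gamma>: "\<gamma> \<in> R" and x: "x \<in> rs \<gamma>"
  shows "bracket x (PS (G i) v) = PS (G (i + h \<gamma>)) (bracket x v)"
proof -
  have comp: "bracket x (PS (G i) (proj \<kappa> v)) = PS (G (i + h \<gamma>)) (bracket x (proj \<kappa> v))"
    if \<kappa>: "\<kappa> \<in> W" for \<kappa>
  proof -
    note d = W_dual[OF \<kappa>]
    have mem: "bracket x (proj \<kappa> v) \<in> rs (\<gamma> + \<kappa>)" by (rule rs_bracket[OF x proj_rs[OF d]])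
    show ?thesis
    proof (cases "bracket x (proj \<kappa> v) = 0")
      case True
      then show ?thesis
        by (simp add: PS_of_rs[OF finite_G d proj_rs[OF d]] lin_zero[OF lin_PS])
    next
      case False
      have gk: "\<gamma> + \<kappa> \<in> W" by (rule rs_weight[OF add_dual[OF root_dual[OF \<gamma>] d] mem False])
      have "\<gamma> + \<kappa> \<in> G (i + h \<gamma>) \<longleftrightarrow> \<kappa> \<in> G i"
        using gk \<kappa> ht_add[OF \<alpha> root_L[OF \<gamma>] W_L[OF \<kappa>]] by (auto simp: G_def)
      then show ?thesis
        by (simp add: PS_of_rs[OF finite_G d proj_rs[OF d]]
            PS_of_rs[OF finite_G add_dual[OF root_dual[OF \<gamma>] d] mem])
    qed
  qed
  have "bracket x (PS (G i) (\<Sum>\<kappa>\<in>W. proj \<kappa> v)) = PS (G (i + h \<gamma>)) (bracket x (\<Sum>\<kappa>\<in>W. proj \<kappa> v))"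
    unfolding bracket_sum_right lin_sum[OF lin_PS] by (intro sum.cong refl comp)
  then show ?thesis by (simp only: sum_proj_W)
qed

definition T :: "('g \<Rightarrow> 'k) \<Rightarrow> int \<Rightarrow> 'k" where
  "T \<gamma> i = trace (\<lambda>v. bracket (rv (- \<gamma>)) (bracket (rv \<gamma>) (PS (G i) v)))"

text \<open>The trace of \<open>ad x \<circ> ad y\<close> on \<open>g(i)\<close> is the trace of \<open>ad y \<circ> ad x\<close> on \<open>g(i - 1)\<close>; on the other hand
  the two operators differ on \<open>g(i)\<close> by \<open>ad (tv \<gamma>)\<close>.\<close>

lemma trace_swap_G:
  assumes \<gamma>: "\<gamma> \<in> D 1"
  shows "trace (\<lambda>v. bracket (rv \<gamma>) (bracket (rv (- \<gamma>)) (PS (G i) v))) = T \<gamma> (i - 1)"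
    and "trace (\<lambda>v. bracket (rv \<gamma>) (bracket (rv (- \<gamma>)) (PS (G i) v)))
      = T \<gamma> i + ip (\<Sum>(G i)) \<gamma>"
proof -
  have R: "\<gamma> \<in> R" "- \<gamma> \<in> R" and hs: "h \<gamma> = 1" "h (- \<gamma>) = - 1"
    using \<gamma> D_uminus[OF \<gamma>] by (simp_all add: D_iff)
  let ?x = "rv \<gamma>" and ?y = "rv (- \<gamma>)"
  have "trace (\<lambda>v. bracket ?x (bracket ?y (PS (G i) v))) = trace (\<lambda>v. bracket ?y (PS (G i) (bracket ?x v)))"
    by (rule trace_comm[OF lin_bracket lin_comp[OF lin_bracket lin_PS]])
  also have "\<dots> = T \<gamma> (i - 1)"
    unfolding T_def by (simp add: bracket_PS_G[OF R(1) rv_rs[OF R(1)]] hs)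
  finally show "trace (\<lambda>v. bracket ?x (bracket ?y (PS (G i) v))) = T \<gamma> (i - 1)" .
  have "bracket ?x (bracket ?y z) = bracket (tv \<gamma>) z + bracket ?y (bracket ?x z)" for z
    unfolding bracket_rv[OF R(1), symmetric] by (rule bracket_derivation)
  then have "trace (\<lambda>v. bracket ?x (bracket ?y (PS (G i) v)))
      = trace (\<lambda>v. bracket (tv \<gamma>) (PS (G i) v)) + T \<gamma> i"
    by (simp add: T_def trace_plus)
  also have "trace (\<lambda>v. bracket (tv \<gamma>) (PS (G i) v)) = (\<Sum>\<kappa>\<in>G i. \<kappa> (tv \<gamma>) * of_nat (dim (rs \<kappa>)))"
    by (rule trace_PS[OF G_sub tv(1)[OF root_dual[OF R(1)]]])
  also have "\<dots> = (\<Sum>\<kappa>\<in>G i. ip \<kappa> \<gamma>)"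
  proof (rule sum.cong[OF refl])
    fix \<kappa> assume "\<kappa> \<in> G i"
    then show "\<kappa> (tv \<gamma>) * of_nat (dim (rs \<kappa>)) = ip \<kappa> \<gamma>"
      using G_sub root_multiples(1)[of \<kappa>] by (cases "\<kappa> = 0") (auto simp: ip_def)
  qed
  finally show "trace (\<lambda>v. bracket ?x (bracket ?y (PS (G i) v))) = T \<gamma> i + ip (\<Sum>(G i)) \<gamma>"
    by (simp only: ip_sum add.commute)
qed

lemma T_step: "\<gamma> \<in> D 1 \<Longrightarrow> T \<gamma> (i - 1) = T \<gamma> i + ip (\<Sum>(G i)) \<gamma>"
  using trace_swap_G by metis

lemma ip_sum_G: "\<gamma> \<in> D 1 \<Longrightarrow> i \<noteq> 0 \<Longrightarrow> ip (\<Sum>(G i)) \<gamma> = of_rat (of_int (Q i) * c)"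
  using ip_sum_D_L[of i \<gamma>] ip_sym[OF L_dual[OF sum_D_L] L_dual, of \<gamma> i]
  by (simp add: G_eq_D D_iff root_L of_rat_mult)

lemma ip_sum_G_0:
  assumes "\<gamma> \<in> D 1" shows "ip (\<Sum>(G 0)) \<gamma> = 0"
proof -
  have img: "uminus ` D 0 = D 0"
    using D_uminus[of _ 0] by (auto intro!: image_eqI[of _ uminus "- _"])
  have "\<Sum>(D 0) = (\<Sum>\<gamma>\<in>uminus ` D 0. \<gamma>)" by (simp only: img)
  also have "\<dots> = - \<Sum>(D 0)" by (simp add: sum.reindex sum_negf inj_on_def)
  finally have "ip (\<Sum>(D 0)) \<gamma> = - ip (\<Sum>(D 0)) \<gamma>" by (metis ip_uminus)
  then have "ip (\<Sum>(D 0)) \<gamma> = 0" by simp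
  moreover have "\<Sum>(G 0) = \<Sum>(D 0)" unfolding G_0 using finite_D h_zero zero_not_root by (simp add: D_iff)
  ultimately show ?thesis by simp
qed

text \<open>Telescoping downwards from \<open>T \<gamma> d = 0\<close>.\<close>

lemma T_sum:
  assumes \<gamma>: "\<gamma> \<in> D 1" shows "0 \<le> j \<Longrightarrow> j \<le> d \<Longrightarrow> T \<gamma> j = of_rat (of_int (\<Sum>i=j+1..d. Q i) * c)"
proof (induction "nat (d - j)" arbitrary: j)
  case 0
  then have j: "j = d" by simp
  have R: "\<gamma> \<in> R" "h \<gamma> = 1" using \<gamma> by (simp_all add: D_iff)
  have "G (d + 1) = {}" using D_empty[of "d + 1"] d_pos by (simp add: G_eq_D)
  then have "bracket (rv \<gamma>) (PS (G d) v) = 0" for v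
    using bracket_PS_G[OF R(1) rv_rs[OF R(1)], of d v] R(2) by (simp add: PS_def)
  then show ?case by (simp add: T_def j trace_zero)
next
  case (Suc k)
  then have IH: "T \<gamma> (j + 1) = of_rat (of_int (\<Sum>i=j+1+1..d. Q i) * c)" and lt: "j < d" by auto
  have "T \<gamma> j = T \<gamma> (j + 1) + of_rat (of_int (Q (j + 1)) * c)"
    using T_step[OF \<gamma>, of "j + 1"] ip_sum_G[OF \<gamma>, of "j + 1"] Suc.prems(1) by simp
  also have "\<dots> = of_rat (of_int (Q (j + 1) + (\<Sum>i=j+1+1..d. Q i)) * c)"
    unfolding IH by (simp add: of_rat_add[symmetric] distrib_right add.commute)
  also have "Q (j + 1) + (\<Sum>i=j+1+1..d. Q i) = (\<Sum>i=j+1..d. Q i)"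
  proof -
    have "{j+1..d} = insert (j + 1) {j+1+1..d}" using lt by auto
    then show ?thesis by simp
  qed
  finally show ?case .
qed

lemma T_0: "\<gamma> \<in> D 1 \<Longrightarrow> T \<gamma> 0 = of_rat (of_int q * c)"
  using T_sum[of \<gamma> 0] d_pos by (simp add: q_def)

lemma T_1: "\<gamma> \<in> D 1 \<Longrightarrow> T \<gamma> 1 = of_rat (of_int (q - Q 1) * c)"
  using T_0 T_step[of \<gamma> 1] ip_sum_G[of \<gamma> 1] by (simp add: of_rat_diff left_diff_distrib)

text \<open>An operator that shifts all weights by \<open>\<nu> \<noteq> 0\<close> has no diagonal part.\<close>

lemma trace_shift_zero:
  assumes f: "lin f" and \<nu>: "\<nu> \<in> dual_space H" "\<nu> \<noteq> 0"
    and sh: "\<And>\<kappa> v. \<kappa> \<in> W \<Longrightarrow> v \<in> rs \<kappa> \<Longrightarrow> f v \<in> rs (\<kappa> + \<nu>)"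
  shows "trace f = 0"
proof -
  have "trace (\<lambda>v. f (proj \<kappa> v)) = 0" if \<kappa>: "\<kappa> \<in> W" for \<kappa>
  proof -
    note d = W_dual[OF \<kappa>]
    have "proj \<kappa> (proj \<kappa> v) = proj \<kappa> v" for v using proj_of_rs[OF d proj_rs[OF d]] by simp
    then have "trace (\<lambda>v. f (proj \<kappa> v)) = trace (\<lambda>v. f (proj \<kappa> (proj \<kappa> v)))" by simp
    also have "\<dots> = trace (\<lambda>v. proj \<kappa> (f (proj \<kappa> v)))"
      by (rule trace_comm[OF lin_comp[OF f lin_proj] lin_proj])
    also have "\<dots> = 0"
    proof -
      have "proj \<kappa> (f (proj \<kappa> v)) = 0" for v
        using proj_of_rs[OF add_dual[OF d \<nu>(1)] sh[OF \<kappa> proj_rs[OF d]]] \<nu>(2) by simp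
      then show ?thesis by (simp add: trace_zero)
    qed
    finally show ?thesis .
  qed
  moreover have "f = (\<lambda>v. \<Sum>\<kappa>\<in>W. f (proj \<kappa> v))"
    by (simp only: lin_sum[OF f, symmetric] sum_proj_W)
  then have "trace f = trace (\<lambda>v. \<Sum>\<kappa>\<in>W. f (proj \<kappa> v))" by (rule arg_cong)
  ultimately show ?thesis by (simp only: trace_sum sum.neutral_const cong: sum.cong)
qed

end


subsection \<open>Contractions with dual bases\<close>

locale casimir_grading = simple_grading scale Basis bracket H \<Pi> \<alpha>
  for scale :: "'k::{alg_closed_field, field_char_0} \<Rightarrow> 'g::ab_group_add \<Rightarrow> 'g"
    and Basis :: "'g set" and bracket :: "'g \<Rightarrow> 'g \<Rightarrow> 'g"
    and H :: "'g set" and \<Pi> :: "('g \<Rightarrow> 'k) set" and \<alpha> :: "'g \<Rightarrow> 'k" +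
  fixes n :: nat and e e' :: "nat \<Rightarrow> 'g"
  assumes dual: "dual_bases (grading \<alpha> 0) n e e'"
begin

abbreviation g0 :: "'g set" where "g0 \<equiv> grading \<alpha> 0"
abbreviation g1 :: "'g set" where "g1 \<equiv> grading \<alpha> 1"

lemma e_g0: "l < n \<Longrightarrow> e l \<in> g0" and e'_g0: "l < n \<Longrightarrow> e' l \<in> g0"
  using dual by (auto simp: dual_bases_def intro: span_base)

lemma killing_dual: "k < n \<Longrightarrow> l < n \<Longrightarrow> killing (e k) (e' l) = (if k = l then 1 else 0)"
  using dual by (auto simp: dual_bases_def)

lemma span_image_combination:
  fixes f :: "nat \<Rightarrow> 'g" shows "z \<in> span (f ` {..<n}) \<Longrightarrow> \<exists>a. z = (\<Sum>l<n. scale (a l) (f l))"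
proof (induction rule: span_induct_alt)
  case base
  show ?case by (intro exI[of _ "\<lambda>_. 0"]) simp
next
  case (step t x y)
  then obtain k a where k: "k < n" "x = f k" and a: "y = (\<Sum>l<n. scale (a l) (f l))" by blast
  have "scale t x + y = (\<Sum>l<n. (if l = k then scale t x else 0) + scale (a l) (f l))"
    using k(1) by (simp add: sum.distrib a)
  also have "\<dots> = (\<Sum>l<n. scale ((if l = k then t else 0) + a l) (f l))"
    by (intro sum.cong refl) (simp add: k(2) scale_left_distrib)
  finally show ?case by (rule exI[of "\<lambda>a. scale t x + y = (\<Sum>l<n. scale (a l) (f l))"])
qed

lemma expand_e':
  assumes "z \<in> g0" shows "z = (\<Sum>l<n. scale (killing (e l) z) (e' l))"
proof -
  have "z \<in> span (e' ` {..<n})" using assms dual by (simp add: dual_bases_def)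
  then obtain a where a: "z = (\<Sum>l<n. scale (a l) (e' l))" using span_image_combination by blast
  have "killing (e k) z = a k" if "k < n" for k
  proof -
    have "killing (e k) z = (\<Sum>l<n. if l = k then a k else 0)"
      unfolding a killing_sum_right killing_scale_right
      using that by (intro sum.cong refl) (auto simp: killing_dual)
    then show ?thesis using that by simp
  qed
  then show ?thesis using a by simp
qed

lemma expand_e:
  assumes "z \<in> g0" shows "z = (\<Sum>l<n. scale (killing z (e' l)) (e l))"
proof -
  have "z \<in> span (e ` {..<n})" using assms dual by (simp add: dual_bases_def)
  then obtain a where a: "z = (\<Sum>l<n. scale (a l) (e l))" using span_image_combination by blast
  have "killing z (e' k) = a k" if "k < n" for k
  proof -
    have "killing z (e' k) = (\<Sum>l<n. if l = k then a k else 0)"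
      unfolding a killing_sum_left killing_scale_left
      using that by (intro sum.cong refl) (auto simp: killing_dual)
    then show ?thesis using that by simp
  qed
  then show ?thesis using a by simp
qed

lemma contract_killing:
  assumes "u \<in> g0" "w \<in> g0" shows "(\<Sum>l<n. killing (e l) u * killing (e' l) w) = killing u w"
proof -
  have "killing u w = killing (\<Sum>l<n. scale (killing (e l) u) (e' l)) w"
    using expand_e'[OF assms(1)] by simp
  then show ?thesis by (simp add: killing_sum_left killing_scale_left)
qed

definition bilinear_g0 :: "('g \<Rightarrow> 'g \<Rightarrow> 'k) \<Rightarrow> bool" where
  "bilinear_g0 F \<longleftrightarrow>
     (\<forall>x\<in>g0. \<forall>y\<in>g0. \<forall>z\<in>g0. F (x + y) z = F x z + F y z \<and> F z (x + y) = F z x + F z y) \<and>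
     (\<forall>t. \<forall>x\<in>g0. \<forall>z\<in>g0. F (scale t x) z = t * F x z \<and> F z (scale t x) = t * F z x)"

lemma bilinear_g0_sum:
  assumes F: "bilinear_g0 F" and z: "z \<in> g0" and f: "\<And>i. i \<in> I \<Longrightarrow> f i \<in> g0"
  shows "F (\<Sum>i\<in>I. scale (a i) (f i)) z = (\<Sum>i\<in>I. a i * F (f i) z)"
    and "F z (\<Sum>i\<in>I. scale (a i) (f i)) = (\<Sum>i\<in>I. a i * F z (f i))"
proof -
  have g0_0: "0 \<in> g0" by (rule subspace_0[OF subspace_grading])
  have F0: "F 0 z = 0" "F z 0 = 0"
    using F z g0_0 unfolding bilinear_g0_def by (metis mult_zero_left scale_zero_left)+
  have mem: "(\<Sum>i\<in>J. scale (a i) (f i)) \<in> g0" if "J \<subseteq> I" for J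
    using that f by (intro subspace_sum subspace_scale subspace_grading) auto
  have "J \<subseteq> I \<Longrightarrow> F (\<Sum>i\<in>J. scale (a i) (f i)) z = (\<Sum>i\<in>J. a i * F (f i) z)
      \<and> F z (\<Sum>i\<in>J. scale (a i) (f i)) = (\<Sum>i\<in>J. a i * F z (f i))" for J
  proof (induction J rule: infinite_finite_induct)
    case (insert i J)
    have "scale (a i) (f i) \<in> g0" using insert.prems f by (intro subspace_scale subspace_grading) auto
    moreover have "F (scale (a i) (f i)) z = a i * F (f i) z" "F z (scale (a i) (f i)) = a i * F z (f i)"
      using F z f insert.prems unfolding bilinear_g0_def by auto
    ultimately show ?case
      using insert mem[of J] F z unfolding bilinear_g0_def by simp
  qed (simp_all add: F0)
  then show "F (\<Sum>i\<in>I. scale (a i) (f i)) z = (\<Sum>i\<in>I. a i * F (f i) z)"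
    and "F z (\<Sum>i\<in>I. scale (a i) (f i)) = (\<Sum>i\<in>I. a i * F z (f i))" by blast+
qed

text \<open>The Casimir tensor \<open>\<Sum>l. e' l \<otimes> e l\<close> is invariant: expanding \<open>[x, e l]\<close> and \<open>[x, e' l]\<close> in the dual bases
  gives opposite coefficients, because the Killing form is invariant.\<close>

lemma contraction_invariant:
  assumes F: "bilinear_g0 F" and x: "x \<in> g0"
  shows "(\<Sum>l<n. F (bracket x (e' l)) (e l)) + (\<Sum>l<n. F (e' l) (bracket x (e l))) = 0"
proof -
  have br: "bracket x z \<in> g0" if "z \<in> g0" for z using bracket_grading[OF x that] by simp
  have "(\<Sum>l<n. F (e' l) (bracket x (e l))) = (\<Sum>l<n. \<Sum>j<n. killing (bracket x (e l)) (e' j) * F (e' l) (e j))"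
  proof (rule sum.cong[OF refl])
    fix l assume "l \<in> {..<n}"
    then have "F (e' l) (\<Sum>j<n. scale (killing (bracket x (e l)) (e' j)) (e j))
        = (\<Sum>j<n. killing (bracket x (e l)) (e' j) * F (e' l) (e j))"
      by (intro bilinear_g0_sum(2)[OF F]) (auto simp: e_g0 e'_g0)
    then show "F (e' l) (bracket x (e l)) = (\<Sum>j<n. killing (bracket x (e l)) (e' j) * F (e' l) (e j))"
      using expand_e[OF br[OF e_g0], of l] \<open>l \<in> {..<n}\<close> by simp
  qed
  moreover have "(\<Sum>j<n. F (bracket x (e' j)) (e j)) = (\<Sum>j<n. \<Sum>l<n. killing (e l) (bracket x (e' j)) * F (e' l) (e j))"
  proof (rule sum.cong[OF refl])
    fix j assume "j \<in> {..<n}"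
    then have "F (\<Sum>l<n. scale (killing (e l) (bracket x (e' j))) (e' l)) (e j)
        = (\<Sum>l<n. killing (e l) (bracket x (e' j)) * F (e' l) (e j))"
      by (intro bilinear_g0_sum(1)[OF F]) (auto simp: e_g0 e'_g0)
    then show "F (bracket x (e' j)) (e j) = (\<Sum>l<n. killing (e l) (bracket x (e' j)) * F (e' l) (e j))"
      using expand_e'[OF br[OF e'_g0], of j] \<open>j \<in> {..<n}\<close> by simp
  qed
  moreover have "(\<Sum>j<n. \<Sum>l<n. killing (e l) (bracket x (e' j)) * F (e' l) (e j))
      = (\<Sum>l<n. \<Sum>j<n. killing (e l) (bracket x (e' j)) * F (e' l) (e j))"
    by (rule sum.swap)
  moreover have "killing (e l) (bracket x (e' j)) = - killing (bracket x (e l)) (e' j)" for l j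
  proof -
    have "killing (e l) (bracket x (e' j)) = killing (bracket (e l) x) (e' j)" by (rule killing_invariant[symmetric])
    also have "bracket (e l) x = - bracket x (e l)" by (rule bracket_swap)
    finally show ?thesis by (simp add: killing_minus_left)
  qed
  ultimately show ?thesis by (simp add: sum_negf)
qed

lemma proj_0_g0: "proj 0 z \<in> g0"
  using rs_grading[of 0] proj_rs[OF zero_dual, of z] h_zero by auto

text \<open>The Casimir tensor does not depend on the dual bases, so its part outside \<open>H\<close> can be written with root
  vectors.\<close>

lemma contraction_split:
  assumes F: "bilinear_g0 F"
  shows "(\<Sum>l<n. F (e' l) (e l)) = (\<Sum>l<n. F (e' l) (proj 0 (e l))) + (\<Sum>\<beta>\<in>D 0. F (rv (- \<beta>)) (rv \<beta>))"
proof -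
  have rvm: "rv (- \<beta>) \<in> g0" if "\<beta> \<in> D 0" for \<beta> using rv_grading[OF D_uminus[OF that]] by simp
  have step: "F (e' l) (e l) = F (e' l) (proj 0 (e l)) + (\<Sum>\<beta>\<in>D 0. killing (e l) (rv (- \<beta>)) * F (e' l) (rv \<beta>))"
    if l: "l < n" for l
  proof -
    have "e l = PS (G 0) (e l)" using e_g0[OF l] by (simp add: grading_eq)
    also have "\<dots> = proj 0 (e l) + PS (D 0) (e l)"
      unfolding G_0 PS_def using finite_D zero_not_root by (simp add: D_iff)
    finally have el: "e l = proj 0 (e l) + (\<Sum>\<beta>\<in>D 0. scale (killing (e l) (rv (- \<beta>))) (rv \<beta>))"
      by (simp only: PS_D_expand)
    have mem: "(\<Sum>\<beta>\<in>D 0. scale (killing (e l) (rv (- \<beta>))) (rv \<beta>)) \<in> g0"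
      by (intro subspace_sum subspace_scale subspace_grading rv_grading)
    have "F (e' l) (proj 0 (e l) + (\<Sum>\<beta>\<in>D 0. scale (killing (e l) (rv (- \<beta>))) (rv \<beta>)))
        = F (e' l) (proj 0 (e l)) + F (e' l) (\<Sum>\<beta>\<in>D 0. scale (killing (e l) (rv (- \<beta>))) (rv \<beta>))"
      using F e'_g0[OF l] mem proj_0_g0 unfolding bilinear_g0_def by blast
    then show ?thesis
      using bilinear_g0_sum(2)[OF F e'_g0[OF l], of "D 0" rv "\<lambda>\<beta>. killing (e l) (rv (- \<beta>))"] rv_grading
      by (simp only: el[symmetric])
  qed
  have "(\<Sum>l<n. \<Sum>\<beta>\<in>D 0. killing (e l) (rv (- \<beta>)) * F (e' l) (rv \<beta>))
      = (\<Sum>\<beta>\<in>D 0. \<Sum>l<n. killing (e l) (rv (- \<beta>)) * F (e' l) (rv \<beta>))"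
    by (rule sum.swap)
  also have "\<dots> = (\<Sum>\<beta>\<in>D 0. F (rv (- \<beta>)) (rv \<beta>))"
  proof (rule sum.cong[OF refl])
    fix \<beta> assume \<beta>: "\<beta> \<in> D 0"
    have "F (\<Sum>l<n. scale (killing (e l) (rv (- \<beta>))) (e' l)) (rv \<beta>)
        = (\<Sum>l<n. killing (e l) (rv (- \<beta>)) * F (e' l) (rv \<beta>))"
      by (rule bilinear_g0_sum(1)[OF F rv_grading[OF \<beta>]]) (simp add: e'_g0)
    then show "(\<Sum>l<n. killing (e l) (rv (- \<beta>)) * F (e' l) (rv \<beta>)) = F (rv (- \<beta>)) (rv \<beta>)"
      using expand_e'[OF rvm[OF \<beta>]] by simp
  qed
  finally show ?thesis by (simp add: step sum.distrib)
qed

text \<open>On \<open>g(1)\<close> the Casimir element is a scalar, because its matrix coefficients are the traces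
  of \<open>ad x \<circ> ad w\<close> on \<open>g(0)\<close>.\<close>

lemma casimir_g1:
  assumes v: "v \<in> g1" shows "(\<Sum>l<n. bracket (e' l) (bracket (e l) v)) = scale (of_rat (of_int q * c)) v"
proof -
  \<comment> \<open>contracting the Casimir tensor with \<open>v\<close> projects \<open>v\<close> to \<open>g(0)\<close>\<close>
  have P0: "(\<Sum>l<n. scale (killing (e l) v) (e' l)) = PS (G 0) v" for v
  proof -
    have mem: "PS (G 0) v \<in> g0"
    proof -
      have "PS (G 0) (PS (G 0) v) = PS (G 0) v"
        unfolding PS_def[of _ v] lin_sum[OF lin_PS]
        using G_sub by (intro sum.cong refl) (simp add: PS_of_rs[OF finite_G W_dual proj_rs[OF W_dual]] subset_iff)
      then show ?thesis by (simp add: grading_eq)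
    qed
    have "killing (e l) v = killing (e l) (PS (G 0) v)" if l: "l < n" for l
    proof -
      have "killing (e l) (proj \<kappa> v) = 0" if \<kappa>: "\<kappa> \<in> W" "\<kappa> \<notin> G 0" for \<kappa>
      proof -
        have "e l = (\<Sum>\<mu>\<in>G 0. proj \<mu> (e l))" using e_g0[OF l] by (simp add: grading_eq PS_def)
        then have "killing (e l) (proj \<kappa> v) = (\<Sum>\<mu>\<in>G 0. killing (proj \<mu> (e l)) (proj \<kappa> v))"
          by (metis killing_sum_left)
        also have "\<dots> = 0"
        proof (rule sum.neutral, rule ballI)
          fix \<mu> assume \<mu>: "\<mu> \<in> G 0"
          then have \<mu>W: "\<mu> \<in> W" using G_sub by blast
          have "\<mu> + \<kappa> \<noteq> 0"
          proof
            assume "\<mu> + \<kappa> = 0"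
            then have "h (\<mu> + \<kappa>) = 0" by (simp only: h_zero)
            then have "h \<kappa> = 0" using \<mu> ht_add[OF \<alpha> W_L[OF \<mu>W] W_L[OF \<kappa>(1)]] by (simp add: G_def)
            then show False using \<kappa> by (simp add: G_def)
          qed
          then show "killing (proj \<mu> (e l)) (proj \<kappa> v) = 0"
            by (intro killing_rs_zero[OF proj_rs proj_rs] W_dual \<mu>W \<kappa>)
        qed
        finally show ?thesis .
      qed
      then have "(\<Sum>\<kappa>\<in>W. killing (e l) (proj \<kappa> v)) = (\<Sum>\<kappa>\<in>G 0. killing (e l) (proj \<kappa> v))"
        by (intro sum.mono_neutral_right finite_W G_sub) blast
      then show ?thesis by (simp only: killing_sum_right[symmetric] sum_proj_W PS_def)
    qed
    then have "(\<Sum>l<n. scale (killing (e l) v) (e' l)) = (\<Sum>l<n. scale (killing (e l) (PS (G 0) v)) (e' l))"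
      by simp
    also have "\<dots> = PS (G 0) v" by (rule expand_e'[OF mem, symmetric])
    finally show ?thesis .
  qed
  have coeff: "killing (\<Sum>l<n. bracket (e' l) (bracket (e l) (rv \<gamma>))) (rv (- \<delta>))
      = (if \<gamma> = \<delta> then of_rat (of_int q * c) else 0)" if \<gamma>: "\<gamma> \<in> D 1" and \<delta>: "\<delta> \<in> D 1" for \<gamma> \<delta>
  proof -
    let ?x = "rv \<gamma>" and ?w = "rv (- \<delta>)"
    have R: "\<gamma> \<in> R" "- \<delta> \<in> R" using \<gamma> \<delta> uminus_root by (auto simp: D_iff)
    \<comment> \<open>this exhibits the coefficient as a sum of traces of operators of rank one\<close>
    have one: "killing (bracket a (bracket b ?x)) ?w = killing b (bracket ?x (bracket ?w a))" for a b
    proof -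
      have "bracket a (bracket b ?x) = - bracket (bracket b ?x) a" by (rule bracket_swap)
      then have "killing (bracket a (bracket b ?x)) ?w = - killing (bracket b ?x) (bracket a ?w)"
        by (simp add: killing_minus_left killing_invariant)
      also have "bracket a ?w = - bracket ?w a" by (rule bracket_swap)
      also have "- killing (bracket b ?x) (- bracket ?w a) = killing b (bracket ?x (bracket ?w a))"
        by (simp only: killing_minus_right minus_minus killing_invariant)
      finally show ?thesis .
    qed
    have "killing (\<Sum>l<n. bracket (e' l) (bracket (e l) ?x)) ?w
        = (\<Sum>l<n. trace (\<lambda>v. scale (killing (e l) v) (bracket ?x (bracket ?w (e' l)))))"
      by (simp only: killing_sum_left one trace_rank_one[OF lform_killing])
    also have "\<dots> = trace (\<lambda>v. bracket ?x (bracket ?w (\<Sum>l<n. scale (killing (e l) v) (e' l))))"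
      by (simp only: trace_sum[symmetric] bracket_sum_right bracket_scale_right)
    also have "\<dots> = trace (\<lambda>v. bracket ?x (bracket ?w (PS (G 0) v)))" by (simp only: P0)
    also have "\<dots> = (if \<gamma> = \<delta> then of_rat (of_int q * c) else 0)"
    proof (cases "\<gamma> = \<delta>")
      case True
      then show ?thesis
        using trace_swap_G(2)[OF \<gamma>, of 0] T_0[OF \<gamma>] ip_sum_G_0[OF \<gamma>] by simp
    next
      case False
      have "trace (\<lambda>v. bracket ?x (bracket ?w (PS (G 0) v))) = 0"
      proof (rule trace_shift_zero[OF lin_comp[OF lin_bracket lin_comp[OF lin_bracket lin_PS]]])
        show "\<gamma> + - \<delta> \<in> dual_space H" by (intro add_dual root_dual R)
        show "\<gamma> + - \<delta> \<noteq> 0" using False by (simp add: add_eq_0_iff)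
        fix \<kappa> v assume \<kappa>: "\<kappa> \<in> W" "v \<in> rs \<kappa>"
        have "PS (G 0) v \<in> rs \<kappa>"
          using PS_of_rs[OF finite_G W_dual[OF \<kappa>(1)] \<kappa>(2)] \<kappa>(2) subspace_0[OF subspace_rs] by simp
        then have "bracket ?x (bracket ?w (PS (G 0) v)) \<in> rs (\<gamma> + (- \<delta> + \<kappa>))"
          by (intro rs_bracket rv_rs R)
        also have "\<gamma> + (- \<delta> + \<kappa>) = \<kappa> + (\<gamma> + - \<delta>)" by (simp only: ac_simps)
        finally show "bracket ?x (bracket ?w (PS (G 0) v)) \<in> rs (\<kappa> + (\<gamma> + - \<delta>))" .
      qed
      then show ?thesis using False by simp
    qed
    finally show ?thesis .
  qed
  have rv_case: "(\<Sum>l<n. bracket (e' l) (bracket (e l) (rv \<gamma>))) = scale (of_rat (of_int q * c)) (rv \<gamma>)"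
    if \<gamma>: "\<gamma> \<in> D 1" for \<gamma>
  proof -
    let ?u = "\<Sum>l<n. bracket (e' l) (bracket (e l) (rv \<gamma>))"
    have "bracket (e' l) (bracket (e l) (rv \<gamma>)) \<in> g1" if "l < n" for l
      using bracket_grading[OF e'_g0[OF that] bracket_grading[OF e_g0[OF that] rv_grading[OF \<gamma>]]] by simp
    then have "?u \<in> g1" by (intro subspace_sum subspace_grading) simp
    then have "?u = (\<Sum>\<delta>\<in>D 1. scale (killing ?u (rv (- \<delta>))) (rv \<delta>))" by (rule grading_expand) simp
    also have "\<dots> = (\<Sum>\<delta>\<in>D 1. if \<delta> = \<gamma> then scale (of_rat (of_int q * c)) (rv \<gamma>) else 0)"
      by (intro sum.cong refl) (auto simp: coeff[OF \<gamma>])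
    finally show ?thesis using finite_D \<gamma> by simp
  qed
  let ?a = "\<lambda>\<gamma>. killing v (rv (- \<gamma>))"
  have v_eq: "v = (\<Sum>\<gamma>\<in>D 1. scale (?a \<gamma>) (rv \<gamma>))" using grading_expand[OF v] by simp
  have "(\<Sum>l<n. bracket (e' l) (bracket (e l) (\<Sum>\<gamma>\<in>D 1. scale (?a \<gamma>) (rv \<gamma>))))
      = (\<Sum>\<gamma>\<in>D 1. scale (?a \<gamma>) (\<Sum>l<n. bracket (e' l) (bracket (e l) (rv \<gamma>))))"
    by (simp only: bracket_sum_right bracket_scale_right scale_sum_right) (rule sum.swap)
  also have "\<dots> = (\<Sum>\<gamma>\<in>D 1. scale (of_rat (of_int q * c)) (scale (?a \<gamma>) (rv \<gamma>)))"
    by (intro sum.cong refl) (simp only: rv_case scale_left_commute)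
  also have "\<dots> = scale (of_rat (of_int q * c)) (\<Sum>\<gamma>\<in>D 1. scale (?a \<gamma>) (rv \<gamma>))"
    by (simp only: scale_sum_right)
  finally show ?thesis by (simp only: v_eq[symmetric])
qed

text \<open>By \<open>contract_killing\<close> both sums are values of the Killing form, and the Jacobi identity combines them.
  When \<open>z\<close> and \<open>w\<close> are the opposites of two root vectors of degree 1, the left hand side is the
  coefficient of the wedge product of these in \<open>\<Sum>l. [e l, x] \<and> [e' l, y]\<close>, which therefore depends
  only on \<open>[x, y]\<close>.\<close>

lemma contract_pair_coefficient:
  assumes "x \<in> g1" "y \<in> g1" "z \<in> grading \<alpha> (- 1)" "w \<in> grading \<alpha> (- 1)"
  shows "(\<Sum>l<n. killing (bracket (e l) x) z * killing (bracket (e' l) y) w)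
       - (\<Sum>l<n. killing (bracket (e l) x) w * killing (bracket (e' l) y) z) = killing (bracket x y) (bracket z w)"
proof -
  have g0: "bracket a b \<in> g0" if "a \<in> g1" "b \<in> grading \<alpha> (- 1)" for a b
    using bracket_grading[OF that] by simp
  have "(\<Sum>l<n. killing (bracket (e l) x) z * killing (bracket (e' l) y) w) = killing (bracket x z) (bracket y w)"
    if "z \<in> grading \<alpha> (- 1)" "w \<in> grading \<alpha> (- 1)" for z w
    using contract_killing[OF g0[OF assms(1) that(1)] g0[OF assms(2) that(2)]]
    by (simp only: killing_invariant)
  then have "?thesis \<longleftrightarrow> killing (bracket x z) (bracket y w) - killing (bracket x w) (bracket y z)
      = killing (bracket x y) (bracket z w)"
    using assms(3,4) by simp
  moreover have "killing (bracket x z) (bracket y w) = killing (bracket x w) (bracket y z) + killing (bracket x y) (bracket z w)"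
  proof -
    have "killing (bracket x z) (bracket y w) = killing x (bracket (bracket z y) w) + killing x (bracket y (bracket z w))"
      by (simp only: killing_invariant bracket_derivation[of z y w] killing_add_right)
    also have "bracket (bracket z y) w = bracket w (bracket y z)"
      by (subst bracket_swap[of "bracket z y" w], subst bracket_swap[of z y])
        (simp only: bracket_minus_right minus_minus)
    finally show ?thesis by (simp only: killing_invariant)
  qed
  ultimately show ?thesis by simp
qed

text \<open>The structure constants in which the eigenvalues of products of root vectors are expressed.\<close>

definition N :: "('g \<Rightarrow> 'k) \<Rightarrow> ('g \<Rightarrow> 'k) \<Rightarrow> 'k" where
  "N \<gamma> \<delta> = killing (bracket (rv \<gamma>) (rv \<delta>)) (bracket (rv (- \<gamma>)) (rv (- \<delta>)))"

text \<open>The constants \<open>- N \<gamma> \<delta>\<close> are the diagonal entries of \<open>ad (rv (- \<gamma>)) \<circ> ad (rv \<gamma>)\<close> on \<open>g(1)\<close>.\<close>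

lemma sum_N:
  assumes \<gamma>: "\<gamma> \<in> D 1" shows "(\<Sum>\<delta>\<in>D 1. N \<gamma> \<delta>) = - of_rat (of_int (q - Q 1) * c)"
proof -
  let ?x = "rv \<gamma>" and ?y = "rv (- \<gamma>)"
  have N_eq: "N \<gamma> \<delta> = - killing (bracket ?y (bracket ?x (rv \<delta>))) (rv (- \<delta>))" for \<delta>
  proof -
    have "bracket ?y (bracket ?x (rv \<delta>)) = - bracket (bracket ?x (rv \<delta>)) ?y" by (rule bracket_swap)
    then show ?thesis by (simp add: N_def killing_minus_left killing_invariant)
  qed
  have "T \<gamma> 1 = trace (\<lambda>v. \<Sum>\<delta>\<in>D 1. scale (killing v (rv (- \<delta>))) (bracket ?y (bracket ?x (rv \<delta>))))"
    by (simp only: T_def G_eq_D one_neq_zero not_False_eq_True PS_D_expand bracket_sum_right bracket_scale_right)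
  also have "\<dots> = (\<Sum>\<delta>\<in>D 1. killing (bracket ?y (bracket ?x (rv \<delta>))) (rv (- \<delta>)))"
    by (simp only: trace_sum trace_rank_one[OF lform_killing_left])
  finally show ?thesis by (simp only: N_eq sum_negf T_1[OF \<gamma>])
qed

lemma N_sym: "N \<delta> \<gamma> = N \<gamma> \<delta>"
  by (simp add: N_def bracket_swap[of "rv \<delta>" "rv \<gamma>"] bracket_swap[of "rv (- \<delta>)" "rv (- \<gamma>)"]
      killing_minus_left killing_minus_right)

end

section \<open>Exterior powers through alternating forms\<close>

context lie_algebra
begin

text \<open>Alternating multilinear forms: the functions on tuples that respect the relations of the exterior
  power.\<close>

definition alt :: "'g set \<Rightarrow> nat \<Rightarrow> ('g list \<Rightarrow> 'k) \<Rightarrow> bool" where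
  "alt V i f \<longleftrightarrow>
     (\<forall>vs\<in>tuples V i. \<forall>j<i. \<forall>x\<in>V. \<forall>y\<in>V. f (vs[j := x + y]) = f (vs[j := x]) + f (vs[j := y])) \<and>
     (\<forall>vs\<in>tuples V i. \<forall>j<i. \<forall>x\<in>V. \<forall>c. f (vs[j := scale c x]) = c * f (vs[j := x])) \<and>
     (\<forall>vs\<in>tuples V i. \<not> distinct vs \<longrightarrow> f vs = 0)"

text \<open>The linear extension of \<open>f\<close> to formal combinations of tuples.\<close>

definition pair :: "('g list \<Rightarrow> 'k) \<Rightarrow> ('g list \<Rightarrow>\<^sub>0 'k) \<Rightarrow> 'k" where
  "pair f p = (\<Sum>vs\<in>Poly_Mapping.keys p. Poly_Mapping.lookup p vs * f vs)"

lemma pair_eq: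
  assumes "finite S" "Poly_Mapping.keys p \<subseteq> S"
  shows "pair f p = (\<Sum>vs\<in>S. Poly_Mapping.lookup p vs * f vs)"
  unfolding pair_def using assms by (intro sum.mono_neutral_left) (auto simp: in_keys_iff)

lemma pair_add: "pair f (p + r) = pair f p + pair f r"
proof -
  let ?S = "Poly_Mapping.keys p \<union> Poly_Mapping.keys r"
  have "Poly_Mapping.keys (p + r) \<subseteq> ?S" by (rule keys_add)
  then show ?thesis
    by (simp add: pair_eq[of ?S] lookup_add distrib_right sum.distrib)
qed

lemma keys_free_scale: "Poly_Mapping.keys (free_scale c p) \<subseteq> Poly_Mapping.keys p"
  by (auto simp: in_keys_iff lookup_free_scale)

lemma pair_scale: "pair f (free_scale c p) = c * pair f p"
  using keys_free_scale[of c p]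
  by (simp add: pair_eq[of "Poly_Mapping.keys p"] lookup_free_scale sum_distrib_left mult.assoc)

lemma pair_zero: "pair f 0 = 0"
  by (simp add: pair_def)

lemma pair_diff: "pair f (p - r) = pair f p - pair f r"
proof -
  have "p - r = p + free_scale (- 1) r"
    by (simp add: poly_mapping_eq_iff fun_eq_iff lookup_free_scale lookup_add lookup_minus)
  then show ?thesis by (simp only: pair_add pair_scale) simp
qed

lemma pair_sum: "pair f (\<Sum>i\<in>I. p i) = (\<Sum>i\<in>I. pair f (p i))"
  by (induction I rule: infinite_finite_induct) (simp_all add: pair_zero pair_add)

lemma pair_single: "pair f (Poly_Mapping.single vs a) = a * f vs"
  by (simp add: pair_eq[of "{vs}"])

lemma tuples_update: "vs \<in> tuples V i \<Longrightarrow> x \<in> V \<Longrightarrow> vs[j := x] \<in> tuples V i"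
  using set_update_subset_insert[of vs j x] by (auto simp: tuples_def)

lemma tuples_length: "vs \<in> tuples V i \<Longrightarrow> length vs = i"
  by (simp add: tuples_def)

lemma tuples_nth: "vs \<in> tuples V i \<Longrightarrow> j < i \<Longrightarrow> vs ! j \<in> V"
  by (auto simp: tuples_def)

lemma ext_free_subspace: "free.subspace (ext_free V i)"
proof (rule free.subspaceI)
  show "x + y \<in> ext_free V i" if "x \<in> ext_free V i" "y \<in> ext_free V i" for x y
    using that keys_add[of x y] by (auto simp: ext_free_def)
  show "free_scale c x \<in> ext_free V i" if "x \<in> ext_free V i" for c x
    using that keys_free_scale[of c x] by (auto simp: ext_free_def)
qed (simp add: ext_free_def)

lemma single_ext_free: "vs \<in> tuples V i \<Longrightarrow> Poly_Mapping.single vs a \<in> ext_free V i"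
  by (simp add: ext_free_def)

lemma ext_free_expand: "p = (\<Sum>vs\<in>Poly_Mapping.keys p. free_scale (Poly_Mapping.lookup p vs) (Poly_Mapping.single vs 1))"
proof (rule poly_mapping_eqI)
  fix ws
  have "Poly_Mapping.lookup (\<Sum>vs\<in>Poly_Mapping.keys p. free_scale (Poly_Mapping.lookup p vs) (Poly_Mapping.single vs 1)) ws
      = (\<Sum>vs\<in>Poly_Mapping.keys p. if vs = ws then Poly_Mapping.lookup p ws else 0)"
    unfolding lookup_sum by (intro sum.cong refl) (simp add: lookup_free_scale lookup_single when_def)
  then show "Poly_Mapping.lookup p ws = Poly_Mapping.lookup (\<Sum>vs\<in>Poly_Mapping.keys p. free_scale (Poly_Mapping.lookup p vs) (Poly_Mapping.single vs 1)) ws"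
    by (simp add: in_keys_iff)
qed

definition gens :: "'g set \<Rightarrow> nat \<Rightarrow> ('g list \<Rightarrow>\<^sub>0 'k) set" where
  "gens V i =
     ({Poly_Mapping.single (vs[j := x + y]) 1
         - Poly_Mapping.single (vs[j := x]) 1 - Poly_Mapping.single (vs[j := y]) 1
         | vs j x y. vs \<in> tuples V i \<and> j < i \<and> x \<in> V \<and> y \<in> V} \<union>
      {Poly_Mapping.single (vs[j := scale c x]) 1 - Poly_Mapping.single (vs[j := x]) c
         | vs j c x. vs \<in> tuples V i \<and> j < i \<and> x \<in> V} \<union>
      {Poly_Mapping.single vs 1 | vs. vs \<in> tuples V i \<and> \<not> distinct vs})"

lemma ext_rel_gens: "ext_rel V i = free.span (gens V i)"
  by (simp add: ext_rel_def gens_def)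

lemma pair_ext_rel:
  assumes f: "alt V i f" and p: "p \<in> ext_rel V i" shows "pair f p = 0"
proof -
  have "free.subspace {p. pair f p = 0}"
    by (rule free.subspaceI) (simp_all add: pair_zero pair_add pair_scale)
  moreover have "gens V i \<subseteq> {p. pair f p = 0}"
    using f by (auto simp: gens_def pair_diff pair_single alt_def)
  ultimately have "ext_rel V i \<subseteq> {p. pair f p = 0}"
    unfolding ext_rel_gens by (intro free.span_minimal)
  then show ?thesis using p by blast
qed

text \<open>A vector outside a span is detected by a linear functional vanishing on the span; a
  functional vanishing on the relations is an alternating form.\<close>

lemma separating_alt:
  assumes p: "p \<notin> ext_rel V i" obtains f where "alt V i f" "pair f p \<noteq> 0"
proof -
  interpret fk: vector_space_pair free_scale "(*) :: 'k \<Rightarrow> 'k \<Rightarrow> 'k"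
    by unfold_locales (auto simp: algebra_simps)
  obtain B where B: "B \<subseteq> gens V i" "free.independent B" "gens V i \<subseteq> free.span B"
    using free.maximal_independent_subset[of "gens V i"] by blast
  have "free.span B \<subseteq> ext_rel V i" unfolding ext_rel_gens by (rule free.span_mono[OF B(1)])
  then have pB: "p \<notin> free.span B" using p by blast
  then have ind: "free.independent (insert p B)" using B(2) by (rule free.independent_insertI)
  obtain g where g: "Vector_Spaces.linear free_scale (*) g" "\<forall>x\<in>insert p B. g x = (if x = p then 1 else 0)"
    using fk.linear_independent_extend[OF ind, of "\<lambda>x. if x = p then 1 else 0"] by auto
  have g_add: "g (x + y) = g x + g y" and g_scale: "g (free_scale a x) = a * g x" for x y a
    using g(1) by (simp_all add: Vector_Spaces.linear_iff)
  have g0: "g 0 = 0" using g_scale[of 0 0] by simp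
  have g_diff: "g (x - y) = g x - g y" for x y using g_add[of "x - y" y] by simp
  have g_sum: "g (\<Sum>x\<in>I. t x) = (\<Sum>x\<in>I. g (t x))" for t and I :: "'g list set"
    by (induction I rule: infinite_finite_induct) (simp_all add: g0 g_add)
  have "p \<notin> B" using pB free.span_base by blast
  have "free.subspace {x. g x = 0}"
    by (rule free.subspaceI) (simp_all add: g0 g_add g_scale)
  moreover have "B \<subseteq> {x. g x = 0}" using g(2) \<open>p \<notin> B\<close> by auto
  ultimately have "free.span B \<subseteq> {x. g x = 0}" by (intro free.span_minimal)
  then have g_gens: "g x = 0" if "x \<in> gens V i" for x using B(3) that by blast
  define f where "f vs = g (Poly_Mapping.single vs 1)" for vs
  have g_single: "g (Poly_Mapping.single vs a) = a * f vs" for vs a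
  proof -
    have "Poly_Mapping.single vs a = free_scale a (Poly_Mapping.single vs 1)"
      by (simp add: poly_mapping_eq_iff fun_eq_iff lookup_free_scale lookup_single when_def)
    then show ?thesis by (simp add: g_scale f_def)
  qed
  have pair_g: "pair f r = g r" for r
  proof -
    have "g r = g (\<Sum>vs\<in>Poly_Mapping.keys r. free_scale (Poly_Mapping.lookup r vs) (Poly_Mapping.single vs 1))"
      by (simp only: ext_free_expand[symmetric])
    then show ?thesis by (simp add: g_sum g_scale pair_def f_def)
  qed
  have "alt V i f"
    unfolding alt_def
  proof (intro conjI ballI allI impI)
    fix vs j x y assume a: "vs \<in> tuples V i" "j < i" "x \<in> V" "y \<in> V"
    have "Poly_Mapping.single (vs[j := x + y]) 1
         - Poly_Mapping.single (vs[j := x]) 1 - Poly_Mapping.single (vs[j := y]) 1 \<in> gens V i"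
      unfolding gens_def using a by blast
    then have "g (Poly_Mapping.single (vs[j := x + y]) 1
         - Poly_Mapping.single (vs[j := x]) 1 - Poly_Mapping.single (vs[j := y]) 1) = 0"
      by (rule g_gens)
    then show "f (vs[j := x + y]) = f (vs[j := x]) + f (vs[j := y])"
      by (simp only: g_diff g_single mult_1_left diff_eq_eq add_0_left) (simp add: add.commute)
  next
    fix vs j x c assume a: "vs \<in> tuples V i" "j < i" "x \<in> V"
    have "Poly_Mapping.single (vs[j := scale c x]) 1 - Poly_Mapping.single (vs[j := x]) c \<in> gens V i"
      unfolding gens_def using a by blast
    then have "g (Poly_Mapping.single (vs[j := scale c x]) 1 - Poly_Mapping.single (vs[j := x]) c) = 0"
      by (rule g_gens)
    then show "f (vs[j := scale c x]) = c * f (vs[j := x])"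
      by (simp add: g_diff g_single)
  next
    fix vs assume a: "vs \<in> tuples V i" "\<not> distinct vs"
    then have "Poly_Mapping.single vs 1 \<in> gens V i" unfolding gens_def by blast
    then have "g (Poly_Mapping.single vs 1) = 0" by (rule g_gens)
    then show "f vs = 0" by (simp add: g_single)
  qed
  moreover have "pair f p \<noteq> 0" using g(2) by (simp add: pair_g)
  ultimately show ?thesis using that by blast
qed

lemma ext_rel_iff: "p \<in> ext_rel V i \<longleftrightarrow> (\<forall>f. alt V i f \<longrightarrow> pair f p = 0)"
proof
  assume "\<forall>f. alt V i f \<longrightarrow> pair f p = 0"
  then show "p \<in> ext_rel V i"
    using separating_alt[of p V i] by blast
qed (simp add: pair_ext_rel)


subsection \<open>Alternating forms\<close>

lemma alt_add: "alt V i f \<Longrightarrow> vs \<in> tuples V i \<Longrightarrow> j < i \<Longrightarrow> x \<in> V \<Longrightarrow> y \<in> V \<Longrightarrow>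
    f (vs[j := x + y]) = f (vs[j := x]) + f (vs[j := y])"
  and alt_scale: "alt V i f \<Longrightarrow> vs \<in> tuples V i \<Longrightarrow> j < i \<Longrightarrow> x \<in> V \<Longrightarrow>
    f (vs[j := scale a x]) = a * f (vs[j := x])"
  and alt_distinct: "alt V i f \<Longrightarrow> vs \<in> tuples V i \<Longrightarrow> \<not> distinct vs \<Longrightarrow> f vs = 0"
  by (simp_all add: alt_def)

lemma alt_sum:
  assumes f: "alt V i f" and V: "subspace V" and vs: "vs \<in> tuples V i" and j: "j < i"
    and x: "\<And>k. k \<in> I \<Longrightarrow> x k \<in> V"
  shows "f (vs[j := \<Sum>k\<in>I. scale (a k) (x k)]) = (\<Sum>k\<in>I. a k * f (vs[j := x k]))"
proof -
  have zero: "f (vs[j := 0]) = 0"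
    using alt_scale[OF f vs j subspace_0[OF V], of 0] by simp
  have "J \<subseteq> I \<Longrightarrow> f (vs[j := \<Sum>k\<in>J. scale (a k) (x k)]) = (\<Sum>k\<in>J. a k * f (vs[j := x k]))" for J
  proof (induction J rule: infinite_finite_induct)
    case (insert k J)
    have "(\<Sum>k\<in>J. scale (a k) (x k)) \<in> V" "x k \<in> V" "scale (a k) (x k) \<in> V"
      using insert.prems x V by (auto intro!: subspace_sum subspace_scale)
    then show ?case
      using insert alt_add[OF f vs j] alt_scale[OF f vs j] by simp
  qed (simp_all add: zero)
  then show ?thesis by blast
qed

lemma alt_swap:
  assumes f: "alt V i f" and V: "subspace V" and vs: "vs \<in> tuples V i"
    and ab: "a < i" "b < i" "a \<noteq> b" and uv: "u \<in> V" "v \<in> V"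
  shows "f (vs[a := u, b := v]) = - f (vs[a := v, b := u])"
proof -
  let ?F = "\<lambda>u v. f (vs[a := u, b := v])"
  have len: "length vs = i" by (rule tuples_length[OF vs])
  have diag: "?F w w = 0" if "w \<in> V" for w
  proof (rule alt_distinct[OF f])
    show "vs[a := w, b := w] \<in> tuples V i" by (intro tuples_update vs that)
    have "vs[a := w, b := w] ! a = vs[a := w, b := w] ! b" using ab len by simp
    then show "\<not> distinct (vs[a := w, b := w])"
      using ab len by (metis length_list_update nth_eq_iff_index_eq)
  qed
  have r: "?F x (y + z) = ?F x y + ?F x z" if "x \<in> V" "y \<in> V" "z \<in> V" for x y z
    by (rule alt_add[OF f tuples_update[OF vs that(1)] ab(2) that(2,3)])
  have l: "?F (y + z) x = ?F y x + ?F z x" if "x \<in> V" "y \<in> V" "z \<in> V" for x y z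
    using alt_add[OF f tuples_update[OF vs that(1)] ab(1) that(2,3), of b] ab(3)
    by (simp add: list_update_swap[of b a])
  have "0 = ?F (u + v) (u + v)" using diag[of "u + v"] uv V by (simp add: subspace_add)
  also have "\<dots> = ?F (u + v) u + ?F (u + v) v"
    by (rule r[OF subspace_add[OF V uv] uv])
  also have "\<dots> = (?F u u + ?F v u) + (?F u v + ?F v v)"
    by (simp only: l[OF uv(1) uv] l[OF uv(2) uv])
  finally have "?F u v + ?F v u = 0" by (simp only: diag[OF uv(1)] diag[OF uv(2)]) (simp add: add.commute)
  then show ?thesis by (simp only: eq_neg_iff_add_eq_0)
qed

text \<open>The transpose of the action of \<open>x\<close> on the exterior power.\<close>

definition ctr :: "'g \<Rightarrow> ('g list \<Rightarrow> 'k) \<Rightarrow> 'g list \<Rightarrow> 'k" where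
  "ctr x f vs = (\<Sum>j<length vs. f (vs[j := bracket x (vs ! j)]))"

lemma pair_ext_act: "pair f (ext_act x p) = pair (ctr x f) p"
  by (simp add: ext_act_def pair_sum pair_scale pair_single pair_def[of "ctr x f"] ctr_def)

lemma ext_act_free:
  assumes x: "\<And>v. v \<in> V \<Longrightarrow> bracket x v \<in> V" and p: "p \<in> ext_free V i"
  shows "ext_act x p \<in> ext_free V i"
  unfolding ext_act_def
proof (intro free.subspace_sum[OF ext_free_subspace] free.subspace_scale[OF ext_free_subspace] single_ext_free)
  fix vs j assume "vs \<in> Poly_Mapping.keys p" "j \<in> {..<length vs}"
  then have "vs \<in> tuples V i" "j < i" using p by (auto simp: ext_free_def tuples_def)
  then show "vs[j := bracket x (vs ! j)] \<in> tuples V i"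
    by (intro tuples_update x tuples_nth)
qed

lemma pair_cong:
  assumes "\<And>vs. vs \<in> tuples V i \<Longrightarrow> f vs = g vs" "p \<in> ext_free V i" shows "pair f p = pair g p"
  unfolding pair_def using assms by (intro sum.cong refl) (auto simp: ext_free_def)

lemma ctr_term:
  assumes "vs \<in> tuples V i" "j < i" "k < i"
  shows "f (vs[j := w, k := bracket x (vs[j := w] ! k)])
      = (if k = j then f (vs[j := bracket x w]) else f (vs[k := bracket x (vs ! k), j := w]))"
  using assms by (auto simp: tuples_length list_update_swap[of j k])

text \<open>If the entries \<open>a\<close> and \<open>b\<close> coincide, only the terms that change one of these survive, and they cancel by
  antisymmetry.\<close>

lemma alt_ctr:
  assumes f: "alt V i f" and V: "subspace V" and x: "\<And>v. v \<in> V \<Longrightarrow> bracket x v \<in> V"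
  shows "alt V i (ctr x f)"
  unfolding alt_def
proof (intro conjI ballI allI impI)
  fix vs j u v assume a: "vs \<in> tuples V i" "j < i" "u \<in> V" "v \<in> V"
  note len = tuples_length[OF a(1)]
  have "f (vs[j := u + v, k := bracket x (vs[j := u + v] ! k)])
      = f (vs[j := u, k := bracket x (vs[j := u] ! k)]) + f (vs[j := v, k := bracket x (vs[j := v] ! k)])"
    if k: "k < i" for k
    unfolding ctr_term[OF a(1,2) k]
    using alt_add[OF f a(1,2) x[OF a(3)] x[OF a(4)]]
      alt_add[OF f tuples_update[OF a(1) x[OF tuples_nth[OF a(1) k]]] a(2,3,4)]
    by (simp add: bracket_add_right)
  then show "ctr x f (vs[j := u + v]) = ctr x f (vs[j := u]) + ctr x f (vs[j := v])"
    by (simp add: ctr_def len sum.distrib)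
next
  fix vs j u t assume a: "vs \<in> tuples V i" "j < i" "u \<in> V"
  note len = tuples_length[OF a(1)]
  have "f (vs[j := scale t u, k := bracket x (vs[j := scale t u] ! k)])
      = t * f (vs[j := u, k := bracket x (vs[j := u] ! k)])"
    if k: "k < i" for k
    unfolding ctr_term[OF a(1,2) k]
    using alt_scale[OF f a(1,2) x[OF a(3)]]
      alt_scale[OF f tuples_update[OF a(1) x[OF tuples_nth[OF a(1) k]]] a(2,3)]
    by (simp add: bracket_scale_right)
  then show "ctr x f (vs[j := scale t u]) = t * ctr x f (vs[j := u])"
    by (simp add: ctr_def len sum_distrib_left)
next
  fix vs assume vs: "vs \<in> tuples V i" and nd: "\<not> distinct vs"
  note len = tuples_length[OF vs]
  obtain a b where ab: "a < i" "b < i" "a \<noteq> b" "vs ! a = vs ! b"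
    using nd len by (auto simp: distinct_conv_nth)
  let ?t = "\<lambda>k. f (vs[k := bracket x (vs ! k)])"
  have other: "?t k = 0" if k: "k < i" "k \<noteq> a" "k \<noteq> b" for k
  proof (rule alt_distinct[OF f])
    show "vs[k := bracket x (vs ! k)] \<in> tuples V i" by (intro tuples_update vs x tuples_nth[OF vs] k)
    have "vs[k := bracket x (vs ! k)] ! a = vs[k := bracket x (vs ! k)] ! b" using ab k len by simp
    then show "\<not> distinct (vs[k := bracket x (vs ! k)])"
      using ab len by (metis length_list_update nth_eq_iff_index_eq)
  qed
  have "vs ! a \<in> V" by (rule tuples_nth[OF vs ab(1)])
  then have "f (vs[a := bracket x (vs ! a), b := vs ! a]) = - f (vs[a := vs ! a, b := bracket x (vs ! a)])"
    by (intro alt_swap[OF f V vs ab(1-3)] x)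
  moreover have "vs[a := bracket x (vs ! a), b := vs ! a] = vs[a := bracket x (vs ! a)]"
    using ab(3,4) by (metis list_update_id list_update_swap)
  moreover have "vs[a := vs ! a, b := bracket x (vs ! a)] = vs[b := bracket x (vs ! b)]"
    by (simp only: list_update_id ab(4)[symmetric])
  ultimately have "?t a + ?t b = 0" by simp
  moreover have "ctr x f vs = (\<Sum>k\<in>{a, b}. ?t k)"
    unfolding ctr_def len using ab other by (intro sum.mono_neutral_right) auto
  ultimately show "ctr x f vs = 0" using ab(3) by simp
qed

lemma ctr_add:
  assumes f: "alt V i f" and x: "\<And>v. v \<in> V \<Longrightarrow> bracket x v \<in> V" and y: "\<And>v. v \<in> V \<Longrightarrow> bracket y v \<in> V"
    and vs: "vs \<in> tuples V i"
  shows "ctr (x + y) f vs = ctr x f vs + ctr y f vs"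
  unfolding ctr_def tuples_length[OF vs] sum.distrib[symmetric]
  by (intro sum.cong refl) (simp add: bracket_add_left alt_add[OF f vs] x y tuples_nth[OF vs])

lemma ctr_scale:
  assumes f: "alt V i f" and x: "\<And>v. v \<in> V \<Longrightarrow> bracket x v \<in> V" and vs: "vs \<in> tuples V i"
  shows "ctr (scale a x) f vs = a * ctr x f vs"
  unfolding ctr_def tuples_length[OF vs] sum_distrib_left
  by (intro sum.cong refl) (simp add: bracket_scale_left alt_scale[OF f vs] x tuples_nth[OF vs])

text \<open>The terms in which \<open>x\<close> and \<open>y\<close> act on the same entry, and those in which they act on two entries.\<close>

lemma ctr_ctr:
  assumes vs: "vs \<in> tuples V i"
  shows "ctr y (ctr x f) vs = (\<Sum>j<i. f (vs[j := bracket x (bracket y (vs ! j))]))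
    + (\<Sum>j<i. \<Sum>k\<in>{..<i} - {j}. f (vs[j := bracket y (vs ! j), k := bracket x (vs ! k)]))"
proof -
  note len = tuples_length[OF vs]
  have "ctr x f (vs[j := bracket y (vs ! j)]) = f (vs[j := bracket x (bracket y (vs ! j))])
      + (\<Sum>k\<in>{..<i} - {j}. f (vs[j := bracket y (vs ! j), k := bracket x (vs ! k)]))" if j: "j < i" for j
  proof -
    have "ctr x f (vs[j := bracket y (vs ! j)])
        = (\<Sum>k<i. f (vs[j := bracket y (vs ! j), k := bracket x (vs[j := bracket y (vs ! j)] ! k)]))"
      by (simp add: ctr_def len)
    also have "\<dots> = f (vs[j := bracket x (bracket y (vs ! j))])
        + (\<Sum>k\<in>{..<i} - {j}. f (vs[j := bracket y (vs ! j), k := bracket x (vs[j := bracket y (vs ! j)] ! k)]))"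
      using j len by (subst sum.remove[of _ j]) auto
    also have "(\<Sum>k\<in>{..<i} - {j}. f (vs[j := bracket y (vs ! j), k := bracket x (vs[j := bracket y (vs ! j)] ! k)]))
        = (\<Sum>k\<in>{..<i} - {j}. f (vs[j := bracket y (vs ! j), k := bracket x (vs ! k)]))"
      by (intro sum.cong refl) auto
    finally show ?thesis .
  qed
  then show ?thesis by (simp add: ctr_def[of y] len sum.distrib)
qed

text \<open>The order of the factors is reversed because \<open>ctr\<close> is a transpose.\<close>

lemma ctr_commutator:
  assumes f: "alt V i f" and V: "subspace V" and x: "\<And>v. v \<in> V \<Longrightarrow> bracket x v \<in> V"
    and y: "\<And>v. v \<in> V \<Longrightarrow> bracket y v \<in> V" and vs: "vs \<in> tuples V i"
  shows "ctr y (ctr x f) vs = ctr x (ctr y f) vs + ctr (bracket x y) f vs"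
proof -
  let ?off = "\<lambda>x y. \<Sum>j<i. \<Sum>k\<in>{..<i} - {j}. f (vs[j := bracket y (vs ! j), k := bracket x (vs ! k)])"
  let ?t = "\<lambda>j k. f (vs[j := bracket y (vs ! j), k := bracket x (vs ! k)])"
  have "?off x y = (\<Sum>j<i. \<Sum>k<i. if k = j then 0 else ?t j k)"
    by (intro sum.cong refl sum.mono_neutral_cong_left) auto
  also have "\<dots> = (\<Sum>k<i. \<Sum>j<i. if k = j then 0 else ?t j k)" by (rule sum.swap)
  also have "\<dots> = (\<Sum>k<i. \<Sum>j<i. if j = k then 0
      else f (vs[k := bracket x (vs ! k), j := bracket y (vs ! j)]))"
  proof (intro sum.cong refl)
    fix k j
    show "(if k = j then 0 else ?t j k)
        = (if j = k then 0 else f (vs[k := bracket x (vs ! k), j := bracket y (vs ! j)]))"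
      by (cases "k = j") (simp_all add: list_update_swap[of j k])
  qed
  also have "\<dots> = ?off y x"
    by (intro sum.cong refl sum.mono_neutral_cong_right) auto
  finally have off: "?off x y = ?off y x" .
  have "f (vs[j := bracket x (bracket y (vs ! j))])
      = f (vs[j := bracket y (bracket x (vs ! j))]) + f (vs[j := bracket (bracket x y) (vs ! j)])" if j: "j < i" for j
  proof -
    have "bracket x (bracket y (vs ! j)) = bracket y (bracket x (vs ! j)) + bracket (bracket x y) (vs ! j)"
      by (simp add: bracket_bracket_left)
    moreover have "bracket (bracket x y) (vs ! j) \<in> V"
      unfolding bracket_bracket_left by (intro subspace_diff V x y tuples_nth[OF vs j])
    ultimately show ?thesis
      using alt_add[OF f vs j, of "bracket y (bracket x (vs ! j))" "bracket (bracket x y) (vs ! j)"]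
        x y tuples_nth[OF vs j] by simp
  qed
  then show ?thesis
    unfolding ctr_ctr[OF vs] off ctr_def[of "bracket x y"] tuples_length[OF vs] by (simp add: sum.distrib)
qed


subsection \<open>Products of linear forms\<close>

text \<open>The product of a linear form and an alternating form. In the usual alternating sum the entry fed to
  \<open>\<xi>\<close> is omitted; moving the first entry into the gap turns every sign but the first into \<open>- 1\<close>.\<close>

definition wedge :: "('g \<Rightarrow> 'k) \<Rightarrow> ('g list \<Rightarrow> 'k) \<Rightarrow> 'g list \<Rightarrow> 'k" where
  "wedge \<xi> f vs = \<xi> (hd vs) * f (tl vs) - (\<Sum>j<length (tl vs). \<xi> (tl vs ! j) * f ((tl vs)[j := hd vs]))"

text \<open>Alternation: if the first entry occurs again, its two terms are equal with opposite signs; if two later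
  entries coincide, the terms that change one of them cancel by antisymmetry of \<open>f\<close>.\<close>

lemma alt_wedge:
  assumes \<xi>: "lform \<xi>" and f: "alt V i f" and V: "subspace V"
  shows "alt V (Suc i) (wedge \<xi> f)"
proof -
  have wedge_Cons: "wedge \<xi> f (v # vs) = \<xi> v * f vs - (\<Sum>j<i. \<xi> (vs ! j) * f (vs[j := v]))"
    if "vs \<in> tuples V i" for v vs
    by (simp add: wedge_def tuples_length[OF that])
  have Cons: "\<exists>v us. vs = v # us \<and> v \<in> V \<and> us \<in> tuples V i" if "vs \<in> tuples V (Suc i)" for vs
    using that by (auto simp: tuples_def length_Suc_conv)
  have slot: "\<xi> (us[k := x] ! j) * f (us[k := x, j := v])
      = (if j = k then \<xi> x * f (us[k := v]) else \<xi> (us ! j) * f (us[j := v, k := x]))"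
    if "us \<in> tuples V i" "k < i" for us k j x v
    using that tuples_length[OF that(1)] by (auto simp: list_update_swap[of j k])
  show ?thesis
    unfolding alt_def
  proof (intro conjI ballI allI impI)
    fix vs j x y assume "vs \<in> tuples V (Suc i)" and j: "j < Suc i" and x: "x \<in> V" and y: "y \<in> V"
    then obtain v us where vs: "vs = v # us" "v \<in> V" "us \<in> tuples V i" using Cons by blast
    show "wedge \<xi> f (vs[j := x + y]) = wedge \<xi> f (vs[j := x]) + wedge \<xi> f (vs[j := y])"
    proof (cases j)
      case 0
      then show ?thesis
        using alt_add[OF f vs(3) _ x y]
        by (simp add: vs(1) wedge_Cons[OF vs(3)] lform_add[OF \<xi>] algebra_simps sum.distrib)
    next
      case (Suc k)
      then have k: "k < i" using j by simp
      have "\<xi> (us[k := x + y] ! l) * f (us[k := x + y, l := v])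
          = \<xi> (us[k := x] ! l) * f (us[k := x, l := v]) + \<xi> (us[k := y] ! l) * f (us[k := y, l := v])" for l
        unfolding slot[OF vs(3) k] using alt_add[OF f tuples_update[OF vs(3,2)] k x y]
        by (simp add: lform_add[OF \<xi>] algebra_simps)
      then show ?thesis
        using alt_add[OF f vs(3) k x y]
        by (simp add: Suc vs(1) wedge_Cons tuples_update vs(3) x y subspace_add[OF V] algebra_simps sum.distrib)
    qed
  next
    fix vs j x t assume "vs \<in> tuples V (Suc i)" and j: "j < Suc i" and x: "x \<in> V"
    then obtain v us where vs: "vs = v # us" "v \<in> V" "us \<in> tuples V i" using Cons by blast
    show "wedge \<xi> f (vs[j := scale t x]) = t * wedge \<xi> f (vs[j := x])"
    proof (cases j)
      case 0
      then show ?thesis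
        using alt_scale[OF f vs(3) _ x]
        by (simp add: vs(1) wedge_Cons[OF vs(3)] lform_scale[OF \<xi>] right_diff_distrib sum_distrib_left ac_simps)
    next
      case (Suc k)
      then have k: "k < i" using j by simp
      have "\<xi> (us[k := scale t x] ! l) * f (us[k := scale t x, l := v])
          = t * (\<xi> (us[k := x] ! l) * f (us[k := x, l := v]))" for l
        unfolding slot[OF vs(3) k] using alt_scale[OF f tuples_update[OF vs(3,2)] k x]
        by (simp add: lform_scale[OF \<xi>])
      then show ?thesis
        using alt_scale[OF f vs(3) k x]
        by (simp add: Suc vs(1) wedge_Cons tuples_update vs(3) x subspace_scale[OF V] right_diff_distrib
            sum_distrib_left ac_simps)
    qed
  next
    fix vs assume "vs \<in> tuples V (Suc i)" and nd: "\<not> distinct vs"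
    then obtain v us where vs: "vs = v # us" "v \<in> V" "us \<in> tuples V i" using Cons by blast
    have len: "length us = i" by (rule tuples_length[OF vs(3)])
    let ?t = "\<lambda>j. \<xi> (us ! j) * f (us[j := v])"
    have rep: "f (us[j := v]) = 0" if "j < i" "a < i" "b < i" "a \<noteq> b" "us[j := v] ! a = us[j := v] ! b" for j a b
      using that len alt_distinct[OF f tuples_update[OF vs(3,2)]]
      by (metis length_list_update nth_eq_iff_index_eq)
    show "wedge \<xi> f vs = 0"
    proof (cases "v \<in> set us")
      case True
      then obtain a where a: "a < i" "us ! a = v" using len by (auto simp: in_set_conv_nth)
      have "(\<Sum>j<i. ?t j) = (\<Sum>j<i. if j = a then \<xi> v * f us else 0)"
      proof (rule sum.cong[OF refl])
        fix j assume "j \<in> {..<i}"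
        then have j: "j < i" by simp
        show "?t j = (if j = a then \<xi> v * f us else 0)"
        proof (cases "j = a")
          case True
          have "us[a := v] = us" using a(2) list_update_id[of us a] by simp
          then show ?thesis using True a(2) by simp
        next
          case False
          then have "f (us[j := v]) = 0" using rep[OF j a(1) j False[symmetric]] j a len by simp
          then show ?thesis using False by simp
        qed
      qed
      then show ?thesis using a by (simp add: vs(1) wedge_Cons[OF vs(3)])
    next
      case False
      then have us: "\<not> distinct us" using nd by (simp add: vs(1))
      then obtain a b where ab: "a < i" "b < i" "a \<noteq> b" "us ! a = us ! b"
        using len by (auto simp: distinct_conv_nth)
      from us have 0: "f us = 0" by (rule alt_distinct[OF f vs(3)])
      have other: "?t j = 0" if "j < i" "j \<noteq> a" "j \<noteq> b" for j
        using rep[OF that(1) ab(1-3)] that ab len by simp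
      have "us ! a \<in> V" by (rule tuples_nth[OF vs(3) ab(1)])
      then have "f (us[a := v, b := us ! a]) = - f (us[a := us ! a, b := v])"
        by (intro alt_swap[OF f V vs(3) ab(1-3) vs(2)])
      moreover have "us[a := v, b := us ! a] = us[a := v]"
        using ab(3,4) by (metis list_update_id list_update_swap)
      ultimately have "f (us[a := v]) = - f (us[b := v])" by simp
      then have "?t a + ?t b = 0" by (simp add: ab(4))
      moreover have "(\<Sum>j<i. ?t j) = (\<Sum>j\<in>{a, b}. ?t j)"
        using ab other by (intro sum.mono_neutral_right) auto
      ultimately show ?thesis using ab(3) 0 by (simp add: vs(1) wedge_Cons[OF vs(3)])
    qed
  qed
qed


section \<open>Casimir eigenvalues and lowest weights\<close>

lemma alt_sum_forms: "(\<And>l. l \<in> I \<Longrightarrow> alt V i (f l)) \<Longrightarrow> alt V i (\<lambda>vs. \<Sum>l\<in>I. f l vs)"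
  by (simp add: alt_def sum.distrib sum_distrib_left)

lemma pair_sum_forms: "pair (\<lambda>vs. \<Sum>l\<in>I. f l vs) p = (\<Sum>l\<in>I. pair (f l) p)"
  unfolding pair_def sum_distrib_left by (rule sum.swap)

lemma ctr_sum_forms: "ctr x (\<lambda>vs. \<Sum>l\<in>I. f l vs) vs = (\<Sum>l\<in>I. ctr x (f l) vs)"
  unfolding ctr_def by (rule sum.swap)

lemma ctr_cong:
  assumes "\<And>ws. ws \<in> tuples V i \<Longrightarrow> f ws = g ws" and x: "\<And>v. v \<in> V \<Longrightarrow> bracket x v \<in> V"
    and vs: "vs \<in> tuples V i"
  shows "ctr x f vs = ctr x g vs"
  unfolding ctr_def tuples_length[OF vs]
  by (intro sum.cong refl assms(1) tuples_update vs x tuples_nth[OF vs]) simp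

lemma ctr_form_add: "ctr x (\<lambda>vs. f vs + g vs) vs = ctr x f vs + ctr x g vs"
  by (simp add: ctr_def sum.distrib)

lemma ctr_form_scale: "ctr x (\<lambda>vs. a * f vs) vs = a * ctr x f vs"
  by (simp add: ctr_def sum_distrib_left)

end

context casimir_grading
begin

lemma bracket_g1: "x \<in> g0 \<Longrightarrow> v \<in> g1 \<Longrightarrow> bracket x v \<in> g1"
  using bracket_grading[of x 0 v 1] by simp

lemma H_g0: "t \<in> H \<Longrightarrow> t \<in> g0"
  using rs_grading[of 0] by (auto simp: rs_0 h_zero)

lemma alt_ctr_g1: "alt g1 i f \<Longrightarrow> x \<in> g0 \<Longrightarrow> alt g1 i (ctr x f)"
  by (rule alt_ctr[OF _ subspace_grading bracket_g1])

lemma bilinear_ctr_ctr: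
  assumes f: "alt g1 i f" and vs: "vs \<in> tuples g1 i"
  shows "bilinear_g0 (\<lambda>y z. ctr z (ctr y f) vs)"
  unfolding bilinear_g0_def
proof (intro conjI ballI allI)
  fix x y z assume xyz: "x \<in> g0" "y \<in> g0" "z \<in> g0"
  have "ctr z (ctr (x + y) f) vs = ctr z (\<lambda>ws. ctr x f ws + ctr y f ws) vs"
    by (rule ctr_cong[OF ctr_add[OF f bracket_g1[OF xyz(1)] bracket_g1[OF xyz(2)]] bracket_g1[OF xyz(3)] vs])
  then show "ctr z (ctr (x + y) f) vs = ctr z (ctr x f) vs + ctr z (ctr y f) vs"
    by (simp only: ctr_form_add)
  show "ctr (x + y) (ctr z f) vs = ctr x (ctr z f) vs + ctr y (ctr z f) vs"
    by (rule ctr_add[OF alt_ctr_g1[OF f xyz(3)] bracket_g1[OF xyz(1)] bracket_g1[OF xyz(2)] vs])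
next
  fix a x z assume xz: "x \<in> g0" "z \<in> g0"
  have "ctr z (ctr (scale a x) f) vs = ctr z (\<lambda>ws. a * ctr x f ws) vs"
    by (rule ctr_cong[OF ctr_scale[OF f bracket_g1[OF xz(1)]] bracket_g1[OF xz(2)] vs])
  then show "ctr z (ctr (scale a x) f) vs = a * ctr z (ctr x f) vs"
    by (simp only: ctr_form_scale)
  show "ctr (scale a x) (ctr z f) vs = a * ctr x (ctr z f) vs"
    by (rule ctr_scale[OF alt_ctr_g1[OF f xz(2)] bracket_g1[OF xz(1)] vs])
qed

text \<open>The transpose of the Casimir element.\<close>

definition cas_form :: "('g list \<Rightarrow> 'k) \<Rightarrow> 'g list \<Rightarrow> 'k" where
  "cas_form f vs = (\<Sum>l<n. ctr (e l) (ctr (e' l) f) vs)"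

lemma alt_cas_form: "alt g1 i f \<Longrightarrow> alt g1 i (cas_form f)"
  unfolding cas_form_def by (intro alt_sum_forms alt_ctr_g1) (simp_all add: e_g0 e'_g0)

lemma pair_casimir: "pair f (casimir_act n e e' p) = pair (cas_form f) p"
  by (simp add: casimir_act_def pair_sum pair_ext_act cas_form_def[abs_def] pair_sum_forms)

lemma bilinear_g0_minus:
  assumes F: "bilinear_g0 F" and yz: "y \<in> g0" "z \<in> g0"
  shows "F (- y) z = - F y z" "F z (- y) = - F z y"
proof -
  have "F (scale (- 1) y) z = - 1 * F y z" "F z (scale (- 1) y) = - 1 * F z y"
    using F yz unfolding bilinear_g0_def by blast+
  then show "F (- y) z = - F y z" "F z (- y) = - F z y" by simp_all
qed

lemma cas_form_ctr:
  assumes f: "alt g1 i f" and x: "x \<in> g0" and vs: "vs \<in> tuples g1 i"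
  shows "cas_form (ctr x f) vs = ctr x (cas_form f) vs"
proof -
  let ?F = "\<lambda>y z. ctr z (ctr y f) vs"
  note F = bilinear_ctr_ctr[OF f vs]
  have br: "bracket x z \<in> g0" if "z \<in> g0" for z using bracket_grading[OF x that] by simp
  have sw: "bracket z x = - bracket x z" for z by (rule bracket_swap)
  have step: "ctr x (ctr (e l) (ctr (e' l) f)) vs
      = ctr (e l) (ctr (e' l) (ctr x f)) vs - (?F (bracket x (e' l)) (e l) + ?F (e' l) (bracket x (e l)))"
    if l: "l < n" for l
  proof -
    note el = e_g0[OF l] and el' = e'_g0[OF l]
    have in0: "bracket (e' l) x \<in> g0" using bracket_grading[OF el' x] by simp
    have "ctr x (ctr (e l) (ctr (e' l) f)) vs
        = ctr (e l) (ctr x (ctr (e' l) f)) vs + ctr (bracket (e l) x) (ctr (e' l) f) vs"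
      by (rule ctr_commutator[OF alt_ctr_g1[OF f el'] subspace_grading bracket_g1[OF el] bracket_g1[OF x] vs])
    also have "ctr (e l) (ctr x (ctr (e' l) f)) vs
        = ctr (e l) (\<lambda>ws. ctr (e' l) (ctr x f) ws + ctr (bracket (e' l) x) f ws) vs"
      by (rule ctr_cong[OF ctr_commutator[OF f subspace_grading bracket_g1[OF el'] bracket_g1[OF x]] bracket_g1[OF el] vs])
    also have "\<dots> = ctr (e l) (ctr (e' l) (ctr x f)) vs + ?F (bracket (e' l) x) (e l)"
      by (simp only: ctr_form_add)
    also have "?F (bracket (e' l) x) (e l) = - ?F (bracket x (e' l)) (e l)"
      unfolding sw[of "e' l"] by (rule bilinear_g0_minus(1)[OF F br[OF el'] el])
    also have "ctr (bracket (e l) x) (ctr (e' l) f) vs = - ?F (e' l) (bracket x (e l))"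
      unfolding sw[of "e l"] by (rule bilinear_g0_minus(2)[OF F br[OF el] el'])
    finally show ?thesis by simp
  qed
  have "ctr x (cas_form f) vs = (\<Sum>l<n. ctr x (ctr (e l) (ctr (e' l) f)) vs)"
    unfolding cas_form_def by (rule ctr_sum_forms)
  also have "\<dots> = cas_form (ctr x f) vs
      - ((\<Sum>l<n. ?F (bracket x (e' l)) (e l)) + (\<Sum>l<n. ?F (e' l) (bracket x (e l))))"
    by (simp add: step cas_form_def sum_subtractf sum.distrib)
  finally show ?thesis using contraction_invariant[OF F x] by simp
qed


subsection \<open>Weight components\<close>

text \<open>In the induction step \<open>t - \<mu>\<^sub>0 t\<close> removes the summand of weight \<open>\<mu>\<^sub>0\<close> and multiplies the one of weight \<open>\<mu>\<close>
  by \<open>\<mu> t - \<mu>\<^sub>0 t\<close>, which is nonzero for some \<open>t \<in> H\<close>.\<close>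

lemma weights_independent:
  assumes "finite S" "S \<subseteq> dual_space H"
    and act: "\<And>f t. f \<in> A \<Longrightarrow> t \<in> H \<Longrightarrow> act t f \<in> A"
    and wt: "\<And>\<mu> f t. \<mu> \<in> S \<Longrightarrow> f \<in> A \<Longrightarrow> t \<in> H \<Longrightarrow> F \<mu> (act t f) = \<mu> t * F \<mu> f"
    and sum: "\<And>f. f \<in> A \<Longrightarrow> (\<Sum>\<mu>\<in>S. F \<mu> f) = 0"
  shows "\<mu> \<in> S \<Longrightarrow> f \<in> A \<Longrightarrow> F \<mu> f = (0 :: 'k)"
  using assms(1,2) wt sum
proof (induction S arbitrary: F \<mu> f rule: finite_induct)
  case (insert \<mu>0 S)
  have zero: "F \<mu> f = 0" if \<mu>: "\<mu> \<in> S" and f: "f \<in> A" for \<mu> f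
  proof -
    have dual: "\<mu> \<in> dual_space H" "\<mu>0 \<in> dual_space H" using insert.prems \<mu> by auto
    have "\<mu> \<noteq> \<mu>0" using insert.hyps \<mu> by blast
    then obtain t where "\<mu> t \<noteq> \<mu>0 t" by (auto simp: fun_eq_iff)
    then have t: "t \<in> H" "\<mu> t \<noteq> \<mu>0 t"
      using dual_space_outside[OF dual(1)] dual_space_outside[OF dual(2)] by metis+
    have "(\<lambda>\<nu> g. (\<nu> t - \<mu>0 t) * F \<nu> g) \<mu> f = 0"
    proof (rule insert.IH[OF \<mu> f])
      show "S \<subseteq> dual_space H" using insert.prems by blast
      show "(\<nu> t - \<mu>0 t) * F \<nu> (act s g) = \<nu> s * ((\<nu> t - \<mu>0 t) * F \<nu> g)" if "\<nu> \<in> S" "g \<in> A" "s \<in> H" for \<nu> g s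
        using insert.prems(4)[of \<nu> g s] that by simp
      fix g assume g: "g \<in> A"
      have "(\<Sum>\<nu>\<in>insert \<mu>0 S. (\<nu> t - \<mu>0 t) * F \<nu> g) = (\<Sum>\<nu>\<in>insert \<mu>0 S. F \<nu> (act t g) - \<mu>0 t * F \<nu> g)"
        using insert.prems(4)[OF _ g t(1)] by (intro sum.cong refl) (simp add: left_diff_distrib)
      also have "\<dots> = 0"
        using insert.prems(5)[OF g] insert.prems(5)[OF act[OF g t(1)]]
        by (simp only: sum_subtractf sum_distrib_left[symmetric]) simp
      finally show "(\<Sum>\<nu>\<in>S. (\<nu> t - \<mu>0 t) * F \<nu> g) = 0" using insert.hyps by simp
    qed
    then show ?thesis using t by simp
  qed
  have "F \<mu>0 f = 0" if "f \<in> A" for f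
    using insert.prems(5)[OF that] insert.hyps zero[OF _ that] by simp
  then show ?case using insert.prems(1,2) zero by blast
qed simp

text \<open>The index set of the spanning family of products of root vectors of degree 1.\<close>

definition E :: "nat \<Rightarrow> ('g \<Rightarrow> 'k) list set" where
  "E i = {\<gamma>s. set \<gamma>s \<subseteq> D 1 \<and> length \<gamma>s = i \<and> distinct \<gamma>s}"

text \<open>The coefficient of the product of the root vectors for \<open>\<gamma>s\<close> in the expansion of a tuple.\<close>

primrec coord :: "('g \<Rightarrow> 'k) list \<Rightarrow> 'g list \<Rightarrow> 'k" where
  "coord [] vs = 1"
| "coord (\<gamma> # \<gamma>s) vs = killing (hd vs) (rv (- \<gamma>)) * coord \<gamma>s (tl vs)"

lemma finite_E: "finite (E i)"
  by (rule finite_subset[OF _ finite_lists_length_eq[OF finite_D, of 1 i]]) (auto simp: E_def)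

lemma rv_tuple: "set \<gamma>s \<subseteq> D 1 \<Longrightarrow> length \<gamma>s = i \<Longrightarrow> map rv \<gamma>s \<in> tuples g1 i"
  using rv_grading by (auto simp: tuples_def)

text \<open>The entries are expanded one after the other; \<open>us\<close> holds those that have been dealt with.\<close>

lemma expand_tuple_aux:
  assumes f: "alt g1 i f"
  shows "us @ vs \<in> tuples g1 i \<Longrightarrow>
    f (us @ vs) = (\<Sum>\<gamma>s | set \<gamma>s \<subseteq> D 1 \<and> length \<gamma>s = length vs. coord \<gamma>s vs * f (us @ map rv \<gamma>s))"
proof (induction vs arbitrary: us)
  case Nil
  have "{\<gamma>s. set \<gamma>s \<subseteq> D 1 \<and> length \<gamma>s = length ([] :: 'g list)} = {[]}" by auto
  then show ?case by simp
next
  case (Cons v vs)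
  let ?X = "\<lambda>k. {\<gamma>s. set \<gamma>s \<subseteq> D 1 \<and> length \<gamma>s = k}"
  have v: "v \<in> g1" and len: "length us < i" using Cons.prems by (auto simp: tuples_def)
  have "f (us @ v # vs) = f ((us @ v # vs)[length us := \<Sum>\<gamma>\<in>D 1. scale (killing v (rv (- \<gamma>))) (rv \<gamma>)])"
    using grading_expand[OF v] by simp
  also have "\<dots> = (\<Sum>\<gamma>\<in>D 1. killing v (rv (- \<gamma>)) * f ((us @ v # vs)[length us := rv \<gamma>]))"
    by (rule alt_sum[OF f subspace_grading Cons.prems len rv_grading])
  also have "\<dots> = (\<Sum>\<gamma>\<in>D 1. killing v (rv (- \<gamma>)) * (\<Sum>\<gamma>s\<in>?X (length vs). coord \<gamma>s vs * f ((us @ [rv \<gamma>]) @ map rv \<gamma>s)))"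
  proof (rule sum.cong[OF refl])
    fix \<gamma> assume "\<gamma> \<in> D 1"
    then have "(us @ [rv \<gamma>]) @ vs \<in> tuples g1 i"
      using Cons.prems rv_grading by (auto simp: tuples_def)
    from Cons.IH[OF this]
    show "killing v (rv (- \<gamma>)) * f ((us @ v # vs)[length us := rv \<gamma>])
        = killing v (rv (- \<gamma>)) * (\<Sum>\<gamma>s\<in>?X (length vs). coord \<gamma>s vs * f ((us @ [rv \<gamma>]) @ map rv \<gamma>s))"
      by simp
  qed
  also have "\<dots> = (\<Sum>\<gamma>\<in>D 1. \<Sum>\<gamma>s\<in>?X (length vs). coord (\<gamma> # \<gamma>s) (v # vs) * f (us @ map rv (\<gamma> # \<gamma>s)))"
    by (simp add: sum_distrib_left mult.assoc)
  also have "\<dots> = (\<Sum>(\<gamma>, \<gamma>s)\<in>D 1 \<times> ?X (length vs). coord (\<gamma> # \<gamma>s) (v # vs) * f (us @ map rv (\<gamma> # \<gamma>s)))"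
    by (rule sum.cartesian_product)
  also have "\<dots> = (\<Sum>\<gamma>s\<in>?X (length (v # vs)). coord \<gamma>s (v # vs) * f (us @ map rv \<gamma>s))"
    by (rule sum.reindex_bij_witness[of _ "\<lambda>\<gamma>s. (hd \<gamma>s, tl \<gamma>s)" "\<lambda>(\<gamma>, \<gamma>s). \<gamma> # \<gamma>s"])
      (auto simp: length_Suc_conv)
  finally show ?case .
qed

lemma expand_tuple:
  assumes f: "alt g1 i f" and vs: "vs \<in> tuples g1 i"
  shows "f vs = (\<Sum>\<gamma>s\<in>E i. coord \<gamma>s vs * f (map rv \<gamma>s))"
proof -
  let ?X = "{\<gamma>s. set \<gamma>s \<subseteq> D 1 \<and> length \<gamma>s = i}"
  have "f vs = (\<Sum>\<gamma>s\<in>?X. coord \<gamma>s vs * f (map rv \<gamma>s))"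
    using expand_tuple_aux[OF f, of "[]" vs] vs by (simp add: tuples_length[OF vs])
  also have "\<dots> = (\<Sum>\<gamma>s\<in>E i. coord \<gamma>s vs * f (map rv \<gamma>s))"
  proof (rule sum.mono_neutral_right)
    show "finite ?X" by (rule finite_lists_length_eq[OF finite_D])
    show "\<forall>\<gamma>s\<in>?X - E i. coord \<gamma>s vs * f (map rv \<gamma>s) = 0"
      using alt_distinct[OF f rv_tuple] by (auto simp: E_def distinct_map)
  qed (auto simp: E_def)
  finally show ?thesis .
qed

definition weights :: "nat \<Rightarrow> ('g \<Rightarrow> 'k) set" where "weights i = sum_list ` E i"

text \<open>The component of weight \<open>\<mu>\<close>, as a combination of products of root vectors.\<close>

definition comp :: "nat \<Rightarrow> ('g list \<Rightarrow>\<^sub>0 'k) \<Rightarrow> ('g \<Rightarrow> 'k) \<Rightarrow> ('g list \<Rightarrow>\<^sub>0 'k)" where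
  "comp i p \<mu> = (\<Sum>\<gamma>s | \<gamma>s \<in> E i \<and> sum_list \<gamma>s = \<mu>.
     free_scale (pair (coord \<gamma>s) p) (Poly_Mapping.single (map rv \<gamma>s) 1))"

lemma pair_comp: "pair f (comp i p \<mu>) = (\<Sum>\<gamma>s | \<gamma>s \<in> E i \<and> sum_list \<gamma>s = \<mu>. pair (coord \<gamma>s) p * f (map rv \<gamma>s))"
  by (simp add: comp_def pair_sum pair_scale pair_single)

lemma sum_comp:
  assumes f: "alt g1 i f" and p: "p \<in> ext_free g1 i"
  shows "pair f p = (\<Sum>\<mu>\<in>weights i. pair f (comp i p \<mu>))"
proof -
  have "pair f p = pair (\<lambda>vs. \<Sum>\<gamma>s\<in>E i. coord \<gamma>s vs * f (map rv \<gamma>s)) p"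
    by (rule pair_cong[OF expand_tuple[OF f] p])
  also have "\<dots> = (\<Sum>\<gamma>s\<in>E i. pair (coord \<gamma>s) p * f (map rv \<gamma>s))"
    unfolding pair_sum_forms by (simp add: pair_def sum_distrib_right mult.assoc)
  also have "\<dots> = (\<Sum>\<mu>\<in>weights i. pair f (comp i p \<mu>))"
    unfolding pair_comp weights_def by (rule sum.image_gen[OF finite_E])
  finally show ?thesis .
qed

lemma comp_free: "comp i p \<mu> \<in> ext_free g1 i"
  unfolding comp_def
  by (intro free.subspace_sum[OF ext_free_subspace] free.subspace_scale[OF ext_free_subspace] single_ext_free rv_tuple)
    (auto simp: E_def)

lemma weights_cases:
  assumes "\<mu> \<in> weights i" obtains A where "A \<subseteq> D 1" "card A = i" "\<mu> = \<Sum>A"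
proof -
  obtain \<gamma>s where \<gamma>s: "\<gamma>s \<in> E i" "\<mu> = sum_list \<gamma>s" using assms by (auto simp: weights_def)
  have "sum_list \<gamma>s = \<Sum>(set \<gamma>s)"
    using \<gamma>s by (simp add: E_def sum_list_distinct_conv_sum_set[of \<gamma>s "\<lambda>x. x", simplified])
  then show ?thesis using that[of "set \<gamma>s"] \<gamma>s by (simp add: E_def distinct_card)
qed

lemma finite_weights: "finite (weights i)"
  by (simp add: weights_def finite_E)

lemma weights_L: "\<mu> \<in> weights i \<Longrightarrow> \<mu> \<in> L"
  by (erule weights_cases) (simp add: sum_D1_L)

definition wt_vec :: "nat \<Rightarrow> ('g \<Rightarrow> 'k) \<Rightarrow> ('g list \<Rightarrow>\<^sub>0 'k) \<Rightarrow> bool" where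
  "wt_vec i \<mu> p \<longleftrightarrow> p \<in> ext_free g1 i \<and>
     (\<forall>f t. alt g1 i f \<longrightarrow> t \<in> H \<longrightarrow> pair (ctr t f) p = \<mu> t * pair f p)"

lemma ctr_rv:
  assumes f: "alt g1 i f" and t: "t \<in> H" and \<gamma>s: "\<gamma>s \<in> E i"
  shows "ctr t f (map rv \<gamma>s) = sum_list \<gamma>s t * f (map rv \<gamma>s)"
proof -
  have len: "length \<gamma>s = i" and tup: "map rv \<gamma>s \<in> tuples g1 i" using \<gamma>s rv_tuple by (auto simp: E_def)
  have "ctr t f (map rv \<gamma>s) = (\<Sum>j<i. (\<gamma>s ! j) t * f (map rv \<gamma>s))"
    unfolding ctr_def length_map len
  proof (rule sum.cong[OF refl])
    fix j assume "j \<in> {..<i}"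
    then have j: "j < i" by simp
    then have D: "\<gamma>s ! j \<in> D 1" using \<gamma>s len by (auto simp: E_def)
    have "bracket t (map rv \<gamma>s ! j) = scale ((\<gamma>s ! j) t) (map rv \<gamma>s ! j)"
      using rs_bracket_H[OF t rv_rs] D j len by (simp add: D_iff)
    moreover have "map rv \<gamma>s ! j \<in> g1" by (rule tuples_nth[OF tup j])
    ultimately show "f ((map rv \<gamma>s)[j := bracket t (map rv \<gamma>s ! j)]) = (\<gamma>s ! j) t * f (map rv \<gamma>s)"
      using alt_scale[OF f tup j] by (simp only: list_update_id)
  qed
  also have "\<dots> = sum_list \<gamma>s t * f (map rv \<gamma>s)"
    by (simp add: sum_list_sum_nth sum_fun_apply len sum_distrib_right atLeast0LessThan)
  finally show ?thesis .
qed

lemma wt_vec_comp: "wt_vec i \<mu> (comp i p \<mu>)"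
  unfolding wt_vec_def pair_comp sum_distrib_left
  by (intro conjI comp_free allI impI sum.cong refl) (simp add: ctr_rv)


subsection \<open>Lowest weight vectors\<close>

definition eigen :: "nat \<Rightarrow> 'k \<Rightarrow> ('g list \<Rightarrow>\<^sub>0 'k) \<Rightarrow> bool" where
  "eigen i z p \<longleftrightarrow> (\<forall>f. alt g1 i f \<longrightarrow> pair (cas_form f) p = z * pair f p)"

lemma casimir_eigenvalue_iff:
  "casimir_eigenvalue n e e' g1 i z \<longleftrightarrow> (\<exists>p\<in>ext_free g1 i. p \<notin> ext_rel g1 i \<and> eigen i z p)"
  unfolding casimir_eigenvalue_def eigen_def
  by (simp add: ext_rel_iff[of "_ - _"] pair_diff pair_scale pair_casimir)

lemma pair_ctr_cas_form:
  assumes "alt g1 i f" "x \<in> g0" "p \<in> ext_free g1 i"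
  shows "pair (cas_form (ctr x f)) p = pair (ctr x (cas_form f)) p"
  by (rule pair_cong[OF cas_form_ctr[OF assms(1,2)] assms(3)])

text \<open>The Casimir element commutes with \<open>H\<close>, so the equation for \<open>p\<close> holds in each weight separately.\<close>

lemma eigen_comp:
  assumes p: "p \<in> ext_free g1 i" "eigen i z p" and \<mu>: "\<mu> \<in> weights i"
  shows "eigen i z (comp i p \<mu>)"
  unfolding eigen_def
proof (intro allI impI)
  fix f assume f: "alt g1 i f"
  let ?F = "\<lambda>\<mu> f. pair (cas_form f) (comp i p \<mu>) - z * pair f (comp i p \<mu>)"
  have "?F \<mu> f = 0"
  proof (rule weights_independent[of "weights i" "{f. alt g1 i f}" ctr ?F])
    show "finite (weights i)" by (rule finite_weights)
    show "weights i \<subseteq> dual_space H" using weights_L L_dual by blast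
    show "\<mu> \<in> weights i" "f \<in> {f. alt g1 i f}" by (simp_all add: \<mu> f)
    show "ctr t g \<in> {f. alt g1 i f}" if "g \<in> {f. alt g1 i f}" "t \<in> H" for g t
      using that by (simp add: alt_ctr_g1 H_g0)
    show "?F \<nu> (ctr t g) = \<nu> t * ?F \<nu> g" if "g \<in> {f. alt g1 i f}" "t \<in> H" for \<nu> g t
    proof -
      have g: "alt g1 i g" using that by simp
      have "pair (cas_form (ctr t g)) (comp i p \<nu>) = \<nu> t * pair (cas_form g) (comp i p \<nu>)"
        using pair_ctr_cas_form[OF g H_g0[OF that(2)] comp_free] wt_vec_comp[of i \<nu> p] alt_cas_form[OF g] that(2)
        by (simp add: wt_vec_def)
      moreover have "pair (ctr t g) (comp i p \<nu>) = \<nu> t * pair g (comp i p \<nu>)"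
        using wt_vec_comp[of i \<nu> p] g that(2) by (simp add: wt_vec_def)
      ultimately show ?thesis by (simp add: algebra_simps)
    qed
    show "(\<Sum>\<mu>\<in>weights i. ?F \<mu> g) = 0" if "g \<in> {f. alt g1 i f}" for g
    proof -
      have g: "alt g1 i g" using that by simp
      show ?thesis
        using p(2) g sum_comp[OF g p(1)] sum_comp[OF alt_cas_form[OF g] p(1)]
        by (simp add: sum_subtractf sum_distrib_left[symmetric] eigen_def)
    qed
  qed
  then show "pair (cas_form f) (comp i p \<mu>) = z * pair f (comp i p \<mu>)" by simp
qed

text \<open>Otherwise \<open>p\<close> and minus its components would be a vanishing sum of vectors of different weights.\<close>

lemma wt_vec_weight:
  assumes p: "wt_vec i \<mu> p" "p \<notin> ext_rel g1 i" and \<mu>: "\<mu> \<in> dual_space H" shows "\<mu> \<in> weights i"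
proof (rule ccontr)
  assume notin: "\<mu> \<notin> weights i"
  have free: "p \<in> ext_free g1 i" using p(1) by (simp add: wt_vec_def)
  have "pair f p = 0" if f: "alt g1 i f" for f
  proof -
    let ?F = "\<lambda>\<nu> f. if \<nu> = \<mu> then pair f p else - pair f (comp i p \<nu>)"
    have "?F \<mu> f = 0"
    proof (rule weights_independent[of "insert \<mu> (weights i)" "{f. alt g1 i f}" ctr ?F])
      show "finite (insert \<mu> (weights i))" by (simp add: finite_weights)
      show "insert \<mu> (weights i) \<subseteq> dual_space H" using weights_L L_dual \<mu> by blast
      show "ctr t g \<in> {f. alt g1 i f}" if "g \<in> {f. alt g1 i f}" "t \<in> H" for g t
        using that by (simp add: alt_ctr_g1 H_g0)
      show "?F \<nu> (ctr t g) = \<nu> t * ?F \<nu> g" if "g \<in> {f. alt g1 i f}" "t \<in> H" for \<nu> g t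
        using that p(1) wt_vec_comp[of i \<nu> p] by (simp add: wt_vec_def)
      show "(\<Sum>\<nu>\<in>insert \<mu> (weights i). ?F \<nu> g) = 0" if "g \<in> {f. alt g1 i f}" for g
      proof -
        have "(\<Sum>\<nu>\<in>weights i. ?F \<nu> g) = (\<Sum>\<nu>\<in>weights i. - pair g (comp i p \<nu>))"
          using notin by (intro sum.cong) auto
        also have "\<dots> = - pair g p" using sum_comp[of i g p] that free by (simp add: sum_negf)
        finally show ?thesis by (simp add: sum.insert[OF finite_weights notin])
      qed
    qed (simp_all add: f)
    then show ?thesis by simp
  qed
  then show False using p(2) by (simp add: ext_rel_iff)
qed

lemma wt_vec_ext_act:
  assumes p: "wt_vec i \<mu> p" and \<nu>: "\<nu> \<in> W" "x \<in> rs \<nu>" "x \<in> g0"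
  shows "wt_vec i (\<mu> + \<nu>) (ext_act x p)"
  unfolding wt_vec_def
proof (intro conjI allI impI)
  have free: "p \<in> ext_free g1 i" using p by (simp add: wt_vec_def)
  show "ext_act x p \<in> ext_free g1 i" by (rule ext_act_free[OF bracket_g1[OF \<nu>(3)] free])
  fix f t assume f: "alt g1 i f" and t: "t \<in> H"
  have "pair (ctr x (ctr t f)) p = pair (\<lambda>vs. \<Sum>b\<in>{True, False}. if b then ctr t (ctr x f) vs else ctr (bracket t x) f vs) p"
    by (rule pair_cong[OF _ free])
      (simp add: ctr_commutator[OF f subspace_grading bracket_g1[OF H_g0[OF t]] bracket_g1[OF \<nu>(3)]])
  also have "\<dots> = pair (ctr t (ctr x f)) p + pair (ctr (bracket t x) f) p"
    by (simp only: pair_sum_forms) simp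
  also have "pair (ctr (bracket t x) f) p = pair (\<lambda>vs. \<Sum>b\<in>{()}. \<nu> t * ctr x f vs) p"
    unfolding rs_bracket_H[OF t \<nu>(2)]
    by (rule pair_cong[OF _ free]) (simp add: ctr_scale[OF f bracket_g1[OF \<nu>(3)]])
  also have "\<dots> = \<nu> t * pair (ctr x f) p"
    by (simp add: pair_def sum_distrib_left mult.left_commute)
  also have "pair (ctr t (ctr x f)) p = \<mu> t * pair (ctr x f) p"
    using p t alt_ctr_g1[OF f \<nu>(3)] by (simp add: wt_vec_def)
  finally show "pair (ctr t f) (ext_act x p) = (\<mu> + \<nu>) t * pair f (ext_act x p)"
    by (simp add: pair_ext_act distrib_right)
qed

lemma eigen_ext_act:
  assumes p: "p \<in> ext_free g1 i" "eigen i z p" and x: "x \<in> g0" shows "eigen i z (ext_act x p)"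
  unfolding eigen_def
proof (intro allI impI)
  fix f assume f: "alt g1 i f"
  have "pair (ctr x (cas_form f)) p = pair (cas_form (ctr x f)) p"
    using pair_ctr_cas_form[OF f x p(1)] by simp
  then show "pair (cas_form f) (ext_act x p) = z * pair f (ext_act x p)"
    using p(2) alt_ctr_g1[OF f x] by (simp add: eigen_def pair_ext_act)
qed

text \<open>Among the weights of eigenvectors for \<open>z\<close> one of minimal height is chosen; lowering operators commute
  with the Casimir element, so they must kill a vector of this weight.\<close>

lemma lowest_weight_vector:
  assumes "casimir_eigenvalue n e e' g1 i z"
  obtains \<mu> p where "\<mu> \<in> weights i" "wt_vec i \<mu> p" "p \<notin> ext_rel g1 i" "eigen i z p"
    "\<And>\<beta> f. \<beta> \<in> Pos0 \<Longrightarrow> alt g1 i f \<Longrightarrow> pair (ctr (rv (- \<beta>)) f) p = 0"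
proof -
  obtain p0 where p0: "p0 \<in> ext_free g1 i" "p0 \<notin> ext_rel g1 i" "eigen i z p0"
    using assms by (auto simp: casimir_eigenvalue_iff)
  obtain f0 where f0: "alt g1 i f0" "pair f0 p0 \<noteq> 0" using p0(2) by (auto simp: ext_rel_iff)
  define M where "M = {\<mu> \<in> weights i. \<exists>p. wt_vec i \<mu> p \<and> p \<notin> ext_rel g1 i \<and> eigen i z p}"
  have "(\<Sum>\<mu>\<in>weights i. pair f0 (comp i p0 \<mu>)) \<noteq> 0" using sum_comp[OF f0(1) p0(1)] f0(2) by simp
  then obtain \<mu>0 where \<mu>0: "\<mu>0 \<in> weights i" "pair f0 (comp i p0 \<mu>0) \<noteq> 0"
    by (meson sum.neutral)
  then have "comp i p0 \<mu>0 \<notin> ext_rel g1 i" using f0(1) by (auto simp: ext_rel_iff)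
  then have "\<mu>0 \<in> M" unfolding M_def using \<mu>0(1) wt_vec_comp eigen_comp[OF p0(1,3)] by blast
  moreover have fin: "finite M" by (simp add: M_def finite_weights)
  ultimately obtain \<mu> where \<mu>: "\<mu> \<in> M" "\<And>\<nu>. \<nu> \<in> M \<Longrightarrow> hgt \<mu> \<le> hgt \<nu>"
    using ex_min_if_finite[of "hgt ` M"] by (fastforce simp: not_less)
  then obtain p where p: "wt_vec i \<mu> p" "p \<notin> ext_rel g1 i" "eigen i z p" and w: "\<mu> \<in> weights i"
    by (auto simp: M_def)
  have free: "p \<in> ext_free g1 i" using p(1) by (simp add: wt_vec_def)
  have low: "pair (ctr (rv (- \<beta>)) f) p = 0" if \<beta>: "\<beta> \<in> Pos0" and f: "alt g1 i f" for \<beta> f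
  proof -
    have \<beta>P: "\<beta> \<in> Pos" "h \<beta> = 0" using \<beta> by (simp_all add: Pos0_def)
    then have R: "\<beta> \<in> R" "- \<beta> \<in> R" by (simp_all add: Pos_root uminus_root)
    have "- \<beta> \<in> D (- 0)" by (rule D_uminus) (simp add: D_iff R \<beta>P)
    then have g0: "rv (- \<beta>) \<in> g0" using rv_grading[of "- \<beta>" 0] by simp
    have wt: "wt_vec i (\<mu> + - \<beta>) (ext_act (rv (- \<beta>)) p)"
      using R by (intro wt_vec_ext_act p(1) rv_rs g0) auto
    have "ext_act (rv (- \<beta>)) p \<in> ext_rel g1 i"
    proof (rule ccontr)
      assume n: "ext_act (rv (- \<beta>)) p \<notin> ext_rel g1 i"
      have L: "\<mu> \<in> L" "- \<beta> \<in> L" using weights_L[OF w] root_L[OF R(2)] .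
      have "\<mu> + - \<beta> \<in> weights i" by (rule wt_vec_weight[OF wt n L_dual[OF L_add[OF L]]])
      then have "\<mu> + - \<beta> \<in> M" unfolding M_def using wt n eigen_ext_act[OF free p(3) g0] by blast
      then have "hgt \<mu> \<le> hgt (\<mu> + - \<beta>)" by (rule \<mu>(2))
      moreover have "hgt (\<mu> + - \<beta>) + hgt \<beta> = hgt \<mu>"
        using hgt_add[OF L_add[OF L] root_L[OF R(1)]] by simp
      ultimately show False using hgt_Pos[OF \<beta>P(1)] by linarith
    qed
    then show ?thesis using f by (auto simp: ext_rel_iff pair_ext_act)
  qed
  show ?thesis using that[OF w p low] .
qed

lemma D0_split: "D 0 = Pos0 \<union> uminus ` Pos0" "Pos0 \<inter> uminus ` Pos0 = {}"
proof -
  show "D 0 = Pos0 \<union> uminus ` Pos0"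
  proof (intro equalityI subsetI)
    fix \<gamma> assume \<gamma>: "\<gamma> \<in> D 0"
    then have "h (- \<gamma>) = 0" using D_uminus[OF \<gamma>] by (simp add: D_iff)
    then show "\<gamma> \<in> Pos0 \<union> uminus ` Pos0"
      using \<gamma> root_sign[of \<gamma>] image_eqI[of \<gamma> uminus "- \<gamma>" Pos0] by (auto simp: D_iff Pos0_def)
  next
    fix \<gamma> assume "\<gamma> \<in> Pos0 \<union> uminus ` Pos0"
    then obtain \<beta> where \<beta>: "\<beta> \<in> Pos0" "\<gamma> = \<beta> \<or> \<gamma> = - \<beta>" by blast
    then have "\<beta> \<in> D 0" by (simp add: D_iff Pos0_def Pos_root)
    then show "\<gamma> \<in> D 0" using \<beta>(2) D_uminus[of \<beta> 0] by auto
  qed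
  show "Pos0 \<inter> uminus ` Pos0 = {}" using Pos_uminus Pos0_sub by auto
qed

text \<open>In the split Casimir tensor, \<open>H\<close> contributes \<open>(\<mu>, \<mu>)\<close>, and each \<open>\<beta> \<in> Pos0\<close> contributes \<open>- (\<mu>, \<beta>)\<close>, the
  commutator that remains when the lowering operator is moved next to the vector, which it kills.\<close>

lemma lowest_weight_eigenvalue:
  assumes \<mu>: "\<mu> \<in> L" and p: "wt_vec i \<mu> p" and f: "alt g1 i f"
    and low: "\<And>\<beta> f. \<beta> \<in> Pos0 \<Longrightarrow> alt g1 i f \<Longrightarrow> pair (ctr (rv (- \<beta>)) f) p = 0"
  shows "pair (cas_form f) p = of_rat (cas \<mu>) * pair f p"
proof -
  have free: "p \<in> ext_free g1 i" using p by (simp add: wt_vec_def)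
  have wt: "pair (ctr t g) p = \<mu> t * pair g p" if "alt g1 i g" "t \<in> H" for g t
    using p that by (simp add: wt_vec_def)
  let ?F = "\<lambda>y z. pair (ctr z (ctr y f)) p"
  have dual\<mu>: "\<mu> \<in> dual_space H" by (rule L_dual[OF \<mu>])
  have t\<mu>: "tv \<mu> \<in> H" by (rule tv(1)[OF dual\<mu>])
  have vsf: "vs \<in> tuples g1 i" if "vs \<in> Poly_Mapping.keys p" for vs using free that by (auto simp: ext_free_def)
  have F: "bilinear_g0 ?F"
    unfolding bilinear_g0_def
  proof (intro conjI ballI allI)
    fix x y z assume xyz: "x \<in> g0" "y \<in> g0" "z \<in> g0"
    note B = bilinear_ctr_ctr[OF f vsf, unfolded bilinear_g0_def]
    show "?F (x + y) z = ?F x z + ?F y z" "?F z (x + y) = ?F z x + ?F z y"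
      using B xyz by (simp_all add: pair_def distrib_left sum.distrib)
  next
    fix a x z assume xz: "x \<in> g0" "z \<in> g0"
    note B = bilinear_ctr_ctr[OF f vsf, unfolded bilinear_g0_def]
    show "?F (scale a x) z = a * ?F x z" "?F z (scale a x) = a * ?F z x"
      using B xz by (simp_all add: pair_def sum_distrib_left mult.left_commute)
  qed
  have "pair (cas_form f) p = (\<Sum>l<n. ?F (e' l) (e l))"
    unfolding cas_form_def by (rule pair_sum_forms)
  also have "\<dots> = (\<Sum>l<n. ?F (e' l) (proj 0 (e l))) + (\<Sum>\<beta>\<in>D 0. ?F (rv (- \<beta>)) (rv \<beta>))"
    by (rule contraction_split[OF F])
  also have "(\<Sum>l<n. ?F (e' l) (proj 0 (e l))) = ip \<mu> \<mu> * pair f p"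
  proof -
    have "?F (e' l) (proj 0 (e l)) = killing (e l) (tv \<mu>) * pair (ctr (e' l) f) p" if l: "l < n" for l
    proof -
      have pH: "proj 0 (e l) \<in> H" using proj_rs[OF zero_dual, of "e l"] by (simp add: rs_0)
      have "\<mu> (proj 0 (e l)) = killing (tv \<mu>) (proj 0 (e l))" by (rule tv(2)[OF dual\<mu> pH, symmetric])
      also have "\<dots> = killing (tv \<mu>) (e l)"
      proof -
        have "tv \<mu> \<in> rs 0" using t\<mu> by (simp only: rs_0)
        from killing_proj[OF this zero_dual, of "e l"] show ?thesis by (simp only: minus_zero)
      qed
      finally show ?thesis using wt[OF alt_ctr_g1[OF f e'_g0[OF l]] pH] by (simp only: killing_sym)
    qed
    then have "(\<Sum>l<n. ?F (e' l) (proj 0 (e l))) = (\<Sum>l<n. killing (e l) (tv \<mu>) * pair (ctr (e' l) f) p)"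
      by simp
    also have "\<dots> = pair (ctr (\<Sum>l<n. scale (killing (e l) (tv \<mu>)) (e' l)) f) p"
    proof -
      have "ctr (\<Sum>l<n. scale (killing (e l) (tv \<mu>)) (e' l)) f vs = (\<Sum>l<n. killing (e l) (tv \<mu>) * ctr (e' l) f vs)"
        if vs: "vs \<in> tuples g1 i" for vs
      proof -
        have "(\<Sum>l\<in>J. scale (killing (e l) (tv \<mu>)) (e' l)) \<in> g0 \<and>
            ctr (\<Sum>l\<in>J. scale (killing (e l) (tv \<mu>)) (e' l)) f vs = (\<Sum>l\<in>J. killing (e l) (tv \<mu>) * ctr (e' l) f vs)"
          if "J \<subseteq> {..<n}" for J using finite_subset[OF that finite_lessThan] that
        proof (induction J)
          case empty
          have "ctr (scale 0 0) f vs = 0 * ctr 0 f vs"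
            by (rule ctr_scale[OF f bracket_g1[OF subspace_0[OF subspace_grading]] vs])
          then show ?case by (simp add: subspace_0[OF subspace_grading])
        next
          case (insert l J)
          have e: "e' l \<in> g0" "scale (killing (e l) (tv \<mu>)) (e' l) \<in> g0"
            using insert.prems by (auto intro: e'_g0 subspace_scale[OF subspace_grading])
          show ?case
            using insert e ctr_add[OF f bracket_g1[OF e(2)] bracket_g1 vs] ctr_scale[OF f bracket_g1[OF e(1)] vs]
            by (simp add: subspace_add[OF subspace_grading])
        qed
        then show ?thesis by blast
      qed
      then have "pair (ctr (\<Sum>l<n. scale (killing (e l) (tv \<mu>)) (e' l)) f) p
          = pair (\<lambda>vs. \<Sum>l<n. killing (e l) (tv \<mu>) * ctr (e' l) f vs) p"
        by (rule pair_cong[OF _ free])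
      then show ?thesis
        by (simp add: pair_sum_forms) (simp add: pair_def sum_distrib_left mult.left_commute)
    qed
    also have "(\<Sum>l<n. scale (killing (e l) (tv \<mu>)) (e' l)) = tv \<mu>"
      by (rule expand_e'[OF H_g0[OF t\<mu>], symmetric])
    also have "pair (ctr (tv \<mu>) f) p = ip \<mu> \<mu> * pair f p"
      using wt[OF f t\<mu>] by (simp only: ip_def)
    finally show ?thesis .
  qed
  also have "(\<Sum>\<beta>\<in>D 0. ?F (rv (- \<beta>)) (rv \<beta>)) = - ip \<mu> (\<Sum>Pos0) * pair f p"
  proof -
    have "(\<Sum>\<beta>\<in>D 0. ?F (rv (- \<beta>)) (rv \<beta>))
        = (\<Sum>\<beta>\<in>Pos0. ?F (rv (- \<beta>)) (rv \<beta>)) + (\<Sum>\<beta>\<in>uminus ` Pos0. ?F (rv (- \<beta>)) (rv \<beta>))"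
      unfolding D0_split(1) by (rule sum.union_disjoint[OF finite_Pos0 finite_imageI[OF finite_Pos0] D0_split(2)])
    also have "(\<Sum>\<beta>\<in>uminus ` Pos0. ?F (rv (- \<beta>)) (rv \<beta>)) = (\<Sum>\<beta>\<in>Pos0. ?F (rv \<beta>) (rv (- \<beta>)))"
      by (subst sum.reindex) (simp_all add: inj_on_def)
    also have "\<dots> = 0"
    proof (rule sum.neutral, rule ballI)
      fix \<beta> assume \<beta>: "\<beta> \<in> Pos0"
      then have "rv \<beta> \<in> g0" using D0_split(1) rv_grading by blast
      then show "?F (rv \<beta>) (rv (- \<beta>)) = 0" by (intro low[OF \<beta>] alt_ctr_g1[OF f])
    qed
    also have "(\<Sum>\<beta>\<in>Pos0. ?F (rv (- \<beta>)) (rv \<beta>)) = (\<Sum>\<beta>\<in>Pos0. - ip \<mu> \<beta> * pair f p)"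
    proof (rule sum.cong[OF refl])
      fix \<beta> assume \<beta>: "\<beta> \<in> Pos0"
      then have D: "\<beta> \<in> D 0" "- \<beta> \<in> D 0" using D0_split(1) by blast+
      then have g: "rv \<beta> \<in> g0" "rv (- \<beta>) \<in> g0" by (simp_all only: rv_grading)
      have R: "\<beta> \<in> R" using D(1) by (simp add: D_iff)
      note d\<beta> = root_dual[OF R]
      have "bracket (rv (- \<beta>)) (rv \<beta>) = - bracket (rv \<beta>) (rv (- \<beta>))" by (rule bracket_swap)
      then have br: "bracket (rv (- \<beta>)) (rv \<beta>) = scale (- 1) (tv \<beta>)" by (simp only: bracket_rv[OF R]) simp
      have "?F (rv (- \<beta>)) (rv \<beta>) = pair (\<lambda>vs. \<Sum>b\<in>{True, False}.
          if b then ctr (rv (- \<beta>)) (ctr (rv \<beta>) f) vs else ctr (bracket (rv (- \<beta>)) (rv \<beta>)) f vs) p"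
        by (rule pair_cong[OF _ free])
          (simp add: ctr_commutator[OF f subspace_grading bracket_g1[OF g(2)] bracket_g1[OF g(1)]])
      also have "\<dots> = ?F (rv \<beta>) (rv (- \<beta>)) + pair (ctr (scale (- 1) (tv \<beta>)) f) p"
        by (simp only: pair_sum_forms br) simp
      also have "?F (rv \<beta>) (rv (- \<beta>)) = 0" by (intro low[OF \<beta>] alt_ctr_g1[OF f] g)
      also have "pair (ctr (scale (- 1) (tv \<beta>)) f) p = \<mu> (scale (- 1) (tv \<beta>)) * pair f p"
        by (intro wt f subspace_scale[OF subspace_H] tv(1) d\<beta>)
      also have "\<mu> (scale (- 1) (tv \<beta>)) = - ip \<mu> \<beta>"
        using dual_space_scale[OF dual\<mu> tv(1)[OF d\<beta>], of "- 1"] by (simp add: ip_def)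
      finally show "?F (rv (- \<beta>)) (rv \<beta>) = - ip \<mu> \<beta> * pair f p" by (simp only: add_0_left)
    qed
    also have "(\<Sum>\<beta>\<in>Pos0. - ip \<mu> \<beta> * pair f p) = - ip \<mu> (\<Sum>Pos0) * pair f p"
    proof -
      have "ip \<mu> (\<Sum>Pos0) = (\<Sum>\<beta>\<in>Pos0. ip \<mu> \<beta>)"
        using Pos0_sub by (intro ip_sum_right[OF dual\<mu>] root_dual Pos_root) blast
      then show ?thesis by (simp add: sum_distrib_right sum_negf)
    qed
    finally show ?thesis by (simp only: add_0_right)
  qed
  finally show ?thesis
    by (simp add: cas_def of_rat_diff of_rat_rf \<mu> sum_Pos0_L left_diff_distrib)
qed

lemma eigenvalue_cases:
  assumes "casimir_eigenvalue n e e' g1 i z"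
  obtains A where "A \<subseteq> D 1" "card A = i" "z = of_rat (cas (\<Sum>A))"
proof -
  obtain \<mu> p where p: "\<mu> \<in> weights i" "wt_vec i \<mu> p" "p \<notin> ext_rel g1 i" "eigen i z p"
    "\<And>\<beta> f. \<beta> \<in> Pos0 \<Longrightarrow> alt g1 i f \<Longrightarrow> pair (ctr (rv (- \<beta>)) f) p = 0"
    by (rule lowest_weight_vector[OF assms]) blast
  obtain f where f: "alt g1 i f" "pair f p \<noteq> 0" using p(3) by (auto simp: ext_rel_iff)
  have "z * pair f p = of_rat (cas \<mu>) * pair f p"
    using p(4) f(1) lowest_weight_eigenvalue[OF weights_L[OF p(1)] p(2) f(1) p(5)] by (simp add: eigen_def)
  then have "z = of_rat (cas \<mu>)" using f(2) by simp
  then show ?thesis using weights_cases[OF p(1)] that by metis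
qed


section \<open>Decomposable eigenvectors of the Casimir element\<close>

text \<open>The iterated wedge product of the dual forms takes the value 1.\<close>

lemma root_product_form:
  "set \<gamma>s \<subseteq> D 1 \<Longrightarrow> distinct \<gamma>s \<Longrightarrow> \<exists>f. alt g1 (length \<gamma>s) f \<and> f (map rv \<gamma>s) = 1"
proof (induction \<gamma>s)
  case Nil
  show ?case by (intro exI[of _ "\<lambda>_. 1"]) (simp add: alt_def tuples_def)
next
  case (Cons \<gamma> \<gamma>s)
  then obtain f where f: "alt g1 (length \<gamma>s) f" "f (map rv \<gamma>s) = 1" by auto
  let ?f = "wedge (\<lambda>v. killing v (rv (- \<gamma>))) f"
  have R: "\<gamma> \<in> R" "set \<gamma>s \<subseteq> R" using Cons.prems D_sub[of 1] by auto
  have "killing (rv (\<gamma>s ! j)) (rv (- \<gamma>)) = 0" if j: "j < length \<gamma>s" for j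
  proof -
    have "\<gamma>s ! j \<in> set \<gamma>s" using j by simp
    then show ?thesis using Cons.prems(2) R killing_rv_rv[of "\<gamma>s ! j" \<gamma>] by auto
  qed
  then have "?f (map rv (\<gamma> # \<gamma>s)) = 1" using f(2) killing_rv[OF R(1)] by (simp add: wedge_def)
  moreover have "alt g1 (length (\<gamma> # \<gamma>s)) ?f"
    unfolding length_Cons by (rule alt_wedge[OF lform_killing_left f(1) subspace_grading])
  ultimately show ?case by blast
qed

lemma root_product_not_rel:
  assumes \<gamma>s: "\<gamma>s \<in> E i" shows "Poly_Mapping.single (map rv \<gamma>s) 1 \<notin> ext_rel g1 i"
  using root_product_form[of \<gamma>s] \<gamma>s by (auto simp: E_def ext_rel_iff pair_single)

text \<open>The part of the Casimir element that acts on two entries at once only sees their bracket: an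
  antisymmetric \<open>F\<close> only sees the antisymmetric part of its coefficients, which
  \<open>contract_pair_coefficient\<close> computes.\<close>

lemma contract_two_slots:
  assumes F: "\<And>\<gamma>' \<delta>'. \<gamma>' \<in> D 1 \<Longrightarrow> \<delta>' \<in> D 1 \<Longrightarrow> F \<gamma>' \<delta>' = - F \<delta>' \<gamma>'"
    and x: "x \<in> g1" and y: "y \<in> g1"
  shows "2 * (\<Sum>l<n. \<Sum>\<gamma>'\<in>D 1. \<Sum>\<delta>'\<in>D 1. killing (bracket (e l) x) (rv (- \<gamma>')) *
        killing (bracket (e' l) y) (rv (- \<delta>')) * F \<gamma>' \<delta>')
    = (\<Sum>\<gamma>'\<in>D 1. \<Sum>\<delta>'\<in>D 1. killing (bracket x y) (bracket (rv (- \<gamma>')) (rv (- \<delta>'))) * F \<gamma>' \<delta>')"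
proof -
  let ?M = "\<lambda>\<gamma>' \<delta>'. \<Sum>l<n. killing (bracket (e l) x) (rv (- \<gamma>')) * killing (bracket (e' l) y) (rv (- \<delta>'))"
  have rvm: "rv (- \<gamma>') \<in> grading \<alpha> (- 1)" if "\<gamma>' \<in> D 1" for \<gamma>' using rv_grading[OF D_uminus[OF that]] .
  have "(\<Sum>l<n. \<Sum>\<gamma>'\<in>D 1. \<Sum>\<delta>'\<in>D 1. killing (bracket (e l) x) (rv (- \<gamma>')) *
        killing (bracket (e' l) y) (rv (- \<delta>')) * F \<gamma>' \<delta>')
      = (\<Sum>\<gamma>'\<in>D 1. \<Sum>l<n. \<Sum>\<delta>'\<in>D 1. killing (bracket (e l) x) (rv (- \<gamma>')) *
        killing (bracket (e' l) y) (rv (- \<delta>')) * F \<gamma>' \<delta>')" by (rule sum.swap)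
  also have "\<dots> = (\<Sum>\<gamma>'\<in>D 1. \<Sum>\<delta>'\<in>D 1. ?M \<gamma>' \<delta>' * F \<gamma>' \<delta>')"
    unfolding sum_distrib_right by (intro sum.cong refl sum.swap)
  finally have S: "(\<Sum>l<n. \<Sum>\<gamma>'\<in>D 1. \<Sum>\<delta>'\<in>D 1. killing (bracket (e l) x) (rv (- \<gamma>')) *
        killing (bracket (e' l) y) (rv (- \<delta>')) * F \<gamma>' \<delta>') = (\<Sum>\<gamma>'\<in>D 1. \<Sum>\<delta>'\<in>D 1. ?M \<gamma>' \<delta>' * F \<gamma>' \<delta>')" .
  have "(\<Sum>\<gamma>'\<in>D 1. \<Sum>\<delta>'\<in>D 1. ?M \<gamma>' \<delta>' * F \<gamma>' \<delta>') = (\<Sum>\<gamma>'\<in>D 1. \<Sum>\<delta>'\<in>D 1. ?M \<delta>' \<gamma>' * F \<delta>' \<gamma>')"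
    by (rule sum.swap)
  also have "\<dots> = (\<Sum>\<gamma>'\<in>D 1. \<Sum>\<delta>'\<in>D 1. - (?M \<delta>' \<gamma>' * F \<gamma>' \<delta>'))"
  proof (intro sum.cong refl)
    fix \<gamma>' \<delta>' assume "\<gamma>' \<in> D 1" "\<delta>' \<in> D 1"
    then have "F \<delta>' \<gamma>' = - F \<gamma>' \<delta>'" using F by blast
    then show "?M \<delta>' \<gamma>' * F \<delta>' \<gamma>' = - (?M \<delta>' \<gamma>' * F \<gamma>' \<delta>')" by simp
  qed
  finally have "2 * (\<Sum>\<gamma>'\<in>D 1. \<Sum>\<delta>'\<in>D 1. ?M \<gamma>' \<delta>' * F \<gamma>' \<delta>')
      = (\<Sum>\<gamma>'\<in>D 1. \<Sum>\<delta>'\<in>D 1. (?M \<gamma>' \<delta>' - ?M \<delta>' \<gamma>') * F \<gamma>' \<delta>')"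
    by (simp add: left_diff_distrib sum_subtractf sum_negf)
  also have "\<dots> = (\<Sum>\<gamma>'\<in>D 1. \<Sum>\<delta>'\<in>D 1. killing (bracket x y) (bracket (rv (- \<gamma>')) (rv (- \<delta>'))) * F \<gamma>' \<delta>')"
    by (intro sum.cong refl) (simp only: contract_pair_coefficient[OF x y rvm rvm])
  finally show ?thesis by (simp only: S)
qed

lemma two_slot_expand:
  assumes f: "alt g1 i f" and vs: "vs \<in> tuples g1 i" and jk: "j < i" "k < i" "j \<noteq> k"
    and x: "x \<in> g1" and y: "y \<in> g1"
  shows "f (vs[j := x, k := y]) = (\<Sum>\<gamma>'\<in>D 1. \<Sum>\<delta>'\<in>D 1. killing x (rv (- \<gamma>')) * killing y (rv (- \<delta>')) *
    f (vs[j := rv \<gamma>', k := rv \<delta>']))"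
proof -
  have "f (vs[j := x, k := y]) = f ((vs[k := y])[j := \<Sum>\<gamma>'\<in>D 1. scale (killing x (rv (- \<gamma>'))) (rv \<gamma>')])"
    using grading_expand[OF x] jk(3) by (simp add: list_update_swap)
  also have "\<dots> = (\<Sum>\<gamma>'\<in>D 1. killing x (rv (- \<gamma>')) * f ((vs[k := y])[j := rv \<gamma>']))"
    by (rule alt_sum[OF f subspace_grading tuples_update[OF vs y] jk(1) rv_grading])
  also have "\<dots> = (\<Sum>\<gamma>'\<in>D 1. killing x (rv (- \<gamma>')) *
      (\<Sum>\<delta>'\<in>D 1. killing y (rv (- \<delta>')) * f (vs[j := rv \<gamma>', k := rv \<delta>'])))"
  proof (rule sum.cong[OF refl])
    fix \<gamma>' assume \<gamma>': "\<gamma>' \<in> D 1"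
    have "f ((vs[k := y])[j := rv \<gamma>']) = f ((vs[j := rv \<gamma>'])[k := \<Sum>\<delta>'\<in>D 1. scale (killing y (rv (- \<delta>'))) (rv \<delta>')])"
      using grading_expand[OF y] jk(3) by (simp add: list_update_swap)
    also have "\<dots> = (\<Sum>\<delta>'\<in>D 1. killing y (rv (- \<delta>')) * f (vs[j := rv \<gamma>', k := rv \<delta>']))"
      by (rule alt_sum[OF f subspace_grading tuples_update[OF vs rv_grading[OF \<gamma>']] jk(2) rv_grading])
    finally show "killing x (rv (- \<gamma>')) * f ((vs[k := y])[j := rv \<gamma>'])
        = killing x (rv (- \<gamma>')) * (\<Sum>\<delta>'\<in>D 1. killing y (rv (- \<delta>')) * f (vs[j := rv \<gamma>', k := rv \<delta>']))" by simp
  qed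
  finally show ?thesis by (simp add: sum_distrib_left mult.assoc)
qed

text \<open>If the Casimir element replaces two factors of the product over \<open>B\<close> by the root vectors of \<open>\<gamma>'\<close> and \<open>\<delta>'\<close>,
  then one of these is a factor already and the term vanishes, or the two factors are the old ones,
  or the coefficient is 0. This makes the product an eigenvector.\<close>

definition isolated :: "('g \<Rightarrow> 'k) set \<Rightarrow> bool" where
  "isolated B \<longleftrightarrow> (\<forall>\<gamma>\<in>B. \<forall>\<delta>\<in>B. \<gamma> \<noteq> \<delta> \<longrightarrow> (\<forall>\<gamma>'\<in>D 1 - (B - {\<gamma>, \<delta>}). \<forall>\<delta>'\<in>D 1 - (B - {\<gamma>, \<delta>}).
     {\<gamma>', \<delta>'} \<noteq> {\<gamma>, \<delta>} \<longrightarrow>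
     killing (bracket (rv \<gamma>) (rv \<delta>)) (bracket (rv (- \<gamma>')) (rv (- \<delta>'))) = 0))"

text \<open>Only the two orders of the old pair of factors survive, with equal contributions.\<close>

lemma two_slot_eigen:
  assumes iso: "isolated (set \<gamma>s)" and \<gamma>s: "\<gamma>s \<in> E i" and f: "alt g1 i f" and jk: "j < i" "k < i" "j \<noteq> k"
  shows "(\<Sum>l<n. f ((map rv \<gamma>s)[j := bracket (e l) (rv (\<gamma>s ! j)), k := bracket (e' l) (rv (\<gamma>s ! k))]))
    = N (\<gamma>s ! j) (\<gamma>s ! k) * f (map rv \<gamma>s)"
proof -
  let ?vs = "map rv \<gamma>s" and ?\<gamma> = "\<gamma>s ! j" and ?\<delta> = "\<gamma>s ! k"
  let ?G = "\<lambda>\<gamma>' \<delta>'. f (?vs[j := rv \<gamma>', k := rv \<delta>'])"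
  let ?K = "\<lambda>\<gamma>' \<delta>'. killing (bracket (rv ?\<gamma>) (rv ?\<delta>)) (bracket (rv (- \<gamma>')) (rv (- \<delta>')))"
  have len: "length \<gamma>s = i" and dist: "distinct \<gamma>s" and sub: "set \<gamma>s \<subseteq> D 1" using \<gamma>s by (simp_all add: E_def)
  have tup: "?vs \<in> tuples g1 i" by (rule rv_tuple[OF sub len])
  have D: "?\<gamma> \<in> D 1" "?\<delta> \<in> D 1" and B: "?\<gamma> \<in> set \<gamma>s" "?\<delta> \<in> set \<gamma>s" using sub jk len by auto
  have ne: "?\<gamma> \<noteq> ?\<delta>" using dist jk len by (simp add: nth_eq_iff_index_eq)
  have anti: "?G \<gamma>' \<delta>' = - ?G \<delta>' \<gamma>'" if "\<gamma>' \<in> D 1" "\<delta>' \<in> D 1" for \<gamma>' \<delta>'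
    by (rule alt_swap[OF f subspace_grading tup jk rv_grading[OF that(1)] rv_grading[OF that(2)]])
  have self: "?G ?\<gamma> ?\<delta> = f ?vs" using jk len by (metis list_update_id nth_map)
  \<comment> \<open>a repeated factor makes \<open>f\<close> vanish; without one, \<open>isolated\<close> makes the coefficient vanish\<close>
  have vanish: "?K \<gamma>' \<delta>' * ?G \<gamma>' \<delta>' = 0"
    if "\<gamma>' \<in> D 1" "\<delta>' \<in> D 1" "{\<gamma>', \<delta>'} \<noteq> {?\<gamma>, ?\<delta>}" for \<gamma>' \<delta>'
  proof (cases "\<gamma>' \<in> set \<gamma>s - {?\<gamma>, ?\<delta>} \<or> \<delta>' \<in> set \<gamma>s - {?\<gamma>, ?\<delta>}")
    case False
    then have "?K \<gamma>' \<delta>' = 0" using iso B ne that unfolding isolated_def by blast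
    then show ?thesis by simp
  next
    case True
    let ?us = "?vs[j := rv \<gamma>', k := rv \<delta>']"
    have "\<not> distinct ?us"
      using True
    proof
      assume "\<gamma>' \<in> set \<gamma>s - {?\<gamma>, ?\<delta>}"
      then obtain r where r: "r < i" "\<gamma>s ! r = \<gamma>'" "r \<noteq> j" "r \<noteq> k" using len by (auto simp: in_set_conv_nth)
      then have "?us ! r = ?us ! j" using jk len by simp
      then show ?thesis using r jk len by (metis length_list_update length_map nth_eq_iff_index_eq)
    next
      assume "\<delta>' \<in> set \<gamma>s - {?\<gamma>, ?\<delta>}"
      then obtain r where r: "r < i" "\<gamma>s ! r = \<delta>'" "r \<noteq> j" "r \<noteq> k" using len by (auto simp: in_set_conv_nth)
      then have "?us ! r = ?us ! k" using jk len by simp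
      then show ?thesis using r jk len by (metis length_list_update length_map nth_eq_iff_index_eq)
    qed
    moreover have "?us \<in> tuples g1 i" by (intro tuples_update tup rv_grading that)
    ultimately have "?G \<gamma>' \<delta>' = 0" using alt_distinct[OF f] by blast
    then show ?thesis by simp
  qed
  have "2 * (\<Sum>l<n. f (?vs[j := bracket (e l) (rv ?\<gamma>), k := bracket (e' l) (rv ?\<delta>)]))
      = 2 * (\<Sum>l<n. \<Sum>\<gamma>'\<in>D 1. \<Sum>\<delta>'\<in>D 1. killing (bracket (e l) (rv ?\<gamma>)) (rv (- \<gamma>')) *
        killing (bracket (e' l) (rv ?\<delta>)) (rv (- \<delta>')) * ?G \<gamma>' \<delta>')"
    by (intro arg_cong[of _ _ "(*) 2"] sum.cong refl two_slot_expand[OF f tup jk] bracket_g1 rv_grading D)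
      (simp_all add: e_g0 e'_g0)
  also have "\<dots> = (\<Sum>\<gamma>'\<in>D 1. \<Sum>\<delta>'\<in>D 1. ?K \<gamma>' \<delta>' * ?G \<gamma>' \<delta>')"
    by (rule contract_two_slots[of ?G, OF anti rv_grading[OF D(1)] rv_grading[OF D(2)]])
  also have "\<dots> = (\<Sum>(\<gamma>', \<delta>')\<in>D 1 \<times> D 1. ?K \<gamma>' \<delta>' * ?G \<gamma>' \<delta>')"
    by (rule sum.cartesian_product)
  also have "\<dots> = (\<Sum>(\<gamma>', \<delta>')\<in>{(?\<gamma>, ?\<delta>), (?\<delta>, ?\<gamma>)}. ?K \<gamma>' \<delta>' * ?G \<gamma>' \<delta>')"
  proof (rule sum.mono_neutral_right)
    show "finite (D 1 \<times> D 1)" by (simp add: finite_D)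
    show "{(?\<gamma>, ?\<delta>), (?\<delta>, ?\<gamma>)} \<subseteq> D 1 \<times> D 1" using D by simp
    show "\<forall>z\<in>D 1 \<times> D 1 - {(?\<gamma>, ?\<delta>), (?\<delta>, ?\<gamma>)}. (case z of (\<gamma>', \<delta>') \<Rightarrow> ?K \<gamma>' \<delta>' * ?G \<gamma>' \<delta>') = 0"
    proof (rule ballI)
      fix z assume z: "z \<in> D 1 \<times> D 1 - {(?\<gamma>, ?\<delta>), (?\<delta>, ?\<gamma>)}"
      obtain \<gamma>' \<delta>' where eq: "z = (\<gamma>', \<delta>')" by (cases z)
      have a: "\<gamma>' \<in> D 1" "\<delta>' \<in> D 1" "{\<gamma>', \<delta>'} \<noteq> {?\<gamma>, ?\<delta>}"
        using z by (auto simp: eq doubleton_eq_iff)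
      then show "(case z of (\<gamma>', \<delta>') \<Rightarrow> ?K \<gamma>' \<delta>' * ?G \<gamma>' \<delta>') = 0"
        unfolding eq prod.case by (rule vanish)
    qed
  qed
  also have "\<dots> = ?K ?\<gamma> ?\<delta> * ?G ?\<gamma> ?\<delta> + ?K ?\<delta> ?\<gamma> * ?G ?\<delta> ?\<gamma>" using ne by simp
  also have "?G ?\<delta> ?\<gamma> = - ?G ?\<gamma> ?\<delta>" by (rule anti[OF D(2,1)])
  also have "?K ?\<delta> ?\<gamma> = - ?K ?\<gamma> ?\<delta>"
    unfolding bracket_swap[of "rv (- ?\<gamma>)" "rv (- ?\<delta>)"] by (simp only: killing_minus_right minus_minus)
  also have "?K ?\<gamma> ?\<delta> * ?G ?\<gamma> ?\<delta> + - ?K ?\<gamma> ?\<delta> * - ?G ?\<gamma> ?\<delta> = 2 * (N ?\<gamma> ?\<delta> * f ?vs)"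
    by (simp only: self N_def minus_mult_minus mult_2)
  finally show ?thesis by simp
qed

lemma isolated_eigenvalue:
  assumes B: "B \<subseteq> D 1" and iso: "isolated B"
  shows "casimir_eigenvalue n e e' g1 (card B)
    (of_nat (card B) * of_rat (of_int q * c) + (\<Sum>\<gamma>\<in>B. \<Sum>\<delta>\<in>B. N \<gamma> \<delta>))"
proof -
  let ?i = "card B"
  have fin: "finite B" by (rule finite_subset[OF B finite_D])
  obtain \<gamma>s where \<gamma>s: "set \<gamma>s = B" "distinct \<gamma>s" using finite_distinct_list[OF fin] by blast
  have len: "length \<gamma>s = ?i" using distinct_card[OF \<gamma>s(2)] \<gamma>s(1) by simp
  have E: "\<gamma>s \<in> E ?i" using \<gamma>s B len by (simp add: E_def)
  let ?vs = "map rv \<gamma>s" and ?p = "Poly_Mapping.single (map rv \<gamma>s) (1 :: 'k)"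
  have tup: "?vs \<in> tuples g1 ?i" using rv_tuple[of \<gamma>s ?i] \<gamma>s B len by simp
  have "eigen ?i (of_nat ?i * of_rat (of_int q * c) + (\<Sum>\<gamma>\<in>B. \<Sum>\<delta>\<in>B. N \<gamma> \<delta>)) ?p"
    unfolding eigen_def pair_single mult_1_left
  proof (intro allI impI)
    fix f assume f: "alt g1 ?i f"
    have one: "(\<Sum>l<n. f (?vs[j := bracket (e' l) (bracket (e l) (?vs ! j))])) = of_rat (of_int q * c) * f ?vs"
      if j: "j < ?i" for j
    proof -
      have v: "?vs ! j \<in> g1" by (rule tuples_nth[OF tup j])
      have "(\<Sum>l<n. f (?vs[j := bracket (e' l) (bracket (e l) (?vs ! j))]))
          = (\<Sum>l<n. 1 * f (?vs[j := bracket (e' l) (bracket (e l) (?vs ! j))]))" by simp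
      also have "\<dots> = f (?vs[j := \<Sum>l<n. scale 1 (bracket (e' l) (bracket (e l) (?vs ! j)))])"
        by (rule alt_sum[OF f subspace_grading tup j, symmetric]) (auto intro!: bracket_g1 v e_g0 e'_g0)
      also have "\<dots> = f (?vs[j := scale (of_rat (of_int q * c)) (?vs ! j)])"
        using casimir_g1[OF v] by simp
      also have "\<dots> = of_rat (of_int q * c) * f ?vs"
        using alt_scale[OF f tup j v] by (simp only: list_update_id)
      finally show ?thesis .
    qed
    have two: "(\<Sum>l<n. f (?vs[j := bracket (e l) (?vs ! j), k := bracket (e' l) (?vs ! k)]))
        = N (\<gamma>s ! j) (\<gamma>s ! k) * f ?vs" if "j < ?i" "k \<in> {..<?i} - {j}" for j k
    proof -
      have jk: "j < ?i" "k < ?i" "j \<noteq> k" using that by auto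
      have "isolated (set \<gamma>s)" using iso \<gamma>s(1) by simp
      from two_slot_eigen[OF this E f jk] show ?thesis using jk len by simp
    qed
    have "cas_form f ?vs = (\<Sum>l<n. \<Sum>j<?i. f (?vs[j := bracket (e' l) (bracket (e l) (?vs ! j))]))
        + (\<Sum>l<n. \<Sum>j<?i. \<Sum>k\<in>{..<?i} - {j}. f (?vs[j := bracket (e l) (?vs ! j), k := bracket (e' l) (?vs ! k)]))"
      unfolding cas_form_def ctr_ctr[OF tup] by (rule sum.distrib)
    also have "(\<Sum>l<n. \<Sum>j<?i. f (?vs[j := bracket (e' l) (bracket (e l) (?vs ! j))]))
        = (\<Sum>j<?i. \<Sum>l<n. f (?vs[j := bracket (e' l) (bracket (e l) (?vs ! j))]))" by (rule sum.swap)
    also have "\<dots> = of_nat ?i * of_rat (of_int q * c) * f ?vs" using one by simp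
    also have "(\<Sum>l<n. \<Sum>j<?i. \<Sum>k\<in>{..<?i} - {j}. f (?vs[j := bracket (e l) (?vs ! j), k := bracket (e' l) (?vs ! k)]))
        = (\<Sum>j<?i. \<Sum>k\<in>{..<?i} - {j}. \<Sum>l<n. f (?vs[j := bracket (e l) (?vs ! j), k := bracket (e' l) (?vs ! k)]))"
      by (subst sum.swap) (intro sum.cong refl sum.swap)
    also have "\<dots> = (\<Sum>j<?i. \<Sum>k\<in>{..<?i} - {j}. N (\<gamma>s ! j) (\<gamma>s ! k) * f ?vs)"
      by (intro sum.cong refl two) auto
    also have "\<dots> = (\<Sum>j<?i. \<Sum>k<?i. N (\<gamma>s ! j) (\<gamma>s ! k)) * f ?vs"
    proof -
      have "(\<Sum>k\<in>{..<?i} - {j}. N (\<gamma>s ! j) (\<gamma>s ! k)) = (\<Sum>k<?i. N (\<gamma>s ! j) (\<gamma>s ! k))" for j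
        by (rule sum.mono_neutral_left) (auto simp: N_def bracket_self killing_zero_left)
      then show ?thesis by (simp only: sum_distrib_right[symmetric])
    qed
    also have "(\<Sum>j<?i. \<Sum>k<?i. N (\<gamma>s ! j) (\<gamma>s ! k)) = (\<Sum>\<gamma>\<in>B. \<Sum>\<delta>\<in>B. N \<gamma> \<delta>)"
    proof -
      have bij: "bij_betw ((!) \<gamma>s) {..<?i} B" using bij_betw_nth[OF \<gamma>s(2)] len \<gamma>s(1) by simp
      show ?thesis
        unfolding sum.reindex_bij_betw[OF bij, symmetric] ..
    qed
    finally show "cas_form f ?vs = (of_nat ?i * of_rat (of_int q * c) + (\<Sum>\<gamma>\<in>B. \<Sum>\<delta>\<in>B. N \<gamma> \<delta>)) * f ?vs"
      by (simp add: distrib_right)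
  qed
  then show ?thesis
    using root_product_not_rel[OF E] single_ext_free[OF tup] by (auto simp: casimir_eigenvalue_iff)
qed


subsection \<open>Commutative sets of roots\<close>

definition commutative :: "('g \<Rightarrow> 'k) set \<Rightarrow> bool" where
  "commutative A \<longleftrightarrow> A \<subseteq> D 1 \<and> (\<forall>\<gamma>\<in>A. \<forall>\<delta>\<in>A. \<gamma> + \<delta> \<notin> R)"

text \<open>The sum of two roots of degree 1 has degree 2, so it is not 0, and if it is not a root it is no weight.\<close>

lemma commutative_bracket:
  assumes A: "commutative A" and \<gamma>\<delta>: "\<gamma> \<in> A" "\<delta> \<in> A"
  shows "bracket (rv \<gamma>) (rv \<delta>) = 0" "bracket (rv (- \<gamma>)) (rv (- \<delta>)) = 0"
proof -
  have D: "\<gamma> \<in> D 1" "\<delta> \<in> D 1" and nR: "\<gamma> + \<delta> \<notin> R" using assms by (auto simp: commutative_def)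
  then have R: "\<gamma> \<in> R" "\<delta> \<in> R" "- \<gamma> \<in> R" "- \<delta> \<in> R" by (simp_all add: D_iff uminus_root)
  have "h (\<gamma> + \<delta>) = 2" using D ht_add[OF \<alpha> root_L[OF R(1)] root_L[OF R(2)]] by (simp add: D_iff)
  then have n0: "\<gamma> + \<delta> \<noteq> 0" using h_zero by auto
  then have "\<gamma> + \<delta> \<notin> W" using nR by blast
  then show "bracket (rv \<gamma>) (rv \<delta>) = 0"
    using rs_weight[OF add_dual[OF root_dual[OF R(1)] root_dual[OF R(2)]] rs_bracket[OF rv_rs[OF R(1)] rv_rs[OF R(2)]]]
    by blast
  have eq: "- \<gamma> + - \<delta> = - (\<gamma> + \<delta>)" by (simp only: minus_add_distrib)
  have "- \<gamma> + - \<delta> \<notin> W"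
  proof
    assume "- \<gamma> + - \<delta> \<in> W"
    then consider "- (\<gamma> + \<delta>) = 0" | "- (\<gamma> + \<delta>) \<in> R" unfolding eq by blast
    then show False
    proof cases
      case 1
      then show ?thesis using n0 by (simp only: neg_equal_0_iff_equal)
    next
      case 2
      from uminus_root[OF this] show ?thesis using nR by (simp only: minus_minus)
    qed
  qed
  then show "bracket (rv (- \<gamma>)) (rv (- \<delta>)) = 0"
    using rs_weight[OF add_dual[OF root_dual[OF R(3)] root_dual[OF R(4)]] rs_bracket[OF rv_rs[OF R(3)] rv_rs[OF R(4)]]]
    by blast
qed

lemma commutative_N: "commutative A \<Longrightarrow> \<gamma> \<in> A \<Longrightarrow> \<delta> \<in> A \<Longrightarrow> N \<gamma> \<delta> = 0"
  by (simp add: N_def commutative_bracket killing_zero_left)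

lemma commutative_subset: "commutative A \<Longrightarrow> B \<subseteq> A \<Longrightarrow> commutative B"
  by (auto simp: commutative_def)

lemma commutative_eigenvalue:
  assumes A: "commutative A"
  shows "casimir_eigenvalue n e e' g1 (card A) (of_rat (of_int (q * int (card A)) * c))"
proof -
  have "isolated A"
    by (auto simp: isolated_def commutative_bracket[OF A] killing_zero_left)
  moreover have "A \<subseteq> D 1" using A by (simp add: commutative_def)
  moreover have "(\<Sum>\<gamma>\<in>A. \<Sum>\<delta>\<in>A. N \<gamma> \<delta>) = 0"
    using commutative_N[OF A] by simp
  ultimately show ?thesis
    using isolated_eigenvalue[of A] by (simp add: of_rat_mult ac_simps)
qed

lemma killing_bracket_weight:
  assumes "\<gamma> \<in> R" "\<delta> \<in> R" "\<gamma>' \<in> R" "\<delta>' \<in> R" "\<gamma> + \<delta> \<noteq> \<gamma>' + \<delta>'"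
  shows "killing (bracket (rv \<gamma>) (rv \<delta>)) (bracket (rv (- \<gamma>')) (rv (- \<delta>'))) = 0"
proof (rule killing_rs_zero)
  show "bracket (rv \<gamma>) (rv \<delta>) \<in> rs (\<gamma> + \<delta>)" by (intro rs_bracket rv_rs assms)
  show "bracket (rv (- \<gamma>')) (rv (- \<delta>')) \<in> rs (- \<gamma>' + - \<delta>')" by (intro rs_bracket rv_rs uminus_root assms)
  show "\<gamma> + \<delta> \<in> dual_space H" "- \<gamma>' + - \<delta>' \<in> dual_space H" by (intro add_dual root_dual uminus_root assms)+
  show "\<gamma> + \<delta> + (- \<gamma>' + - \<delta>') \<noteq> 0"
  proof
    assume "\<gamma> + \<delta> + (- \<gamma>' + - \<delta>') = 0"
    then have "(\<gamma> + \<delta>) - (\<gamma>' + \<delta>') = 0" by (simp only: diff_conv_add_uminus minus_add_distrib)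
    then show False using assms(5) by (simp only: right_minus_eq)
  qed
qed

text \<open>Each of \<open>\<gamma>'\<close> and \<open>\<delta>'\<close> lies in \<open>A\<close> or is one of \<open>\<gamma>\<close>, \<open>\<delta>\<close>. If both lie in \<open>A\<close>, their root vectors
  commute; otherwise \<open>\<gamma>' + \<delta>' = \<gamma> + \<delta>\<close> would make the two pairs equal, so the brackets have weights that
  are not opposite.\<close>

lemma isolated_complement:
  assumes A: "commutative A" shows "isolated (D 1 - A)"
  unfolding isolated_def
proof (intro ballI impI)
  fix \<gamma> \<delta> \<gamma>' \<delta>'
  assume \<gamma>: "\<gamma> \<in> D 1 - A" and \<delta>: "\<delta> \<in> D 1 - A" and ne: "\<gamma> \<noteq> \<delta>" "{\<gamma>', \<delta>'} \<noteq> {\<gamma>, \<delta>}"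
    and "\<gamma>' \<in> D 1 - (D 1 - A - {\<gamma>, \<delta>})" "\<delta>' \<in> D 1 - (D 1 - A - {\<gamma>, \<delta>})"
  then have mem: "\<gamma>' \<in> D 1" "\<delta>' \<in> D 1" "\<gamma>' \<in> A \<or> \<gamma>' \<in> {\<gamma>, \<delta>}" "\<delta>' \<in> A \<or> \<delta>' \<in> {\<gamma>, \<delta>}" by auto
  have R: "\<gamma> \<in> R" "\<delta> \<in> R" "\<gamma>' \<in> R" "\<delta>' \<in> R" using \<gamma> \<delta> mem by (auto simp: D_iff)
  show "killing (bracket (rv \<gamma>) (rv \<delta>)) (bracket (rv (- \<gamma>')) (rv (- \<delta>'))) = 0"
  proof (cases "\<gamma>' \<in> A \<and> \<delta>' \<in> A \<or> \<gamma>' = \<delta>'")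
    case True
    then have "bracket (rv (- \<gamma>')) (rv (- \<delta>')) = 0"
      using commutative_bracket(2)[OF A] bracket_self by blast
    then show ?thesis by (simp add: killing_zero_right)
  next
    case False
    have "\<gamma> + \<delta> \<noteq> \<gamma>' + \<delta>'"
    proof
      assume eq: "\<gamma> + \<delta> = \<gamma>' + \<delta>'"
      have "\<gamma>' \<in> {\<gamma>, \<delta>} \<or> \<delta>' \<in> {\<gamma>, \<delta>}" using mem(3,4) False by blast
      then consider "\<gamma>' = \<gamma>" | "\<gamma>' = \<delta>" | "\<delta>' = \<gamma>" | "\<delta>' = \<delta>" by blast
      then have "{\<gamma>', \<delta>'} = {\<gamma>, \<delta>}"
      proof cases
        case 1
        then have "\<delta>' = \<delta>" using eq by (simp only: add_left_cancel)
        then show ?thesis using 1 by simp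
      next
        case 2
        then have "\<delta> + \<gamma> = \<delta> + \<delta>'" using eq by (simp only: add.commute)
        then have "\<delta>' = \<gamma>" by (simp only: add_left_cancel)
        then show ?thesis using 2 by auto
      next
        case 3
        then have "\<gamma> + \<delta> = \<gamma> + \<gamma>'" using eq by (simp only: add.commute)
        then have "\<gamma>' = \<delta>" by (simp only: add_left_cancel)
        then show ?thesis using 3 by auto
      next
        case 4
        then have "\<gamma>' = \<gamma>" using eq by (simp only: add_right_cancel)
        then show ?thesis using 4 by simp
      qed
      then show False using ne by blast
    qed
    then show ?thesis by (rule killing_bracket_weight[OF R])
  qed
qed

text \<open>The sum of \<open>N\<close> over pairs in the complement of \<open>A\<close> is found by inclusion and exclusion from the row sums
  \<open>sum_N\<close>, as \<open>N\<close> vanishes on pairs in \<open>A\<close>.\<close>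

lemma complement_eigenvalue:
  assumes A: "commutative A"
  shows "casimir_eigenvalue n e e' g1 (m - card A)
    (of_rat (of_int (q * int (card A) + Q 1 * (int m - 2 * int (card A))) * c))"
proof -
  let ?B = "D 1 - A" and ?t = "of_rat (of_int (q - Q 1) * c) :: 'k"
  have sub: "A \<subseteq> D 1" using A by (simp add: commutative_def)
  have finA: "finite A" by (rule finite_subset[OF sub finite_D])
  have cB: "card ?B = m - card A" by (rule card_Diff_subset[OF finA sub])
  have le: "card A \<le> m" by (rule card_mono[OF finite_D sub])
  have row: "(\<Sum>\<delta>\<in>?B. N \<gamma> \<delta>) = - ?t - (\<Sum>\<delta>\<in>A. N \<gamma> \<delta>)" if "\<gamma> \<in> D 1" for \<gamma>
    using sum_N[OF that] sum.subset_diff[OF sub finite_D, of "N \<gamma>"] by (simp add: algebra_simps)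
  have mixed: "(\<Sum>\<gamma>\<in>?B. \<Sum>\<delta>\<in>A. N \<gamma> \<delta>) = - of_nat (card A) * ?t"
  proof -
    have "(\<Sum>\<gamma>\<in>?B. \<Sum>\<delta>\<in>A. N \<gamma> \<delta>) = (\<Sum>\<delta>\<in>A. \<Sum>\<gamma>\<in>?B. N \<delta> \<gamma>)"
      by (subst sum.swap) (simp only: N_sym)
    also have "\<dots> = (\<Sum>\<delta>\<in>A. - ?t)"
    proof (rule sum.cong[OF refl])
      fix \<delta> assume \<delta>: "\<delta> \<in> A"
      then have "(\<Sum>\<gamma>\<in>A. N \<delta> \<gamma>) = 0" using commutative_N[OF A \<delta>] by simp
      then show "(\<Sum>\<gamma>\<in>?B. N \<delta> \<gamma>) = - ?t" using row[of \<delta>] \<delta> sub by auto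
    qed
    finally show ?thesis by simp
  qed
  have "(\<Sum>\<gamma>\<in>?B. \<Sum>\<delta>\<in>?B. N \<gamma> \<delta>) = (\<Sum>\<gamma>\<in>?B. - ?t - (\<Sum>\<delta>\<in>A. N \<gamma> \<delta>))"
    by (intro sum.cong refl row) simp
  also have "\<dots> = - of_nat (m - card A) * ?t + of_nat (card A) * ?t"
    by (simp add: sum_subtractf mixed cB)
  finally have "of_nat (card ?B) * of_rat (of_int q * c) + (\<Sum>\<gamma>\<in>?B. \<Sum>\<delta>\<in>?B. N \<gamma> \<delta>)
      = of_nat (m - card A) * of_rat (of_int q * c) + (- of_nat (m - card A) * ?t + of_nat (card A) * ?t)"
    by (simp only: cB)
  also have "\<dots> = of_rat (of_nat (m - card A) * (of_int q * c)
      + (- of_nat (m - card A) * (of_int (q - Q 1) * c) + of_nat (card A) * (of_int (q - Q 1) * c)))"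
    by (simp only: of_rat_add of_rat_mult of_rat_minus of_rat_of_nat_eq)
  also have "of_nat (m - card A) * (of_int q * c)
      + (- of_nat (m - card A) * (of_int (q - Q 1) * c) + of_nat (card A) * (of_int (q - Q 1) * c))
      = of_int (q * int (card A) + Q 1 * (int m - 2 * int (card A))) * c"
    using le by (simp add: of_nat_diff algebra_simps)
  finally show ?thesis
    using isolated_eigenvalue[OF _ isolated_complement[OF A]] cB by simp
qed


section \<open>Abelian subspaces and the maximal eigenvalues\<close>

text \<open>The heights of a root are the coefficients of a polynomial; evaluation is additive, and at all but
  finitely many integers it separates finitely many polynomials.\<close>

lemma separating_functional:
  obtains lv :: "('g \<Rightarrow> 'k) \<Rightarrow> int"
  where "\<And>\<mu> \<nu>. \<mu> \<in> L \<Longrightarrow> \<nu> \<in> L \<Longrightarrow> lv (\<mu> + \<nu>) = lv \<mu> + lv \<nu>" "inj_on lv (D 1)"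
proof -
  obtain r :: "('g \<Rightarrow> 'k) \<Rightarrow> nat" where r: "inj_on r \<Pi>"
    using finite_imp_inj_to_nat_seg[OF finite_base] by blast
  define P :: "('g \<Rightarrow> 'k) \<Rightarrow> int poly" where "P \<mu> = (\<Sum>\<beta>\<in>\<Pi>. monom (ht \<beta> \<mu>) (r \<beta>))" for \<mu>
  have P_add: "P (\<mu> + \<nu>) = P \<mu> + P \<nu>" if "\<mu> \<in> L" "\<nu> \<in> L" for \<mu> \<nu>
    by (simp add: P_def ht_add that add_monom[symmetric] sum.distrib cong: sum.cong)
  have coeff: "coeff (P \<mu>) (r \<beta>) = ht \<beta> \<mu>" if "\<beta> \<in> \<Pi>" for \<mu> \<beta>
  proof -
    have "coeff (P \<mu>) (r \<beta>) = (\<Sum>\<kappa>\<in>\<Pi>. if \<kappa> = \<beta> then ht \<beta> \<mu> else 0)"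
      unfolding P_def coeff_sum using that r
      by (intro sum.cong refl) (auto simp: inj_on_def)
    then show ?thesis using that finite_base by simp
  qed
  have P_inj: "\<mu> = \<nu>" if "\<mu> \<in> L" "\<nu> \<in> L" "P \<mu> = P \<nu>" for \<mu> \<nu>
    using that coeff by (intro L_eqI) metis+
  \<comment> \<open>the integers at which two of the polynomials agree\<close>
  let ?Z = "\<Union>(\<gamma>, \<delta>)\<in>{(\<gamma>, \<delta>). \<gamma> \<in> D 1 \<and> \<delta> \<in> D 1 \<and> \<gamma> \<noteq> \<delta>}. {t. poly (P \<gamma> - P \<delta>) t = 0}"
  have "finite ?Z"
  proof (rule finite_UN_I)
    show "finite {(\<gamma>, \<delta>). \<gamma> \<in> D 1 \<and> \<delta> \<in> D 1 \<and> \<gamma> \<noteq> \<delta>}"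
      by (rule finite_subset[of _ "D 1 \<times> D 1"]) (auto simp: finite_D)
    fix z assume "z \<in> {(\<gamma>, \<delta>). \<gamma> \<in> D 1 \<and> \<delta> \<in> D 1 \<and> \<gamma> \<noteq> \<delta>}"
    then obtain \<gamma> \<delta> where z: "z = (\<gamma>, \<delta>)" "\<gamma> \<in> D 1" "\<delta> \<in> D 1" "\<gamma> \<noteq> \<delta>" by blast
    then have "P \<gamma> - P \<delta> \<noteq> 0" using P_inj[of \<gamma> \<delta>] by (auto simp: D_iff root_L)
    then show "finite (case z of (\<gamma>, \<delta>) \<Rightarrow> {t. poly (P \<gamma> - P \<delta>) t = 0})"
      unfolding z(1) prod.case by (rule poly_roots_finite)
  qed
  then obtain t where t: "t \<notin> ?Z" using ex_new_if_finite[OF infinite_UNIV_int] by blast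
  show ?thesis
  proof (rule that[of "\<lambda>\<mu>. poly (P \<mu>) t"])
    show "inj_on (\<lambda>\<mu>. poly (P \<mu>) t) (D 1)"
      using t by (auto intro!: inj_onI)
  qed (simp add: P_add)
qed

text \<open>The component of \<open>[x, y] = 0\<close> whose weight is the sum of the leading roots of \<open>x\<close> and \<open>y\<close> is the
  bracket of the leading terms, so this sum is not a root. The size is at least \<open>dim a\<close> because a vector
  of \<open>a\<close> is determined by its coordinates at the leading roots.\<close>

lemma leading_roots:
  assumes a: "subspace a" "a \<subseteq> grading \<alpha> 1" and ab: "\<And>x y. x \<in> a \<Longrightarrow> y \<in> a \<Longrightarrow> bracket x y = 0"
  obtains A where "commutative A" "dim a \<le> card A"
proof -
  obtain lv :: "('g \<Rightarrow> 'k) \<Rightarrow> int" where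
    add: "\<And>\<mu> \<nu>. \<mu> \<in> L \<Longrightarrow> \<nu> \<in> L \<Longrightarrow> lv (\<mu> + \<nu>) = lv \<mu> + lv \<nu>" and inj: "inj_on lv (D 1)"
    using separating_functional by blast
  let ?k = "\<lambda>x \<gamma>. killing x (rv (- \<gamma>))"
  define lead where "lead x \<gamma> \<longleftrightarrow> \<gamma> \<in> D 1 \<and> ?k x \<gamma> \<noteq> 0 \<and> (\<forall>\<gamma>'\<in>D 1. ?k x \<gamma>' \<noteq> 0 \<longrightarrow> lv \<gamma>' \<le> lv \<gamma>)" for x \<gamma>
  define A where "A = {\<gamma>. \<exists>x\<in>a. lead x \<gamma>}"
  have sub: "A \<subseteq> D 1" by (auto simp: A_def lead_def)
  have "commutative A"
    unfolding commutative_def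
  proof (intro conjI sub ballI notI)
    fix \<gamma> \<delta> assume "\<gamma> \<in> A" "\<delta> \<in> A" and gd: "\<gamma> + \<delta> \<in> R"
    then obtain x y where x: "x \<in> a" "lead x \<gamma>" and y: "y \<in> a" "lead y \<delta>" by (auto simp: A_def)
    have D: "\<gamma> \<in> D 1" "\<delta> \<in> D 1" using x(2) y(2) by (simp_all add: lead_def)
    have R: "\<kappa> \<in> R" "\<kappa> \<in> L" "\<kappa> \<in> dual_space H" if "\<kappa> \<in> D 1" for \<kappa>
      using that by (auto simp: D_iff root_L root_dual)
    have rs: "bracket (rv \<gamma>') (rv \<delta>') \<in> rs (\<gamma>' + \<delta>')" if "\<gamma>' \<in> D 1" "\<delta>' \<in> D 1" for \<gamma>' \<delta>'
      by (intro rs_bracket rv_rs R that)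
    \<comment> \<open>the only pair of weights occurring in \<open>x\<close> and \<open>y\<close> with the sum \<open>\<gamma> + \<delta>\<close> is the pair of leading ones\<close>
    have entry: "scale (?k x \<gamma>' * ?k y \<delta>') (proj (\<gamma> + \<delta>) (bracket (rv \<gamma>') (rv \<delta>')))
        = (if \<gamma>' = \<gamma> \<and> \<delta>' = \<delta> then scale (?k x \<gamma> * ?k y \<delta>) (bracket (rv \<gamma>) (rv \<delta>)) else 0)"
      if D': "\<gamma>' \<in> D 1" "\<delta>' \<in> D 1" for \<gamma>' \<delta>'
    proof (cases "?k x \<gamma>' = 0 \<or> ?k y \<delta>' = 0 \<or> \<gamma> + \<delta> \<noteq> \<gamma>' + \<delta>'")
      case True
      have "\<not> (\<gamma>' = \<gamma> \<and> \<delta>' = \<delta>)" using True x(2) y(2) by (auto simp: lead_def)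
      moreover have "?k x \<gamma>' * ?k y \<delta>' = 0 \<or> proj (\<gamma> + \<delta>) (bracket (rv \<gamma>') (rv \<delta>')) = 0"
        using True proj_of_rs[OF add_dual[OF R(3)[OF D'(1)] R(3)[OF D'(2)]] rs[OF D'], of "\<gamma> + \<delta>"] by auto
      ultimately show ?thesis by auto
    next
      case False
      then have "lv \<gamma>' \<le> lv \<gamma>" "lv \<delta>' \<le> lv \<delta>" using x(2) y(2) D' by (auto simp: lead_def)
      moreover have "lv \<gamma> + lv \<delta> = lv \<gamma>' + lv \<delta>'"
        using False add[OF R(2)[OF D(1)] R(2)[OF D(2)]] add[OF R(2)[OF D'(1)] R(2)[OF D'(2)]] by simp
      ultimately have "lv \<gamma>' = lv \<gamma>" "lv \<delta>' = lv \<delta>" by linarith+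
      then have "\<gamma>' = \<gamma>" "\<delta>' = \<delta>" using inj D D' by (auto simp: inj_on_def)
      then show ?thesis
        using proj_of_rs[OF add_dual[OF R(3)[OF D(1)] R(3)[OF D(2)]] rs[OF D], of "\<gamma> + \<delta>"] by simp
    qed
    have ga: "x \<in> grading \<alpha> 1" "y \<in> grading \<alpha> 1" using x(1) y(1) a(2) by auto
    have exp: "bracket x y = (\<Sum>\<gamma>'\<in>D 1. \<Sum>\<delta>'\<in>D 1. scale (?k x \<gamma>' * ?k y \<delta>') (bracket (rv \<gamma>') (rv \<delta>')))"
    proof -
      have "bracket x y = bracket (\<Sum>\<gamma>'\<in>D 1. scale (?k x \<gamma>') (rv \<gamma>')) (\<Sum>\<delta>'\<in>D 1. scale (?k y \<delta>') (rv \<delta>'))"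
        using grading_expand[OF ga(1)] grading_expand[OF ga(2)] by simp
      also have "\<dots> = (\<Sum>\<gamma>'\<in>D 1. \<Sum>\<delta>'\<in>D 1. scale (?k x \<gamma>' * ?k y \<delta>') (bracket (rv \<gamma>') (rv \<delta>')))"
        by (simp only: bracket_sum_left bracket_scale_left)
          (simp only: bracket_sum_right bracket_scale_right scale_sum_right scale_scale)
      finally show ?thesis .
    qed
    have "proj (\<gamma> + \<delta>) (bracket x y)
        = (\<Sum>\<gamma>'\<in>D 1. \<Sum>\<delta>'\<in>D 1. scale (?k x \<gamma>' * ?k y \<delta>') (proj (\<gamma> + \<delta>) (bracket (rv \<gamma>') (rv \<delta>'))))"
      unfolding exp by (simp only: lin_sum[OF lin_proj] lin_scale[OF lin_proj])
    also have "\<dots> = (\<Sum>\<gamma>'\<in>D 1. \<Sum>\<delta>'\<in>D 1. if \<gamma>' = \<gamma> \<and> \<delta>' = \<delta> then scale (?k x \<gamma> * ?k y \<delta>) (bracket (rv \<gamma>) (rv \<delta>)) else 0)"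
      by (intro sum.cong refl entry)
    also have "\<dots> = (\<Sum>\<gamma>'\<in>D 1. if \<gamma>' = \<gamma> then scale (?k x \<gamma> * ?k y \<delta>) (bracket (rv \<gamma>) (rv \<delta>)) else 0)"
      using D finite_D by (intro sum.cong refl) auto
    also have "\<dots> = scale (?k x \<gamma> * ?k y \<delta>) (bracket (rv \<gamma>) (rv \<delta>))" using D finite_D by simp
    finally have "scale (?k x \<gamma> * ?k y \<delta>) (bracket (rv \<gamma>) (rv \<delta>)) = 0"
      using ab[OF x(1) y(1)] by (simp add: lin_zero[OF lin_proj])
    then have "bracket (rv \<gamma>) (rv \<delta>) = 0" using x(2) y(2) by (simp add: lead_def)
    moreover have "\<delta> + \<gamma> \<in> R" using gd by (simp only: add.commute)
    ultimately show False
      using bracket_nonzero[OF R(1)[OF D(1)] R(1)[OF D(2)] _ rv_rs rv_nonzero rv_rs rv_nonzero] R(1) D by blast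
  qed
  moreover have "dim a \<le> card A"
  proof -
    interpret fp: finite_dimensional_vector_space_pair_1 scale Basis scale ..
    have fin: "finite A" by (rule finite_subset[OF sub finite_D])
    have img: "PS A x \<in> span (rv ` A)" for x
      unfolding PS_def
    proof (intro span_sum)
      fix \<gamma> assume "\<gamma> \<in> A"
      then have "proj \<gamma> x = scale (?k x \<gamma>) (rv \<gamma>)" using sub by (intro proj_rv) (auto simp: D_iff)
      then show "proj \<gamma> x \<in> span (rv ` A)" using \<open>\<gamma> \<in> A\<close> by (simp only:) (intro span_scale span_base imageI)
    qed
    \<comment> \<open>the coordinates at \<open>A\<close> determine \<open>x \<in> a\<close>: one of them is the leading coordinate\<close>
    have ker: "x = 0" if x: "x \<in> a" "PS A x = 0" for x
    proof (rule ccontr)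
      assume "x \<noteq> 0"
      have xg: "x \<in> grading \<alpha> 1" using x(1) a(2) by blast
      define S where "S = {\<gamma> \<in> D 1. ?k x \<gamma> \<noteq> 0}"
      have "S \<noteq> {}"
      proof
        assume "S = {}"
        then have "(\<Sum>\<gamma>\<in>D 1. scale (?k x \<gamma>) (rv \<gamma>)) = 0" by (intro sum.neutral) (auto simp: S_def)
        then show False using grading_expand[OF xg] \<open>x \<noteq> 0\<close> by simp
      qed
      moreover have "finite S" by (simp add: S_def finite_D)
      ultimately have "Max (lv ` S) \<in> lv ` S" by (intro Max_in) auto
      then obtain \<gamma> where \<gamma>: "\<gamma> \<in> S" "lv \<gamma> = Max (lv ` S)" by auto
      then have "lead x \<gamma>" using \<open>finite S\<close> by (auto simp: lead_def S_def)
      then have A: "\<gamma> \<in> A" using x(1) by (auto simp: A_def)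
      have R: "\<gamma> \<in> R" using \<gamma>(1) by (simp add: S_def D_iff)
      have "proj \<gamma> (PS A x) = (\<Sum>\<delta>\<in>A. if \<delta> = \<gamma> then proj \<gamma> x else 0)"
        unfolding PS_def lin_sum[OF lin_proj]
      proof (rule sum.cong[OF refl])
        fix \<delta> assume "\<delta> \<in> A"
        then have d: "\<delta> \<in> dual_space H" using sub by (intro root_dual) (auto simp: D_iff)
        show "proj \<gamma> (proj \<delta> x) = (if \<delta> = \<gamma> then proj \<gamma> x else 0)"
          using proj_of_rs[OF d proj_rs[OF d], of \<gamma> x] by auto
      qed
      then have "proj \<gamma> x = 0" using A fin x(2) by (simp add: lin_zero[OF lin_proj])
      then have "scale (?k x \<gamma>) (rv \<gamma>) = 0" by (simp add: proj_rv[OF R])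
      then show False using \<gamma>(1) rv_nonzero[OF R] by (simp add: S_def)
    qed
    have "inj_on (PS A) (span a)"
    proof (rule inj_onI)
      fix x y assume xy: "x \<in> span a" "y \<in> span a" "PS A x = PS A y"
      have sp: "span a = a" using a(1) by (simp add: span_eq_iff)
      have "x - y \<in> a" using xy(1,2) unfolding sp by (rule subspace_diff[OF a(1)])
      moreover have "PS A (x - y) = 0" using xy(3) by (simp add: lin_diff[OF lin_PS])
      ultimately show "x = y" using ker[of "x - y"] by simp
    qed
    then have "dim a = dim (PS A ` a)"
      using lin_PS by (intro fp.dim_image_eq[symmetric]) (simp_all add: lin_def)
    also have "\<dots> \<le> card (rv ` A)" using img fin by (intro dim_le_card) auto
    also have "\<dots> \<le> card A" by (rule card_image_le[OF fin])
    finally show ?thesis .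
  qed
  ultimately show ?thesis using that by blast
qed


lemma max_casimir_eqI:
  assumes ev: "casimir_eigenvalue n e e' g1 i (of_rat r)"
    and le: "\<And>A. A \<subseteq> D 1 \<Longrightarrow> card A = i \<Longrightarrow> cas (\<Sum>A) \<le> r"
  shows "max_casimir n e e' \<alpha> i = r"
  unfolding max_casimir_def
proof (rule the_equality)
  have max: "\<exists>s\<le>r. z = of_rat s" if "casimir_eigenvalue n e e' g1 i z" for z
    using eigenvalue_cases[OF that] le by metis
  then show "casimir_eigenvalue n e e' g1 i (of_rat r) \<and>
      (\<forall>z. casimir_eigenvalue n e e' g1 i z \<longrightarrow> (\<exists>s\<le>r. z = of_rat s))"
    using ev by blast
  fix r' assume r': "casimir_eigenvalue n e e' g1 i (of_rat r') \<and>
      (\<forall>z. casimir_eigenvalue n e e' g1 i z \<longrightarrow> (\<exists>s\<le>r'. z = of_rat s))"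
  obtain s where "s \<le> r'" "(of_rat r :: 'k) = of_rat s" using r' ev by blast
  moreover obtain s' where "s' \<le> r" "(of_rat r' :: 'k) = of_rat s'" using r' max by blast
  ultimately show "r' = r" by (simp add: of_rat_eq_iff)
qed

lemma max_casimir_low:
  assumes A: "commutative A" and i: "i \<le> card A"
  shows "max_casimir n e e' \<alpha> i = of_int (q * int i) * c"
proof -
  obtain B where B: "B \<subseteq> A" "card B = i" using obtain_subset_with_card_n[OF i] by metis
  show ?thesis
  proof (rule max_casimir_eqI)
    show "casimir_eigenvalue n e e' g1 i (of_rat (of_int (q * int i) * c))"
      using commutative_eigenvalue[OF commutative_subset[OF A B(1)]] by (simp only: B(2))
    show "cas (\<Sum>A') \<le> of_int (q * int i) * c" if "A' \<subseteq> D 1" "card A' = i" for A'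
      using cas_le[OF that(1)] by (simp only: that(2))
  qed
qed

lemma max_casimir_high:
  assumes A: "commutative A" and i: "m - card A \<le> i" "i \<le> m"
  shows "max_casimir n e e' \<alpha> i = of_int (q * int (m - i) + Q 1 * (2 * int i - int m)) * c"
proof -
  have "m - i \<le> card A" using i by simp
  then obtain B where B: "B \<subseteq> A" "card B = m - i" using obtain_subset_with_card_n by metis
  have "q * int (card B) + Q 1 * (int m - 2 * int (card B)) = q * int (m - i) + Q 1 * (2 * int i - int m)"
    using i(2) by (simp add: B(2) of_nat_diff)
  moreover have "m - card B = i" using i(2) B(2) by simp
  ultimately have "casimir_eigenvalue n e e' g1 i
      (of_rat (of_int (q * int (m - i) + Q 1 * (2 * int i - int m)) * c))"
    using complement_eigenvalue[OF commutative_subset[OF A B(1)]] by (simp only:)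
  then show ?thesis
  proof (rule max_casimir_eqI)
    show "cas (\<Sum>A') \<le> of_int (q * int (m - i) + Q 1 * (2 * int i - int m)) * c"
      if "A' \<subseteq> D 1" "card A' = i" for A'
      using cas_le_complement[OF that(1)] by (simp only: that(2))
  qed
qed

text \<open>Both upper bounds are attained: the one for \<open>i \<le> dim a\<close> by a subset of the commutative set of leading
  roots, the other by the complement of such a subset.\<close>

lemma max_casimir_piecewise:
  assumes a: "subspace a" "a \<subseteq> g1" "\<And>x y. x \<in> a \<Longrightarrow> y \<in> a \<Longrightarrow> bracket x y = 0"
    and half: "2 * dim a = m" and i: "i \<le> m"
  shows "max_casimir n e e' \<alpha> i =
    (if i \<le> dim a then of_int (q * int i) * c
     else of_int (q * int (dim a) + (2 * Q 1 - q) * (int i - int (dim a))) * c)"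
proof -
  obtain A where A: "commutative A" "dim a \<le> card A" using leading_roots[OF a] by blast
  show ?thesis
  proof (cases "i \<le> dim a")
    case True
    then show ?thesis using max_casimir_low[OF A(1), of i] A(2) by simp
  next
    case False
    have "q * int (m - i) + Q 1 * (2 * int i - int m) = q * int (dim a) + (2 * Q 1 - q) * (int i - int (dim a))"
      using i by (simp add: of_nat_diff half[symmetric] algebra_simps)
    then show ?thesis using max_casimir_high[OF A(1), of i] A(2) half i False by simp
  qed
qed

end


subsection \<open>Unimodality\<close>

lemma piecewise_linear_cases:
  fixes \<delta> :: "nat \<Rightarrow> rat" and k :: nat and s t :: int and c :: rat
  assumes k: "k \<ge> 1" and c: "c > 0" and s: "s > 0"
    and \<delta>: "\<And>i. i \<le> 2 * k \<Longrightarrow>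
      \<delta> i = (if i \<le> k then of_int (s * int i) * c else of_int (s * int k + t * (int i - int k)) * c)"
  shows "t < 0 \<Longrightarrow> Max (\<delta> ` {1..2 * k}) = \<delta> k \<and> unimodal_on {1..2 * k} \<delta>"
    and "t = 0 \<Longrightarrow> \<forall>i\<in>{k..2 * k}. \<delta> i = \<delta> k"
    and "t > 0 \<Longrightarrow> Max (\<delta> ` {1..2 * k}) = \<delta> (2 * k) \<and> strict_mono_on {1..2 * k} \<delta>"
proof -
  have low: "\<delta> i = of_int (s * int i) * c" if "i \<le> k" for i using \<delta>[of i] that by simp
  have high: "\<delta> i = of_int (s * int k + t * (int i - int k)) * c" if "k \<le> i" "i \<le> 2 * k" for i
    using \<delta>[of i] that by (cases "i = k") simp_all
  have up: "\<delta> i < \<delta> j" if "i < j" "j \<le> k" for i j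
    using that c s by (simp add: low)
  show "t = 0 \<Longrightarrow> \<forall>i\<in>{k..2 * k}. \<delta> i = \<delta> k"
    using high by simp
  {
    assume t: "t < 0"
    have down: "\<delta> j \<le> \<delta> i" if "k \<le> i" "i \<le> j" "j \<le> 2 * k" for i j
    proof -
      have "t * (int j - int k) \<le> t * (int i - int k)" using that t by (intro mult_left_mono_neg) auto
      then have "of_int (s * int k + t * (int j - int k)) \<le> (of_int (s * int k + t * (int i - int k)) :: rat)"
        by (simp only: of_int_le_iff add_le_cancel_left)
      then show ?thesis using that c by (simp only: high mult_right_mono less_imp_le)
    qed
    have mono: "mono_on {i \<in> {1..2 * k}. i \<le> k} \<delta>"
    proof (rule mono_onI)
      fix i j assume "i \<in> {i \<in> {1..2 * k}. i \<le> k}" "j \<in> {i \<in> {1..2 * k}. i \<le> k}" "i \<le> j"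
      then show "\<delta> i \<le> \<delta> j" using up[of i j] by (cases "i = j") auto
    qed
    have "\<delta> i \<le> \<delta> k" if "i \<in> {1..2 * k}" for i
      using up[of i k] down[of k i] that by (cases i k rule: linorder_cases) auto
    then have "Max (\<delta> ` {1..2 * k}) = \<delta> k" using k by (intro Max_eqI) auto
    moreover have "antimono_on {i \<in> {1..2 * k}. k \<le> i} \<delta>"
      by (rule monotone_onI) (auto intro: down)
    ultimately show "Max (\<delta> ` {1..2 * k}) = \<delta> k \<and> unimodal_on {1..2 * k} \<delta>"
      unfolding unimodal_on_def using mono k by (intro conjI bexI[of _ k]) auto
  }
  {
    assume t: "t > 0"
    have high_up: "\<delta> i < \<delta> j" if "k \<le> i" "i < j" "j \<le> 2 * k" for i j
    proof -
      have "t * (int i - int k) < t * (int j - int k)" using that t by (intro mult_strict_left_mono) auto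
      then have "of_int (s * int k + t * (int i - int k)) < (of_int (s * int k + t * (int j - int k)) :: rat)"
        by (simp only: of_int_less_iff add_less_cancel_left)
      then show ?thesis using that c by (simp only: high mult_strict_right_mono)
    qed
    have strict: "\<delta> i < \<delta> j" if "i < j" "j \<le> 2 * k" for i j
    proof (cases "j \<le> k \<or> k \<le> i")
      case True
      then show ?thesis using up high_up that by blast
    next
      case False
      then have "\<delta> i < \<delta> k" "\<delta> k < \<delta> j" using up[of i k] high_up[of k j] that by auto
      then show ?thesis by simp
    qed
    have "\<delta> i \<le> \<delta> (2 * k)" if "i \<in> {1..2 * k}" for i
      using strict[of i "2 * k"] that by (cases "i = 2 * k") auto
    then have "Max (\<delta> ` {1..2 * k}) = \<delta> (2 * k)" using k by (intro Max_eqI) auto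
    then show "Max (\<delta> ` {1..2 * k}) = \<delta> (2 * k) \<and> strict_mono_on {1..2 * k} \<delta>"
      by (auto intro!: strict_mono_onI strict)
  }
qed

context based_simple_lie_algebra
begin

text \<open>Dual bases exist only for a nonzero form: \<open>g(0)\<close> contains \<open>H\<close>, which is nonzero because the functional
  \<open>\<alpha>\<close> is. A nonzero Killing form is nondegenerate.\<close>

lemma casimir_gradingI:
  assumes \<alpha>: "\<alpha> \<in> \<Pi>" and dual: "dual_bases (grading \<alpha> 0) n e e'"
  shows "casimir_grading scale Basis bracket H \<Pi> \<alpha> n e e'"
proof -
  have \<alpha>R: "\<alpha> \<in> dual_space H" "\<alpha> \<noteq> 0" using base \<alpha> by (auto simp: root_base_def roots_def)
  then obtain t where t: "\<alpha> t \<noteq> 0" by (auto simp: fun_eq_iff)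
  then have tH: "t \<in> H" using \<alpha>R(1) by (auto simp: dual_space_def)
  have "\<alpha> (scale 0 t) = 0 * \<alpha> t" using \<alpha>R(1) tH unfolding dual_space_def by blast
  then have t0: "t \<noteq> 0" using t by auto
  have "t \<in> grading \<alpha> 0" using tH by (auto simp: grading_def intro: span_base)
  then have "n \<noteq> 0" using t0 dual by (cases "n = 0") (auto simp: dual_bases_def)
  then have "killing (e 0) (e' 0) = 1" using dual by (simp add: dual_bases_def)
  then have ne: "killing (e 0) (e' 0) \<noteq> 0" by simp
  show ?thesis
    by unfold_locales (fact killing_nondegenerate[OF ne] cartan \<alpha> dual)+
qed

end

theorem corollary5p2:
  fixes scale :: "'k::{alg_closed_field, field_char_0} \<Rightarrow> 'g::ab_group_add \<Rightarrow> 'g"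
    and Basis :: "'g set" and bracket :: "'g \<Rightarrow> 'g \<Rightarrow> 'g"
    and H :: "'g set" and \<Pi> :: "('g \<Rightarrow> 'k) set" and \<alpha> :: "'g \<Rightarrow> 'k"
    and n :: nat and e e' :: "nat \<Rightarrow> 'g" and a :: "'g set"
    and \<gg> :: "int \<Rightarrow> 'g set" and m :: nat and \<delta> :: "nat \<Rightarrow> rat"
    and q :: "int \<Rightarrow> int" and q_sum d :: int
  assumes "based_simple_lie_algebra scale Basis bracket H \<Pi>"
    and "\<alpha> \<in> \<Pi>"
    and "\<gg> = based_simple_lie_algebra.grading scale bracket H \<Pi> \<alpha>"
    and "d = based_simple_lie_algebra.depth scale bracket H \<Pi> \<alpha>"
    and "q = based_simple_lie_algebra.q_deg scale Basis bracket H \<Pi> \<alpha>"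
    and "q_sum = based_simple_lie_algebra.q_total scale Basis bracket H \<Pi> \<alpha>"
    and "lie_algebra.dual_bases scale Basis bracket (\<gg> 0) n e e'"
    and "\<delta> = based_simple_lie_algebra.max_casimir scale bracket H \<Pi> n e e' \<alpha>"
    and "m = vector_space.dim scale (\<gg> 1)"
    and "module.subspace scale a" and "a \<subseteq> \<gg> 1"
    and "\<forall>x\<in>a. \<forall>y\<in>a. bracket x y = 0"
    and "2 * vector_space.dim scale a = m"
  shows "(q_sum > 2 * q 1 \<longrightarrow>
            Max (\<delta> ` {1..m}) = \<delta> (m div 2) \<and> unimodal_on {1..m} \<delta>)
       \<and> (q_sum = 2 * q 1 \<longrightarrow> (\<forall>i\<in>{m div 2..m}. \<delta> i = \<delta> (m div 2)))
       \<and> (q_sum < 2 * q 1 \<longrightarrow>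
            Max (\<delta> ` {1..m}) = \<delta> m \<and> strict_mono_on {1..m} \<delta>)
       \<and> (d \<ge> 3 \<longrightarrow> q_sum > 2 * q 1)"
proof -
  interpret B: based_simple_lie_algebra scale Basis bracket H \<Pi> by (rule assms(1))
  interpret G: casimir_grading scale Basis bracket H \<Pi> \<alpha> n e e'
    by (rule B.casimir_gradingI[OF assms(2)]) (use assms(3,7) in simp)
  let ?k = "B.dim a"
  have m: "m = card (B.roots_deg \<alpha> 1)" using assms(3,9) G.dim_grading_1 by simp
  have half: "2 * ?k = m" by (rule assms(13))
  have qs: "q_sum = G.q" "q 1 = G.Q 1"
    using assms(5,6) G.q_total_eq G.q_deg_eq[of 1] by simp_all
  have "?k \<ge> 1" using G.card_D1_pos half m by linarith
  moreover have "G.c > 0" "G.q > 0" by (rule G.c_pos G.q_pos)+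
  moreover have "\<delta> i = (if i \<le> ?k then of_int (G.q * int i) * G.c
      else of_int (G.q * int ?k + (2 * G.Q 1 - G.q) * (int i - int ?k)) * G.c)" if "i \<le> 2 * ?k" for i
    unfolding assms(8)
    by (rule G.max_casimir_piecewise) (use assms(3,10-12) half m that in auto)
  ultimately have cases:
    "2 * G.Q 1 - G.q < 0 \<Longrightarrow> Max (\<delta> ` {1..2 * ?k}) = \<delta> ?k \<and> unimodal_on {1..2 * ?k} \<delta>"
    "2 * G.Q 1 - G.q = 0 \<Longrightarrow> \<forall>i\<in>{?k..2 * ?k}. \<delta> i = \<delta> ?k"
    "2 * G.Q 1 - G.q > 0 \<Longrightarrow> Max (\<delta> ` {1..2 * ?k}) = \<delta> (2 * ?k) \<and> strict_mono_on {1..2 * ?k} \<delta>"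
    by (rule piecewise_linear_cases; blast)+
  have mid: "m div 2 = ?k" using half by simp
  note cases = cases[unfolded half]
  show ?thesis
    unfolding mid
  proof (intro conjI impI)
    assume "q_sum > 2 * q 1"
    then have "2 * G.Q 1 - G.q < 0" using qs by linarith
    from cases(1)[OF this] show "Max (\<delta> ` {1..m}) = \<delta> ?k" "unimodal_on {1..m} \<delta>" by blast+
  next
    assume "q_sum = 2 * q 1"
    then have "2 * G.Q 1 - G.q = 0" using qs by linarith
    from cases(2)[OF this] show "\<forall>i\<in>{?k..m}. \<delta> i = \<delta> ?k" .
  next
    assume "q_sum < 2 * q 1"
    then have "2 * G.Q 1 - G.q > 0" using qs by linarith
    from cases(3)[OF this] show "Max (\<delta> ` {1..m}) = \<delta> m" "strict_mono_on {1..m} \<delta>" by blast+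
  next
    assume "d \<ge> 3"
    then show "q_sum > 2 * q 1" using G.q_depth_ge_3 by (simp only: qs assms(4))
  qed
qed

end
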